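(* (i) For every $\mathcal{X}\subseteq\mathcal{N}$: $\mathcal{X}$ is $\mathbf{\Pi}^0_1$ if and only if $\mathcal{X}\preceq\mathcal{A}_1$. (ii) For every $\mathcal{X}\subseteq\mathcal{N}$ and every $n>0$: $\mathcal{X}\preceq\mathbb{D}^n(\mathcal{A}_1)$ if and only if there exist $\mathbf{\Pi}^0_1$ sets $\mathcal{F}_0,\ldots,\mathcal{F}_{n-1}$ with $\mathcal{X}=\bigcup_{i<n}\mathcal{F}_i$. (iii) $\mathbb{D}^2(\mathcal{A}_1)$ is not $\mathbf{\Pi}^0_2$. (iv) For every $n>0$, $\mathbb{D}^{n+1}(\mathcal{A}_1)\not\preceq\mathbb{D}^n(\mathcal{A}_1)$ (i.e. the assumption $\mathbb{D}^{n+1}(\mathcal{A}_1)\preceq\mathbb{D}^n(\mathcal{A}_1)$ leads to a contradiction).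
   Context: The setting is intuitionistic mathematics (logical constants read constructively; "not" means "leads to a contradiction"), with Brouwer's Continuity Principle accepted: for every $R\subseteq\mathcal{N}\times\mathbb{N}$, if $\forall\alpha\exists n[\alpha Rn]$ then $\forall\alpha\exists m\exists n\forall\beta[\overline{\alpha}m\sqsubset\beta\rightarrow\beta Rn]$. $\mathcal{N}$ is the set of infinite sequences of natural numbers; finite sequences are coded by natural numbers; $\overline{\alpha}m=\langle\alpha(0),\ldots,\alpha(m-1)\rangle$ and $s\sqsubset\beta$ means $s=\overline{\beta}k$ for some $k$. For $\alpha\in\mathcal{N}$ and $n\in\mathbb{N}$, the $n$-th subsequence $\alpha^n$ is given by $\alpha^n(m)=\alpha(2^m(2n+1)-1)$. A code $\varphi\in\mathcal{N}$ satisfies $\varphi:\mathcal{N}\rightarrow\mathbb{N}$ iff $\forall\alpha\exists n[\varphi(\overline{\alpha}n)\neq0]$; then $\varphi(\alpha)=p$ where $\varphi(\overline{\alpha}n)=p+1$ for the least $n$ with $\varphi(\overline{\alpha}n)\neq0$. $\varphi:\mathcal{N}\rightarrow\mathcal{N}$ iff $\forall n[\varphi^n:\mathcal{N}\rightarrow\mathbb{N}]$, and then $\varphi|\alpha$ is the element with $(\varphi|\alpha)(n)=\varphi^n(\alpha)$. For $\mathcal{X},\mathcal{Y}\subseteq\mathcal{N}$, $\mathcal{X}\preceq\mathcal{Y}$ iff there is $\varphi:\mathcal{N}\rightarrow\mathcal{N}$ with $\forall\alpha[\alpha\in\mathcal{X}\leftrightarrow\varphi|\alpha\in\mathcal{Y}]$.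 $\mathcal{A}_1=\{\alpha\mid\forall n[\alpha(n)=0]\}$. For $n>0$ and $\mathcal{X}\subseteq\mathcal{N}$, $\mathbb{D}^n(\mathcal{X})=\{\alpha\mid\exists i<n[\alpha^i\in\mathcal{X}]\}$. $\mathcal{X}$ is $\mathbf{\Pi}^0_1$ iff there is $\beta$ with $\mathcal{X}=\{\alpha\mid\forall n[\beta(\overline{\alpha}n)=0]\}$. $\mathcal{X}$ is $\mathbf{\Pi}^0_2$ iff there is $\beta$ with $\mathcal{X}=\{\alpha\mid\forall m\exists n[\beta^m(\overline{\alpha}n)\neq0]\}$ (a countable intersection of open sets). *)

theory Defs
  imports Main
begin

text \<open>
  The mathematics formalized here is intuitionistic and contradicts classical logic, so it cannot
  be stated about the HOL types themselves.  It is stated as derivability in an explicit formal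
  system: many-sorted intuitionistic predicate logic with variables for natural numbers, for
  infinite sequences of natural numbers (elements of Baire space \<open>\<N>\<close>), for subsets of
  \<open>\<N>\<close>, and for subsets of \<open>\<N> \<times> \<nat>\<close>, together with arithmetic, comprehension
  and unique choice (every functional property of numbers is given by a sequence).  Brouwer's
  Continuity Principle is a single closed formula of that language.
\<close>

section \<open>Syntax\<close>

text \<open>
  Variables are de Bruijn indices, with a separate index space for each of the four sorts: under
  \<open>AllN\<close> or \<open>ExN\<close> only the indices of number variables are shifted, and so on.

  \<open>Sect a t\<close> is the subsequence $\alpha^n$ and \<open>Init a t\<close> the code of the finite sequence
  $\overline{\alpha}n$.
\<close>

datatype ntm =
    NVar nat | Zero | Succ ntm | Pred ntm | Add ntm ntm | Mul ntm ntm | Pow ntm ntm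
  | App stm ntm | Init stm ntm
and stm =
    SVar nat | Sect stm ntm

datatype fm =
    Bot | EqN ntm ntm | EqS stm stm
  | Mem stm nat       \<comment> \<open>a sequence belongs to the set variable with this index\<close>
  | Rel nat stm ntm   \<comment> \<open>the relation variable with this index holds\<close>
  | And fm fm | Or fm fm | Imp fm fm
  | AllN fm | ExN fm  \<comment> \<open>numbers\<close>
  | AllS fm | ExS fm  \<comment> \<open>sequences\<close>
  | AllX fm | ExX fm  \<comment> \<open>subsets of \<open>\<N>\<close>\<close>
  | AllR fm | ExR fm  \<comment> \<open>subsets of \<open>\<N> \<times> \<nat>\<close>\<close>

definition Iff :: "fm \<Rightarrow> fm \<Rightarrow> fm" where
  "Iff A B = And (Imp A B) (Imp B A)"

primrec nsub :: "(nat \<Rightarrow> ntm) \<Rightarrow> (nat \<Rightarrow> stm) \<Rightarrow> ntm \<Rightarrow> ntm"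
  and ssub :: "(nat \<Rightarrow> ntm) \<Rightarrow> (nat \<Rightarrow> stm) \<Rightarrow> stm \<Rightarrow> stm" where
  "nsub f g (NVar i) = f i"
| "nsub f g Zero = Zero"
| "nsub f g (Succ t) = Succ (nsub f g t)"
| "nsub f g (Pred t) = Pred (nsub f g t)"
| "nsub f g (Add t u) = Add (nsub f g t) (nsub f g u)"
| "nsub f g (Mul t u) = Mul (nsub f g t) (nsub f g u)"
| "nsub f g (Pow t u) = Pow (nsub f g t) (nsub f g u)"
| "nsub f g (App a t) = App (ssub f g a) (nsub f g t)"
| "nsub f g (Init a t) = Init (ssub f g a) (nsub f g t)"
| "ssub f g (SVar i) = g i"
| "ssub f g (Sect a t) = Sect (ssub f g a) (nsub f g t)"

abbreviation nsucc :: "nat \<Rightarrow> ntm" where "nsucc i \<equiv> NVar (Suc i)"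
abbreviation ssucc :: "nat \<Rightarrow> stm" where "ssucc i \<equiv> SVar (Suc i)"

text \<open>Simultaneous capture-avoiding substitution of number terms, sequence terms, set variables
  and relation variables for the free variables of the respective sorts.\<close>

primrec fsub :: "(nat \<Rightarrow> ntm) \<Rightarrow> (nat \<Rightarrow> stm) \<Rightarrow> (nat \<Rightarrow> nat) \<Rightarrow> (nat \<Rightarrow> nat) \<Rightarrow> fm \<Rightarrow> fm" where
  "fsub f g x r Bot = Bot"
| "fsub f g x r (EqN t u) = EqN (nsub f g t) (nsub f g u)"
| "fsub f g x r (EqS a b) = EqS (ssub f g a) (ssub f g b)"
| "fsub f g x r (Mem a i) = Mem (ssub f g a) (x i)"
| "fsub f g x r (Rel i a t) = Rel (r i) (ssub f g a) (nsub f g t)"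
| "fsub f g x r (And A B) = And (fsub f g x r A) (fsub f g x r B)"
| "fsub f g x r (Or A B) = Or (fsub f g x r A) (fsub f g x r B)"
| "fsub f g x r (Imp A B) = Imp (fsub f g x r A) (fsub f g x r B)"
| "fsub f g x r (AllN A) =
     AllN (fsub (case_nat (NVar 0) (\<lambda>i. nsub nsucc SVar (f i))) (\<lambda>i. ssub nsucc SVar (g i)) x r A)"
| "fsub f g x r (ExN A) =
     ExN (fsub (case_nat (NVar 0) (\<lambda>i. nsub nsucc SVar (f i))) (\<lambda>i. ssub nsucc SVar (g i)) x r A)"
| "fsub f g x r (AllS A) =
     AllS (fsub (\<lambda>i. nsub NVar ssucc (f i)) (case_nat (SVar 0) (\<lambda>i. ssub NVar ssucc (g i))) x r A)"
| "fsub f g x r (ExS A) =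
     ExS (fsub (\<lambda>i. nsub NVar ssucc (f i)) (case_nat (SVar 0) (\<lambda>i. ssub NVar ssucc (g i))) x r A)"
| "fsub f g x r (AllX A) = AllX (fsub f g (case_nat 0 (\<lambda>i. Suc (x i))) r A)"
| "fsub f g x r (ExX A) = ExX (fsub f g (case_nat 0 (\<lambda>i. Suc (x i))) r A)"
| "fsub f g x r (AllR A) = AllR (fsub f g x (case_nat 0 (\<lambda>i. Suc (r i))) A)"
| "fsub f g x r (ExR A) = ExR (fsub f g x (case_nat 0 (\<lambda>i. Suc (r i))) A)"

definition liftN :: "fm \<Rightarrow> fm" where "liftN = fsub nsucc SVar id id"
definition liftS :: "fm \<Rightarrow> fm" where "liftS = fsub NVar ssucc id id"
definition liftX :: "fm \<Rightarrow> fm" where "liftX = fsub NVar SVar Suc id"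
definition liftR :: "fm \<Rightarrow> fm" where "liftR = fsub NVar SVar id Suc"

definition instN :: "ntm \<Rightarrow> fm \<Rightarrow> fm" where "instN t = fsub (case_nat t NVar) SVar id id"
definition instS :: "stm \<Rightarrow> fm \<Rightarrow> fm" where "instS a = fsub NVar (case_nat a SVar) id id"
definition instX :: "nat \<Rightarrow> fm \<Rightarrow> fm" where "instX i = fsub NVar SVar (case_nat i id) id"
definition instR :: "nat \<Rightarrow> fm \<Rightarrow> fm" where "instR i = fsub NVar SVar id (case_nat i id)"

section \<open>Intuitionistic derivability\<close>

text \<open>
  Finite sequences are coded bijectively by $\langle\rangle = 0$ and
  $s * \langle n\rangle = 2^s(2n+1)$; cf. the rules for \<open>Init\<close>.
\<close>

definition two :: ntm where "two = Succ (Succ Zero)"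

definition pair :: "ntm \<Rightarrow> ntm \<Rightarrow> ntm" where
  "pair t u = Mul (Pow two t) (Succ (Mul two u))"

inductive derives :: "fm list \<Rightarrow> fm \<Rightarrow> bool" (infix "\<turnstile>" 45) where
  \<comment> \<open>intuitionistic propositional logic\<close>
  Assm: "A \<in> set \<Gamma> \<Longrightarrow> \<Gamma> \<turnstile> A"
| BotE: "\<Gamma> \<turnstile> Bot \<Longrightarrow> \<Gamma> \<turnstile> A"
| AndI: "\<Gamma> \<turnstile> A \<Longrightarrow> \<Gamma> \<turnstile> B \<Longrightarrow> \<Gamma> \<turnstile> And A B"
| AndE1: "\<Gamma> \<turnstile> And A B \<Longrightarrow> \<Gamma> \<turnstile> A"
| AndE2: "\<Gamma> \<turnstile> And A B \<Longrightarrow> \<Gamma> \<turnstile> B"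
| OrI1: "\<Gamma> \<turnstile> A \<Longrightarrow> \<Gamma> \<turnstile> Or A B"
| OrI2: "\<Gamma> \<turnstile> B \<Longrightarrow> \<Gamma> \<turnstile> Or A B"
| OrE: "\<Gamma> \<turnstile> Or A B \<Longrightarrow> A # \<Gamma> \<turnstile> C \<Longrightarrow> B # \<Gamma> \<turnstile> C \<Longrightarrow> \<Gamma> \<turnstile> C"
| ImpI: "A # \<Gamma> \<turnstile> B \<Longrightarrow> \<Gamma> \<turnstile> Imp A B"
| ImpE: "\<Gamma> \<turnstile> Imp A B \<Longrightarrow> \<Gamma> \<turnstile> A \<Longrightarrow> \<Gamma> \<turnstile> B"
  \<comment> \<open>quantifiers\<close>
| AllNI: "map liftN \<Gamma> \<turnstile> A \<Longrightarrow> \<Gamma> \<turnstile> AllN A"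
| AllNE: "\<Gamma> \<turnstile> AllN A \<Longrightarrow> \<Gamma> \<turnstile> instN t A"
| ExNI: "\<Gamma> \<turnstile> instN t A \<Longrightarrow> \<Gamma> \<turnstile> ExN A"
| ExNE: "\<Gamma> \<turnstile> ExN A \<Longrightarrow> A # map liftN \<Gamma> \<turnstile> liftN C \<Longrightarrow> \<Gamma> \<turnstile> C"
| AllSI: "map liftS \<Gamma> \<turnstile> A \<Longrightarrow> \<Gamma> \<turnstile> AllS A"
| AllSE: "\<Gamma> \<turnstile> AllS A \<Longrightarrow> \<Gamma> \<turnstile> instS a A"
| ExSI: "\<Gamma> \<turnstile> instS a A \<Longrightarrow> \<Gamma> \<turnstile> ExS A"
| ExSE: "\<Gamma> \<turnstile> ExS A \<Longrightarrow> A # map liftS \<Gamma> \<turnstile> liftS C \<Longrightarrow> \<Gamma> \<turnstile> C"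
| AllXI: "map liftX \<Gamma> \<turnstile> A \<Longrightarrow> \<Gamma> \<turnstile> AllX A"
| AllXE: "\<Gamma> \<turnstile> AllX A \<Longrightarrow> \<Gamma> \<turnstile> instX i A"
| ExXI: "\<Gamma> \<turnstile> instX i A \<Longrightarrow> \<Gamma> \<turnstile> ExX A"
| ExXE: "\<Gamma> \<turnstile> ExX A \<Longrightarrow> A # map liftX \<Gamma> \<turnstile> liftX C \<Longrightarrow> \<Gamma> \<turnstile> C"
| AllRI: "map liftR \<Gamma> \<turnstile> A \<Longrightarrow> \<Gamma> \<turnstile> AllR A"
| AllRE: "\<Gamma> \<turnstile> AllR A \<Longrightarrow> \<Gamma> \<turnstile> instR i A"
| ExRI: "\<Gamma> \<turnstile> instR i A \<Longrightarrow> \<Gamma> \<turnstile> ExR A"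
| ExRE: "\<Gamma> \<turnstile> ExR A \<Longrightarrow> A # map liftR \<Gamma> \<turnstile> liftR C \<Longrightarrow> \<Gamma> \<turnstile> C"
  \<comment> \<open>equality; equality of sequences is extensional\<close>
| EqN_refl: "\<Gamma> \<turnstile> EqN t t"
| EqN_subst: "\<Gamma> \<turnstile> EqN t u \<Longrightarrow> \<Gamma> \<turnstile> instN t A \<Longrightarrow> \<Gamma> \<turnstile> instN u A"
| EqS_refl: "\<Gamma> \<turnstile> EqS a a"
| EqS_subst: "\<Gamma> \<turnstile> EqS a b \<Longrightarrow> \<Gamma> \<turnstile> instS a A \<Longrightarrow> \<Gamma> \<turnstile> instS b A"
| EqS_ext: "\<Gamma> \<turnstile> AllN (EqN (App (ssub nsucc SVar a) (NVar 0)) (App (ssub nsucc SVar b) (NVar 0)))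
    \<Longrightarrow> \<Gamma> \<turnstile> EqS a b"
  \<comment> \<open>arithmetic\<close>
| Succ_neq: "\<Gamma> \<turnstile> Imp (EqN (Succ t) Zero) Bot"
| Pred_Zero: "\<Gamma> \<turnstile> EqN (Pred Zero) Zero"
| Pred_Succ: "\<Gamma> \<turnstile> EqN (Pred (Succ t)) t"
| Add_Zero: "\<Gamma> \<turnstile> EqN (Add t Zero) t"
| Add_Succ: "\<Gamma> \<turnstile> EqN (Add t (Succ u)) (Succ (Add t u))"
| Mul_Zero: "\<Gamma> \<turnstile> EqN (Mul t Zero) Zero"
| Mul_Succ: "\<Gamma> \<turnstile> EqN (Mul t (Succ u)) (Add (Mul t u) t)"
| Pow_Zero: "\<Gamma> \<turnstile> EqN (Pow t Zero) (Succ Zero)"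
| Pow_Succ: "\<Gamma> \<turnstile> EqN (Pow t (Succ u)) (Mul (Pow t u) t)"
| Induct: "\<Gamma> \<turnstile> instN Zero A
    \<Longrightarrow> A # map liftN \<Gamma> \<turnstile> fsub (case_nat (Succ (NVar 0)) nsucc) SVar id id A
    \<Longrightarrow> \<Gamma> \<turnstile> AllN A"
  \<comment> \<open>subsequences, $\alpha^n(m) = \alpha(2^m(2n+1)-1)$, and initial segments\<close>
| App_Sect: "\<Gamma> \<turnstile> EqN (App (Sect a n) m) (App a (Pred (pair m n)))"
| Init_Zero: "\<Gamma> \<turnstile> EqN (Init a Zero) Zero"
| Init_Succ: "\<Gamma> \<turnstile> EqN (Init a (Succ t)) (pair (Init a t) (App a t))"
  \<comment> \<open>every formula with a distinguished sequence variable (and a distinguished number variable)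
     determines a set (relation); the lifting prevents \<open>A\<close> from mentioning the object defined\<close>
| CompX: "\<Gamma> \<turnstile> ExX (AllS (Iff (Mem (SVar 0) 0) (liftX A)))"
| CompR: "\<Gamma> \<turnstile> ExR (AllS (AllN (Iff (Rel 0 (SVar 0) (NVar 0)) (liftR A))))"
  \<comment> \<open>$\forall n\exists!m\,A(n,m) \to \exists\alpha\forall n\forall m[\alpha(n)=m \leftrightarrow A(n,m)]$,
     where \<open>NVar 1\<close> and \<open>NVar 0\<close> are $n$ and $m$ in \<open>A\<close>, and $\exists!m\,A(n,m)$ is
     $\exists k\forall m[A(n,m) \leftrightarrow m=k]$\<close>
| Unique_Choice: "\<Gamma> \<turnstile> AllN (ExN (AllN
      (Iff (fsub (case_nat (NVar 0) (\<lambda>i. NVar (i + 2))) SVar id id A) (EqN (NVar 0) (NVar 1)))))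
    \<Longrightarrow> \<Gamma> \<turnstile> ExS (AllN (AllN (Iff (EqN (App (SVar 0) (NVar 1)) (NVar 0)) (liftS A))))"

section \<open>Writing formulas with named variables\<close>

text \<open>
  An expression in scope maps the numbers of enclosing binders of each sort (numbers, sequences,
  sets, relations) to a de Bruijn expression.  The binders below let HOL bind the variables: a
  variable introduced under \<open>n\<close> binders of its sort has index \<open>n' - Suc n\<close> at a place that is
  under \<open>n'\<close> binders of its sort.  All other bold symbols act pointwise.
\<close>

type_synonym 'a scoped = "nat \<times> nat \<times> nat \<times> nat \<Rightarrow> 'a"

definition closed_fm :: "fm scoped \<Rightarrow> fm" where
  "closed_fm P = P (0, 0, 0, 0)"

definition allN :: "(ntm scoped \<Rightarrow> fm scoped) \<Rightarrow> fm scoped" (binder "\<^bold>\<forall>\<^sub>N" 10) where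
  "allN P = (\<lambda>(n, s, x, r). AllN (P (\<lambda>(n', _, _, _). NVar (n' - Suc n)) (Suc n, s, x, r)))"
definition exN :: "(ntm scoped \<Rightarrow> fm scoped) \<Rightarrow> fm scoped" (binder "\<^bold>\<exists>\<^sub>N" 10) where
  "exN P = (\<lambda>(n, s, x, r). ExN (P (\<lambda>(n', _, _, _). NVar (n' - Suc n)) (Suc n, s, x, r)))"
definition allS :: "(stm scoped \<Rightarrow> fm scoped) \<Rightarrow> fm scoped" (binder "\<^bold>\<forall>\<^sub>S" 10) where
  "allS P = (\<lambda>(n, s, x, r). AllS (P (\<lambda>(_, s', _, _). SVar (s' - Suc s)) (n, Suc s, x, r)))"
definition exS :: "(stm scoped \<Rightarrow> fm scoped) \<Rightarrow> fm scoped" (binder "\<^bold>\<exists>\<^sub>S" 10) where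
  "exS P = (\<lambda>(n, s, x, r). ExS (P (\<lambda>(_, s', _, _). SVar (s' - Suc s)) (n, Suc s, x, r)))"
definition allX :: "(nat scoped \<Rightarrow> fm scoped) \<Rightarrow> fm scoped" (binder "\<^bold>\<forall>\<^sub>X" 10) where
  "allX P = (\<lambda>(n, s, x, r). AllX (P (\<lambda>(_, _, x', _). x' - Suc x) (n, s, Suc x, r)))"
definition allR :: "(nat scoped \<Rightarrow> fm scoped) \<Rightarrow> fm scoped" (binder "\<^bold>\<forall>\<^sub>R" 10) where
  "allR P = (\<lambda>(n, s, x, r). AllR (P (\<lambda>(_, _, _, r'). r' - Suc r) (n, s, x, Suc r)))"
definition exR :: "(nat scoped \<Rightarrow> fm scoped) \<Rightarrow> fm scoped" (binder "\<^bold>\<exists>\<^sub>R" 10) where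
  "exR P = (\<lambda>(n, s, x, r). ExR (P (\<lambda>(_, _, _, r'). r' - Suc r) (n, s, x, Suc r)))"

definition zero :: "ntm scoped" ("\<^bold>0") where
  "\<^bold>0 = (\<lambda>d. Zero)"
definition succ :: "ntm scoped \<Rightarrow> ntm scoped" ("\<^bold>S _" [80] 80) where
  "(\<^bold>S t) = (\<lambda>d. Succ (t d))"
definition add :: "ntm scoped \<Rightarrow> ntm scoped \<Rightarrow> ntm scoped" (infixl "\<^bold>+" 65) where
  "t \<^bold>+ u = (\<lambda>d. Add (t d) (u d))"
definition app :: "stm scoped \<Rightarrow> ntm scoped \<Rightarrow> ntm scoped" (infixl "\<^bold>\<cdot>" 90) where
  "a \<^bold>\<cdot> t = (\<lambda>d. App (a d) (t d))"
definition init :: "stm scoped \<Rightarrow> ntm scoped \<Rightarrow> ntm scoped" (infixl "\<^bold>\<restriction>" 95) where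
  "a \<^bold>\<restriction> t = (\<lambda>d. Init (a d) (t d))"
definition sect :: "stm scoped \<Rightarrow> ntm scoped \<Rightarrow> stm scoped" (infixl "\<^bold>^" 95) where
  "a \<^bold>^ t = (\<lambda>d. Sect (a d) (t d))"

definition bot :: "fm scoped" ("\<^bold>\<bottom>") where
  "\<^bold>\<bottom> = (\<lambda>d. Bot)"
definition eqN :: "ntm scoped \<Rightarrow> ntm scoped \<Rightarrow> fm scoped" (infix "\<^bold>=" 50) where
  "(t \<^bold>= u) = (\<lambda>d. EqN (t d) (u d))"
definition mem :: "stm scoped \<Rightarrow> nat scoped \<Rightarrow> fm scoped" (infix "\<^bold>\<in>" 50) where
  "(a \<^bold>\<in> X) = (\<lambda>d. Mem (a d) (X d))"
definition rel :: "nat scoped \<Rightarrow> stm scoped \<Rightarrow> ntm scoped \<Rightarrow> fm scoped" where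
  "rel R a t = (\<lambda>d. Rel (R d) (a d) (t d))"
definition conj :: "fm scoped \<Rightarrow> fm scoped \<Rightarrow> fm scoped" (infixr "\<^bold>\<and>" 35) where
  "(A \<^bold>\<and> B) = (\<lambda>d. And (A d) (B d))"
definition imp :: "fm scoped \<Rightarrow> fm scoped \<Rightarrow> fm scoped" (infixr "\<^bold>\<longrightarrow>" 25) where
  "(A \<^bold>\<longrightarrow> B) = (\<lambda>d. Imp (A d) (B d))"
definition iff :: "fm scoped \<Rightarrow> fm scoped \<Rightarrow> fm scoped" (infixr "\<^bold>\<longleftrightarrow>" 25) where
  "(A \<^bold>\<longleftrightarrow> B) = (\<lambda>d. Iff (A d) (B d))"
definition neg :: "fm scoped \<Rightarrow> fm scoped" ("\<^bold>\<not> _" [40] 40) where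
  "(\<^bold>\<not> A) = (A \<^bold>\<longrightarrow> \<^bold>\<bottom>)"
definition neqN :: "ntm scoped \<Rightarrow> ntm scoped \<Rightarrow> fm scoped" (infix "\<^bold>\<noteq>" 50) where
  "(t \<^bold>\<noteq> u) = (\<^bold>\<not> (t \<^bold>= u))"
definition less :: "ntm scoped \<Rightarrow> ntm scoped \<Rightarrow> fm scoped" (infix "\<^bold><" 50) where
  "(t \<^bold>< u) = (\<^bold>\<exists>\<^sub>N k. t \<^bold>+ \<^bold>S k \<^bold>= u)"

section \<open>The notions of intuitionistic descriptive set theory\<close>

text \<open>A definable subset of \<open>\<N>\<close> is a function from sequences to formulas in scope; for a set
  variable \<open>X\<close> it is \<open>\<lambda>\<alpha>. \<alpha> \<^bold>\<in> X\<close>.\<close>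

type_synonym sclass = "stm scoped \<Rightarrow> fm scoped"

definition initial_of :: "ntm scoped \<Rightarrow> stm scoped \<Rightarrow> fm scoped" (infix "\<^bold>\<sqsubset>" 50) where
  "(s \<^bold>\<sqsubset> \<beta>) = (\<^bold>\<exists>\<^sub>N k. s \<^bold>= \<beta> \<^bold>\<restriction> k)"

definition BCP :: "fm scoped" where
  "BCP = (\<^bold>\<forall>\<^sub>R R. (\<^bold>\<forall>\<^sub>S \<alpha>. \<^bold>\<exists>\<^sub>N n. rel R \<alpha> n) \<^bold>\<longrightarrow>
     (\<^bold>\<forall>\<^sub>S \<alpha>. \<^bold>\<exists>\<^sub>N m. \<^bold>\<exists>\<^sub>N n. \<^bold>\<forall>\<^sub>S \<beta>. \<alpha> \<^bold>\<restriction> m \<^bold>\<sqsubset> \<beta> \<^bold>\<longrightarrow> rel R \<beta> n))"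

text \<open>$\varphi : \mathcal{N} \to \mathbb{N}$ and $\varphi(\alpha) = p$\<close>

definition codes_NtoNat :: "stm scoped \<Rightarrow> fm scoped" where
  "codes_NtoNat \<phi> = (\<^bold>\<forall>\<^sub>S \<alpha>. \<^bold>\<exists>\<^sub>N n. \<phi> \<^bold>\<cdot> (\<alpha> \<^bold>\<restriction> n) \<^bold>\<noteq> \<^bold>0)"

definition value_at :: "stm scoped \<Rightarrow> stm scoped \<Rightarrow> ntm scoped \<Rightarrow> fm scoped" where
  "value_at \<phi> \<alpha> p = (\<^bold>\<exists>\<^sub>N n. \<phi> \<^bold>\<cdot> (\<alpha> \<^bold>\<restriction> n) \<^bold>= \<^bold>S p \<^bold>\<and> (\<^bold>\<forall>\<^sub>N k. k \<^bold>< n \<^bold>\<longrightarrow> \<phi> \<^bold>\<cdot> (\<alpha> \<^bold>\<restriction> k) \<^bold>= \<^bold>0))"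

text \<open>$\varphi : \mathcal{N} \to \mathcal{N}$ and $\varphi|\alpha = \gamma$\<close>

definition codes_NtoN :: "stm scoped \<Rightarrow> fm scoped" where
  "codes_NtoN \<phi> = (\<^bold>\<forall>\<^sub>N n. codes_NtoNat (\<phi> \<^bold>^ n))"

definition image_is :: "stm scoped \<Rightarrow> stm scoped \<Rightarrow> stm scoped \<Rightarrow> fm scoped" where
  "image_is \<phi> \<alpha> \<gamma> = (\<^bold>\<forall>\<^sub>N n. value_at (\<phi> \<^bold>^ n) \<alpha> (\<gamma> \<^bold>\<cdot> n))"

text \<open>As \<open>\<phi>|\<alpha>\<close> is not a term of the language, $\varphi|\alpha \in \mathcal{Y}$ is expressed by
  saying that the sequence \<open>\<gamma>\<close> that is $\varphi|\alpha$ belongs to $\mathcal{Y}$.\<close>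

definition reducible :: "sclass \<Rightarrow> sclass \<Rightarrow> fm scoped" (infix "\<^bold>\<preceq>" 50) where
  "(X \<^bold>\<preceq> Y) = (\<^bold>\<exists>\<^sub>S \<phi>. codes_NtoN \<phi> \<^bold>\<and>
     (\<^bold>\<forall>\<^sub>S \<alpha>. X \<alpha> \<^bold>\<longleftrightarrow> (\<^bold>\<exists>\<^sub>S \<gamma>. image_is \<phi> \<alpha> \<gamma> \<^bold>\<and> Y \<gamma>)))"

definition A1 :: sclass where
  "A1 \<alpha> = (\<^bold>\<forall>\<^sub>N n. \<alpha> \<^bold>\<cdot> n \<^bold>= \<^bold>0)"

definition \<D> :: "ntm scoped \<Rightarrow> sclass \<Rightarrow> sclass" where
  "\<D> n X \<alpha> = (\<^bold>\<exists>\<^sub>N i. i \<^bold>< n \<^bold>\<and> X (\<alpha> \<^bold>^ i))"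

definition Pi01 :: "sclass \<Rightarrow> fm scoped" where
  "Pi01 X = (\<^bold>\<exists>\<^sub>S \<beta>. \<^bold>\<forall>\<^sub>S \<alpha>. X \<alpha> \<^bold>\<longleftrightarrow> (\<^bold>\<forall>\<^sub>N n. \<beta> \<^bold>\<cdot> (\<alpha> \<^bold>\<restriction> n) \<^bold>= \<^bold>0))"

definition Pi02 :: "sclass \<Rightarrow> fm scoped" where
  "Pi02 X = (\<^bold>\<exists>\<^sub>S \<beta>. \<^bold>\<forall>\<^sub>S \<alpha>. X \<alpha> \<^bold>\<longleftrightarrow> (\<^bold>\<forall>\<^sub>N m. \<^bold>\<exists>\<^sub>N n. \<beta> \<^bold>^ m \<^bold>\<cdot> (\<alpha> \<^bold>\<restriction> n) \<^bold>\<noteq> \<^bold>0))"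

end

theory Submission
  imports Defs
begin

text \<open>
  Derivability is turned into forcing: contexts are worlds, and truth values are upward closed sets of
  contexts that respect proof by cases. Implication and the quantifiers then become HOL quantification
  over larger contexts and over all terms, and induction, comprehension and unique choice hold for
  every definable HOL function into the truth values.

  A code $\beta$ of a closed set and a reduction $\varphi$ to $\mathcal{A}_1$ yield each other: $(\varphi|\alpha)(n)$ can
  be taken to be $\beta(n)$ if \<open>n\<close> codes an initial segment of $\alpha$, and \<open>0\<close> otherwise; conversely $\beta$ can
  inspect, on each initial segment, one stage of the computation of one value of $\varphi|\alpha$. A finite
  union only requires a finite choice of such codes.

  For the negative results consider the sequences with at most one non-zero entry (a spike). Each of
  them belongs to every $\mathbf{\Pi}^0_2$ set that agrees with $\mathbb{D}^2(\mathcal{A}_1)$: as long as no spike has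
  appeared it cannot be distinguished from the zero sequence, and afterwards one of the two rows is
  seen to vanish. But the continuity principle would decide which row vanishes before the spike
  appears. If $\mathbb{D}^{n+1}(\mathcal{A}_1)$ reduces to $\mathbb{D}^n(\mathcal{A}_1)$, then by continuity each of the \<open>n + 1\<close> rows
  forces one of \<open>n\<close> rows of the image near the zero sequence, so that two rows \<open>i < i'\<close> force the same
  one. A sequence with a spike in these rows is then mapped into $\mathbb{D}^n(\mathcal{A}_1)$ without a decision which
  of the two rows vanishes, which is impossible for the same reason.
\<close>

section \<open>Substitution\<close>

text \<open>Two levels have to be kept apart: HOL is classical, while the continuity principle
  contradicts classical logic. In the forcing relation a disjunction or an existence statement is
  eliminated only by passing to larger contexts, never by a HOL case split on it. The price is
  definability: a HOL function of terms need not come from a formula, and induction, comprehension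
  and choice are available for formulas only. Both negative results end in one contradiction,
  \<open>no_spike_choice\<close>, about sequences that differ from a fixed \<open>b\<close> in at
  most one place, where it remains open whether and where they do. Here \<open>b\<close> is the zero
  sequence for the \<open>Pi02\<close> result, and a sequence that vanishes in exactly two rows for
  the result on reductions. Such a sequence can be placed in the set in question only by tests that
  see finitely many entries, or by refuting the negation of an equation between numbers; the first
  way serves the \<open>Pi02\<close> result, the second the other. The continuity principle speaks
  of all sequences, whereas the hypotheses concern spikes or sequences with a vanishing row; so each
  time an arbitrary sequence is first mapped to one of the required kind.\<close>

lemma nsub_nsub: "nsub f g (nsub f' g' t) = nsub (\<lambda>i. nsub f g (f' i)) (\<lambda>i. ssub f g (g' i)) t"
  and ssub_ssub: "ssub f g (ssub f' g' a) = ssub (\<lambda>i. nsub f g (f' i)) (\<lambda>i. ssub f g (g' i)) a"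
  by (induction t and a) simp_all

lemma nsub_id [simp]: "nsub NVar SVar t = t"
  and ssub_id [simp]: "ssub NVar SVar a = a"
  by (induction t and a) simp_all

lemma up_id [simp]: "case_nat (NVar 0) (\<lambda>i. NVar (Suc i)) = NVar"
  "case_nat (SVar 0) (\<lambda>i. SVar (Suc i)) = SVar" "case_nat 0 Suc = id"
  by (auto split: nat.split)

text \<open>Under a binder an environment has the shape \<open>case_nat t h\<close>, with a new
  value at index 0 and the old ones shifted; these rules push a substitution through that
  shape.\<close>

lemma case_nat_comp:
  "(\<lambda>i. nsub f g (case_nat t h i)) = case_nat (nsub f g t) (\<lambda>i. nsub f g (h i))"
  "(\<lambda>i. ssub f g (case_nat a k i)) = case_nat (ssub f g a) (\<lambda>i. ssub f g (k i))"
  "(\<lambda>i. case_nat u v (case_nat m w i)) = case_nat (case_nat u v m) (\<lambda>i. case_nat u v (w i))"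
  by (auto split: nat.split)

lemma fun_case_nat: "(\<lambda>i. h (case_nat a f i)) = case_nat (h a) (\<lambda>i. h (f i))"
  by (auto split: nat.split)

lemma fsub_fsub:
  "fsub f g x r (fsub f' g' x' r' A) =
   fsub (\<lambda>i. nsub f g (f' i)) (\<lambda>i. ssub f g (g' i)) (\<lambda>i. x (x' i)) (\<lambda>i. r (r' i)) A"
  by (induction A arbitrary: f g x r f' g' x' r')
     (simp_all add: nsub_nsub ssub_ssub case_nat_comp)

lemma fsub_id [simp]: "fsub NVar SVar id id A = A" "fsub NVar SVar (\<lambda>i. i) (\<lambda>i. i) A = A"
proof -
  show "fsub NVar SVar id id A = A"
    by (induction A) (simp_all add: id_def up_id(3)[unfolded id_def])
  then show "fsub NVar SVar (\<lambda>i. i) (\<lambda>i. i) A = A" by (simp add: id_def)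
qed

text \<open>A context counts only as a set, so that weakening, exchange and contraction are one
  statement. This makes inclusion of contexts an order of worlds.\<close>

lemma derives_mono: "\<Gamma> \<turnstile> A \<Longrightarrow> set \<Gamma> \<subseteq> set \<Delta> \<Longrightarrow> \<Delta> \<turnstile> A"
proof (induction arbitrary: \<Delta> rule: derives.induct)
  case (OrE \<Gamma> A B C)
  show ?case
    by (rule derives.OrE, rule OrE.IH(1)[OF OrE.prems], rule OrE.IH(2), use OrE.prems in auto)
       (rule OrE.IH(3), use OrE.prems in auto)
next
  case (ImpI A \<Gamma> B)
  show ?case by (rule derives.ImpI, rule ImpI.IH) (use ImpI.prems in auto)
next
  case (Induct \<Gamma> A)
  show ?case
    by (rule derives.Induct, rule Induct.IH(1)[OF Induct.prems], rule Induct.IH(2))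
       (use Induct.prems in auto)
next
  case (Unique_Choice \<Gamma> A)
  then show ?case by (intro derives.Unique_Choice) auto
next
  case (ExNE \<Gamma> A C)
  show ?case by (rule derives.ExNE, rule ExNE.IH(1)[OF ExNE.prems], rule ExNE.IH(2)) (use ExNE.prems in auto)
next
  case (ExSE \<Gamma> A C)
  show ?case by (rule derives.ExSE, rule ExSE.IH(1)[OF ExSE.prems], rule ExSE.IH(2)) (use ExSE.prems in auto)
next
  case (ExXE \<Gamma> A C)
  show ?case by (rule derives.ExXE, rule ExXE.IH(1)[OF ExXE.prems], rule ExXE.IH(2)) (use ExXE.prems in auto)
next
  case (ExRE \<Gamma> A C)
  show ?case by (rule derives.ExRE, rule ExRE.IH(1)[OF ExRE.prems], rule ExRE.IH(2)) (use ExRE.prems in auto)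
next
  case (AllNI \<Gamma> A)
  show ?case by (rule derives.AllNI, rule AllNI.IH) (use AllNI.prems in auto)
next
  case (AllSI \<Gamma> A)
  show ?case by (rule derives.AllSI, rule AllSI.IH) (use AllSI.prems in auto)
next
  case (AllXI \<Gamma> A)
  show ?case by (rule derives.AllXI, rule AllXI.IH) (use AllXI.prems in auto)
next
  case (AllRI \<Gamma> A)
  show ?case by (rule derives.AllRI, rule AllRI.IH) (use AllRI.prems in auto)
next
  case BotE then show ?case by (metis derives.BotE)
next
  case AndI then show ?case by (metis derives.AndI)
next
  case AndE1 then show ?case by (metis derives.AndE1)
next
  case AndE2 then show ?case by (metis derives.AndE2)
next
  case OrI1 then show ?case by (metis derives.OrI1)
next
  case OrI2 then show ?case by (metis derives.OrI2)
next
  case ImpE then show ?case by (metis derives.ImpE)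
next
  case AllNE then show ?case by (metis derives.AllNE)
next
  case ExNI then show ?case by (metis derives.ExNI)
next
  case AllSE then show ?case by (metis derives.AllSE)
next
  case ExSI then show ?case by (metis derives.ExSI)
next
  case AllXE then show ?case by (metis derives.AllXE)
next
  case ExXI then show ?case by (metis derives.ExXI)
next
  case AllRE then show ?case by (metis derives.AllRE)
next
  case ExRI then show ?case by (metis derives.ExRI)
next
  case EqN_subst then show ?case by (metis derives.EqN_subst)
next
  case EqS_subst then show ?case by (metis derives.EqS_subst)
next
  case EqS_ext then show ?case by (metis derives.EqS_ext)
next
  case Assm then show ?case by (intro derives.Assm) auto
qed (rule derives.EqN_refl derives.EqS_refl derives.Succ_neq derives.Pred_Zero derives.Pred_Succ derives.Add_Zero derives.Add_Succ derives.Mul_Zero derives.Mul_Succ derives.Pow_Zero derives.Pow_Succ derives.App_Sect derives.Init_Zero derives.Init_Succ derives.CompX derives.CompR)+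

section \<open>Substitution in derivations\<close>

lemma fsub_lift:
  "fsub (case_nat (NVar 0) (\<lambda>i. nsub nsucc SVar (f i))) (\<lambda>i. ssub nsucc SVar (g i)) x r (liftN A) = liftN (fsub f g x r A)"
  "fsub (\<lambda>i. nsub NVar ssucc (f i)) (case_nat (SVar 0) (\<lambda>i. ssub NVar ssucc (g i))) x r (liftS A) = liftS (fsub f g x r A)"
  "fsub f g (case_nat 0 (\<lambda>i. Suc (x i))) r (liftX A) = liftX (fsub f g x r A)"
  "fsub f g x (case_nat 0 (\<lambda>i. Suc (r i))) (liftR A) = liftR (fsub f g x r A)"
  by (simp_all add: liftN_def liftS_def liftX_def liftR_def fsub_fsub)

lemma fsub_inst:
  "fsub f g x r (instN t A) =
    instN (nsub f g t) (fsub (case_nat (NVar 0) (\<lambda>i. nsub nsucc SVar (f i))) (\<lambda>i. ssub nsucc SVar (g i)) x r A)"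
  "fsub f g x r (instS a A) =
    instS (ssub f g a) (fsub (\<lambda>i. nsub NVar ssucc (f i)) (case_nat (SVar 0) (\<lambda>i. ssub NVar ssucc (g i))) x r A)"
  "fsub f g x r (instX i A) = instX (x i) (fsub f g (case_nat 0 (\<lambda>i. Suc (x i))) r A)"
  "fsub f g x r (instR i A) = instR (r i) (fsub f g x (case_nat 0 (\<lambda>i. Suc (r i))) A)"
  by (simp_all add: instN_def instS_def instX_def instR_def fsub_fsub nsub_nsub ssub_ssub case_nat_comp
      fun_case_nat[of x] fun_case_nat[of r])

lemma map_lift:
  "map liftN (map (fsub f g x r) \<Gamma>) = map (fsub (case_nat (NVar 0) (\<lambda>i. nsub nsucc SVar (f i))) (\<lambda>i. ssub nsucc SVar (g i)) x r) (map liftN \<Gamma>)"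
  "map liftS (map (fsub f g x r) \<Gamma>) = map (fsub (\<lambda>i. nsub NVar ssucc (f i)) (case_nat (SVar 0) (\<lambda>i. ssub NVar ssucc (g i))) x r) (map liftS \<Gamma>)"
  "map liftX (map (fsub f g x r) \<Gamma>) = map (fsub f g (case_nat 0 (\<lambda>i. Suc (x i))) r) (map liftX \<Gamma>)"
  "map liftR (map (fsub f g x r) \<Gamma>) = map (fsub f g x (case_nat 0 (\<lambda>i. Suc (r i)))) (map liftR \<Gamma>)"
  by (simp_all add: fsub_lift)

text \<open>The rules with eigenvariables are the reason for the commutation lemmas above: a
  substitution has to pass under the binder, through the lifted context and past the instantiation.
  It is applied to the renamings that exchange a fresh variable for an eigenvariable.\<close>

lemma derives_fsub: "\<Gamma> \<turnstile> A \<Longrightarrow> map (fsub f g x r) \<Gamma> \<turnstile> fsub f g x r A"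
proof (induction arbitrary: f g x r rule: derives.induct)
  case (Induct \<Gamma> A)
  let ?A = "fsub (case_nat (NVar 0) (\<lambda>i. nsub nsucc SVar (f i))) (\<lambda>i. ssub nsucc SVar (g i)) x r A"
  have eq: "fsub (case_nat (NVar 0) (\<lambda>i. nsub nsucc SVar (f i))) (\<lambda>i. ssub nsucc SVar (g i)) x r
      (fsub (case_nat (Succ (NVar 0)) nsucc) SVar id id A) = fsub (case_nat (Succ (NVar 0)) nsucc) SVar id id ?A"
    by (simp add: fsub_fsub nsub_nsub ssub_ssub case_nat_comp)
  show ?case
    using derives.Induct[of "map (fsub f g x r) \<Gamma>" ?A] Induct.IH(1)[of f g x r]
      Induct.IH(2)[of "case_nat (NVar 0) (\<lambda>i. nsub nsucc SVar (f i))" "\<lambda>i. ssub nsucc SVar (g i)" x r]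
    by (simp only: map_lift list.map eq fsub_inst fsub.simps nsub.simps) 
next
  case (Unique_Choice \<Gamma> A)
  \<comment> \<open>In \<open>A\<close> both the argument and the value of the chosen function are
    bound, so the substitution is lifted past two number variables.\<close>
  let ?f = "\<lambda>f i. case i of 0 \<Rightarrow> NVar 0 | Suc i \<Rightarrow> nsub nsucc SVar (f i)" 
  let ?A = "fsub (?f (?f f)) (\<lambda>i. ssub (\<lambda>i. nsucc (Suc i)) SVar (g i)) x r A"
  show ?case
    using derives.Unique_Choice[of "map (fsub f g x r) \<Gamma>" ?A] Unique_Choice.IH[of f g x r]
    by (simp add: Iff_def liftS_def fsub_fsub nsub_nsub ssub_ssub case_nat_comp)
next
  case (AllNI \<Gamma> A) then show ?case by (simp only: fsub.simps) (rule derives.AllNI, simp only: map_lift)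
next
  case (AllSI \<Gamma> A) then show ?case by (simp only: fsub.simps) (rule derives.AllSI, simp only: map_lift)
next
  case (AllXI \<Gamma> A) then show ?case by (simp only: fsub.simps) (rule derives.AllXI, simp only: map_lift)
next
  case (AllRI \<Gamma> A) then show ?case by (simp only: fsub.simps) (rule derives.AllRI, simp only: map_lift)
next
  case (ExNE \<Gamma> A C)
  then show ?case
    by (intro derives.ExNE[of "map (fsub f g x r) \<Gamma>", OF ExNE.IH(1)[unfolded fsub.simps]])
       (simp only: map_lift fsub_lift(1)[symmetric] list.map(2)[symmetric])
next
  case (ExSE \<Gamma> A C)
  then show ?case
    by (intro derives.ExSE[of "map (fsub f g x r) \<Gamma>", OF ExSE.IH(1)[unfolded fsub.simps]])
       (simp only: map_lift fsub_lift(2)[symmetric] list.map(2)[symmetric])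
next
  case (ExXE \<Gamma> A C)
  then show ?case
    by (intro derives.ExXE[of "map (fsub f g x r) \<Gamma>", OF ExXE.IH(1)[unfolded fsub.simps]])
       (simp only: map_lift fsub_lift(3)[symmetric] list.map(2)[symmetric])
next
  case (ExRE \<Gamma> A C)
  then show ?case
    by (intro derives.ExRE[of "map (fsub f g x r) \<Gamma>", OF ExRE.IH(1)[unfolded fsub.simps]])
       (simp only: map_lift fsub_lift(4)[symmetric] list.map(2)[symmetric])
next
  case (EqS_ext \<Gamma> a b)
  show ?case
    using derives.EqS_ext[of "map (fsub f g x r) \<Gamma>" "ssub f g a" "ssub f g b"] EqS_ext.IH[of f g x r]
    by (simp add: ssub_ssub)
next
  case (CompX \<Gamma> A)
  show ?case
    using derives.CompX[of "map (fsub f g x r) \<Gamma>" "fsub (\<lambda>i. nsub NVar ssucc (f i)) (case_nat (SVar 0) (\<lambda>i. ssub NVar ssucc (g i))) x r A"]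
    by (simp add: Iff_def liftX_def fsub_fsub)
next
  case (CompR \<Gamma> A)
  let ?f = "case_nat (NVar 0) (\<lambda>i. nsub nsucc SVar (nsub NVar ssucc (f i)))"
  let ?g = "\<lambda>i. ssub nsucc SVar (case_nat (SVar 0) (\<lambda>i. ssub NVar ssucc (g i)) i)"
  show ?case
    using derives.CompR[of "map (fsub f g x r) \<Gamma>" "fsub ?f ?g x r A"]
    by (simp add: Iff_def liftR_def fsub_fsub)
next
  case BotE then show ?case by simp (metis derives.BotE)
next
  case AndI then show ?case by simp (metis derives.AndI)
next
  case AndE1 then show ?case by simp (metis derives.AndE1)
next
  case AndE2 then show ?case by simp (metis derives.AndE2)
next
  case OrI1 then show ?case by simp (metis derives.OrI1)
next
  case OrI2 then show ?case by simp (metis derives.OrI2)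
next
  case ImpE then show ?case by simp (metis derives.ImpE)
next
  case OrE then show ?case by simp (metis derives.OrE)
next
  case ImpI then show ?case by simp (metis derives.ImpI)
next
  case AllNE then show ?case by (simp only: fsub_inst fsub.simps) (rule derives.AllNE)
next
  case AllSE then show ?case by (simp only: fsub_inst fsub.simps) (rule derives.AllSE)
next
  case AllXE then show ?case by (simp only: fsub_inst fsub.simps) (rule derives.AllXE)
next
  case AllRE then show ?case by (simp only: fsub_inst fsub.simps) (rule derives.AllRE)
next
  case ExNI then show ?case by (simp only: fsub_inst fsub.simps) (rule derives.ExNI)
next
  case ExSI then show ?case by (simp only: fsub_inst fsub.simps) (rule derives.ExSI)
next
  case ExXI then show ?case by (simp only: fsub_inst fsub.simps) (rule derives.ExXI)
next
  case ExRI then show ?case by (simp only: fsub_inst fsub.simps) (rule derives.ExRI)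
next
  case EqN_subst then show ?case by (simp only: fsub_inst fsub.simps) (rule derives.EqN_subst)
next
  case EqS_subst then show ?case by (simp only: fsub_inst fsub.simps) (rule derives.EqS_subst)
next
  case Assm then show ?case by (intro derives.Assm) auto
qed (simp_all add: pair_def two_def derives.EqN_refl derives.EqS_refl derives.Succ_neq derives.Pred_Zero derives.Pred_Succ derives.Add_Zero derives.Add_Succ derives.Mul_Zero derives.Mul_Succ derives.Pow_Zero derives.Pow_Succ derives.App_Sect derives.Init_Zero derives.Init_Succ
    derives.App_Sect[unfolded pair_def two_def] derives.Init_Succ[unfolded pair_def two_def])

section \<open>Fresh variables\<close>

primrec nbd :: "ntm \<Rightarrow> nat" and sbd :: "stm \<Rightarrow> nat" where
  "nbd (NVar i) = Suc i"
| "nbd Zero = 0"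
| "nbd (Succ t) = nbd t"
| "nbd (Pred t) = nbd t"
| "nbd (Add t u) = max (nbd t) (nbd u)"
| "nbd (Mul t u) = max (nbd t) (nbd u)"
| "nbd (Pow t u) = max (nbd t) (nbd u)"
| "nbd (App a t) = max (sbd a) (nbd t)"
| "nbd (Init a t) = max (sbd a) (nbd t)"
| "sbd (SVar i) = Suc i"
| "sbd (Sect a t) = max (sbd a) (nbd t)"

text \<open>Binders are deliberately not accounted for: any bound on the indices will do.\<close>

primrec fbd :: "fm \<Rightarrow> nat" where
  "fbd Bot = 0"
| "fbd (EqN t u) = max (nbd t) (nbd u)"
| "fbd (EqS a b) = max (sbd a) (sbd b)"
| "fbd (Mem a i) = max (sbd a) (Suc i)"
| "fbd (Rel i a t) = max (Suc i) (max (sbd a) (nbd t))"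
| "fbd (And A B) = max (fbd A) (fbd B)"
| "fbd (Or A B) = max (fbd A) (fbd B)"
| "fbd (Imp A B) = max (fbd A) (fbd B)"
| "fbd (AllN A) = fbd A"
| "fbd (ExN A) = fbd A"
| "fbd (AllS A) = fbd A"
| "fbd (ExS A) = fbd A"
| "fbd (AllX A) = fbd A"
| "fbd (ExX A) = fbd A"
| "fbd (AllR A) = fbd A"
| "fbd (ExR A) = fbd A"

lemma nsub_agree: "\<forall>i<nbd t. f i = f' i \<and> g i = g' i \<Longrightarrow> nsub f g t = nsub f' g' t"
  and ssub_agree: "\<forall>i<sbd a. f i = f' i \<and> g i = g' i \<Longrightarrow> ssub f g a = ssub f' g' a"
  by (induction t and a) simp_all

text \<open>Under a binder the lifted substitutions at \<open>Suc i\<close> are built from the old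
  ones at \<open>i\<close>, so agreement below the bound persists although \<open>fbd\<close> does
  not change there.\<close>

lemma fsub_agree:
  "\<forall>i<fbd A. f i = f' i \<and> g i = g' i \<and> x i = x' i \<and> r i = r' i \<Longrightarrow>
   fsub f g x r A = fsub f' g' x' r' A"
proof (induction A arbitrary: f f' g g' x x' r r')
  case (EqN t u)
  then show ?case using nsub_agree[of t f f' g g'] nsub_agree[of u f f' g g'] by simp
next
  case (EqS a b)
  then show ?case using ssub_agree[of a f f' g g'] ssub_agree[of b f f' g g'] by simp
next
  case (Mem a i)
  then show ?case using ssub_agree[of a f f' g g'] by simp
next
  case (Rel i a t)
  then show ?case using ssub_agree[of a f f' g g'] nsub_agree[of t f f' g g'] by simp
next
  case (AllN A) show ?case using AllN.prems by (simp, intro AllN.IH) (auto split: nat.split)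
next
  case (ExN A) show ?case using ExN.prems by (simp, intro ExN.IH) (auto split: nat.split)
next
  case (AllS A) show ?case using AllS.prems by (simp, intro AllS.IH) (auto split: nat.split)
next
  case (ExS A) show ?case using ExS.prems by (simp, intro ExS.IH) (auto split: nat.split)
next
  case (AllX A) show ?case using AllX.prems by (simp, intro AllX.IH) (auto split: nat.split)
next
  case (ExX A) show ?case using ExX.prems by (simp, intro ExX.IH) (auto split: nat.split)
next
  case (AllR A) show ?case using AllR.prems by (simp, intro AllR.IH) (auto split: nat.split)
next
  case (ExR A) show ?case using ExR.prems by (simp, intro ExR.IH) (auto split: nat.split)
next
  case (And A B)
  then show ?case
    using And.IH(1)[of f f' g g' x x' r r'] And.IH(2)[of f f' g g' x x' r r'] by simp
next
  case (Or A B)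
  then show ?case
    using Or.IH(1)[of f f' g g' x x' r r'] Or.IH(2)[of f f' g g' x x' r r'] by simp
next
  case (Imp A B)
  then show ?case
    using Imp.IH(1)[of f f' g g' x x' r r'] Imp.IH(2)[of f f' g g' x x' r r'] by simp
qed simp

definition fresh_for :: "nat \<Rightarrow> fm list \<Rightarrow> bool" where
  "fresh_for k \<Gamma> \<longleftrightarrow> (\<forall>A\<in>set \<Gamma>. fbd A \<le> k)"

lemma fresh_exists: "\<exists>k. fresh_for k \<Gamma>"
  unfolding fresh_for_def
  by (rule exI[of _ "sum_list (map fbd \<Gamma>)"]) (auto intro!: member_le_sum_list)

lemma fresh_Cons [simp]: "fresh_for k (A # \<Gamma>) \<longleftrightarrow> fbd A \<le> k \<and> fresh_for k \<Gamma>"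
  by (auto simp: fresh_for_def)

text \<open>On formulas without the variable \<open>k\<close> this is \<open>liftN\<close>, and on
  the instance of a matrix at \<open>NVar k\<close> it undoes the instantiation. So it turns a
  derivation about a fresh \<open>k\<close> into the premise of a rule with an
  eigenvariable.\<close>

definition renN :: "nat \<Rightarrow> fm \<Rightarrow> fm" where
  "renN k = fsub (\<lambda>i. if i = k then NVar 0 else NVar (Suc i)) SVar id id"
definition renS :: "nat \<Rightarrow> fm \<Rightarrow> fm" where
  "renS k = fsub NVar (\<lambda>i. if i = k then SVar 0 else SVar (Suc i)) id id"
definition renX :: "nat \<Rightarrow> fm \<Rightarrow> fm" where
  "renX k = fsub NVar SVar (\<lambda>i. if i = k then 0 else Suc i) id"
definition renR :: "nat \<Rightarrow> fm \<Rightarrow> fm" where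
  "renR k = fsub NVar SVar id (\<lambda>i. if i = k then 0 else Suc i)"

lemma ren_lift:
  "fbd A \<le> k \<Longrightarrow> renN k A = liftN A" "fbd A \<le> k \<Longrightarrow> renS k A = liftS A"
  "fbd A \<le> k \<Longrightarrow> renX k A = liftX A" "fbd A \<le> k \<Longrightarrow> renR k A = liftR A"
  by (auto simp: renN_def liftN_def renS_def liftS_def renX_def liftX_def renR_def liftR_def intro!: fsub_agree)

lemma ren_lift_map:
  "fresh_for k \<Gamma> \<Longrightarrow> map (renN k) \<Gamma> = map liftN \<Gamma>" "fresh_for k \<Gamma> \<Longrightarrow> map (renS k) \<Gamma> = map liftS \<Gamma>"
  "fresh_for k \<Gamma> \<Longrightarrow> map (renX k) \<Gamma> = map liftX \<Gamma>" "fresh_for k \<Gamma> \<Longrightarrow> map (renR k) \<Gamma> = map liftR \<Gamma>"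
  by (auto simp: fresh_for_def ren_lift)

lemma ren_inst:
  "fbd A \<le> k \<Longrightarrow> renN k (instN (NVar k) A) = A" "fbd A \<le> k \<Longrightarrow> renS k (instS (SVar k) A) = A"
  "fbd A \<le> k \<Longrightarrow> renX k (instX k A) = A" "fbd A \<le> k \<Longrightarrow> renR k (instR k A) = A"
proof -
  have *: "A = fsub NVar SVar id id A" by simp
  show "fbd A \<le> k \<Longrightarrow> renN k (instN (NVar k) A) = A" "fbd A \<le> k \<Longrightarrow> renS k (instS (SVar k) A) = A"
    "fbd A \<le> k \<Longrightarrow> renX k (instX k A) = A" "fbd A \<le> k \<Longrightarrow> renR k (instR k A) = A"
    unfolding renN_def instN_def renS_def instS_def renX_def instX_def renR_def instR_def fsub_fsub
    by (subst (2) *, rule fsub_agree, auto split: nat.split)+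
qed

lemma derives_ren:
  "\<Gamma> \<turnstile> A \<Longrightarrow> map (renN k) \<Gamma> \<turnstile> renN k A" "\<Gamma> \<turnstile> A \<Longrightarrow> map (renS k) \<Gamma> \<turnstile> renS k A"
  "\<Gamma> \<turnstile> A \<Longrightarrow> map (renX k) \<Gamma> \<turnstile> renX k A" "\<Gamma> \<turnstile> A \<Longrightarrow> map (renR k) \<Gamma> \<turnstile> renR k A"
  by (simp_all add: renN_def renS_def renX_def renR_def derives_fsub)

text \<open>A fresh variable can be renamed into the eigenvariable; hence HOL quantification over all terms
  replaces the eigenvariable conditions.\<close>

lemma derives_AllN: "\<Gamma> \<turnstile> AllN A \<longleftrightarrow> (\<forall>t. \<Gamma> \<turnstile> instN t A)"
proof (intro iffI allI AllNI)
  assume *: "\<forall>t. \<Gamma> \<turnstile> instN t A"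
  obtain k where k: "fresh_for k (A # \<Gamma>)" using fresh_exists by blast
  show "map liftN \<Gamma> \<turnstile> A"
    using derives_ren(1)[OF *[rule_format], of k "NVar k"] k by (simp add: ren_inst ren_lift_map)
qed (rule AllNE)

lemma derives_AllS: "\<Gamma> \<turnstile> AllS A \<longleftrightarrow> (\<forall>t. \<Gamma> \<turnstile> instS t A)"
proof (intro iffI allI AllSI)
  assume *: "\<forall>t. \<Gamma> \<turnstile> instS t A"
  obtain k where k: "fresh_for k (A # \<Gamma>)" using fresh_exists by blast
  show "map liftS \<Gamma> \<turnstile> A"
    using derives_ren(2)[OF *[rule_format], of k "SVar k"] k by (simp add: ren_inst ren_lift_map)
qed (rule AllSE)

lemma derives_AllX: "\<Gamma> \<turnstile> AllX A \<longleftrightarrow> (\<forall>t. \<Gamma> \<turnstile> instX t A)"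
proof (intro iffI allI AllXI)
  assume *: "\<forall>t. \<Gamma> \<turnstile> instX t A"
  obtain k where k: "fresh_for k (A # \<Gamma>)" using fresh_exists by blast
  show "map liftX \<Gamma> \<turnstile> A"
    using derives_ren(3)[OF *[rule_format], of k k] k by (simp add: ren_inst ren_lift_map)
qed (rule AllXE)

lemma derives_AllR: "\<Gamma> \<turnstile> AllR A \<longleftrightarrow> (\<forall>t. \<Gamma> \<turnstile> instR t A)"
proof (intro iffI allI AllRI)
  assume *: "\<forall>t. \<Gamma> \<turnstile> instR t A"
  obtain k where k: "fresh_for k (A # \<Gamma>)" using fresh_exists by blast
  show "map liftR \<Gamma> \<turnstile> A"
    using derives_ren(4)[OF *[rule_format], of k k] k by (simp add: ren_inst ren_lift_map)
qed (rule AllRE)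

lemma derives_ExN_elim:
  assumes "\<Gamma> \<turnstile> ExN A" and "\<And>t. instN t A # \<Gamma> \<turnstile> C" shows "\<Gamma> \<turnstile> C"
proof -
  obtain k where k: "fresh_for k (A # C # \<Gamma>)" using fresh_exists by blast
  show ?thesis
    using derives_ren(1)[OF assms(2)[of "NVar k"], of k] k
    by - (rule ExNE[OF assms(1)], simp add: ren_inst ren_lift ren_lift_map)
qed

lemma derives_ExS_elim:
  assumes "\<Gamma> \<turnstile> ExS A" and "\<And>t. instS t A # \<Gamma> \<turnstile> C" shows "\<Gamma> \<turnstile> C"
proof -
  obtain k where k: "fresh_for k (A # C # \<Gamma>)" using fresh_exists by blast
  show ?thesis
    using derives_ren(2)[OF assms(2)[of "SVar k"], of k] k
    by - (rule ExSE[OF assms(1)], simp add: ren_inst ren_lift ren_lift_map)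
qed

lemma derives_ExR_elim:
  assumes "\<Gamma> \<turnstile> ExR A" and "\<And>t. instR t A # \<Gamma> \<turnstile> C" shows "\<Gamma> \<turnstile> C"
proof -
  obtain k where k: "fresh_for k (A # C # \<Gamma>)" using fresh_exists by blast
  show ?thesis
    using derives_ren(4)[OF assms(2)[of k], of k] k
    by - (rule ExRE[OF assms(1)], simp add: ren_inst ren_lift ren_lift_map)
qed

lemma derives_Induct:
  assumes "\<Gamma> \<turnstile> instN Zero A" and "\<And>t. instN t A # \<Gamma> \<turnstile> instN (Succ t) A" shows "\<Gamma> \<turnstile> instN t A"
proof -
  obtain k where k: "fresh_for k (A # \<Gamma>)" using fresh_exists by blast
  \<comment> \<open>The instance at the successor of the fresh variable becomes the shifted instance
    that the rule \<open>Induct\<close> asks for.\<close>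
  have "renN k (instN (Succ (NVar k)) A) = fsub (case_nat (Succ (NVar 0)) nsucc) SVar id id A"
    using k unfolding renN_def instN_def fsub_fsub
    by (intro fsub_agree) (auto split: nat.split)
  then show ?thesis
    using derives_ren(1)[OF assms(2)[of "NVar k"], of k] k
    by - (rule AllNE[OF Induct[OF assms(1)]], simp add: ren_inst ren_lift_map)
qed

section \<open>Forcing\<close>

definition extends :: "fm list \<Rightarrow> fm list \<Rightarrow> bool" (infix "\<preceq>" 50) where
  "\<Gamma> \<preceq> \<Delta> \<longleftrightarrow> set \<Gamma> \<subseteq> set \<Delta>"

lemma extends_refl [simp]: "\<Gamma> \<preceq> \<Gamma>" by (simp add: extends_def)
lemma extends_trans [trans]: "\<Gamma> \<preceq> \<Delta> \<Longrightarrow> \<Delta> \<preceq> \<Theta> \<Longrightarrow> \<Gamma> \<preceq> \<Theta>" by (auto simp: extends_def)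
lemma extends_Cons [simp]: "\<Gamma> \<preceq> A # \<Gamma>" by (auto simp: extends_def)
lemma derives_extends: "\<Gamma> \<preceq> \<Delta> \<Longrightarrow> \<Gamma> \<turnstile> A \<Longrightarrow> \<Delta> \<turnstile> A" by (auto simp: extends_def intro: derives_mono)

text \<open>The second-order reading of "\<open>U\<close> may be assumed": for every formula
  \<open>C\<close>, if \<open>U\<close> implies \<open>C\<close>, then \<open>C\<close>. This is the
  closure that the elimination rules for disjunction and existence support, since their conclusion
  is a formula. The quantification over extensions \<open>\<Theta>\<close> makes it monotone in the
  context.\<close>

definition covers :: "(fm list \<Rightarrow> bool) \<Rightarrow> fm list \<Rightarrow> bool" where
  "covers U \<Gamma> \<longleftrightarrow> (\<forall>C \<Theta>. \<Gamma> \<preceq> \<Theta> \<longrightarrow> (\<forall>\<Delta>. \<Theta> \<preceq> \<Delta> \<longrightarrow> U \<Delta> \<longrightarrow> \<Delta> \<turnstile> C) \<longrightarrow> \<Theta> \<turnstile> C)"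

text \<open>The truth values are the upward closed sets of contexts that are closed under proof by cases
  with a formula as goal. They form a complete Heyting algebra that contains the formulas modulo
  provable equivalence; quantification in it is over arbitrary HOL types.\<close>

typedef tv = "{U. (\<forall>\<Gamma> \<Delta>. \<Gamma> \<preceq> \<Delta> \<longrightarrow> U \<Gamma> \<longrightarrow> U \<Delta>) \<and> (\<forall>\<Gamma>. covers U \<Gamma> \<longrightarrow> U \<Gamma>)}"
  by (rule exI[of _ "\<lambda>_. True"]) simp

definition forces :: "fm list \<Rightarrow> tv \<Rightarrow> bool" (infix "\<tturnstile>" 42) where
  "\<Gamma> \<tturnstile> P \<longleftrightarrow> Rep_tv P \<Gamma>"

lemma o_eqI: "(\<And>\<Gamma>. \<Gamma> \<tturnstile> P \<longleftrightarrow> \<Gamma> \<tturnstile> Q) \<Longrightarrow> P = Q"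
  by (rule Rep_tv_inject[THEN iffD1]) (auto simp: forces_def)

lemma forces_mono: "\<Gamma> \<preceq> \<Delta> \<Longrightarrow> \<Gamma> \<tturnstile> P \<Longrightarrow> \<Delta> \<tturnstile> P"
  unfolding forces_def using Rep_tv[of P] by blast

text \<open>The common root of all eliminations: a truth value may be established on a cover, just
  as a formula may be proved by cases.\<close>

lemma forces_local: "covers (\<lambda>\<Delta>. \<Delta> \<tturnstile> P) \<Gamma> \<Longrightarrow> \<Gamma> \<tturnstile> P"
  unfolding forces_def using Rep_tv[of P] by blast

lemma forces_Abs:
  "(\<And>\<Gamma> \<Delta>. \<Gamma> \<preceq> \<Delta> \<Longrightarrow> U \<Gamma> \<Longrightarrow> U \<Delta>) \<Longrightarrow> (\<And>\<Gamma>. covers U \<Gamma> \<Longrightarrow> U \<Gamma>) \<Longrightarrow> \<Gamma> \<tturnstile> Abs_tv U \<longleftrightarrow> U \<Gamma>"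
  by (simp add: forces_def Abs_tv_inverse)

lemma covers_mono: "\<Gamma> \<preceq> \<Delta> \<Longrightarrow> covers U \<Gamma> \<Longrightarrow> covers U \<Delta>"
  unfolding covers_def by (meson extends_trans)

lemma covers_covers: "covers (covers U) \<Gamma> \<Longrightarrow> covers U \<Gamma>"
  unfolding covers_def by (meson extends_refl extends_trans)

lemma covers_sub: "covers U \<Gamma> \<Longrightarrow> (\<And>\<Delta>. \<Gamma> \<preceq> \<Delta> \<Longrightarrow> U \<Delta> \<Longrightarrow> V \<Delta>) \<Longrightarrow> covers V \<Gamma>"
  unfolding covers_def by (meson extends_trans)

definition tr :: "fm \<Rightarrow> tv" where "tr A = Abs_tv (\<lambda>\<Gamma>. \<Gamma> \<turnstile> A)"

definition and_o :: "tv \<Rightarrow> tv \<Rightarrow> tv" (infixr "\<and>\<^sub>o" 47) where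
  "(P \<and>\<^sub>o Q) = Abs_tv (\<lambda>\<Gamma>. \<Gamma> \<tturnstile> P \<and> \<Gamma> \<tturnstile> Q)"
text \<open>A union of truth values need not respect proof by cases, so disjunction and existence
  are closed off with \<open>covers\<close>. The other connectives preserve this property by
  themselves.\<close>

definition or_o :: "tv \<Rightarrow> tv \<Rightarrow> tv" (infixr "\<or>\<^sub>o" 46) where
  "(P \<or>\<^sub>o Q) = Abs_tv (covers (\<lambda>\<Gamma>. \<Gamma> \<tturnstile> P \<or> \<Gamma> \<tturnstile> Q))"
definition imp_o :: "tv \<Rightarrow> tv \<Rightarrow> tv" (infixr "\<longrightarrow>\<^sub>o" 45) where
  "(P \<longrightarrow>\<^sub>o Q) = Abs_tv (\<lambda>\<Gamma>. \<forall>\<Delta>. \<Gamma> \<preceq> \<Delta> \<longrightarrow> \<Delta> \<tturnstile> P \<longrightarrow> \<Delta> \<tturnstile> Q)"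
definition all_o :: "('a \<Rightarrow> tv) \<Rightarrow> tv" (binder "\<forall>\<^sub>o" 10) where
  "(\<forall>\<^sub>o t. P t) = Abs_tv (\<lambda>\<Gamma>. \<forall>t. \<Gamma> \<tturnstile> P t)"
definition ex_o :: "('a \<Rightarrow> tv) \<Rightarrow> tv" (binder "\<exists>\<^sub>o" 10) where
  "(\<exists>\<^sub>o t. P t) = Abs_tv (covers (\<lambda>\<Gamma>. \<exists>t. \<Gamma> \<tturnstile> P t))"
definition bot_o :: tv ("\<bottom>\<^sub>o") where "\<bottom>\<^sub>o = tr Bot"
definition not_o :: "tv \<Rightarrow> tv" ("\<not>\<^sub>o _" [48] 48) where "(\<not>\<^sub>o P) = (P \<longrightarrow>\<^sub>o \<bottom>\<^sub>o)"
definition iff_o :: "tv \<Rightarrow> tv \<Rightarrow> tv" (infixr "\<longleftrightarrow>\<^sub>o" 45) where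
  "(P \<longleftrightarrow>\<^sub>o Q) = ((P \<longrightarrow>\<^sub>o Q) \<and>\<^sub>o (Q \<longrightarrow>\<^sub>o P))"

text \<open>Derivability of \<open>A\<close> respects covers because the goal \<open>C\<close> may
  be taken to be \<open>A\<close> itself.\<close>

lemma forces_tr: "\<Gamma> \<tturnstile> tr A \<longleftrightarrow> \<Gamma> \<turnstile> A"
  unfolding tr_def by (rule forces_Abs) (auto simp: covers_def intro: derives_extends)

lemma forces_and [simp]: "\<Gamma> \<tturnstile> P \<and>\<^sub>o Q \<longleftrightarrow> \<Gamma> \<tturnstile> P \<and> \<Gamma> \<tturnstile> Q"
  unfolding and_o_def by (rule forces_Abs) (auto intro: forces_mono forces_local covers_sub)

lemma forces_imp: "\<Gamma> \<tturnstile> P \<longrightarrow>\<^sub>o Q \<longleftrightarrow> (\<forall>\<Delta>. \<Gamma> \<preceq> \<Delta> \<longrightarrow> \<Delta> \<tturnstile> P \<longrightarrow> \<Delta> \<tturnstile> Q)"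
  unfolding imp_o_def
proof (rule forces_Abs)
  fix \<Gamma> assume *: "covers (\<lambda>\<Gamma>. \<forall>\<Delta>. \<Gamma> \<preceq> \<Delta> \<longrightarrow> \<Delta> \<tturnstile> P \<longrightarrow> \<Delta> \<tturnstile> Q) \<Gamma>"
  show "\<forall>\<Delta>. \<Gamma> \<preceq> \<Delta> \<longrightarrow> \<Delta> \<tturnstile> P \<longrightarrow> \<Delta> \<tturnstile> Q"
  proof (intro allI impI)
    fix \<Delta> assume "\<Gamma> \<preceq> \<Delta>" "\<Delta> \<tturnstile> P"
    then have "covers (\<lambda>\<Delta>. \<Delta> \<tturnstile> Q) \<Delta>"
      using covers_sub[OF covers_mono[OF \<open>\<Gamma> \<preceq> \<Delta>\<close> *]] by (meson extends_refl forces_mono)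
    then show "\<Delta> \<tturnstile> Q" by (rule forces_local)
  qed
qed (meson extends_trans)

lemma forces_all [simp]: "\<Gamma> \<tturnstile> (\<forall>\<^sub>o t. P t) \<longleftrightarrow> (\<forall>t. \<Gamma> \<tturnstile> P t)"
  unfolding all_o_def
proof (rule forces_Abs)
  fix \<Gamma> assume "covers (\<lambda>\<Gamma>. \<forall>t. \<Gamma> \<tturnstile> P t) \<Gamma>"
  then have "covers (\<lambda>\<Delta>. \<Delta> \<tturnstile> P t) \<Gamma>" for t by (rule covers_sub) blast
  then show "\<forall>t. \<Gamma> \<tturnstile> P t" by (blast intro: forces_local)
qed (blast intro: forces_mono)

lemma forces_or: "\<Gamma> \<tturnstile> P \<or>\<^sub>o Q \<longleftrightarrow> covers (\<lambda>\<Gamma>. \<Gamma> \<tturnstile> P \<or> \<Gamma> \<tturnstile> Q) \<Gamma>"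
  unfolding or_o_def by (rule forces_Abs) (auto intro: covers_mono covers_covers)

lemma forces_ex: "\<Gamma> \<tturnstile> (\<exists>\<^sub>o t. P t) \<longleftrightarrow> covers (\<lambda>\<Gamma>. \<exists>t. \<Gamma> \<tturnstile> P t) \<Gamma>"
  unfolding ex_o_def by (rule forces_Abs) (auto intro: covers_mono covers_covers)

lemma impI_o: "(\<And>\<Delta>. \<Gamma> \<preceq> \<Delta> \<Longrightarrow> \<Delta> \<tturnstile> P \<Longrightarrow> \<Delta> \<tturnstile> Q) \<Longrightarrow> \<Gamma> \<tturnstile> P \<longrightarrow>\<^sub>o Q"
  by (simp add: forces_imp)

lemma mp_o: "\<Gamma> \<tturnstile> P \<longrightarrow>\<^sub>o Q \<Longrightarrow> \<Gamma> \<tturnstile> P \<Longrightarrow> \<Gamma> \<tturnstile> Q"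
  by (simp add: forces_imp)

lemma notI_o: "(\<And>\<Delta>. \<Gamma> \<preceq> \<Delta> \<Longrightarrow> \<Delta> \<tturnstile> P \<Longrightarrow> \<Delta> \<tturnstile> \<bottom>\<^sub>o) \<Longrightarrow> \<Gamma> \<tturnstile> \<not>\<^sub>o P"
  by (simp add: not_o_def forces_imp)

text \<open>The truth value \<open>G\<close> need not be a formula; but a context that derives
  \<open>Bot\<close> derives every goal and is therefore covered by anything.\<close>

lemma botE_o: "\<Gamma> \<tturnstile> \<bottom>\<^sub>o \<Longrightarrow> \<Gamma> \<tturnstile> G"
  by (rule forces_local) (auto simp: covers_def bot_o_def forces_tr intro: BotE derives_extends)

lemma notE_o: "\<Gamma> \<tturnstile> \<not>\<^sub>o P \<Longrightarrow> \<Gamma> \<tturnstile> P \<Longrightarrow> \<Gamma> \<tturnstile> G"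
  unfolding not_o_def by (blast intro: botE_o mp_o)

lemma orI1_o: "\<Gamma> \<tturnstile> P \<Longrightarrow> \<Gamma> \<tturnstile> P \<or>\<^sub>o Q"
  and orI2_o: "\<Gamma> \<tturnstile> Q \<Longrightarrow> \<Gamma> \<tturnstile> P \<or>\<^sub>o Q"
  unfolding forces_or covers_def by (blast intro: forces_mono extends_refl)+

lemma orE_o:
  assumes "\<Gamma> \<tturnstile> P \<or>\<^sub>o Q" "\<And>\<Delta>. \<Gamma> \<preceq> \<Delta> \<Longrightarrow> \<Delta> \<tturnstile> P \<Longrightarrow> \<Delta> \<tturnstile> G" "\<And>\<Delta>. \<Gamma> \<preceq> \<Delta> \<Longrightarrow> \<Delta> \<tturnstile> Q \<Longrightarrow> \<Delta> \<tturnstile> G"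
  shows "\<Gamma> \<tturnstile> G"
  by (rule forces_local, rule covers_sub[OF assms(1)[unfolded forces_or]]) (use assms(2,3) in blast)

lemma exI_o: "\<Gamma> \<tturnstile> P t \<Longrightarrow> \<Gamma> \<tturnstile> (\<exists>\<^sub>o t. P t)"
  unfolding forces_ex covers_def by (blast intro: forces_mono extends_refl)

lemma exE_o:
  assumes "\<Gamma> \<tturnstile> (\<exists>\<^sub>o t. P t)" "\<And>\<Delta> t. \<Gamma> \<preceq> \<Delta> \<Longrightarrow> \<Delta> \<tturnstile> P t \<Longrightarrow> \<Delta> \<tturnstile> G"
  shows "\<Gamma> \<tturnstile> G"
  by (rule forces_local, rule covers_sub[OF assms(1)[unfolded forces_ex]]) (use assms(2) in blast)

lemma iffI_o:
  "(\<And>\<Delta>. \<Gamma> \<preceq> \<Delta> \<Longrightarrow> \<Delta> \<tturnstile> P \<Longrightarrow> \<Delta> \<tturnstile> Q) \<Longrightarrow> (\<And>\<Delta>. \<Gamma> \<preceq> \<Delta> \<Longrightarrow> \<Delta> \<tturnstile> Q \<Longrightarrow> \<Delta> \<tturnstile> P) \<Longrightarrow> \<Gamma> \<tturnstile> P \<longleftrightarrow>\<^sub>o Q"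
  by (simp add: iff_o_def forces_imp)

lemma iffD1_o: "\<Gamma> \<tturnstile> P \<longleftrightarrow>\<^sub>o Q \<Longrightarrow> \<Gamma> \<tturnstile> P \<Longrightarrow> \<Gamma> \<tturnstile> Q"
  and iffD2_o: "\<Gamma> \<tturnstile> P \<longleftrightarrow>\<^sub>o Q \<Longrightarrow> \<Gamma> \<tturnstile> Q \<Longrightarrow> \<Gamma> \<tturnstile> P"
  by (auto simp: iff_o_def intro: mp_o)

section \<open>Formulas inside the algebra of truth values\<close>

lemma tr_And: "tr (And A B) = (tr A \<and>\<^sub>o tr B)"
  by (rule o_eqI) (auto simp: forces_tr intro: AndI AndE1 AndE2)

lemma tr_Imp: "tr (Imp A B) = (tr A \<longrightarrow>\<^sub>o tr B)"
proof (rule o_eqI)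
  fix \<Gamma>
  \<comment> \<open>Among all extensions of the context, the one by \<open>A\<close> alone is
    decisive.\<close>
  have "\<Gamma> \<turnstile> Imp A B" if "\<forall>\<Delta>. \<Gamma> \<preceq> \<Delta> \<longrightarrow> \<Delta> \<turnstile> A \<longrightarrow> \<Delta> \<turnstile> B"
    by (rule ImpI, rule that[rule_format]) (simp_all add: Assm)
  then show "\<Gamma> \<tturnstile> tr (Imp A B) \<longleftrightarrow> \<Gamma> \<tturnstile> tr A \<longrightarrow>\<^sub>o tr B"
    by (auto simp: forces_tr forces_imp intro: ImpE derives_extends)
qed

text \<open>From left to right this is the rule \<open>OrE\<close>: a goal derivable wherever one of
  the disjuncts is derivable is derivable after adding either disjunct, hence already
  before.\<close>

lemma tr_Or: "tr (Or A B) = (tr A \<or>\<^sub>o tr B)"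
proof (rule o_eqI, rule iffI)
  fix \<Gamma> assume *: "\<Gamma> \<tturnstile> tr (Or A B)"
  show "\<Gamma> \<tturnstile> tr A \<or>\<^sub>o tr B"
    unfolding forces_or covers_def forces_tr
  proof (intro allI impI)
    fix C \<Theta> assume C: "\<Gamma> \<preceq> \<Theta>" "\<forall>\<Delta>. \<Theta> \<preceq> \<Delta> \<longrightarrow> \<Delta> \<turnstile> A \<or> \<Delta> \<turnstile> B \<longrightarrow> \<Delta> \<turnstile> C"
    have "A # \<Theta> \<turnstile> C" by (rule C(2)[rule_format]) (simp_all add: Assm)
    moreover have "B # \<Theta> \<turnstile> C" by (rule C(2)[rule_format]) (simp_all add: Assm)
    ultimately show "\<Theta> \<turnstile> C" using * C(1) by (auto simp: forces_tr intro: OrE derives_extends)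
  qed
next
  fix \<Gamma> assume "\<Gamma> \<tturnstile> tr A \<or>\<^sub>o tr B"
  then show "\<Gamma> \<tturnstile> tr (Or A B)" by (rule orE_o) (auto simp: forces_tr intro: OrI1 OrI2)
qed

lemma tr_AllN: "tr (AllN A) = (\<forall>\<^sub>o t. tr (instN t A))"
  by (rule o_eqI) (simp add: forces_tr derives_AllN)

lemma tr_AllS: "tr (AllS A) = (\<forall>\<^sub>o t. tr (instS t A))"
  by (rule o_eqI) (simp add: forces_tr derives_AllS)

lemma tr_AllX: "tr (AllX A) = (\<forall>\<^sub>o t. tr (instX t A))"
  by (rule o_eqI) (simp add: forces_tr derives_AllX)

lemma tr_AllR: "tr (AllR A) = (\<forall>\<^sub>o t. tr (instR t A))"
  by (rule o_eqI) (simp add: forces_tr derives_AllR)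

text \<open>Common to three sorts. The first hypothesis is the elimination rule, with a premise for
  each instance \<open>F t\<close> in place of an eigenvariable; the second is the introduction
  rule.\<close>

lemma tr_Ex_aux:
  assumes "\<And>\<Gamma> C. \<Gamma> \<turnstile> E \<Longrightarrow> (\<And>t. F t # \<Gamma> \<turnstile> C) \<Longrightarrow> \<Gamma> \<turnstile> C" "\<And>\<Gamma> t. \<Gamma> \<turnstile> F t \<Longrightarrow> \<Gamma> \<turnstile> E"
  shows "tr E = (\<exists>\<^sub>o t. tr (F t))"
proof (rule o_eqI, rule iffI)
  fix \<Gamma> assume *: "\<Gamma> \<tturnstile> tr E"
  show "\<Gamma> \<tturnstile> (\<exists>\<^sub>o t. tr (F t))"
    unfolding forces_ex covers_def forces_tr
  proof (intro allI impI)
    fix C \<Theta> assume C: "\<Gamma> \<preceq> \<Theta>" "\<forall>\<Delta>. \<Theta> \<preceq> \<Delta> \<longrightarrow> (\<exists>t. \<Delta> \<turnstile> F t) \<longrightarrow> \<Delta> \<turnstile> C"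
    have "F t # \<Theta> \<turnstile> C" for t by (rule C(2)[rule_format]) (auto intro!: exI[of _ t] Assm)
    then show "\<Theta> \<turnstile> C" using * C(1) by (auto simp: forces_tr intro: assms(1) derives_extends)
  qed
next
  fix \<Gamma> assume "\<Gamma> \<tturnstile> (\<exists>\<^sub>o t. tr (F t))"
  then show "\<Gamma> \<tturnstile> tr E" by (rule exE_o) (auto simp: forces_tr intro: assms(2))
qed

lemma tr_ExN: "tr (ExN A) = (\<exists>\<^sub>o t. tr (instN t A))"
  by (rule tr_Ex_aux) (auto intro: derives_ExN_elim ExNI)

lemma tr_ExS: "tr (ExS A) = (\<exists>\<^sub>o t. tr (instS t A))"
  by (rule tr_Ex_aux) (auto intro: derives_ExS_elim ExSI)

lemma tr_ExR: "tr (ExR A) = (\<exists>\<^sub>o t. tr (instR t A))"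
  by (rule tr_Ex_aux) (auto intro: derives_ExR_elim ExRI)

definition eq_o :: "ntm \<Rightarrow> ntm \<Rightarrow> tv" (infix "\<doteq>" 50) where "t \<doteq> u = tr (EqN t u)"

text \<open>Environments consist of terms, so evaluation is substitution followed by
  \<open>tr\<close>. By \<open>val_simps\<close> it unfolds clause by clause like a Tarskian
  semantics, with quantifiers over HOL types of terms and indices.\<close>

definition val :: "(nat \<Rightarrow> ntm) \<Rightarrow> (nat \<Rightarrow> stm) \<Rightarrow> (nat \<Rightarrow> nat) \<Rightarrow> (nat \<Rightarrow> nat) \<Rightarrow> fm \<Rightarrow> tv" where
  "val f g x r A = tr (fsub f g x r A)"

lemma inst_up:
  "instN t (fsub (case_nat (NVar 0) (\<lambda>i. nsub nsucc SVar (f i))) (\<lambda>i. ssub nsucc SVar (g i)) x r A) = fsub (case_nat t f) g x r A"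
  "instS a (fsub (\<lambda>i. nsub NVar ssucc (f i)) (case_nat (SVar 0) (\<lambda>i. ssub NVar ssucc (g i))) x r A) = fsub f (case_nat a g) x r A"
  "instX i (fsub f g (case_nat 0 (\<lambda>i. Suc (x i))) r A) = fsub f g (case_nat i x) r A"
  "instR i (fsub f g x (case_nat 0 (\<lambda>i. Suc (r i))) A) = fsub f g x (case_nat i r) A"
  by (simp_all add: instN_def instS_def instX_def instR_def fsub_fsub nsub_nsub ssub_ssub case_nat_comp)

lemma val_simps [simp]:
  "val f g x r Bot = \<bottom>\<^sub>o"
  "val f g x r (EqN t u) = (nsub f g t \<doteq> nsub f g u)"
  "val f g x r (EqS a b) = tr (EqS (ssub f g a) (ssub f g b))"
  "val f g x r (Mem a i) = tr (Mem (ssub f g a) (x i))"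
  "val f g x r (Rel i a t) = tr (Rel (r i) (ssub f g a) (nsub f g t))"
  "val f g x r (And A B) = (val f g x r A \<and>\<^sub>o val f g x r B)"
  "val f g x r (Or A B) = (val f g x r A \<or>\<^sub>o val f g x r B)"
  "val f g x r (Imp A B) = (val f g x r A \<longrightarrow>\<^sub>o val f g x r B)"
  "val f g x r (Iff A B) = (val f g x r A \<longleftrightarrow>\<^sub>o val f g x r B)"
  "val f g x r (AllN A) = (\<forall>\<^sub>o t. val (case_nat t f) g x r A)"
  "val f g x r (ExN A) = (\<exists>\<^sub>o t. val (case_nat t f) g x r A)"
  "val f g x r (AllS A) = (\<forall>\<^sub>o t. val f (case_nat t g) x r A)"
  "val f g x r (ExS A) = (\<exists>\<^sub>o t. val f (case_nat t g) x r A)"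
  "val f g x r (AllX A) = (\<forall>\<^sub>o t. val f g (case_nat t x) r A)"
  "val f g x r (AllR A) = (\<forall>\<^sub>o t. val f g x (case_nat t r) A)"
  "val f g x r (ExR A) = (\<exists>\<^sub>o t. val f g x (case_nat t r) A)"
  "val f g x r (fsub f' g' x' r' A) =
     val (\<lambda>i. nsub f g (f' i)) (\<lambda>i. ssub f g (g' i)) (\<lambda>i. x (x' i)) (\<lambda>i. r (r' i)) A"
  by (simp_all add: val_def bot_o_def eq_o_def tr_And tr_Or tr_Imp iff_o_def Iff_def tr_AllN tr_ExN
      tr_AllS tr_ExS tr_AllX tr_AllR tr_ExR inst_up fsub_fsub)

lemma tr_val: "tr A = val NVar SVar id id A"
  by (simp add: val_def)

section \<open>Definable families of truth values\<close>

definition ntail :: "nat \<Rightarrow> (nat \<Rightarrow> ntm) \<Rightarrow> bool" where "ntail n f \<longleftrightarrow> (\<forall>i. f (n + i) = NVar i)"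
definition stail :: "nat \<Rightarrow> (nat \<Rightarrow> stm) \<Rightarrow> bool" where "stail n g \<longleftrightarrow> (\<forall>i. g (n + i) = SVar i)"

text \<open>A family indexed by environments is definable in \<open>n\<close> number and \<open>s\<close> sequence variables if it
  is given by one expression. Beyond these variables an environment is the identity, so that all
  terms are admitted as parameters.\<close>

definition dnt :: "nat \<Rightarrow> nat \<Rightarrow> ((nat \<Rightarrow> ntm) \<Rightarrow> (nat \<Rightarrow> stm) \<Rightarrow> ntm) \<Rightarrow> bool" where
  "dnt n s T \<longleftrightarrow> (\<exists>t. \<forall>f g. ntail n f \<longrightarrow> stail s g \<longrightarrow> T f g = nsub f g t)"
definition dst :: "nat \<Rightarrow> nat \<Rightarrow> ((nat \<Rightarrow> ntm) \<Rightarrow> (nat \<Rightarrow> stm) \<Rightarrow> stm) \<Rightarrow> bool" where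
  "dst n s T \<longleftrightarrow> (\<exists>a. \<forall>f g. ntail n f \<longrightarrow> stail s g \<longrightarrow> T f g = ssub f g a)"
definition dfm :: "nat \<Rightarrow> nat \<Rightarrow> ((nat \<Rightarrow> ntm) \<Rightarrow> (nat \<Rightarrow> stm) \<Rightarrow> tv) \<Rightarrow> bool" where
  "dfm n s P \<longleftrightarrow> (\<exists>A. \<forall>f g. ntail n f \<longrightarrow> stail s g \<longrightarrow> P f g = val f g id id A)"

text \<open>The last number argument has index 0, in agreement with \<open>Unique_Choice\<close>,
  where argument and value are the variables 1 and 0. Further free variables of the expression act
  as parameters.\<close>

abbreviation "defN P \<equiv> dfm (Suc 0) 0 (\<lambda>f g. P (f 0))"
abbreviation "defNN P \<equiv> dfm (Suc (Suc 0)) 0 (\<lambda>f g. P (f (Suc 0)) (f 0))"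
abbreviation "defNNN P \<equiv> dfm (Suc (Suc (Suc 0))) 0 (\<lambda>f g. P (f (Suc (Suc 0))) (f (Suc 0)) (f 0))"
abbreviation "defS P \<equiv> dfm 0 (Suc 0) (\<lambda>f g. P (g 0))"
abbreviation "defSN P \<equiv> dfm (Suc 0) (Suc 0) (\<lambda>f g. P (g 0) (f 0))"

named_theorems def_intros

lemma nsub_cong_tail: "ntail n f \<Longrightarrow> (\<lambda>i. f (n + i)) = NVar" "stail s g \<Longrightarrow> (\<lambda>i. g (s + i)) = SVar"
  by (auto simp: ntail_def stail_def)

text \<open>The variables of a fixed term are shifted past the distinguished ones; the identity tail
  of the environment brings them back.\<close>

lemma dnt_const: "dnt n s (\<lambda>f g. t)"
  unfolding dnt_def
  by (rule exI[of _ "nsub (\<lambda>i. NVar (n + i)) (\<lambda>i. SVar (s + i)) t"]) (simp add: nsub_nsub nsub_cong_tail)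

lemma dst_const: "dst n s (\<lambda>f g. a)"
  unfolding dst_def
  by (rule exI[of _ "ssub (\<lambda>i. NVar (n + i)) (\<lambda>i. SVar (s + i)) a"]) (simp add: ssub_ssub nsub_cong_tail)

lemma dnt_var: "dnt n s (\<lambda>f g. f i)"
  unfolding dnt_def by (rule exI[of _ "NVar i"]) simp

lemma dst_var: "dst n s (\<lambda>f g. g i)"
  unfolding dst_def by (rule exI[of _ "SVar i"]) simp

lemma dnt_Succ: "dnt n s T \<Longrightarrow> dnt n s (\<lambda>f g. Succ (T f g))"
  unfolding dnt_def by (metis nsub.simps(3))
lemma dnt_Pred: "dnt n s T \<Longrightarrow> dnt n s (\<lambda>f g. Pred (T f g))"
  unfolding dnt_def by (metis nsub.simps(4))
lemma dnt_Add: "dnt n s T \<Longrightarrow> dnt n s U \<Longrightarrow> dnt n s (\<lambda>f g. Add (T f g) (U f g))"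
  unfolding dnt_def by (metis nsub.simps(5))
lemma dnt_Mul: "dnt n s T \<Longrightarrow> dnt n s U \<Longrightarrow> dnt n s (\<lambda>f g. Mul (T f g) (U f g))"
  unfolding dnt_def by (metis nsub.simps(6))
lemma dnt_Pow: "dnt n s T \<Longrightarrow> dnt n s U \<Longrightarrow> dnt n s (\<lambda>f g. Pow (T f g) (U f g))"
  unfolding dnt_def by (metis nsub.simps(7))
lemma dnt_App: "dst n s T \<Longrightarrow> dnt n s U \<Longrightarrow> dnt n s (\<lambda>f g. App (T f g) (U f g))"
  unfolding dnt_def dst_def by (metis nsub.simps(8))
lemma dnt_Init: "dst n s T \<Longrightarrow> dnt n s U \<Longrightarrow> dnt n s (\<lambda>f g. Init (T f g) (U f g))"
  unfolding dnt_def dst_def by (metis nsub.simps(9))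
lemma dst_Sect: "dst n s T \<Longrightarrow> dnt n s U \<Longrightarrow> dst n s (\<lambda>f g. Sect (T f g) (U f g))"
  unfolding dnt_def dst_def by (metis ssub.simps(2))

lemma dfm_eq: "dnt n s T \<Longrightarrow> dnt n s U \<Longrightarrow> dfm n s (\<lambda>f g. T f g \<doteq> U f g)"
  unfolding dnt_def dfm_def by (metis val_simps(2))
lemma dfm_bot: "dfm n s (\<lambda>f g. \<bottom>\<^sub>o)"
  unfolding dfm_def by (metis val_simps(1))
lemma dfm_and: "dfm n s P \<Longrightarrow> dfm n s Q \<Longrightarrow> dfm n s (\<lambda>f g. P f g \<and>\<^sub>o Q f g)"
  unfolding dfm_def by (metis val_simps(6))
lemma dfm_or: "dfm n s P \<Longrightarrow> dfm n s Q \<Longrightarrow> dfm n s (\<lambda>f g. P f g \<or>\<^sub>o Q f g)"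
  unfolding dfm_def by (metis val_simps(7))
lemma dfm_imp: "dfm n s P \<Longrightarrow> dfm n s Q \<Longrightarrow> dfm n s (\<lambda>f g. P f g \<longrightarrow>\<^sub>o Q f g)"
  unfolding dfm_def by (metis val_simps(8))
lemma dfm_not: "dfm n s P \<Longrightarrow> dfm n s (\<lambda>f g. \<not>\<^sub>o P f g)"
  unfolding not_o_def by (intro dfm_imp dfm_bot)
lemma dfm_iff: "dfm n s P \<Longrightarrow> dfm n s Q \<Longrightarrow> dfm n s (\<lambda>f g. P f g \<longleftrightarrow>\<^sub>o Q f g)"
  unfolding dfm_def by (metis val_simps(9))
lemma dfm_rel: "dst n s T \<Longrightarrow> dnt n s U \<Longrightarrow> dfm n s (\<lambda>f g. tr (Rel r (T f g) (U f g)))"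
  unfolding dfm_def dnt_def dst_def by (metis val_simps(5) id_apply)
lemma ntail_case: "ntail n f \<Longrightarrow> ntail (Suc n) (case_nat t f)" by (simp add: ntail_def)
lemma stail_case: "stail n f \<Longrightarrow> stail (Suc n) (case_nat t f)" by (simp add: stail_def)

text \<open>The matrix of a quantifier is a family in one variable more, and the bound variable
  takes index 0. Evaluating it in \<open>case_nat t f\<close> yields one expression for all
  \<open>t\<close>.\<close>

lemma dfm_quantN:
  assumes "dfm (Suc n) s (\<lambda>f g. P (\<lambda>i. f (Suc i)) g (f 0))"
  obtains A where "\<And>f g t. ntail n f \<Longrightarrow> stail s g \<Longrightarrow> P f g t = val (case_nat t f) g id id A"
proof -
  obtain A where A: "\<And>f g. ntail (Suc n) f \<Longrightarrow> stail s g \<Longrightarrow> P (\<lambda>i. f (Suc i)) g (f 0) = val f g id id A"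
    using assms by (auto simp: dfm_def)
  show ?thesis
    by (rule that) (use A[OF ntail_case] in \<open>simp\<close>)
qed

lemma dfm_quantS:
  assumes "dfm n (Suc s) (\<lambda>f g. P f (\<lambda>i. g (Suc i)) (g 0))"
  obtains A where "\<And>f g a. ntail n f \<Longrightarrow> stail s g \<Longrightarrow> P f g a = val f (case_nat a g) id id A"
proof -
  obtain A where A: "\<And>f g. ntail n f \<Longrightarrow> stail (Suc s) g \<Longrightarrow> P f (\<lambda>i. g (Suc i)) (g 0) = val f g id id A"
    using assms by (auto simp: dfm_def)
  show ?thesis
    by (rule that) (use A[OF _ stail_case] in \<open>simp\<close>)
qed

lemma dfm_allN:
  assumes "dfm (Suc n) s (\<lambda>f g. P (\<lambda>i. f (Suc i)) g (f 0))" shows "dfm n s (\<lambda>f g. \<forall>\<^sub>o t::ntm. P f g t)"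
proof (rule dfm_quantN[OF assms])
  fix A assume "\<And>f g t. ntail n f \<Longrightarrow> stail s g \<Longrightarrow> P f g t = val (case_nat t f) g id id A"
  then have "P f g = (\<lambda>t. val (case_nat t f) g id id A)" if "ntail n f" "stail s g" for f g using that by auto
  then show ?thesis unfolding dfm_def by (intro exI[of _ "AllN A"]) simp
qed
lemma dfm_exN:
  assumes "dfm (Suc n) s (\<lambda>f g. P (\<lambda>i. f (Suc i)) g (f 0))" shows "dfm n s (\<lambda>f g. \<exists>\<^sub>o t::ntm. P f g t)"
proof (rule dfm_quantN[OF assms])
  fix A assume "\<And>f g t. ntail n f \<Longrightarrow> stail s g \<Longrightarrow> P f g t = val (case_nat t f) g id id A"
  then have "P f g = (\<lambda>t. val (case_nat t f) g id id A)" if "ntail n f" "stail s g" for f g using that by auto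
  then show ?thesis unfolding dfm_def by (intro exI[of _ "ExN A"]) simp
qed
lemma dfm_allS:
  assumes "dfm n (Suc s) (\<lambda>f g. P f (\<lambda>i. g (Suc i)) (g 0))" shows "dfm n s (\<lambda>f g. \<forall>\<^sub>o a::stm. P f g a)"
proof (rule dfm_quantS[OF assms])
  fix A assume "\<And>f g a. ntail n f \<Longrightarrow> stail s g \<Longrightarrow> P f g a = val f (case_nat a g) id id A"
  then have "P f g = (\<lambda>t. val f (case_nat t g) id id A)" if "ntail n f" "stail s g" for f g using that by auto
  then show ?thesis unfolding dfm_def by (intro exI[of _ "AllS A"]) simp
qed
lemma dfm_exS:
  assumes "dfm n (Suc s) (\<lambda>f g. P f (\<lambda>i. g (Suc i)) (g 0))" shows "dfm n s (\<lambda>f g. \<exists>\<^sub>o a::stm. P f g a)"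
proof (rule dfm_quantS[OF assms])
  fix A assume "\<And>f g a. ntail n f \<Longrightarrow> stail s g \<Longrightarrow> P f g a = val f (case_nat a g) id id A"
  then have "P f g = (\<lambda>t. val f (case_nat t g) id id A)" if "ntail n f" "stail s g" for f g using that by auto
  then show ?thesis unfolding dfm_def by (intro exI[of _ "ExS A"]) simp
qed

text \<open>Definability follows the syntax of the HOL expression, so
  \<open>intro def_intros\<close> discharges the side conditions of induction, substitution,
  comprehension and choice.\<close>

lemmas [def_intros] = dnt_const dst_const dnt_var dst_var dnt_Succ dnt_Pred dnt_Add dnt_Mul dnt_Pow dnt_App dnt_Init
  dst_Sect dfm_eq dfm_bot dfm_and dfm_or dfm_imp dfm_not dfm_iff dfm_rel dfm_allN dfm_exN dfm_allS dfm_exS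

lemma ntail_1: "ntail (Suc 0) f \<longleftrightarrow> f = case_nat (f 0) NVar"
  and ntail_2: "ntail (Suc (Suc 0)) f \<longleftrightarrow> f = case_nat (f 0) (case_nat (f (Suc 0)) NVar)"
  and ntail_3: "ntail (Suc (Suc (Suc 0))) f \<longleftrightarrow> f = case_nat (f 0) (case_nat (f (Suc 0)) (case_nat (f (Suc (Suc 0))) NVar))"
  and ntail_0: "ntail 0 f \<longleftrightarrow> f = NVar"
  and stail_0: "stail 0 g \<longleftrightarrow> g = SVar"
  and stail_1: "stail (Suc 0) g \<longleftrightarrow> g = case_nat (g 0) SVar"
  by (auto simp: ntail_def stail_def fun_eq_iff split: nat.split)

lemma defN_iff: "defN P \<longleftrightarrow> (\<exists>A. \<forall>t. P t = val (case_nat t NVar) SVar id id A)"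
  unfolding dfm_def ntail_1 stail_0 by (metis nat.case(1))
lemma defNN_iff: "defNN P \<longleftrightarrow> (\<exists>A. \<forall>t u. P t u = val (case_nat u (case_nat t NVar)) SVar id id A)"
  unfolding dfm_def ntail_2 stail_0 by (metis nat.case)
lemma defNNN_iff: "defNNN P \<longleftrightarrow> (\<exists>A. \<forall>t u v. P t u v = val (case_nat v (case_nat u (case_nat t NVar))) SVar id id A)"
  unfolding dfm_def ntail_3 stail_0 by (metis nat.case)
lemma defS_iff: "defS P \<longleftrightarrow> (\<exists>A. \<forall>a. P a = val NVar (case_nat a SVar) id id A)"
  unfolding dfm_def ntail_0 stail_1 by (metis nat.case)
lemma defSN_iff: "defSN P \<longleftrightarrow> (\<exists>A. \<forall>a t. P a t = val (case_nat t NVar) (case_nat a SVar) id id A)"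
  unfolding dfm_def ntail_1 stail_1 by (metis nat.case)

text \<open>Allows a predicate of which only definability is known to occur inside a larger
  expression, as happens in the lemmas on search and choice. Its parameters are shifted past the
  variables of that expression.\<close>

lemma dfm_defN:
  assumes "defN P" "dnt n s T" shows "dfm n s (\<lambda>f g. P (T f g))"
proof -
  obtain A t where A: "\<And>t. P t = val (case_nat t NVar) SVar id id A"
    and t: "\<And>f g. ntail n f \<Longrightarrow> stail s g \<Longrightarrow> T f g = nsub f g t"
    using assms by (auto simp: defN_iff dnt_def)
  show ?thesis
    unfolding dfm_def
    by (rule exI[of _ "fsub (case_nat t (\<lambda>i. NVar (n + i))) (\<lambda>i. SVar (s + i)) id id A"])
       (auto simp: A t case_nat_comp nsub_cong_tail id_def)
qed

lemma dfm_defNN: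
  assumes "defNN P" "dnt n s T" "dnt n s U" shows "dfm n s (\<lambda>f g. P (T f g) (U f g))"
proof -
  obtain A t u where A: "\<And>t u. P t u = val (case_nat u (case_nat t NVar)) SVar id id A"
    and t: "\<And>f g. ntail n f \<Longrightarrow> stail s g \<Longrightarrow> T f g = nsub f g t" "\<And>f g. ntail n f \<Longrightarrow> stail s g \<Longrightarrow> U f g = nsub f g u"
    using assms by (auto simp: defNN_iff dnt_def)
  show ?thesis
    unfolding dfm_def
    by (rule exI[of _ "fsub (case_nat u (case_nat t (\<lambda>i. NVar (n + i)))) (\<lambda>i. SVar (s + i)) id id A"])
       (auto simp: A t case_nat_comp nsub_cong_tail id_def)
qed

lemma dfm_defNNN:
  assumes "defNNN P" "dnt n s T" "dnt n s U" "dnt n s V" shows "dfm n s (\<lambda>f g. P (T f g) (U f g) (V f g))"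
proof -
  obtain A t u v where A: "\<And>t u v. P t u v = val (case_nat v (case_nat u (case_nat t NVar))) SVar id id A"
    and t: "\<And>f g. ntail n f \<Longrightarrow> stail s g \<Longrightarrow> T f g = nsub f g t" "\<And>f g. ntail n f \<Longrightarrow> stail s g \<Longrightarrow> U f g = nsub f g u"
      "\<And>f g. ntail n f \<Longrightarrow> stail s g \<Longrightarrow> V f g = nsub f g v"
    using assms by (auto simp: defNNN_iff dnt_def)
  show ?thesis
    unfolding dfm_def
    by (rule exI[of _ "fsub (case_nat v (case_nat u (case_nat t (\<lambda>i. NVar (n + i))))) (\<lambda>i. SVar (s + i)) id id A"])
       (auto simp: A t case_nat_comp nsub_cong_tail id_def)
qed

lemma dnt_comp:
  assumes "dnt (Suc 0) 0 (\<lambda>f g. T (f 0))" "dnt n s U" shows "dnt n s (\<lambda>f g. T (U f g))"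
proof -
  obtain t u where t: "\<And>v. T v = nsub (case_nat v NVar) SVar t"
    and u: "\<And>f g. ntail n f \<Longrightarrow> stail s g \<Longrightarrow> U f g = nsub f g u"
    using assms unfolding dnt_def ntail_1 stail_0 by (metis nat.case(1))
  show ?thesis
    unfolding dnt_def
    by (rule exI[of _ "nsub (case_nat u (\<lambda>i. NVar (n + i))) (\<lambda>i. SVar (s + i)) t"])
       (auto simp: t u case_nat_comp nsub_cong_tail nsub_nsub)
qed

lemma dst_comp:
  assumes "dst (Suc 0) 0 (\<lambda>f g. T (f 0))" "dnt n s U" shows "dst n s (\<lambda>f g. T (U f g))"
proof -
  obtain t u where t: "\<And>v. T v = ssub (case_nat v NVar) SVar t"
    and u: "\<And>f g. ntail n f \<Longrightarrow> stail s g \<Longrightarrow> U f g = nsub f g u"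
    using assms unfolding dnt_def dst_def ntail_1 stail_0 by (metis nat.case(1))
  show ?thesis
    unfolding dst_def
    by (rule exI[of _ "ssub (case_nat u (\<lambda>i. NVar (n + i))) (\<lambda>i. SVar (s + i)) t"])
       (auto simp: t u case_nat_comp nsub_cong_tail ssub_ssub)
qed

text \<open>A term given outside a quantifier may be used under it. This is needed whenever a notion
  with a bound variable, such as \<open>lt\<close> or \<open>val_is\<close>, is unfolded at given
  terms.\<close>

lemma dnt_shiftN: "dnt n s T \<Longrightarrow> dnt (Suc n) s (\<lambda>f g. T (\<lambda>i. f (Suc i)) g)"
  unfolding dnt_def
  by (elim exE, rule_tac x = "nsub nsucc SVar t" in exI) (simp add: nsub_nsub ntail_def)
lemma dst_shiftN: "dst n s T \<Longrightarrow> dst (Suc n) s (\<lambda>f g. T (\<lambda>i. f (Suc i)) g)"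
  unfolding dst_def
  by (elim exE, rule_tac x = "ssub nsucc SVar a" in exI) (simp add: ssub_ssub ntail_def)

lemma dnt_shiftS: "dnt n s T \<Longrightarrow> dnt n (Suc s) (\<lambda>f g. T f (\<lambda>i. g (Suc i)))"
  unfolding dnt_def
  by (elim exE, rule_tac x = "nsub NVar ssucc t" in exI) (simp add: nsub_nsub stail_def)

section \<open>Equality, induction, comprehension and choice for definable families\<close>

lemma subst_o:
  assumes "defN P" "\<Gamma> \<tturnstile> t \<doteq> u" "\<Gamma> \<tturnstile> P t" shows "\<Gamma> \<tturnstile> P u"
proof -
  obtain A where A: "\<And>t. P t = tr (instN t A)" using assms(1) by (auto simp: defN_iff val_def instN_def)
  show ?thesis using EqN_subst[of \<Gamma> t u A] assms(2,3) by (simp add: A forces_tr eq_o_def)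
qed

text \<open>Extensionality in usable form: sequences are exchanged as soon as their values agree,
  without any mention of \<open>EqS\<close>.\<close>

lemma substS_o:
  assumes "defS P" "\<And>n. \<Gamma> \<tturnstile> App a n \<doteq> App b n" "\<Gamma> \<tturnstile> P a" shows "\<Gamma> \<tturnstile> P b"
proof -
  obtain A where A: "\<And>t. P t = tr (instS t A)" using assms(1) by (auto simp: defS_iff val_def instS_def)
  have "\<Gamma> \<turnstile> EqS a b"
    by (rule EqS_ext) (use assms(2) in \<open>simp add: derives_AllN instN_def ssub_ssub eq_o_def forces_tr\<close>)
  then show ?thesis using EqS_subst[of \<Gamma> a b A] assms(3) by (simp add: A forces_tr)
qed

lemma induct_o:
  assumes "defN P" "\<Gamma> \<tturnstile> P Zero" "\<And>\<Delta> t. \<Gamma> \<preceq> \<Delta> \<Longrightarrow> \<Delta> \<tturnstile> P t \<Longrightarrow> \<Delta> \<tturnstile> P (Succ t)" shows "\<Gamma> \<tturnstile> P t"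
proof -
  obtain A where A: "\<And>t. P t = tr (instN t A)" using assms(1) by (auto simp: defN_iff val_def instN_def)
  have "\<Gamma> \<turnstile> instN t A"
  proof (rule derives_Induct)
    show "\<Gamma> \<turnstile> instN Zero A" using assms(2) by (simp add: A forces_tr)
    show "instN t A # \<Gamma> \<turnstile> instN (Succ t) A" for t
      using assms(3)[of "instN t A # \<Gamma>" t] by (simp add: A forces_tr Assm)
  qed
  then show ?thesis by (simp add: A forces_tr)
qed

lemma comprehension_o:
  assumes "defSN P" shows "\<Gamma> \<tturnstile> (\<exists>\<^sub>o R. \<forall>\<^sub>o a. \<forall>\<^sub>o t. tr (Rel R a t) \<longleftrightarrow>\<^sub>o P a t)"
proof -
  obtain A where A: "\<And>a t. P a t = val (case_nat t NVar) (case_nat a SVar) id id A"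
    using assms by (auto simp: defSN_iff)
  have "\<Gamma> \<tturnstile> tr (ExR (AllS (AllN (Iff (Rel 0 (SVar 0) (NVar 0)) (liftR A)))))"
    by (simp add: forces_tr CompR)
  then show ?thesis by (simp add: tr_val[of "ExR _"] A liftR_def id_def)
qed

lemma unique_choice_o:
  assumes "defNN P" and "\<And>n. \<Gamma> \<tturnstile> (\<exists>\<^sub>o k. \<forall>\<^sub>o m. P n m \<longleftrightarrow>\<^sub>o m \<doteq> k)"
  shows "\<Gamma> \<tturnstile> (\<exists>\<^sub>o a. \<forall>\<^sub>o n. \<forall>\<^sub>o m. App a n \<doteq> m \<longleftrightarrow>\<^sub>o P n m)"
proof -
  obtain A where A: "\<And>t u. P t u = val (case_nat u (case_nat t NVar)) SVar id id A"
    using assms by (auto simp: defNN_iff)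
  \<comment> \<open>Here \<open>x\<close>, \<open>y\<close> and \<open>z\<close> stand for a
    candidate value, the witness of unique existence, and the argument; the renaming in the rule
    skips the witness.\<close>
  have [simp]: "(\<lambda>i. case_nat x (case_nat y (case_nat z NVar)) (case_nat 0 (\<lambda>i. Suc (Suc i)) i)) = case_nat x (case_nat z NVar)" for x y z
    by (auto split: nat.split)
  have "\<Gamma> \<turnstile> ExS (AllN (AllN (Iff (EqN (App (SVar 0) (NVar 1)) (NVar 0)) (liftS A))))"
    by (rule Unique_Choice, subst forces_tr[symmetric])
       (use assms(2) in \<open>simp add: tr_val[of "AllN _"] A case_nat_comp id_def\<close>)
  then show ?thesis
    by (subst (asm) forces_tr[symmetric]) (simp add: tr_val[of "ExS _"] A liftS_def case_nat_comp id_def)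
qed

text \<open>Equality of equivalence classes is HOL equality, so that the simplifier does the congruence
  reasoning about provable equality.\<close>

lemma eq_refl_o [simp]: "\<Gamma> \<tturnstile> t \<doteq> t" by (simp add: eq_o_def forces_tr EqN_refl)
lemma eq_sym_o: "\<Gamma> \<tturnstile> t \<doteq> u \<Longrightarrow> \<Gamma> \<tturnstile> u \<doteq> t"
  by (rule subst_o[where P = "\<lambda>z. z \<doteq> t"], intro def_intros) (assumption | rule eq_refl_o)+
lemma eq_trans_o [trans]: "\<Gamma> \<tturnstile> t \<doteq> u \<Longrightarrow> \<Gamma> \<tturnstile> u \<doteq> v \<Longrightarrow> \<Gamma> \<tturnstile> t \<doteq> v"
  by (rule subst_o[where P = "\<lambda>z. t \<doteq> z"], intro def_intros)

definition nv :: "fm list \<Rightarrow> ntm \<Rightarrow> ntm set" where "nv \<Gamma> t = {u. \<Gamma> \<tturnstile> t \<doteq> u}"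

lemma nv_eq: "\<Gamma> \<tturnstile> t \<doteq> u \<longleftrightarrow> nv \<Gamma> t = nv \<Gamma> u"
  unfolding nv_def by (auto intro: eq_sym_o eq_trans_o)

text \<open>The union over all representatives lifts an operation from terms to classes without
  choosing one. It is a single class because a definable operation respects provable
  equality.\<close>

lemma nv_lift:
  assumes "dnt (Suc 0) 0 (\<lambda>f g. T (f 0))"
  shows "nv \<Gamma> (T t) = (\<Union>u\<in>nv \<Gamma> t. nv \<Gamma> (T u))"
proof -
  have "nv \<Gamma> (T t) = nv \<Gamma> (T u)" if "\<Gamma> \<tturnstile> t \<doteq> u" for u
    unfolding nv_eq[symmetric]
    by (rule subst_o[where P = "\<lambda>z. T t \<doteq> T z", OF _ that], intro def_intros assms) simp
  moreover have "t \<in> nv \<Gamma> t" by (simp add: nv_def)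
  ultimately show ?thesis unfolding nv_def[of _ t] by blast
qed

definition "Succ_v \<Gamma> A = (\<Union>t\<in>A. nv \<Gamma> (Succ t))"
definition "Pred_v \<Gamma> A = (\<Union>t\<in>A. nv \<Gamma> (Pred t))"
definition "App_v \<Gamma> a A = (\<Union>t\<in>A. nv \<Gamma> (App a t))"
definition "Init_v \<Gamma> a A = (\<Union>t\<in>A. nv \<Gamma> (Init a t))"
definition "Add_v \<Gamma> A B = (\<Union>t\<in>A. \<Union>u\<in>B. nv \<Gamma> (Add t u))"
definition "Mul_v \<Gamma> A B = (\<Union>t\<in>A. \<Union>u\<in>B. nv \<Gamma> (Mul t u))"
definition "pair_v \<Gamma> A B = (\<Union>t\<in>A. \<Union>u\<in>B. nv \<Gamma> (pair t u))"

lemma dnt_pair [def_intros]: "dnt n s T \<Longrightarrow> dnt n s U \<Longrightarrow> dnt n s (\<lambda>f g. pair (T f g) (U f g))"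
  unfolding pair_def two_def by (intro def_intros)

lemma nv_simps:
  "nv \<Gamma> (Succ t) = Succ_v \<Gamma> (nv \<Gamma> t)"
  "nv \<Gamma> (Pred t) = Pred_v \<Gamma> (nv \<Gamma> t)"
  "nv \<Gamma> (App a t) = App_v \<Gamma> a (nv \<Gamma> t)"
  "nv \<Gamma> (Init a t) = Init_v \<Gamma> a (nv \<Gamma> t)"
  "nv \<Gamma> (Add t u) = Add_v \<Gamma> (nv \<Gamma> t) (nv \<Gamma> u)"
  "nv \<Gamma> (Mul t u) = Mul_v \<Gamma> (nv \<Gamma> t) (nv \<Gamma> u)"
  "nv \<Gamma> (pair t u) = pair_v \<Gamma> (nv \<Gamma> t) (nv \<Gamma> u)"
  unfolding Succ_v_def Pred_v_def App_v_def Init_v_def Add_v_def Mul_v_def pair_v_def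
        apply (rule nv_lift; intro def_intros)+
    apply (subst nv_lift[where T = "\<lambda>t. Add t u"], intro def_intros,
      subst nv_lift[where T = "Add _"], intro def_intros, rule refl)
   apply (subst nv_lift[where T = "\<lambda>t. Mul t u"], intro def_intros,
      subst nv_lift[where T = "Mul _"], intro def_intros, rule refl)
  apply (subst nv_lift[where T = "\<lambda>t. pair t u"], intro def_intros,
      subst nv_lift[where T = "pair _"], intro def_intros, rule refl)
  done

lemma ex_mono_o: "\<Gamma> \<tturnstile> (\<exists>\<^sub>o t. P t) \<Longrightarrow> (\<And>\<Delta> t. \<Gamma> \<preceq> \<Delta> \<Longrightarrow> \<Delta> \<tturnstile> P t \<Longrightarrow> \<Delta> \<tturnstile> Q t) \<Longrightarrow> \<Gamma> \<tturnstile> (\<exists>\<^sub>o t. Q t)"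
  by (rule exE_o, assumption) (rule exI_o, blast)

lemma or_mono_o: "\<Gamma> \<tturnstile> P \<or>\<^sub>o Q \<Longrightarrow> (\<And>\<Delta>. \<Gamma> \<preceq> \<Delta> \<Longrightarrow> \<Delta> \<tturnstile> P \<Longrightarrow> \<Delta> \<tturnstile> P') \<Longrightarrow>
    (\<And>\<Delta>. \<Gamma> \<preceq> \<Delta> \<Longrightarrow> \<Delta> \<tturnstile> Q \<Longrightarrow> \<Delta> \<tturnstile> Q') \<Longrightarrow> \<Gamma> \<tturnstile> P' \<or>\<^sub>o Q'"
  by (rule orE_o, assumption) (blast intro: orI1_o orI2_o)+

lemma spec_o: "\<Gamma> \<tturnstile> (\<forall>\<^sub>o t. P t) \<Longrightarrow> \<Gamma> \<tturnstile> P t" by simp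

lemma all_impI: "(\<And>\<Delta> t. \<Gamma> \<preceq> \<Delta> \<Longrightarrow> \<Delta> \<tturnstile> P t \<Longrightarrow> \<Delta> \<tturnstile> Q t) \<Longrightarrow> \<Gamma> \<tturnstile> (\<forall>\<^sub>o t. P t \<longrightarrow>\<^sub>o Q t)"
  by (simp add: forces_imp)

lemma all_impE: "\<Gamma> \<tturnstile> (\<forall>\<^sub>o t. P t \<longrightarrow>\<^sub>o Q t) \<Longrightarrow> \<Gamma> \<tturnstile> P t \<Longrightarrow> \<Gamma> \<tturnstile> Q t"
  unfolding forces_all by (erule allE, rule mp_o)

section \<open>Arithmetic\<close>

text \<open>The side condition under which the lifted operations obey the laws of arithmetic. On
  other sets of terms they fail: adding zero to a set of terms need not return that set, but can
  enlarge it to a full class.\<close>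

definition V :: "fm list \<Rightarrow> ntm set set" where "V \<Gamma> = range (nv \<Gamma>)"

lemma V_intros [simp]:
  "nv \<Gamma> t \<in> V \<Gamma>" "A \<in> V \<Gamma> \<Longrightarrow> Succ_v \<Gamma> A \<in> V \<Gamma>" "A \<in> V \<Gamma> \<Longrightarrow> Pred_v \<Gamma> A \<in> V \<Gamma>"
  "A \<in> V \<Gamma> \<Longrightarrow> App_v \<Gamma> a A \<in> V \<Gamma>" "A \<in> V \<Gamma> \<Longrightarrow> Init_v \<Gamma> a A \<in> V \<Gamma>"
  "A \<in> V \<Gamma> \<Longrightarrow> B \<in> V \<Gamma> \<Longrightarrow> Add_v \<Gamma> A B \<in> V \<Gamma>" "A \<in> V \<Gamma> \<Longrightarrow> B \<in> V \<Gamma> \<Longrightarrow> Mul_v \<Gamma> A B \<in> V \<Gamma>"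
  "A \<in> V \<Gamma> \<Longrightarrow> B \<in> V \<Gamma> \<Longrightarrow> pair_v \<Gamma> A B \<in> V \<Gamma>"
  by (auto simp: V_def nv_simps[symmetric])

lemma VE: assumes "A \<in> V \<Gamma>" obtains t where "A = nv \<Gamma> t"
  using assms by (auto simp: V_def)

lemma axioms_o:
  "\<Gamma> \<tturnstile> Pred Zero \<doteq> Zero" "\<Gamma> \<tturnstile> Pred (Succ t) \<doteq> t" "\<Gamma> \<tturnstile> Add t Zero \<doteq> t"
  "\<Gamma> \<tturnstile> Add t (Succ u) \<doteq> Succ (Add t u)" "\<Gamma> \<tturnstile> Mul t Zero \<doteq> Zero"
  "\<Gamma> \<tturnstile> Mul t (Succ u) \<doteq> Add (Mul t u) t" "\<Gamma> \<tturnstile> Pow t Zero \<doteq> Succ Zero"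
  "\<Gamma> \<tturnstile> Pow t (Succ u) \<doteq> Mul (Pow t u) t" "\<Gamma> \<tturnstile> Init a Zero \<doteq> Zero"
  "\<Gamma> \<tturnstile> Init a (Succ t) \<doteq> pair (Init a t) (App a t)" "\<Gamma> \<tturnstile> App (Sect a n) t \<doteq> App a (Pred (pair t n))"
  by (simp_all add: eq_o_def forces_tr derives.intros)

lemma nv_zero_arith [simp]: "Pred_v \<Gamma> (nv \<Gamma> Zero) = nv \<Gamma> Zero" "Init_v \<Gamma> a (nv \<Gamma> Zero) = nv \<Gamma> Zero"
  using axioms_o(1,9) by (simp_all add: nv_eq nv_simps)

lemma nv_arith [simp]:
  "A \<in> V \<Gamma> \<Longrightarrow> Pred_v \<Gamma> (Succ_v \<Gamma> A) = A"
  "A \<in> V \<Gamma> \<Longrightarrow> Add_v \<Gamma> A (nv \<Gamma> Zero) = A"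
  "A \<in> V \<Gamma> \<Longrightarrow> B \<in> V \<Gamma> \<Longrightarrow> Add_v \<Gamma> A (Succ_v \<Gamma> B) = Succ_v \<Gamma> (Add_v \<Gamma> A B)"
  "A \<in> V \<Gamma> \<Longrightarrow> Mul_v \<Gamma> A (nv \<Gamma> Zero) = nv \<Gamma> Zero"
  "A \<in> V \<Gamma> \<Longrightarrow> B \<in> V \<Gamma> \<Longrightarrow> Mul_v \<Gamma> A (Succ_v \<Gamma> B) = Add_v \<Gamma> (Mul_v \<Gamma> A B) A"
  "A \<in> V \<Gamma> \<Longrightarrow> Init_v \<Gamma> a (Succ_v \<Gamma> A) = pair_v \<Gamma> (Init_v \<Gamma> a A) (App_v \<Gamma> a A)"
  "A \<in> V \<Gamma> \<Longrightarrow> App_v \<Gamma> (Sect a n) A = App_v \<Gamma> a (Pred_v \<Gamma> (pair_v \<Gamma> A (nv \<Gamma> n)))"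
  using axioms_o[of \<Gamma>] by (auto elim!: VE simp: nv_eq nv_simps)

lemma Add_Zero_left: "\<Gamma> \<tturnstile> Add Zero t \<doteq> t"
  by (rule induct_o[where P = "\<lambda>t. Add Zero t \<doteq> t"], intro def_intros) (simp_all add: nv_eq nv_simps)

lemma Add_Succ_left: "\<Gamma> \<tturnstile> Add (Succ u) t \<doteq> Succ (Add u t)"
  by (rule induct_o[where P = "\<lambda>t. Add (Succ u) t \<doteq> Succ (Add u t)"], intro def_intros) (simp_all add: nv_eq nv_simps)

lemma nv_Add_left [simp]:
  "A \<in> V \<Gamma> \<Longrightarrow> Add_v \<Gamma> (nv \<Gamma> Zero) A = A"
  "A \<in> V \<Gamma> \<Longrightarrow> B \<in> V \<Gamma> \<Longrightarrow> Add_v \<Gamma> (Succ_v \<Gamma> A) B = Succ_v \<Gamma> (Add_v \<Gamma> A B)"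
  using Add_Zero_left[of \<Gamma>] Add_Succ_left[of \<Gamma>] by (auto elim!: VE simp: nv_eq nv_simps)

lemma Add_commute: "\<Gamma> \<tturnstile> Add u t \<doteq> Add t u"
  by (rule induct_o[where P = "\<lambda>t. Add u t \<doteq> Add t u"], intro def_intros) (simp_all add: nv_eq nv_simps)

lemma Add_assoc: "\<Gamma> \<tturnstile> Add (Add u v) t \<doteq> Add u (Add v t)"
  by (rule induct_o[where P = "\<lambda>t. Add (Add u v) t \<doteq> Add u (Add v t)"], intro def_intros)
    (simp_all add: nv_eq nv_simps)

lemma nv_Add_commute: "A \<in> V \<Gamma> \<Longrightarrow> B \<in> V \<Gamma> \<Longrightarrow> Add_v \<Gamma> A B = Add_v \<Gamma> B A"
  using Add_commute[of \<Gamma>] by (auto elim!: VE simp: nv_eq nv_simps)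

lemma nv_Add_assoc: "A \<in> V \<Gamma> \<Longrightarrow> B \<in> V \<Gamma> \<Longrightarrow> C \<in> V \<Gamma> \<Longrightarrow> Add_v \<Gamma> (Add_v \<Gamma> A B) C = Add_v \<Gamma> A (Add_v \<Gamma> B C)"
  using Add_assoc[of \<Gamma>] by (auto elim!: VE simp: nv_eq nv_simps)

lemma nv_Add_left_commute: "A \<in> V \<Gamma> \<Longrightarrow> B \<in> V \<Gamma> \<Longrightarrow> C \<in> V \<Gamma> \<Longrightarrow> Add_v \<Gamma> A (Add_v \<Gamma> B C) = Add_v \<Gamma> B (Add_v \<Gamma> A C)"
  by (metis nv_Add_assoc nv_Add_commute)

lemmas nv_Add_ac = nv_Add_commute nv_Add_assoc nv_Add_left_commute

text \<open>Injectivity of the successor is obtained by applying \<open>Pred\<close> to both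
  sides.\<close>

lemma Succ_inj: "\<Gamma> \<tturnstile> Succ t \<doteq> Succ u \<Longrightarrow> \<Gamma> \<tturnstile> t \<doteq> u"
  unfolding nv_eq by (metis nv_arith(1) nv_simps(1) V_intros(1))

lemma Succ_neq_Zero: "\<Gamma> \<tturnstile> Succ t \<doteq> Zero \<Longrightarrow> \<Gamma> \<tturnstile> G"
  by (rule botE_o, rule mp_o[of _ "Succ t \<doteq> Zero"])
    (simp_all add: eq_o_def bot_o_def tr_Imp[symmetric] forces_tr Succ_neq)

lemma Zero_or_Succ: "\<Gamma> \<tturnstile> t \<doteq> Zero \<or>\<^sub>o t \<doteq> Succ (Pred t)"
  by (rule induct_o[where P = "\<lambda>t. t \<doteq> Zero \<or>\<^sub>o t \<doteq> Succ (Pred t)"], intro def_intros)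
    (rule orI1_o, simp, rule orI2_o, simp add: nv_eq nv_simps)

lemma Add_cancel: assumes "\<Gamma> \<tturnstile> Add t u \<doteq> Add t v" shows "\<Gamma> \<tturnstile> u \<doteq> v"
proof -
  have "\<Gamma> \<tturnstile> Add t u \<doteq> Add t v \<longrightarrow>\<^sub>o u \<doteq> v"
  proof (rule induct_o[where P = "\<lambda>t. Add t u \<doteq> Add t v \<longrightarrow>\<^sub>o u \<doteq> v"], intro def_intros)
    show "\<Gamma> \<tturnstile> Add Zero u \<doteq> Add Zero v \<longrightarrow>\<^sub>o u \<doteq> v"
      by (rule impI_o) (simp add: nv_eq nv_simps)
    fix \<Delta> t assume IH: "\<Delta> \<tturnstile> Add t u \<doteq> Add t v \<longrightarrow>\<^sub>o u \<doteq> v"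
    show "\<Delta> \<tturnstile> Add (Succ t) u \<doteq> Add (Succ t) v \<longrightarrow>\<^sub>o u \<doteq> v"
    proof (rule impI_o)
      fix \<Theta> assume le: "\<Delta> \<preceq> \<Theta>" and "\<Theta> \<tturnstile> Add (Succ t) u \<doteq> Add (Succ t) v"
      then have "\<Theta> \<tturnstile> Succ (Add t u) \<doteq> Succ (Add t v)" by (simp add: nv_eq nv_simps)
      then show "\<Theta> \<tturnstile> u \<doteq> v" by (rule mp_o[OF forces_mono[OF le IH] Succ_inj])
    qed
  qed
  then show ?thesis using assms by (rule mp_o)
qed

section \<open>Order and decidability\<close>

definition lt :: "ntm \<Rightarrow> ntm \<Rightarrow> tv" where "lt t u = (\<exists>\<^sub>o k. Add t (Succ k) \<doteq> u)"

lemma dfm_lt [def_intros]: "dnt n s T \<Longrightarrow> dnt n s U \<Longrightarrow> dfm n s (\<lambda>f g. lt (T f g) (U f g))"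
  unfolding lt_def by (intro def_intros dnt_shiftN)

text \<open>The order on classes, so that the simplifier may rewrite both sides of an inequality by
  provable equations.\<close>

definition "lt_v \<Gamma> A B \<longleftrightarrow> (\<exists>t\<in>A. \<exists>u\<in>B. \<Gamma> \<tturnstile> lt t u)"

lemma nv_lt: "\<Gamma> \<tturnstile> lt t u \<longleftrightarrow> lt_v \<Gamma> (nv \<Gamma> t) (nv \<Gamma> u)"
proof
  assume "\<Gamma> \<tturnstile> lt t u"
  then show "lt_v \<Gamma> (nv \<Gamma> t) (nv \<Gamma> u)" unfolding lt_v_def nv_def using eq_refl_o by blast
next
  assume "lt_v \<Gamma> (nv \<Gamma> t) (nv \<Gamma> u)"
  then obtain t' u' where *: "\<Gamma> \<tturnstile> t \<doteq> t'" "\<Gamma> \<tturnstile> u \<doteq> u'" "\<Gamma> \<tturnstile> lt t' u'" by (auto simp: lt_v_def nv_def)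
  have "\<Gamma> \<tturnstile> lt t u'"
    by (rule subst_o[where P = "\<lambda>z. lt z u'", OF _ eq_sym_o[OF *(1)] *(3)]) (intro def_intros)
  then show "\<Gamma> \<tturnstile> lt t u"
    by (rule subst_o[where P = "\<lambda>z. lt t z", OF _ eq_sym_o[OF *(2)], rotated]) (intro def_intros)
qed

lemma ltI: "\<Gamma> \<tturnstile> Add t (Succ k) \<doteq> u \<Longrightarrow> \<Gamma> \<tturnstile> lt t u"
  unfolding lt_def by (rule exI_o)

lemma ltE:
  assumes "\<Gamma> \<tturnstile> lt t u" "\<And>\<Delta> k. \<Gamma> \<preceq> \<Delta> \<Longrightarrow> \<Delta> \<tturnstile> u \<doteq> Succ (Add t k) \<Longrightarrow> \<Delta> \<tturnstile> G" shows "\<Gamma> \<tturnstile> G"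
  using assms(1) unfolding lt_def
proof (rule exE_o)
  fix \<Delta> k assume "\<Gamma> \<preceq> \<Delta>" "\<Delta> \<tturnstile> Add t (Succ k) \<doteq> u"
  then show "\<Delta> \<tturnstile> G" by (intro assms(2)[of _ k]) (simp_all add: nv_eq nv_simps)
qed

lemma lt_cong: "\<Gamma> \<tturnstile> lt t u \<Longrightarrow> \<Gamma> \<tturnstile> t \<doteq> t' \<Longrightarrow> \<Gamma> \<tturnstile> u \<doteq> u' \<Longrightarrow> \<Gamma> \<tturnstile> lt t' u'"
  by (simp add: nv_eq nv_lt)

lemma lt_Add: "\<Gamma> \<tturnstile> lt t (Succ (Add t u))"
  by (rule ltI[of _ _ u]) (simp add: nv_eq nv_simps)

lemma lt_Succ_self: "\<Gamma> \<tturnstile> lt t (Succ t)"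
  by (rule ltI[of _ _ Zero]) (simp add: nv_eq nv_simps)

lemma lt_Zero_Succ: "\<Gamma> \<tturnstile> lt Zero (Succ t)"
  by (rule ltI[of _ _ t]) (simp add: nv_eq nv_simps)

lemma lt_irrefl: assumes "\<Gamma> \<tturnstile> lt t t" shows "\<Gamma> \<tturnstile> G"
  using assms
proof (rule ltE)
  fix \<Delta> k assume "\<Delta> \<tturnstile> t \<doteq> Succ (Add t k)"
  then have "\<Delta> \<tturnstile> Add t (Succ k) \<doteq> Add t Zero" by (simp add: nv_eq nv_simps)
  then show "\<Delta> \<tturnstile> G" by (blast intro: Add_cancel Succ_neq_Zero)
qed

lemma lt_ZeroE: assumes "\<Gamma> \<tturnstile> lt t Zero" shows "\<Gamma> \<tturnstile> G"
  using assms
proof (rule ltE)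
  fix \<Delta> k assume "\<Delta> \<tturnstile> Zero \<doteq> Succ (Add t k)"
  then show "\<Delta> \<tturnstile> G" by (rule Succ_neq_Zero[OF eq_sym_o])
qed

lemma lt_trans: assumes "\<Gamma> \<tturnstile> lt t u" "\<Gamma> \<tturnstile> lt u v" shows "\<Gamma> \<tturnstile> lt t v"
  using assms(1)
proof (rule ltE)
  fix \<Delta> k assume le: "\<Gamma> \<preceq> \<Delta>" and k: "\<Delta> \<tturnstile> u \<doteq> Succ (Add t k)"
  show "\<Delta> \<tturnstile> lt t v"
    using forces_mono[OF le assms(2)]
  proof (rule ltE)
    fix \<Theta> l assume le: "\<Delta> \<preceq> \<Theta>" and "\<Theta> \<tturnstile> v \<doteq> Succ (Add u l)"
    moreover note forces_mono[OF le k]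
    ultimately show "\<Theta> \<tturnstile> lt t v"
      by (intro ltI[of _ _ "Succ (Add k l)"]) (simp add: nv_eq nv_simps nv_Add_ac)
  qed
qed

lemma lt_Succ_Succ: "\<Gamma> \<tturnstile> lt (Succ t) (Succ u) \<longleftrightarrow> \<Gamma> \<tturnstile> lt t u"
proof
  assume "\<Gamma> \<tturnstile> lt t u"
  then show "\<Gamma> \<tturnstile> lt (Succ t) (Succ u)"
    unfolding lt_def by (rule ex_mono_o) (simp add: nv_eq nv_simps)
next
  assume "\<Gamma> \<tturnstile> lt (Succ t) (Succ u)"
  then show "\<Gamma> \<tturnstile> lt t u"
    unfolding lt_def by (rule ex_mono_o) (rule Succ_inj, simp add: nv_eq nv_simps)
qed

lemma lt_Succ: "\<Gamma> \<tturnstile> lt t u \<Longrightarrow> \<Gamma> \<tturnstile> lt t (Succ u)"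
  by (rule lt_trans[OF _ lt_Succ_self])

lemma lt_SuccE:
  assumes "\<Gamma> \<tturnstile> lt t (Succ u)" shows "\<Gamma> \<tturnstile> lt t u \<or>\<^sub>o t \<doteq> u"
  using assms
proof (rule ltE)
  fix \<Delta> k assume "\<Delta> \<tturnstile> Succ u \<doteq> Succ (Add t k)"
  then have u: "\<Delta> \<tturnstile> u \<doteq> Add t k" by (rule Succ_inj)
  show "\<Delta> \<tturnstile> lt t u \<or>\<^sub>o t \<doteq> u"
  proof (rule orE_o[OF Zero_or_Succ[of _ k]])
    fix \<Theta> assume "\<Delta> \<preceq> \<Theta>" and "\<Theta> \<tturnstile> k \<doteq> Zero"
    with forces_mono[OF _ u] show "\<Theta> \<tturnstile> lt t u \<or>\<^sub>o t \<doteq> u" by (intro orI2_o) (simp add: nv_eq nv_simps)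
  next
    fix \<Theta> assume "\<Delta> \<preceq> \<Theta>" and "\<Theta> \<tturnstile> k \<doteq> Succ (Pred k)"
    with forces_mono[OF _ u] have "\<Theta> \<tturnstile> Add t (Succ (Pred k)) \<doteq> u" by (metis nv_eq nv_simps(5))
    then show "\<Theta> \<tturnstile> lt t u \<or>\<^sub>o t \<doteq> u" by (intro orI1_o ltI)
  qed
qed

lemma lt_trichotomy: "\<Gamma> \<tturnstile> lt t u \<or>\<^sub>o t \<doteq> u \<or>\<^sub>o lt u t"
proof (rule induct_o[where P = "\<lambda>t. lt t u \<or>\<^sub>o t \<doteq> u \<or>\<^sub>o lt u t"], intro def_intros)
  show "\<Gamma> \<tturnstile> lt Zero u \<or>\<^sub>o Zero \<doteq> u \<or>\<^sub>o lt u Zero"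
  proof (rule orE_o[OF Zero_or_Succ[of _ u]])
    fix \<Theta> assume "\<Theta> \<tturnstile> u \<doteq> Zero"
    then show "\<Theta> \<tturnstile> lt Zero u \<or>\<^sub>o Zero \<doteq> u \<or>\<^sub>o lt u Zero" by (blast intro: orI1_o orI2_o eq_sym_o)
  next
    fix \<Theta> assume "\<Theta> \<tturnstile> u \<doteq> Succ (Pred u)"
    then show "\<Theta> \<tturnstile> lt Zero u \<or>\<^sub>o Zero \<doteq> u \<or>\<^sub>o lt u Zero"
      by (intro orI1_o lt_cong[OF lt_Zero_Succ eq_refl_o]) (rule eq_sym_o)
  qed
  fix \<Delta> t assume "\<Delta> \<tturnstile> lt t u \<or>\<^sub>o t \<doteq> u \<or>\<^sub>o lt u t"
  then show "\<Delta> \<tturnstile> lt (Succ t) u \<or>\<^sub>o Succ t \<doteq> u \<or>\<^sub>o lt u (Succ t)"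
  proof (rule orE_o)
    fix \<Theta> assume "\<Theta> \<tturnstile> lt t u"
    then have "\<Theta> \<tturnstile> lt (Succ t) (Succ u)" by (simp add: lt_Succ_Succ)
    then show "\<Theta> \<tturnstile> lt (Succ t) u \<or>\<^sub>o Succ t \<doteq> u \<or>\<^sub>o lt u (Succ t)"
      by (rule or_mono_o[OF lt_SuccE]) (auto intro: orI1_o)
  next
    fix \<Theta> assume "\<Theta> \<tturnstile> t \<doteq> u \<or>\<^sub>o lt u t"
    then have "\<Theta> \<tturnstile> lt u (Succ t)"
    proof (rule orE_o)
      fix \<Theta> assume "\<Theta> \<tturnstile> t \<doteq> u"
      then show "\<Theta> \<tturnstile> lt u (Succ t)" by (intro lt_cong[OF lt_Succ_self[of _ u]]) (simp_all add: nv_eq nv_simps)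
    qed (rule lt_Succ)
    then show "\<Theta> \<tturnstile> lt (Succ t) u \<or>\<^sub>o Succ t \<doteq> u \<or>\<^sub>o lt u (Succ t)" by (intro orI2_o)
  qed
qed

lemma eq_dec: "\<Gamma> \<tturnstile> t \<doteq> u \<or>\<^sub>o \<not>\<^sub>o (t \<doteq> u)"
proof -
  have *: "\<Delta> \<tturnstile> \<not>\<^sub>o (t \<doteq> u)" if "\<Delta> \<tturnstile> lt t u" for \<Delta> t u
    by (rule notI_o, rule lt_irrefl[of _ u], rule lt_cong[OF forces_mono[OF _ that]]) simp_all
  show ?thesis
  proof (rule orE_o[OF lt_trichotomy[of _ t u]])
    fix \<Theta> assume "\<Theta> \<tturnstile> lt t u"
    then show "\<Theta> \<tturnstile> t \<doteq> u \<or>\<^sub>o \<not>\<^sub>o (t \<doteq> u)" by (intro orI2_o *)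
  next
    fix \<Theta> assume "\<Theta> \<tturnstile> t \<doteq> u \<or>\<^sub>o lt u t"
    then show "\<Theta> \<tturnstile> t \<doteq> u \<or>\<^sub>o \<not>\<^sub>o (t \<doteq> u)"
    proof (rule or_mono_o)
      fix \<Delta> assume "\<Delta> \<tturnstile> lt u t"
      from *[OF this] show "\<Delta> \<tturnstile> \<not>\<^sub>o (t \<doteq> u)"
        by (intro notI_o) (blast intro: notE_o forces_mono eq_sym_o)
    qed
  qed
qed

text \<open>As in all that follows, \<open>lt u (Succ t)\<close> expresses that \<open>u\<close> is
  at most \<open>t\<close>.\<close>

lemma lt_dec: "\<Gamma> \<tturnstile> lt t u \<or>\<^sub>o lt u (Succ t)"
proof (rule or_mono_o[OF lt_trichotomy[of _ t u]])
  fix \<Delta> assume "\<Delta> \<tturnstile> t \<doteq> u \<or>\<^sub>o lt u t"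
  then show "\<Delta> \<tturnstile> lt u (Succ t)"
    by (rule orE_o) (blast intro: lt_Succ lt_cong[OF lt_Succ_self] eq_refl_o lt_cong[of _ u "Succ u"]
       | simp add: nv_eq nv_lt nv_simps, metis nv_lt lt_Succ_self nv_simps(1))+
qed

lemma lt_trans_Succ: "\<Gamma> \<tturnstile> lt t u \<Longrightarrow> \<Gamma> \<tturnstile> lt u (Succ v) \<Longrightarrow> \<Gamma> \<tturnstile> lt t v"
  by (rule orE_o[OF lt_SuccE], assumption) (blast intro: lt_trans forces_mono lt_cong eq_refl_o)+

lemma lt_trans_Succ': "\<Gamma> \<tturnstile> lt t (Succ u) \<Longrightarrow> \<Gamma> \<tturnstile> lt u v \<Longrightarrow> \<Gamma> \<tturnstile> lt t v"
  by (rule orE_o[OF lt_SuccE], assumption) (blast intro: lt_trans forces_mono lt_cong eq_refl_o eq_sym_o)+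

lemma lt_asym: "\<Gamma> \<tturnstile> lt t u \<Longrightarrow> \<Gamma> \<tturnstile> lt u (Succ t) \<Longrightarrow> \<Gamma> \<tturnstile> G"
  by (rule lt_irrefl, rule lt_trans_Succ)

section \<open>Pairing\<close>

lemma num_cases_o:
  assumes "\<And>\<Delta>. \<Gamma> \<preceq> \<Delta> \<Longrightarrow> \<Delta> \<tturnstile> t \<doteq> Zero \<Longrightarrow> \<Delta> \<tturnstile> G" "\<And>\<Delta> p. \<Gamma> \<preceq> \<Delta> \<Longrightarrow> \<Delta> \<tturnstile> t \<doteq> Succ p \<Longrightarrow> \<Delta> \<tturnstile> G"
  shows "\<Gamma> \<tturnstile> G"
  by (rule orE_o[OF Zero_or_Succ[of _ t]]) (fact assms)+

lemma Mul_one_left: "\<Gamma> \<tturnstile> Mul (Succ Zero) t \<doteq> t"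
  by (rule induct_o[where P = "\<lambda>t. Mul (Succ Zero) t \<doteq> t"], intro def_intros) (simp_all add: nv_eq nv_simps)

lemma Mul_two_left: "\<Gamma> \<tturnstile> Mul two t \<doteq> Add t t"
  unfolding two_def
  by (rule induct_o[where P = "\<lambda>t. Mul (Succ (Succ Zero)) t \<doteq> Add t t"], intro def_intros)
    (simp_all add: nv_eq nv_simps)

lemma Mul_Add_left: "\<Gamma> \<tturnstile> Mul (Add t t) u \<doteq> Add (Mul t u) (Mul t u)"
  by (rule induct_o[where P = "\<lambda>u. Mul (Add t t) u \<doteq> Add (Mul t u) (Mul t u)"], intro def_intros)
    (simp_all add: nv_eq nv_simps nv_Add_ac)

text \<open>Together with \<open>pair_Succ\<close> this replaces powers and products by a recursion:
  odd numbers at zero, doubling at a successor.\<close>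

lemma pair_Zero: "\<Gamma> \<tturnstile> pair Zero n \<doteq> Succ (Add n n)"
  using Mul_two_left[of \<Gamma> n] Mul_one_left[of \<Gamma> "Succ (Mul two n)"] axioms_o(7)[of \<Gamma> two]
  unfolding pair_def nv_eq by (simp add: nv_simps)

lemma pair_Succ: "\<Gamma> \<tturnstile> pair (Succ s) n \<doteq> Add (pair s n) (pair s n)"
proof -
  have "\<Gamma> \<tturnstile> Pow two (Succ s) \<doteq> Add (Pow two s) (Pow two s)"
    using axioms_o(8)[of \<Gamma> two s] unfolding nv_eq by (simp add: nv_simps two_def)
  then show ?thesis
    using Mul_Add_left[of \<Gamma> "Pow two s" "Succ (Mul two n)"]
    unfolding pair_def nv_eq nv_simps(6)[of _ "Pow _ _" "Succ _"] by (simp add: nv_simps)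
qed

lemma nv_pair [simp]:
  "A \<in> V \<Gamma> \<Longrightarrow> pair_v \<Gamma> (nv \<Gamma> Zero) A = Succ_v \<Gamma> (Add_v \<Gamma> A A)"
  "A \<in> V \<Gamma> \<Longrightarrow> B \<in> V \<Gamma> \<Longrightarrow> pair_v \<Gamma> (Succ_v \<Gamma> A) B = Add_v \<Gamma> (pair_v \<Gamma> A B) (pair_v \<Gamma> A B)"
  using pair_Zero[of \<Gamma>] pair_Succ[of \<Gamma>] by (auto elim!: VE simp: nv_eq nv_simps)

text \<open>The position in a sequence of entry \<open>m\<close> of its row \<open>n\<close>. A pair
  is never 0, so the predecessor loses nothing and \<open>idx\<close> is a bijection onto all
  numbers.\<close>

abbreviation idx :: "ntm \<Rightarrow> ntm \<Rightarrow> ntm" where "idx m n \<equiv> Pred (pair m n)"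

lemma Succ_Pred: "\<Gamma> \<tturnstile> t \<doteq> Succ u \<Longrightarrow> \<Gamma> \<tturnstile> Succ (Pred t) \<doteq> t"
  by (simp add: nv_eq nv_simps)

lemma Succ_idx: "\<Gamma> \<tturnstile> Succ (idx s n) \<doteq> pair s n"
proof (rule induct_o[where P = "\<lambda>s. Succ (idx s n) \<doteq> pair s n"], intro def_intros)
  fix \<Delta> s assume "\<Delta> \<tturnstile> Succ (idx s n) \<doteq> pair s n"
  then have "\<Delta> \<tturnstile> pair (Succ s) n \<doteq> Add (Succ (idx s n)) (Succ (idx s n))"
    by (simp add: nv_eq nv_simps)
  then have "\<Delta> \<tturnstile> pair (Succ s) n \<doteq> Succ (Add (idx s n) (Succ (idx s n)))"
    by (rule eq_trans_o) (simp add: nv_eq nv_simps del: nv_arith(1))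
  then show "\<Delta> \<tturnstile> Succ (idx (Succ s) n) \<doteq> pair (Succ s) n" by (rule Succ_Pred)
qed (simp add: nv_eq nv_simps)

lemma even_or_odd: "\<Gamma> \<tturnstile> (\<exists>\<^sub>o q. t \<doteq> Add q q \<or>\<^sub>o t \<doteq> Succ (Add q q))"
proof (rule induct_o[where P = "\<lambda>t. \<exists>\<^sub>o q. t \<doteq> Add q q \<or>\<^sub>o t \<doteq> Succ (Add q q)"], intro def_intros)
  show "\<Gamma> \<tturnstile> (\<exists>\<^sub>o q. Zero \<doteq> Add q q \<or>\<^sub>o Zero \<doteq> Succ (Add q q))"
    by (rule exI_o[of _ _ Zero], rule orI1_o) (simp add: nv_eq nv_simps)
  fix \<Delta> t assume "\<Delta> \<tturnstile> (\<exists>\<^sub>o q. t \<doteq> Add q q \<or>\<^sub>o t \<doteq> Succ (Add q q))"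
  then show "\<Delta> \<tturnstile> (\<exists>\<^sub>o q. Succ t \<doteq> Add q q \<or>\<^sub>o Succ t \<doteq> Succ (Add q q))"
  proof (rule exE_o)
    fix \<Theta> q assume "\<Theta> \<tturnstile> t \<doteq> Add q q \<or>\<^sub>o t \<doteq> Succ (Add q q)"
    then show "\<Theta> \<tturnstile> (\<exists>\<^sub>o q. Succ t \<doteq> Add q q \<or>\<^sub>o Succ t \<doteq> Succ (Add q q))"
    proof (rule orE_o)
      fix \<Theta> assume "\<Theta> \<tturnstile> t \<doteq> Add q q"
      then show "\<Theta> \<tturnstile> (\<exists>\<^sub>o q. Succ t \<doteq> Add q q \<or>\<^sub>o Succ t \<doteq> Succ (Add q q))"
        by (intro exI_o[of _ _ q] orI2_o) (simp add: nv_eq nv_simps)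
    next
      fix \<Theta> assume "\<Theta> \<tturnstile> t \<doteq> Succ (Add q q)"
      then show "\<Theta> \<tturnstile> (\<exists>\<^sub>o q. Succ t \<doteq> Add q q \<or>\<^sub>o Succ t \<doteq> Succ (Add q q))"
        by (intro exI_o[of _ _ "Succ q"] orI1_o) (simp add: nv_eq nv_simps)
    qed
  qed
qed

lemma even_neq_odd:
  assumes "\<Gamma> \<tturnstile> Succ (Add a a) \<doteq> Add b b" shows "\<Gamma> \<tturnstile> G"
proof -
  have "\<Gamma> \<tturnstile> (\<forall>\<^sub>o b. Succ (Add a a) \<doteq> Add b b \<longrightarrow>\<^sub>o \<bottom>\<^sub>o)"
  proof (rule induct_o[where P = "\<lambda>a. \<forall>\<^sub>o b. Succ (Add a a) \<doteq> Add b b \<longrightarrow>\<^sub>o \<bottom>\<^sub>o"], intro def_intros)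
    show "\<Gamma> \<tturnstile> (\<forall>\<^sub>o b. Succ (Add Zero Zero) \<doteq> Add b b \<longrightarrow>\<^sub>o \<bottom>\<^sub>o)"
      unfolding forces_all
    proof (intro allI impI_o)
      fix b \<Delta> assume *: "\<Delta> \<tturnstile> Succ (Add Zero Zero) \<doteq> Add b b"
      show "\<Delta> \<tturnstile> \<bottom>\<^sub>o"
      proof (rule num_cases_o[of _ b])
        fix \<Theta> assume "\<Delta> \<preceq> \<Theta>" "\<Theta> \<tturnstile> b \<doteq> Zero"
        with forces_mono[OF _ *] show "\<Theta> \<tturnstile> \<bottom>\<^sub>o" by - (rule Succ_neq_Zero[of _ Zero], simp add: nv_eq nv_simps)
      next
        fix \<Theta> p assume "\<Delta> \<preceq> \<Theta>" "\<Theta> \<tturnstile> b \<doteq> Succ p"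
        with forces_mono[OF _ *] have "\<Theta> \<tturnstile> Succ (Succ (Add p p)) \<doteq> Succ Zero" by (simp add: nv_eq nv_simps)
        then show "\<Theta> \<tturnstile> \<bottom>\<^sub>o" by (rule Succ_neq_Zero[OF Succ_inj])
      qed
    qed
  next
    fix \<Delta> a assume IH: "\<Delta> \<tturnstile> (\<forall>\<^sub>o b. Succ (Add a a) \<doteq> Add b b \<longrightarrow>\<^sub>o \<bottom>\<^sub>o)"
    show "\<Delta> \<tturnstile> (\<forall>\<^sub>o b. Succ (Add (Succ a) (Succ a)) \<doteq> Add b b \<longrightarrow>\<^sub>o \<bottom>\<^sub>o)"
      unfolding forces_all
    proof (intro allI impI_o)
      fix b \<Theta> assume le: "\<Delta> \<preceq> \<Theta>" and *: "\<Theta> \<tturnstile> Succ (Add (Succ a) (Succ a)) \<doteq> Add b b"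
      show "\<Theta> \<tturnstile> \<bottom>\<^sub>o"
      proof (rule num_cases_o[of _ b])
        fix \<Omega> assume "\<Theta> \<preceq> \<Omega>" "\<Omega> \<tturnstile> b \<doteq> Zero"
        with forces_mono[OF _ *] show "\<Omega> \<tturnstile> \<bottom>\<^sub>o"
          by - (rule Succ_neq_Zero[of _ "Succ (Succ (Add a a))"], simp add: nv_eq nv_simps)
      next
        fix \<Omega> p assume le': "\<Theta> \<preceq> \<Omega>" and "\<Omega> \<tturnstile> b \<doteq> Succ p"
        with forces_mono[OF _ *] have "\<Omega> \<tturnstile> Succ (Succ (Succ (Add a a))) \<doteq> Succ (Succ (Add p p))"
          by (simp add: nv_eq nv_simps)
        then have "\<Omega> \<tturnstile> Succ (Add a a) \<doteq> Add p p" by (blast intro: Succ_inj)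
        then show "\<Omega> \<tturnstile> \<bottom>\<^sub>o" by (rule all_impE[OF forces_mono[OF extends_trans[OF le le'] IH]])
      qed
    qed
  qed
  from botE_o[OF mp_o[OF spec_o[OF this] assms]] show ?thesis .
qed

lemma double_inj:
  assumes "\<Gamma> \<tturnstile> Add a a \<doteq> Add b b" shows "\<Gamma> \<tturnstile> a \<doteq> b"
proof -
  have lt: "\<Delta> \<tturnstile> G" if "\<Delta> \<tturnstile> lt a b" "\<Delta> \<tturnstile> Add a a \<doteq> Add b b" for \<Delta> a b G
    using that(1)
  proof (rule ltE)
    fix \<Theta> k assume "\<Delta> \<preceq> \<Theta>" "\<Theta> \<tturnstile> b \<doteq> Succ (Add a k)"
    with forces_mono[OF _ that(2)] have "\<Theta> \<tturnstile> Add a (Add a (Succ (Succ (Add k k)))) \<doteq> Add a (Add a Zero)"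
      by (simp add: nv_eq nv_simps nv_Add_ac)
    then show "\<Theta> \<tturnstile> G" by (rule Succ_neq_Zero[OF Add_cancel[OF Add_cancel]])
  qed
  show ?thesis
  proof (rule orE_o[OF lt_trichotomy[of _ a b]])
    fix \<Delta> assume "\<Gamma> \<preceq> \<Delta>" "\<Delta> \<tturnstile> lt a b"
    then show "\<Delta> \<tturnstile> a \<doteq> b" using forces_mono assms lt by blast
  next
    fix \<Delta> assume le: "\<Gamma> \<preceq> \<Delta>" and "\<Delta> \<tturnstile> a \<doteq> b \<or>\<^sub>o lt b a"
    from this(2) show "\<Delta> \<tturnstile> a \<doteq> b"
    proof (rule orE_o)
      fix \<Theta> assume "\<Delta> \<preceq> \<Theta>" "\<Theta> \<tturnstile> lt b a"
      then show "\<Theta> \<tturnstile> a \<doteq> b" using forces_mono assms lt le eq_sym_o by blast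
    qed
  qed
qed

lemma strong_induct_o:
  assumes "defN P" "\<And>\<Delta> t. \<Gamma> \<preceq> \<Delta> \<Longrightarrow> (\<And>\<Theta> u. \<Delta> \<preceq> \<Theta> \<Longrightarrow> \<Theta> \<tturnstile> lt u t \<Longrightarrow> \<Theta> \<tturnstile> P u) \<Longrightarrow> \<Delta> \<tturnstile> P t"
  shows "\<Gamma> \<tturnstile> P t"
proof -
  have "\<Gamma> \<tturnstile> (\<forall>\<^sub>o u. lt u (Succ t) \<longrightarrow>\<^sub>o P u)"
  proof (rule induct_o[where P = "\<lambda>t. \<forall>\<^sub>o u. lt u t \<longrightarrow>\<^sub>o P u"], intro def_intros dfm_defN[OF assms(1)])
    show "\<Gamma> \<tturnstile> (\<forall>\<^sub>o u. lt u Zero \<longrightarrow>\<^sub>o P u)" by (rule all_impI) (rule lt_ZeroE)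
    fix \<Delta> t assume \<Delta>: "\<Gamma> \<preceq> \<Delta>" and IH: "\<Delta> \<tturnstile> (\<forall>\<^sub>o u. lt u t \<longrightarrow>\<^sub>o P u)"
    have IH': "\<Theta> \<tturnstile> P u" if "\<Delta> \<preceq> \<Theta>" "\<Theta> \<tturnstile> lt u t" for \<Theta> u
      using forces_mono[OF that(1) IH] that(2) by (rule all_impE)
    show "\<Delta> \<tturnstile> (\<forall>\<^sub>o u. lt u (Succ t) \<longrightarrow>\<^sub>o P u)"
      unfolding forces_all
    proof (intro allI impI_o)
      fix u \<Theta> assume \<Theta>: "\<Delta> \<preceq> \<Theta>" and "\<Theta> \<tturnstile> lt u (Succ t)"
      from lt_SuccE[OF this(2)] show "\<Theta> \<tturnstile> P u"
      proof (rule orE_o)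
        fix \<Omega> assume "\<Theta> \<preceq> \<Omega>" "\<Omega> \<tturnstile> lt u t"
        then show "\<Omega> \<tturnstile> P u" using IH' extends_trans[OF \<Theta>] by blast
      next
        fix \<Omega> assume \<Omega>: "\<Theta> \<preceq> \<Omega>" and "\<Omega> \<tturnstile> u \<doteq> t"
        moreover have "\<Omega> \<tturnstile> P t"
          by (rule assms(2)) (use IH' extends_trans \<Theta> \<Omega> \<Delta> in blast)+
        ultimately show "\<Omega> \<tturnstile> P u" using subst_o[OF assms(1)] eq_sym_o by blast
      qed
    qed
  qed
  then show ?thesis using lt_Succ_self by (rule all_impE)
qed

text \<open>If \<open>p\<close> is twice \<open>q\<close>, its successor is
  \<open>pair Zero q\<close>. If \<open>p\<close> is one more than twice \<open>q\<close>, its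
  successor is the double of \<open>Succ q\<close>, where \<open>q\<close> is smaller than
  \<open>p\<close>; so the first component for \<open>q\<close> goes up by one.\<close>

lemma pair_surj: "\<Gamma> \<tturnstile> (\<exists>\<^sub>o s. \<exists>\<^sub>o n. Succ p \<doteq> pair s n)"
proof (rule strong_induct_o[where P = "\<lambda>p. \<exists>\<^sub>o s. \<exists>\<^sub>o n. Succ p \<doteq> pair s n"], intro def_intros)
  fix \<Delta> p assume IH: "\<And>\<Theta> u. \<Delta> \<preceq> \<Theta> \<Longrightarrow> \<Theta> \<tturnstile> lt u p \<Longrightarrow> \<Theta> \<tturnstile> (\<exists>\<^sub>o s. \<exists>\<^sub>o n. Succ u \<doteq> pair s n)"
  show "\<Delta> \<tturnstile> (\<exists>\<^sub>o s. \<exists>\<^sub>o n. Succ p \<doteq> pair s n)"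
  proof (rule exE_o[OF even_or_odd[of _ p]])
    fix \<Theta> q assume \<Theta>: "\<Delta> \<preceq> \<Theta>" and "\<Theta> \<tturnstile> p \<doteq> Add q q \<or>\<^sub>o p \<doteq> Succ (Add q q)"
    from this(2) show "\<Theta> \<tturnstile> (\<exists>\<^sub>o s. \<exists>\<^sub>o n. Succ p \<doteq> pair s n)"
    proof (rule orE_o)
      fix \<Omega> assume "\<Omega> \<tturnstile> p \<doteq> Add q q"
      then show "\<Omega> \<tturnstile> (\<exists>\<^sub>o s. \<exists>\<^sub>o n. Succ p \<doteq> pair s n)"
        by (intro exI_o[of _ _ Zero] exI_o[of _ _ q]) (simp add: nv_eq nv_simps)
    next
      fix \<Omega> assume \<Omega>: "\<Theta> \<preceq> \<Omega>" and p: "\<Omega> \<tturnstile> p \<doteq> Succ (Add q q)"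
      have "\<Omega> \<tturnstile> lt q p" using p by (intro lt_cong[OF lt_Add[of _ q q]]) (simp_all add: nv_eq)
      from IH[OF extends_trans[OF \<Theta> \<Omega>] this]
      show "\<Omega> \<tturnstile> (\<exists>\<^sub>o s. \<exists>\<^sub>o n. Succ p \<doteq> pair s n)"
      proof (rule exE_o, elim exE_o)
        fix s n \<Omega>' \<Omega>'' assume le: "\<Omega> \<preceq> \<Omega>'" "\<Omega>' \<preceq> \<Omega>''" and *: "\<Omega>'' \<tturnstile> Succ q \<doteq> pair s n"
        note p' = forces_mono[OF le(2) forces_mono[OF le(1) p]]
        show "\<Omega>'' \<tturnstile> (\<exists>\<^sub>o s. \<exists>\<^sub>o n. Succ p \<doteq> pair s n)"
          using p' * by (intro exI_o[of _ _ "Succ s"] exI_o[of _ _ n]) (simp add: nv_eq nv_simps flip: *[unfolded nv_eq nv_simps])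
      qed
    qed
  qed
qed

lemma idx_surj: "\<Gamma> \<tturnstile> (\<exists>\<^sub>o s. \<exists>\<^sub>o n. p \<doteq> idx s n)"
  by (rule ex_mono_o[OF pair_surj[of _ p]], erule ex_mono_o) 
    (simp add: nv_eq nv_simps, metis V_intros(1) nv_arith(1))

text \<open>Parity decides whether a first component is zero, and two even pairs can be halved. The
  quantifiers are internal because halving replaces \<open>s'\<close> by its predecessor.\<close>

lemma pair_inj_aux:
  "\<Gamma> \<tturnstile> (\<forall>\<^sub>o s'. \<forall>\<^sub>o n. \<forall>\<^sub>o n'. pair s n \<doteq> pair s' n' \<longrightarrow>\<^sub>o s \<doteq> s' \<and>\<^sub>o n \<doteq> n')"
proof (rule induct_o[where P = "\<lambda>s. \<forall>\<^sub>o s'. \<forall>\<^sub>o n. \<forall>\<^sub>o n'. pair s n \<doteq> pair s' n' \<longrightarrow>\<^sub>o s \<doteq> s' \<and>\<^sub>o n \<doteq> n'"], intro def_intros)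
  show "\<Gamma> \<tturnstile> (\<forall>\<^sub>o s'. \<forall>\<^sub>o n. \<forall>\<^sub>o n'. pair Zero n \<doteq> pair s' n' \<longrightarrow>\<^sub>o Zero \<doteq> s' \<and>\<^sub>o n \<doteq> n')"
    unfolding forces_all
  proof (intro allI impI_o)
    fix s' n n' \<Delta> assume *: "\<Delta> \<tturnstile> pair Zero n \<doteq> pair s' n'"
    show "\<Delta> \<tturnstile> Zero \<doteq> s' \<and>\<^sub>o n \<doteq> n'"
    proof (rule num_cases_o[of _ s'])
      fix \<Theta> assume "\<Delta> \<preceq> \<Theta>" and s: "\<Theta> \<tturnstile> s' \<doteq> Zero"
      with forces_mono[OF _ *] have "\<Theta> \<tturnstile> Succ (Add n n) \<doteq> Succ (Add n' n')" by (simp add: nv_eq nv_simps)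
      then have "\<Theta> \<tturnstile> n \<doteq> n'" by (rule double_inj[OF Succ_inj])
      then show "\<Theta> \<tturnstile> Zero \<doteq> s' \<and>\<^sub>o n \<doteq> n'" using s by (simp add: nv_eq)
    next
      fix \<Theta> p assume "\<Delta> \<preceq> \<Theta>" and s: "\<Theta> \<tturnstile> s' \<doteq> Succ p"
      with forces_mono[OF _ *] have "\<Theta> \<tturnstile> Succ (Add n n) \<doteq> Add (pair p n') (pair p n')" by (simp add: nv_eq nv_simps)
      then show "\<Theta> \<tturnstile> Zero \<doteq> s' \<and>\<^sub>o n \<doteq> n'" by (rule even_neq_odd)
    qed
  qed
next
  fix \<Delta> s assume IH: "\<Delta> \<tturnstile> (\<forall>\<^sub>o s'. \<forall>\<^sub>o n. \<forall>\<^sub>o n'. pair s n \<doteq> pair s' n' \<longrightarrow>\<^sub>o s \<doteq> s' \<and>\<^sub>o n \<doteq> n')"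
  show "\<Delta> \<tturnstile> (\<forall>\<^sub>o s'. \<forall>\<^sub>o n. \<forall>\<^sub>o n'. pair (Succ s) n \<doteq> pair s' n' \<longrightarrow>\<^sub>o Succ s \<doteq> s' \<and>\<^sub>o n \<doteq> n')"
    unfolding forces_all
  proof (intro allI impI_o)
    fix s' n n' \<Theta> assume \<Theta>: "\<Delta> \<preceq> \<Theta>" and *: "\<Theta> \<tturnstile> pair (Succ s) n \<doteq> pair s' n'"
    show "\<Theta> \<tturnstile> Succ s \<doteq> s' \<and>\<^sub>o n \<doteq> n'"
    proof (rule num_cases_o[of _ s'])
      fix \<Omega> assume "\<Theta> \<preceq> \<Omega>" and s: "\<Omega> \<tturnstile> s' \<doteq> Zero"
      with forces_mono[OF _ *] have "\<Omega> \<tturnstile> Succ (Add n' n') \<doteq> Add (pair s n) (pair s n)" by (simp add: nv_eq nv_simps)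
      then show "\<Omega> \<tturnstile> Succ s \<doteq> s' \<and>\<^sub>o n \<doteq> n'" by (rule even_neq_odd)
    next
      fix \<Omega> p assume \<Omega>: "\<Theta> \<preceq> \<Omega>" and s: "\<Omega> \<tturnstile> s' \<doteq> Succ p"
      with forces_mono[OF _ *] have "\<Omega> \<tturnstile> Add (pair s n) (pair s n) \<doteq> Add (pair p n') (pair p n')" by (simp add: nv_eq nv_simps)
      then have "\<Omega> \<tturnstile> pair s n \<doteq> pair p n'" by (rule double_inj)
      then have "\<Omega> \<tturnstile> s \<doteq> p \<and>\<^sub>o n \<doteq> n'"
        by (rule mp_o[OF spec_o[OF spec_o[OF spec_o[OF forces_mono[OF extends_trans[OF \<Theta> \<Omega>] IH]]]]])
      with s show "\<Omega> \<tturnstile> Succ s \<doteq> s' \<and>\<^sub>o n \<doteq> n'" by (simp add: nv_eq nv_simps)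
    qed
  qed
qed

lemma pair_inj:
  assumes "\<Gamma> \<tturnstile> pair s n \<doteq> pair s' n'" shows "\<Gamma> \<tturnstile> s \<doteq> s'" "\<Gamma> \<tturnstile> n \<doteq> n'"
  using mp_o[OF spec_o[OF spec_o[OF spec_o[OF pair_inj_aux]]] assms] by simp_all

lemma idx_inj:
  assumes "\<Gamma> \<tturnstile> idx s n \<doteq> idx s' n'" shows "\<Gamma> \<tturnstile> s \<doteq> s'" "\<Gamma> \<tturnstile> n \<doteq> n'"
proof -
  have "\<Gamma> \<tturnstile> pair s n \<doteq> pair s' n'"
    using assms Succ_idx[of \<Gamma> s n] Succ_idx[of \<Gamma> s' n'] unfolding nv_eq nv_simps(1) by metis
  then show "\<Gamma> \<tturnstile> s \<doteq> s'" "\<Gamma> \<tturnstile> n \<doteq> n'" by (rule pair_inj)+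
qed

text \<open>Serves two purposes: the code of a finite sequence grows when an entry is appended, and
  an entry number is at most the position of the entry.\<close>

lemma lt_pair: "\<Gamma> \<tturnstile> lt s (pair s n)"
proof (rule induct_o[where P = "\<lambda>s. lt s (pair s n)"], intro def_intros)
  show "\<Gamma> \<tturnstile> lt Zero (pair Zero n)" by (rule lt_cong[OF lt_Zero_Succ[of _ "Add n n"]]) (simp_all add: nv_eq nv_simps)
  fix \<Delta> s assume "\<Delta> \<tturnstile> lt s (pair s n)"
  then show "\<Delta> \<tturnstile> lt (Succ s) (pair (Succ s) n)"
  proof (rule ltE)
    fix \<Theta> k assume "\<Theta> \<tturnstile> pair s n \<doteq> Succ (Add s k)"
    then show "\<Theta> \<tturnstile> lt (Succ s) (pair (Succ s) n)"
      by (intro ltI[of _ _ "Add k (Add s k)"]) (simp add: nv_eq nv_simps nv_Add_ac)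
  qed
qed

lemma lt_idx: "\<Gamma> \<tturnstile> lt s (Succ (idx s n))"
  by (rule lt_cong[OF lt_pair eq_refl_o eq_sym_o[OF Succ_idx]])

section \<open>Bounded search and unique choice\<close>

text \<open>Induction on \<open>m\<close>, with one decision of \<open>D\<close> at each step. The
  positive alternative supplies a witness, not just the negation of the other one.\<close>

lemma bounded_dec:
  assumes D: "defN D" and dec: "\<And>\<Delta> j. \<Gamma> \<preceq> \<Delta> \<Longrightarrow> \<Delta> \<tturnstile> D j \<or>\<^sub>o \<not>\<^sub>o D j"
  shows "\<Gamma> \<tturnstile> (\<exists>\<^sub>o j. lt j m \<and>\<^sub>o D j) \<or>\<^sub>o (\<forall>\<^sub>o j. lt j m \<longrightarrow>\<^sub>o \<not>\<^sub>o D j)"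
proof (rule induct_o[where P = "\<lambda>m. (\<exists>\<^sub>o j. lt j m \<and>\<^sub>o D j) \<or>\<^sub>o (\<forall>\<^sub>o j. lt j m \<longrightarrow>\<^sub>o \<not>\<^sub>o D j)"],
    intro def_intros dfm_defN[OF D])
  show "\<Gamma> \<tturnstile> (\<exists>\<^sub>o j. lt j Zero \<and>\<^sub>o D j) \<or>\<^sub>o (\<forall>\<^sub>o j. lt j Zero \<longrightarrow>\<^sub>o \<not>\<^sub>o D j)"
    by (intro orI2_o all_impI) (rule lt_ZeroE)
  fix \<Delta> m assume \<Delta>: "\<Gamma> \<preceq> \<Delta>" and "\<Delta> \<tturnstile> (\<exists>\<^sub>o j. lt j m \<and>\<^sub>o D j) \<or>\<^sub>o (\<forall>\<^sub>o j. lt j m \<longrightarrow>\<^sub>o \<not>\<^sub>o D j)"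
  from this(2) show "\<Delta> \<tturnstile> (\<exists>\<^sub>o j. lt j (Succ m) \<and>\<^sub>o D j) \<or>\<^sub>o (\<forall>\<^sub>o j. lt j (Succ m) \<longrightarrow>\<^sub>o \<not>\<^sub>o D j)"
  proof (rule orE_o)
    fix \<Theta> assume "\<Theta> \<tturnstile> (\<exists>\<^sub>o j. lt j m \<and>\<^sub>o D j)"
    then show "\<Theta> \<tturnstile> (\<exists>\<^sub>o j. lt j (Succ m) \<and>\<^sub>o D j) \<or>\<^sub>o (\<forall>\<^sub>o j. lt j (Succ m) \<longrightarrow>\<^sub>o \<not>\<^sub>o D j)"
      by (intro orI1_o) (erule ex_mono_o, simp add: lt_Succ)
  next
    fix \<Theta> assume \<Theta>: "\<Delta> \<preceq> \<Theta>" and none: "\<Theta> \<tturnstile> (\<forall>\<^sub>o j. lt j m \<longrightarrow>\<^sub>o \<not>\<^sub>o D j)"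
    show "\<Theta> \<tturnstile> (\<exists>\<^sub>o j. lt j (Succ m) \<and>\<^sub>o D j) \<or>\<^sub>o (\<forall>\<^sub>o j. lt j (Succ m) \<longrightarrow>\<^sub>o \<not>\<^sub>o D j)"
    proof (rule or_mono_o[OF dec[OF extends_trans[OF \<Delta> \<Theta>], of m]])
      fix \<Omega> assume "\<Omega> \<tturnstile> D m"
      then show "\<Omega> \<tturnstile> (\<exists>\<^sub>o j. lt j (Succ m) \<and>\<^sub>o D j)" by (intro exI_o[of _ _ m]) (simp add: lt_Succ_self)
    next
      fix \<Omega> assume \<Omega>: "\<Theta> \<preceq> \<Omega>" and m: "\<Omega> \<tturnstile> \<not>\<^sub>o D m"
      show "\<Omega> \<tturnstile> (\<forall>\<^sub>o j. lt j (Succ m) \<longrightarrow>\<^sub>o \<not>\<^sub>o D j)"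
        unfolding forces_all
      proof (intro allI impI_o)
        fix j \<Omega>' assume le: "\<Omega> \<preceq> \<Omega>'" and "\<Omega>' \<tturnstile> lt j (Succ m)"
        from lt_SuccE[OF this(2)] show "\<Omega>' \<tturnstile> \<not>\<^sub>o D j"
        proof (rule orE_o)
          fix \<Omega>'' assume le': "\<Omega>' \<preceq> \<Omega>''" and "\<Omega>'' \<tturnstile> lt j m"
          from this(2) show "\<Omega>'' \<tturnstile> \<not>\<^sub>o D j"
            by (rule all_impE[OF forces_mono[OF extends_trans[OF extends_trans[OF \<Omega> le] le'] none]])
        next
          fix \<Omega>'' assume "\<Omega>' \<preceq> \<Omega>''" "\<Omega>'' \<tturnstile> j \<doteq> m"
          then show "\<Omega>'' \<tturnstile> \<not>\<^sub>o D j"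
            by - (rule subst_o[OF dfm_not[OF D]], erule eq_sym_o, rule forces_mono[OF extends_trans[OF le] m])
        qed
      qed
    qed
  qed
qed

text \<open>Below a given element the bounded search either finds another one, to which the
  induction hypothesis applies, or shows that the given one is least.\<close>

lemma least_number:
  assumes D: "defN D" and dec: "\<And>\<Delta> j. \<Gamma> \<preceq> \<Delta> \<Longrightarrow> \<Delta> \<tturnstile> D j \<or>\<^sub>o \<not>\<^sub>o D j" and ex: "\<Gamma> \<tturnstile> (\<exists>\<^sub>o j. D j)"
  shows "\<Gamma> \<tturnstile> (\<exists>\<^sub>o j. D j \<and>\<^sub>o (\<forall>\<^sub>o i. lt i j \<longrightarrow>\<^sub>o \<not>\<^sub>o D i))"
proof -
  have "\<Gamma> \<tturnstile> D j \<longrightarrow>\<^sub>o (\<exists>\<^sub>o j. D j \<and>\<^sub>o (\<forall>\<^sub>o i. lt i j \<longrightarrow>\<^sub>o \<not>\<^sub>o D i))" for j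
  proof (rule strong_induct_o[where P = "\<lambda>j. D j \<longrightarrow>\<^sub>o (\<exists>\<^sub>o j. D j \<and>\<^sub>o (\<forall>\<^sub>o i. lt i j \<longrightarrow>\<^sub>o \<not>\<^sub>o D i))"],
      intro def_intros dfm_defN[OF D])
    fix \<Delta> t assume \<Delta>: "\<Gamma> \<preceq> \<Delta>"
      and IH: "\<And>\<Theta> u. \<Delta> \<preceq> \<Theta> \<Longrightarrow> \<Theta> \<tturnstile> lt u t \<Longrightarrow> \<Theta> \<tturnstile> D u \<longrightarrow>\<^sub>o (\<exists>\<^sub>o j. D j \<and>\<^sub>o (\<forall>\<^sub>o i. lt i j \<longrightarrow>\<^sub>o \<not>\<^sub>o D i))"
    show "\<Delta> \<tturnstile> D t \<longrightarrow>\<^sub>o (\<exists>\<^sub>o j. D j \<and>\<^sub>o (\<forall>\<^sub>o i. lt i j \<longrightarrow>\<^sub>o \<not>\<^sub>o D i))"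
    proof (rule impI_o)
      fix \<Theta> assume \<Theta>: "\<Delta> \<preceq> \<Theta>" and t: "\<Theta> \<tturnstile> D t"
      have "\<Theta> \<tturnstile> (\<exists>\<^sub>o j. lt j t \<and>\<^sub>o D j) \<or>\<^sub>o (\<forall>\<^sub>o j. lt j t \<longrightarrow>\<^sub>o \<not>\<^sub>o D j)"
        by (rule bounded_dec[OF D dec]) (use \<Delta> \<Theta> extends_trans in blast)
      then show "\<Theta> \<tturnstile> (\<exists>\<^sub>o j. D j \<and>\<^sub>o (\<forall>\<^sub>o i. lt i j \<longrightarrow>\<^sub>o \<not>\<^sub>o D i))"
      proof (rule orE_o)
        fix \<Omega> assume \<Omega>: "\<Theta> \<preceq> \<Omega>" and "\<Omega> \<tturnstile> (\<exists>\<^sub>o j. lt j t \<and>\<^sub>o D j)"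
        from this(2) show "\<Omega> \<tturnstile> (\<exists>\<^sub>o j. D j \<and>\<^sub>o (\<forall>\<^sub>o i. lt i j \<longrightarrow>\<^sub>o \<not>\<^sub>o D i))"
        proof (rule exE_o)
          fix \<Omega>' j assume "\<Omega> \<preceq> \<Omega>'" and j: "\<Omega>' \<tturnstile> lt j t \<and>\<^sub>o D j"
          then have "\<Delta> \<preceq> \<Omega>'" using \<Theta> \<Omega> extends_trans by blast
          from mp_o[OF IH[OF this, of j]] j show "\<Omega>' \<tturnstile> (\<exists>\<^sub>o j. D j \<and>\<^sub>o (\<forall>\<^sub>o i. lt i j \<longrightarrow>\<^sub>o \<not>\<^sub>o D i))" by simp
        qed
      next
        fix \<Omega> assume \<Omega>: "\<Theta> \<preceq> \<Omega>" and "\<Omega> \<tturnstile> (\<forall>\<^sub>o j. lt j t \<longrightarrow>\<^sub>o \<not>\<^sub>o D j)"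
        then show "\<Omega> \<tturnstile> (\<exists>\<^sub>o j. D j \<and>\<^sub>o (\<forall>\<^sub>o i. lt i j \<longrightarrow>\<^sub>o \<not>\<^sub>o D i))"
          using forces_mono[OF _ t] by (intro exI_o[of _ _ t]) auto
      qed
    qed
  qed
  then show ?thesis by (intro exE_o[OF ex]) (rule mp_o[OF forces_mono])
qed

text \<open>Unique choice with existence and uniqueness as separate premises. Both \<open>P\<close>
  and its uniqueness may rely on the current context.\<close>

lemma seq_exists:
  assumes P: "defNN P" and tot: "\<And>n. \<Gamma> \<tturnstile> (\<exists>\<^sub>o k. P n k)"
    and uniq: "\<And>\<Delta> n k k'. \<Gamma> \<preceq> \<Delta> \<Longrightarrow> \<Delta> \<tturnstile> P n k \<Longrightarrow> \<Delta> \<tturnstile> P n k' \<Longrightarrow> \<Delta> \<tturnstile> k' \<doteq> k"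
  shows "\<Gamma> \<tturnstile> (\<exists>\<^sub>o a. \<forall>\<^sub>o n. P n (App a n))"
proof -
  have "\<Gamma> \<tturnstile> (\<exists>\<^sub>o a. \<forall>\<^sub>o n. \<forall>\<^sub>o m. App a n \<doteq> m \<longleftrightarrow>\<^sub>o P n m)"
  proof (rule unique_choice_o[OF P], rule ex_mono_o[OF tot])
    fix n \<Delta> k assume \<Delta>: "\<Gamma> \<preceq> \<Delta>" and k: "\<Delta> \<tturnstile> P n k"
    show "\<Delta> \<tturnstile> (\<forall>\<^sub>o m. P n m \<longleftrightarrow>\<^sub>o m \<doteq> k)"
      unfolding forces_all
    proof (intro allI iffI_o)
      fix m \<Theta> assume le: "\<Delta> \<preceq> \<Theta>" and "\<Theta> \<tturnstile> P n m"
      then show "\<Theta> \<tturnstile> m \<doteq> k" using uniq[OF extends_trans[OF \<Delta> le] forces_mono[OF le k]] by blast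
    next
      fix m \<Theta> assume le: "\<Delta> \<preceq> \<Theta>" and "\<Theta> \<tturnstile> m \<doteq> k"
      then show "\<Theta> \<tturnstile> P n m"
        by (intro subst_o[where P = "\<lambda>z. P n z", OF _ eq_sym_o forces_mono[OF le k]]) (intro def_intros dfm_defNN[OF P])
    qed
  qed
  then show ?thesis
    by (rule ex_mono_o) (auto intro: iffD1_o[OF _ eq_refl_o])
qed

text \<open>Prescribes all rows of one sequence at once: each position is \<open>idx m n\<close> for
  exactly one pair, so a functional property of \<open>n\<close> and \<open>m\<close> is a
  functional property of the position.\<close>

lemma seq2_exists:
  assumes P: "defNNN P" and tot: "\<And>\<Delta> n m. \<Gamma> \<preceq> \<Delta> \<Longrightarrow> \<Delta> \<tturnstile> (\<exists>\<^sub>o k. P n m k)"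
    and uniq: "\<And>\<Delta> n m k k'. \<Gamma> \<preceq> \<Delta> \<Longrightarrow> \<Delta> \<tturnstile> P n m k \<Longrightarrow> \<Delta> \<tturnstile> P n m k' \<Longrightarrow> \<Delta> \<tturnstile> k' \<doteq> k"
  shows "\<Gamma> \<tturnstile> (\<exists>\<^sub>o a. \<forall>\<^sub>o n. \<forall>\<^sub>o m. P n m (App (Sect a n) m))"
proof -
  let ?Q = "\<lambda>p k. \<exists>\<^sub>o m. \<exists>\<^sub>o n. p \<doteq> idx m n \<and>\<^sub>o P n m k"
  \<comment> \<open>The existential in \<open>?Q\<close> hides no freedom: by \<open>idx_inj\<close>
    its witnesses are the given \<open>m\<close> and \<open>n\<close>.\<close>
  have Q: "\<Delta> \<tturnstile> P n m k" if "\<Delta> \<tturnstile> ?Q p k" "\<Delta> \<tturnstile> p \<doteq> idx m n" for \<Delta> p k m n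
  proof (rule exE_o[OF that(1)], elim exE_o)
    fix \<Theta> \<Omega> m' n' assume le: "\<Delta> \<preceq> \<Theta>" "\<Theta> \<preceq> \<Omega>" and *: "\<Omega> \<tturnstile> p \<doteq> idx m' n' \<and>\<^sub>o P n' m' k"
    have "\<Omega> \<tturnstile> idx m' n' \<doteq> idx m n"
      using * forces_mono[OF le(2) forces_mono[OF le(1) that(2)]] by (simp add: nv_eq)
    note eq = idx_inj[OF this]
    have "\<Omega> \<tturnstile> P n' m k"
      by (rule subst_o[where P = "\<lambda>z. P n' z k", OF _ eq(1)]) (intro def_intros dfm_defNNN[OF P], use * in simp)
    then show "\<Omega> \<tturnstile> P n m k"
      by (intro subst_o[where P = "\<lambda>z. P z m k", OF _ eq(2)]) (intro def_intros dfm_defNNN[OF P])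
  qed
  have "\<Gamma> \<tturnstile> (\<exists>\<^sub>o a. \<forall>\<^sub>o p. ?Q p (App a p))"
  proof (rule seq_exists, intro def_intros dfm_defNNN[OF P])
    fix p show "\<Gamma> \<tturnstile> (\<exists>\<^sub>o k. ?Q p k)"
    proof (rule exE_o[OF idx_surj[of _ p]], elim exE_o)
      fix \<Theta> \<Omega> m n assume le: "\<Gamma> \<preceq> \<Theta>" "\<Theta> \<preceq> \<Omega>" and "\<Omega> \<tturnstile> p \<doteq> idx m n"
      then show "\<Omega> \<tturnstile> (\<exists>\<^sub>o k. ?Q p k)"
        by (intro ex_mono_o[OF tot[OF extends_trans[OF le]]]) (auto intro!: exI_o intro: forces_mono)
    qed
  next
    fix \<Delta> p k k' assume \<Delta>: "\<Gamma> \<preceq> \<Delta>" and k: "\<Delta> \<tturnstile> ?Q p k" and k': "\<Delta> \<tturnstile> ?Q p k'"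
    show "\<Delta> \<tturnstile> k' \<doteq> k"
    proof (rule exE_o[OF idx_surj[of _ p]], elim exE_o)
      fix \<Theta> \<Omega> m n assume le: "\<Delta> \<preceq> \<Theta>" "\<Theta> \<preceq> \<Omega>" and *: "\<Omega> \<tturnstile> p \<doteq> idx m n"
      note up = forces_mono[OF le(2) forces_mono[OF le(1)]]
      show "\<Omega> \<tturnstile> k' \<doteq> k"
        using uniq[OF _ Q[OF up[OF k] *] Q[OF up[OF k'] *]] \<Delta> le extends_trans by blast
    qed
  qed
  then show ?thesis
  proof (rule ex_mono_o)
    fix \<Delta> a assume a: "\<Delta> \<tturnstile> (\<forall>\<^sub>o p. ?Q p (App a p))"
    show "\<Delta> \<tturnstile> (\<forall>\<^sub>o n. \<forall>\<^sub>o m. P n m (App (Sect a n) m))"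
      unfolding forces_all
    proof (intro allI)
      fix n m
      have "\<Delta> \<tturnstile> P n m (App a (idx m n))" by (rule Q[OF spec_o[OF a] eq_refl_o])
      then show "\<Delta> \<tturnstile> P n m (App (Sect a n) m)"
        by (intro subst_o[where P = "\<lambda>z. P n m z", OF _ eq_sym_o[OF axioms_o(11)]]) (intro def_intros dfm_defNNN[OF P])
    qed
  qed
qed

section \<open>Decidable and stable propositions\<close>

lemma dec_not: "\<Gamma> \<tturnstile> P \<or>\<^sub>o \<not>\<^sub>o P \<Longrightarrow> \<Gamma> \<tturnstile> \<not>\<^sub>o P \<or>\<^sub>o \<not>\<^sub>o \<not>\<^sub>o P"
proof (erule orE_o)
  fix \<Delta> assume P: "\<Delta> \<tturnstile> P"
  have "\<Delta> \<tturnstile> \<not>\<^sub>o \<not>\<^sub>o P" by (rule notI_o, erule notE_o, erule forces_mono, rule P)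
  then show "\<Delta> \<tturnstile> \<not>\<^sub>o P \<or>\<^sub>o \<not>\<^sub>o \<not>\<^sub>o P" by (rule orI2_o)
qed (rule orI1_o)

lemma dec_dne: "\<Gamma> \<tturnstile> P \<or>\<^sub>o \<not>\<^sub>o P \<Longrightarrow> \<Gamma> \<tturnstile> \<not>\<^sub>o \<not>\<^sub>o P \<Longrightarrow> \<Gamma> \<tturnstile> P"
  by (erule orE_o, assumption) (rule notE_o[OF forces_mono])

text \<open>Licenses arguments by contradiction later on: an equation between numbers may be proved
  by refuting its negation.\<close>

lemma eq_dne: "\<Gamma> \<tturnstile> \<not>\<^sub>o \<not>\<^sub>o (t \<doteq> u) \<Longrightarrow> \<Gamma> \<tturnstile> t \<doteq> u"
  by (rule dec_dne[OF eq_dec])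

lemma dec_and:
  assumes "\<And>\<Delta>. \<Gamma> \<preceq> \<Delta> \<Longrightarrow> \<Delta> \<tturnstile> P \<or>\<^sub>o \<not>\<^sub>o P" "\<And>\<Delta>. \<Gamma> \<preceq> \<Delta> \<Longrightarrow> \<Delta> \<tturnstile> Q \<or>\<^sub>o \<not>\<^sub>o Q"
  shows "\<Gamma> \<tturnstile> (P \<and>\<^sub>o Q) \<or>\<^sub>o \<not>\<^sub>o (P \<and>\<^sub>o Q)"
proof (rule orE_o[OF assms(1)])
  fix \<Delta> assume \<Delta>: "\<Gamma> \<preceq> \<Delta>" and P: "\<Delta> \<tturnstile> P"
  show "\<Delta> \<tturnstile> (P \<and>\<^sub>o Q) \<or>\<^sub>o \<not>\<^sub>o (P \<and>\<^sub>o Q)"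
  proof (rule or_mono_o[OF assms(2)[OF \<Delta>]])
    fix \<Theta> assume "\<Delta> \<preceq> \<Theta>" "\<Theta> \<tturnstile> Q"
    then show "\<Theta> \<tturnstile> P \<and>\<^sub>o Q" using forces_mono[OF _ P] by simp
  next
    fix \<Theta> assume Q: "\<Theta> \<tturnstile> \<not>\<^sub>o Q"
    show "\<Theta> \<tturnstile> \<not>\<^sub>o (P \<and>\<^sub>o Q)" by (rule notI_o, rule notE_o[OF forces_mono[OF _ Q]]) simp_all
  qed
next
  fix \<Delta> assume P: "\<Delta> \<tturnstile> \<not>\<^sub>o P"
  have "\<Delta> \<tturnstile> \<not>\<^sub>o (P \<and>\<^sub>o Q)" by (rule notI_o, rule notE_o[OF forces_mono[OF _ P]]) simp_all
  then show "\<Delta> \<tturnstile> (P \<and>\<^sub>o Q) \<or>\<^sub>o \<not>\<^sub>o (P \<and>\<^sub>o Q)" by (rule orI2_o)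
qed simp

lemma dec_lt: "\<Gamma> \<tturnstile> lt t u \<or>\<^sub>o \<not>\<^sub>o lt t u"
proof (rule or_mono_o[OF lt_dec])
  fix \<Delta> assume *: "\<Delta> \<tturnstile> lt u (Succ t)"
  show "\<Delta> \<tturnstile> \<not>\<^sub>o lt t u" by (rule notI_o, erule lt_asym, rule forces_mono[OF _ *])
qed

lemma dec_bounded:
  assumes D: "defN D" and dec: "\<And>\<Delta> j. \<Gamma> \<preceq> \<Delta> \<Longrightarrow> \<Delta> \<tturnstile> D j \<or>\<^sub>o \<not>\<^sub>o D j"
  shows "\<Gamma> \<tturnstile> (\<forall>\<^sub>o j. lt j m \<longrightarrow>\<^sub>o D j) \<or>\<^sub>o \<not>\<^sub>o (\<forall>\<^sub>o j. lt j m \<longrightarrow>\<^sub>o D j)"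
proof (rule orE_o[OF bounded_dec[OF dfm_not[OF D] dec_not[OF dec], of _ m]])
  fix \<Delta> assume ex: "\<Delta> \<tturnstile> (\<exists>\<^sub>o j. lt j m \<and>\<^sub>o \<not>\<^sub>o D j)"
  have "\<Delta> \<tturnstile> \<not>\<^sub>o (\<forall>\<^sub>o j. lt j m \<longrightarrow>\<^sub>o D j)"
  proof (rule notI_o)
    fix \<Theta> assume le: "\<Delta> \<preceq> \<Theta>" and all: "\<Theta> \<tturnstile> (\<forall>\<^sub>o j. lt j m \<longrightarrow>\<^sub>o D j)"
    show "\<Theta> \<tturnstile> \<bottom>\<^sub>o"
    proof (rule exE_o[OF forces_mono[OF le ex]])
      fix \<Omega> j assume "\<Theta> \<preceq> \<Omega>" and j: "\<Omega> \<tturnstile> lt j m \<and>\<^sub>o \<not>\<^sub>o D j"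
      from all_impE[OF forces_mono[OF this(1) all], of j] j show "\<Omega> \<tturnstile> \<bottom>\<^sub>o" by (auto intro: notE_o)
    qed
  qed
  then show "\<Delta> \<tturnstile> (\<forall>\<^sub>o j. lt j m \<longrightarrow>\<^sub>o D j) \<or>\<^sub>o \<not>\<^sub>o (\<forall>\<^sub>o j. lt j m \<longrightarrow>\<^sub>o D j)" by (rule orI2_o)
next
  fix \<Delta> assume \<Delta>: "\<Gamma> \<preceq> \<Delta>" and all: "\<Delta> \<tturnstile> (\<forall>\<^sub>o j. lt j m \<longrightarrow>\<^sub>o \<not>\<^sub>o \<not>\<^sub>o D j)"
  have "\<Delta> \<tturnstile> (\<forall>\<^sub>o j. lt j m \<longrightarrow>\<^sub>o D j)"
  proof (rule all_impI)
    fix \<Theta> j assume le: "\<Delta> \<preceq> \<Theta>" and "\<Theta> \<tturnstile> lt j m"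
    from all_impE[OF forces_mono[OF le all] this(2)] show "\<Theta> \<tturnstile> D j"
      by (rule dec_dne[OF dec[OF extends_trans[OF \<Delta> le]]])
  qed
  then show "\<Delta> \<tturnstile> (\<forall>\<^sub>o j. lt j m \<longrightarrow>\<^sub>o D j) \<or>\<^sub>o \<not>\<^sub>o (\<forall>\<^sub>o j. lt j m \<longrightarrow>\<^sub>o D j)" by (rule orI1_o)
qed

section \<open>Sequences and initial segments\<close>

text \<open>As the case distinction is decidable, a value exists and is unique, so unique choice
  applies.\<close>

lemma seq_if:
  assumes D: "defN D" and T: "dnt (Suc 0) 0 (\<lambda>f g. T (f 0))" and U: "dnt (Suc 0) 0 (\<lambda>f g. U (f 0))"
    and dec: "\<And>\<Delta> n. \<Gamma> \<preceq> \<Delta> \<Longrightarrow> \<Delta> \<tturnstile> D n \<or>\<^sub>o \<not>\<^sub>o D n"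
  shows "\<Gamma> \<tturnstile> (\<exists>\<^sub>o a. \<forall>\<^sub>o n. (D n \<longrightarrow>\<^sub>o App a n \<doteq> T n) \<and>\<^sub>o (\<not>\<^sub>o D n \<longrightarrow>\<^sub>o App a n \<doteq> U n))"
proof (rule seq_exists[where P = "\<lambda>n y. (D n \<longrightarrow>\<^sub>o y \<doteq> T n) \<and>\<^sub>o (\<not>\<^sub>o D n \<longrightarrow>\<^sub>o y \<doteq> U n)"])
  show "defNN (\<lambda>n y. (D n \<longrightarrow>\<^sub>o y \<doteq> T n) \<and>\<^sub>o (\<not>\<^sub>o D n \<longrightarrow>\<^sub>o y \<doteq> U n))"
    by (intro def_intros dfm_defN[OF D] dnt_comp[OF T] dnt_comp[OF U])
  fix n
  show "\<Gamma> \<tturnstile> (\<exists>\<^sub>o y. (D n \<longrightarrow>\<^sub>o y \<doteq> T n) \<and>\<^sub>o (\<not>\<^sub>o D n \<longrightarrow>\<^sub>o y \<doteq> U n))"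
  proof (rule orE_o[OF dec])
    fix \<Delta> assume *: "\<Delta> \<tturnstile> D n"
    show "\<Delta> \<tturnstile> (\<exists>\<^sub>o y. (D n \<longrightarrow>\<^sub>o y \<doteq> T n) \<and>\<^sub>o (\<not>\<^sub>o D n \<longrightarrow>\<^sub>o y \<doteq> U n))"
      by (rule exI_o[of _ _ "T n"], unfold forces_and, intro conjI impI_o) (simp, erule notE_o[OF _ forces_mono[OF _ *]])
  next
    fix \<Delta> assume *: "\<Delta> \<tturnstile> \<not>\<^sub>o D n"
    show "\<Delta> \<tturnstile> (\<exists>\<^sub>o y. (D n \<longrightarrow>\<^sub>o y \<doteq> T n) \<and>\<^sub>o (\<not>\<^sub>o D n \<longrightarrow>\<^sub>o y \<doteq> U n))"
      by (rule exI_o[of _ _ "U n"], unfold forces_and, intro conjI impI_o) (erule notE_o[OF forces_mono[OF _ *]], simp_all)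
  qed simp
next
  fix \<Delta> n k k' assume \<Delta>: "\<Gamma> \<preceq> \<Delta>" and k: "\<Delta> \<tturnstile> (D n \<longrightarrow>\<^sub>o k \<doteq> T n) \<and>\<^sub>o (\<not>\<^sub>o D n \<longrightarrow>\<^sub>o k \<doteq> U n)"
    and k': "\<Delta> \<tturnstile> (D n \<longrightarrow>\<^sub>o k' \<doteq> T n) \<and>\<^sub>o (\<not>\<^sub>o D n \<longrightarrow>\<^sub>o k' \<doteq> U n)"
  show "\<Delta> \<tturnstile> k' \<doteq> k"
  proof (rule orE_o[OF dec[OF \<Delta>]])
    fix \<Theta> assume "\<Delta> \<preceq> \<Theta>" "\<Theta> \<tturnstile> D n"
    with forces_mono[OF this(1) k] forces_mono[OF this(1) k'] show "\<Theta> \<tturnstile> k' \<doteq> k" by (auto dest!: mp_o simp: nv_eq)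
  next
    fix \<Theta> assume "\<Delta> \<preceq> \<Theta>" "\<Theta> \<tturnstile> \<not>\<^sub>o D n"
    with forces_mono[OF this(1) k] forces_mono[OF this(1) k'] show "\<Theta> \<tturnstile> k' \<doteq> k" by (auto dest!: mp_o simp: nv_eq)
  qed
qed

lemma if1_o: "\<Gamma> \<tturnstile> (P \<longrightarrow>\<^sub>o A) \<and>\<^sub>o (\<not>\<^sub>o P \<longrightarrow>\<^sub>o B) \<Longrightarrow> \<Gamma> \<tturnstile> P \<Longrightarrow> \<Gamma> \<tturnstile> A"
  and if2_o: "\<Gamma> \<tturnstile> (P \<longrightarrow>\<^sub>o A) \<and>\<^sub>o (\<not>\<^sub>o P \<longrightarrow>\<^sub>o B) \<Longrightarrow> \<Gamma> \<tturnstile> \<not>\<^sub>o P \<Longrightarrow> \<Gamma> \<tturnstile> B"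
  by (auto dest: mp_o)

lemma zero_seq: "\<Gamma> \<tturnstile> (\<exists>\<^sub>o a. \<forall>\<^sub>o n. App a n \<doteq> Zero)"
  by (rule seq_exists[where P = "\<lambda>n y. y \<doteq> Zero"], intro def_intros) (auto intro!: exI_o[of _ _ Zero] simp: nv_eq)

lemma update_seq: "\<Gamma> \<tturnstile> (\<exists>\<^sub>o b. App b k \<doteq> v \<and>\<^sub>o (\<forall>\<^sub>o i. \<not>\<^sub>o (i \<doteq> k) \<longrightarrow>\<^sub>o App b i \<doteq> App a i))"
proof -
  have "\<Gamma> \<tturnstile> (\<exists>\<^sub>o b. \<forall>\<^sub>o n. (n \<doteq> k \<longrightarrow>\<^sub>o App b n \<doteq> v) \<and>\<^sub>o (\<not>\<^sub>o (n \<doteq> k) \<longrightarrow>\<^sub>o App b n \<doteq> App a n))"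
    by (rule seq_if) (intro def_intros | rule eq_dec)+
  then show ?thesis by (rule ex_mono_o) (auto intro: mp_o[OF _ eq_refl_o])
qed

lemma Init_cong:
  assumes "\<And>\<Delta> q. \<Gamma> \<preceq> \<Delta> \<Longrightarrow> \<Delta> \<tturnstile> lt q k \<Longrightarrow> \<Delta> \<tturnstile> App a q \<doteq> App b q"
  shows "\<Gamma> \<tturnstile> Init a k \<doteq> Init b k"
proof -
  have "\<Gamma> \<tturnstile> (\<forall>\<^sub>o q. lt q k \<longrightarrow>\<^sub>o App a q \<doteq> App b q) \<longrightarrow>\<^sub>o Init a k \<doteq> Init b k"
  proof (rule induct_o[where P = "\<lambda>k. (\<forall>\<^sub>o q. lt q k \<longrightarrow>\<^sub>o App a q \<doteq> App b q) \<longrightarrow>\<^sub>o Init a k \<doteq> Init b k"], intro def_intros)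
    fix \<Delta> k assume IH: "\<Delta> \<tturnstile> (\<forall>\<^sub>o q. lt q k \<longrightarrow>\<^sub>o App a q \<doteq> App b q) \<longrightarrow>\<^sub>o Init a k \<doteq> Init b k"
    show "\<Delta> \<tturnstile> (\<forall>\<^sub>o q. lt q (Succ k) \<longrightarrow>\<^sub>o App a q \<doteq> App b q) \<longrightarrow>\<^sub>o Init a (Succ k) \<doteq> Init b (Succ k)"
    proof (rule impI_o)
      fix \<Theta> assume le: "\<Delta> \<preceq> \<Theta>" and *: "\<Theta> \<tturnstile> (\<forall>\<^sub>o q. lt q (Succ k) \<longrightarrow>\<^sub>o App a q \<doteq> App b q)"
      have "\<Theta> \<tturnstile> Init a k \<doteq> Init b k"
        by (rule mp_o[OF forces_mono[OF le IH]], rule all_impI, rule all_impE[OF forces_mono[OF _ *]]) (auto intro: lt_Succ)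
      moreover have "\<Theta> \<tturnstile> App a k \<doteq> App b k" by (rule all_impE[OF * lt_Succ_self])
      ultimately show "\<Theta> \<tturnstile> Init a (Succ k) \<doteq> Init b (Succ k)" by (simp add: nv_eq nv_simps)
    qed
  qed (rule impI_o, simp add: nv_eq nv_simps)
  then show ?thesis by (rule mp_o) (rule all_impI, rule assms)
qed

lemma Init_lt_Succ: "\<Gamma> \<tturnstile> lt (Init a k) (Init a (Succ k))"
  by (rule lt_cong[OF lt_pair[of _ "Init a k" "App a k"]]) (simp_all add: nv_eq nv_simps)

text \<open>Gives a length at which the code of an initial segment has reached a prescribed number;
  this makes the function of \<open>threshold_code\<close> total.\<close>

lemma Init_ge: "\<Gamma> \<tturnstile> lt k (Succ (Init a k))"
proof (rule induct_o[where P = "\<lambda>k. lt k (Succ (Init a k))"], intro def_intros)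
  fix \<Delta> k assume "\<Delta> \<tturnstile> lt k (Succ (Init a k))"
  then show "\<Delta> \<tturnstile> lt (Succ k) (Succ (Init a (Succ k)))"
    unfolding lt_Succ_Succ by (rule lt_trans_Succ'[OF _ Init_lt_Succ])
qed (rule lt_Zero_Succ)

lemma Init_mono: assumes "\<Gamma> \<tturnstile> lt j k" shows "\<Gamma> \<tturnstile> lt (Init a j) (Init a k)"
  using assms
proof (rule ltE)
  fix \<Delta> l assume *: "\<Delta> \<tturnstile> k \<doteq> Succ (Add j l)"
  have "\<Delta> \<tturnstile> lt (Init a j) (Init a (Succ (Add j l)))"
  proof (rule induct_o[where P = "\<lambda>l. lt (Init a j) (Init a (Succ (Add j l)))"], intro def_intros)
    show "\<Delta> \<tturnstile> lt (Init a j) (Init a (Succ (Add j Zero)))"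
      by (rule lt_cong[OF Init_lt_Succ]) (simp_all add: nv_eq nv_simps)
    fix \<Theta> l assume "\<Theta> \<tturnstile> lt (Init a j) (Init a (Succ (Add j l)))"
    from lt_trans[OF this Init_lt_Succ] show "\<Theta> \<tturnstile> lt (Init a j) (Init a (Succ (Add j (Succ l))))"
      by (rule lt_cong) (simp_all add: nv_eq nv_simps)
  qed
  then show "\<Delta> \<tturnstile> lt (Init a j) (Init a k)" by (rule lt_cong) (use * in \<open>simp_all add: nv_eq nv_simps\<close>)
qed

text \<open>Peeling off the last entry with \<open>pair_inj\<close> shows that a code determines its
  length and all shorter segments. Segments rather than entries are compared because functions on
  Baire space read segments.\<close>

lemma Init_inj_aux:
  "\<Gamma> \<tturnstile> (\<forall>\<^sub>o k'. Init a k \<doteq> Init b k' \<longrightarrow>\<^sub>o k \<doteq> k' \<and>\<^sub>o (\<forall>\<^sub>o j. lt j (Succ k) \<longrightarrow>\<^sub>o Init a j \<doteq> Init b j))"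
proof (rule induct_o[where P = "\<lambda>k. \<forall>\<^sub>o k'. Init a k \<doteq> Init b k' \<longrightarrow>\<^sub>o k \<doteq> k' \<and>\<^sub>o (\<forall>\<^sub>o j. lt j (Succ k) \<longrightarrow>\<^sub>o Init a j \<doteq> Init b j)"],
    intro def_intros)
  show "\<Gamma> \<tturnstile> (\<forall>\<^sub>o k'. Init a Zero \<doteq> Init b k' \<longrightarrow>\<^sub>o Zero \<doteq> k' \<and>\<^sub>o (\<forall>\<^sub>o j. lt j (Succ Zero) \<longrightarrow>\<^sub>o Init a j \<doteq> Init b j))"
  proof (rule all_impI)
    fix \<Delta> k' assume *: "\<Delta> \<tturnstile> Init a Zero \<doteq> Init b k'"
    show "\<Delta> \<tturnstile> Zero \<doteq> k' \<and>\<^sub>o (\<forall>\<^sub>o j. lt j (Succ Zero) \<longrightarrow>\<^sub>o Init a j \<doteq> Init b j)"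
    proof (rule num_cases_o[of _ k'])
      fix \<Theta> assume "\<Theta> \<tturnstile> k' \<doteq> Zero"
      moreover have "\<Theta> \<tturnstile> (\<forall>\<^sub>o j. lt j (Succ Zero) \<longrightarrow>\<^sub>o Init a j \<doteq> Init b j)"
      proof (rule all_impI)
        fix \<Omega> j assume "\<Omega> \<tturnstile> lt j (Succ Zero)"
        from lt_SuccE[OF this] show "\<Omega> \<tturnstile> Init a j \<doteq> Init b j"
          by (rule orE_o) (erule lt_ZeroE, simp add: nv_eq nv_simps)
      qed
      ultimately show "\<Theta> \<tturnstile> Zero \<doteq> k' \<and>\<^sub>o (\<forall>\<^sub>o j. lt j (Succ Zero) \<longrightarrow>\<^sub>o Init a j \<doteq> Init b j)"
        by (simp only: forces_and nv_eq)
    next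
      fix \<Theta> p assume "\<Delta> \<preceq> \<Theta>" "\<Theta> \<tturnstile> k' \<doteq> Succ p"
      with forces_mono[OF _ *] Succ_idx[of \<Theta> "Init b p" "App b p"] have "\<Theta> \<tturnstile> Succ (idx (Init b p) (App b p)) \<doteq> Zero"
        by (simp add: nv_eq nv_simps)
      then show "\<Theta> \<tturnstile> Zero \<doteq> k' \<and>\<^sub>o (\<forall>\<^sub>o j. lt j (Succ Zero) \<longrightarrow>\<^sub>o Init a j \<doteq> Init b j)" by (rule Succ_neq_Zero)
    qed
  qed
next
  fix \<Delta> k assume IH: "\<Delta> \<tturnstile> (\<forall>\<^sub>o k'. Init a k \<doteq> Init b k' \<longrightarrow>\<^sub>o k \<doteq> k' \<and>\<^sub>o (\<forall>\<^sub>o j. lt j (Succ k) \<longrightarrow>\<^sub>o Init a j \<doteq> Init b j))"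
  show "\<Delta> \<tturnstile> (\<forall>\<^sub>o k'. Init a (Succ k) \<doteq> Init b k' \<longrightarrow>\<^sub>o Succ k \<doteq> k' \<and>\<^sub>o (\<forall>\<^sub>o j. lt j (Succ (Succ k)) \<longrightarrow>\<^sub>o Init a j \<doteq> Init b j))"
  proof (rule all_impI)
    fix \<Theta> k' assume \<Theta>: "\<Delta> \<preceq> \<Theta>" and *: "\<Theta> \<tturnstile> Init a (Succ k) \<doteq> Init b k'"
    show "\<Theta> \<tturnstile> Succ k \<doteq> k' \<and>\<^sub>o (\<forall>\<^sub>o j. lt j (Succ (Succ k)) \<longrightarrow>\<^sub>o Init a j \<doteq> Init b j)"
    proof (rule num_cases_o[of _ k'])
      fix \<Omega> assume "\<Theta> \<preceq> \<Omega>" "\<Omega> \<tturnstile> k' \<doteq> Zero"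
      with forces_mono[OF _ *] Succ_idx[of \<Omega> "Init a k" "App a k"] have "\<Omega> \<tturnstile> Succ (idx (Init a k) (App a k)) \<doteq> Zero"
        by (simp add: nv_eq nv_simps)
      then show "\<Omega> \<tturnstile> Succ k \<doteq> k' \<and>\<^sub>o (\<forall>\<^sub>o j. lt j (Succ (Succ k)) \<longrightarrow>\<^sub>o Init a j \<doteq> Init b j)" by (rule Succ_neq_Zero)
    next
      fix \<Omega> p assume \<Omega>: "\<Theta> \<preceq> \<Omega>" and p: "\<Omega> \<tturnstile> k' \<doteq> Succ p"
      with forces_mono[OF _ *] have "\<Omega> \<tturnstile> pair (Init a k) (App a k) \<doteq> pair (Init b p) (App b p)"
        by (simp add: nv_eq nv_simps)
      note eq = pair_inj[OF this]
      have 1: "\<Omega> \<tturnstile> k \<doteq> p" and 2: "\<Omega> \<tturnstile> (\<forall>\<^sub>o j. lt j (Succ k) \<longrightarrow>\<^sub>o Init a j \<doteq> Init b j)"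
        using all_impE[OF forces_mono[OF extends_trans[OF \<Theta> \<Omega>] IH] eq(1)] by (simp_all del: forces_all)
      have "\<Omega> \<tturnstile> (\<forall>\<^sub>o j. lt j (Succ (Succ k)) \<longrightarrow>\<^sub>o Init a j \<doteq> Init b j)"
      proof (rule all_impI)
        fix \<Phi> j assume \<Phi>: "\<Omega> \<preceq> \<Phi>" and "\<Phi> \<tturnstile> lt j (Succ (Succ k))"
        from lt_SuccE[OF this(2)] show "\<Phi> \<tturnstile> Init a j \<doteq> Init b j"
        proof (rule orE_o)
          fix \<Psi> assume "\<Phi> \<preceq> \<Psi>" "\<Psi> \<tturnstile> lt j (Succ k)"
          then show "\<Psi> \<tturnstile> Init a j \<doteq> Init b j" by (intro all_impE[OF forces_mono[OF extends_trans[OF \<Phi>] 2]])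
        next
          fix \<Psi> assume "\<Phi> \<preceq> \<Psi>" and j: "\<Psi> \<tturnstile> j \<doteq> Succ k"
          note up = forces_mono[OF extends_trans[OF \<Phi> this(1)]]
          show "\<Psi> \<tturnstile> Init a j \<doteq> Init b j" using j up[OF 1] up[OF eq(1)] up[OF eq(2)] by (simp add: nv_eq nv_simps)
        qed
      qed
      moreover have "\<Omega> \<tturnstile> Succ k \<doteq> k'" using 1 p by (simp add: nv_eq nv_simps)
      ultimately show "\<Omega> \<tturnstile> Succ k \<doteq> k' \<and>\<^sub>o (\<forall>\<^sub>o j. lt j (Succ (Succ k)) \<longrightarrow>\<^sub>o Init a j \<doteq> Init b j)"
        by (simp only: forces_and)
    qed
  qed
qed

lemma Init_inj:
  assumes "\<Gamma> \<tturnstile> Init a k \<doteq> Init b k'"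
  shows "\<Gamma> \<tturnstile> k \<doteq> k'" "\<Gamma> \<tturnstile> (\<forall>\<^sub>o j. lt j (Succ k) \<longrightarrow>\<^sub>o Init a j \<doteq> Init b j)"
  using all_impE[OF Init_inj_aux assms] by (simp_all only: forces_and)

text \<open>A non-zero number is \<open>pair t n\<close> with a smaller \<open>t\<close>. If
  \<open>t\<close> codes a segment of \<open>a\<close> of length \<open>k\<close>, then overwriting
  entry \<open>k\<close> of \<open>a\<close> by \<open>n\<close> gives a sequence for the whole
  number.\<close>

lemma Init_surj: "\<Gamma> \<tturnstile> (\<exists>\<^sub>o a. \<exists>\<^sub>o k. s \<doteq> Init a k)"
proof (rule strong_induct_o[where P = "\<lambda>s. \<exists>\<^sub>o a. \<exists>\<^sub>o k. s \<doteq> Init a k"], intro def_intros)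
  fix \<Delta> s assume IH: "\<And>\<Theta> u. \<Delta> \<preceq> \<Theta> \<Longrightarrow> \<Theta> \<tturnstile> lt u s \<Longrightarrow> \<Theta> \<tturnstile> (\<exists>\<^sub>o a. \<exists>\<^sub>o k. u \<doteq> Init a k)"
  show "\<Delta> \<tturnstile> (\<exists>\<^sub>o a. \<exists>\<^sub>o k. s \<doteq> Init a k)"
  proof (rule num_cases_o[of _ s])
    fix \<Theta> assume "\<Theta> \<tturnstile> s \<doteq> Zero"
    then show "\<Theta> \<tturnstile> (\<exists>\<^sub>o a. \<exists>\<^sub>o k. s \<doteq> Init a k)"
      \<comment> \<open>Any sequence will do, as only its empty segment is used.\<close>
      by (intro exI_o[of _ _ "SVar 0"] exI_o[of _ _ Zero]) (simp add: nv_eq nv_simps)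
  next
    fix \<Theta> p assume \<Theta>: "\<Delta> \<preceq> \<Theta>" and p: "\<Theta> \<tturnstile> s \<doteq> Succ p"
    show "\<Theta> \<tturnstile> (\<exists>\<^sub>o a. \<exists>\<^sub>o k. s \<doteq> Init a k)"
    proof (rule exE_o[OF pair_surj[of _ p]], elim exE_o)
      fix t n \<Delta>1 \<Delta>2 assume le: "\<Theta> \<preceq> \<Delta>1" "\<Delta>1 \<preceq> \<Delta>2" and *: "\<Delta>2 \<tturnstile> Succ p \<doteq> pair t n"
      have s: "\<Delta>2 \<tturnstile> pair t n \<doteq> s" using forces_mono[OF extends_trans[OF le] p] * by (simp add: nv_eq)
      have "\<Delta>2 \<tturnstile> lt t s" by (rule lt_cong[OF lt_pair eq_refl_o s])
      from IH[OF extends_trans[OF \<Theta> extends_trans[OF le]] this]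
      show "\<Delta>2 \<tturnstile> (\<exists>\<^sub>o a. \<exists>\<^sub>o k. s \<doteq> Init a k)"
      proof (rule exE_o, elim exE_o)
        fix a k \<Delta>3 \<Delta>4 assume le: "\<Delta>2 \<preceq> \<Delta>3" "\<Delta>3 \<preceq> \<Delta>4" and t: "\<Delta>4 \<tturnstile> t \<doteq> Init a k"
        note s' = forces_mono[OF extends_trans[OF le] s]
        show "\<Delta>4 \<tturnstile> (\<exists>\<^sub>o a. \<exists>\<^sub>o k. s \<doteq> Init a k)"
        proof (rule exE_o[OF update_seq[of _ k n a]])
          fix b \<Delta>5 assume le: "\<Delta>4 \<preceq> \<Delta>5" and b: "\<Delta>5 \<tturnstile> App b k \<doteq> n \<and>\<^sub>o (\<forall>\<^sub>o i. \<not>\<^sub>o (i \<doteq> k) \<longrightarrow>\<^sub>o App b i \<doteq> App a i)"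
          from b have b1: "\<Delta>5 \<tturnstile> App b k \<doteq> n" and b2: "\<Delta>5 \<tturnstile> (\<forall>\<^sub>o i. \<not>\<^sub>o (i \<doteq> k) \<longrightarrow>\<^sub>o App b i \<doteq> App a i)"
            by (simp_all only: forces_and)
          have "\<Delta>5 \<tturnstile> Init b k \<doteq> Init a k"
          proof (rule Init_cong)
            fix \<Delta>6 q assume le: "\<Delta>5 \<preceq> \<Delta>6" and q: "\<Delta>6 \<tturnstile> lt q k"
            show "\<Delta>6 \<tturnstile> App b q \<doteq> App a q"
            proof (rule all_impE[OF forces_mono[OF le b2]], rule notI_o)
              fix \<Delta>7 assume "\<Delta>6 \<preceq> \<Delta>7" and "\<Delta>7 \<tturnstile> q \<doteq> k"
              with forces_mono[OF this(1) q] show "\<Delta>7 \<tturnstile> \<bottom>\<^sub>o" by - (rule lt_irrefl[of _ k], simp add: nv_eq nv_lt)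
            qed
          qed
          with b1 forces_mono[OF le t] forces_mono[OF le s'] show "\<Delta>5 \<tturnstile> (\<exists>\<^sub>o a. \<exists>\<^sub>o k. s \<doteq> Init a k)"
            by (intro exI_o[of _ _ b] exI_o[of _ _ "Succ k"]) (simp add: nv_eq nv_simps)
        qed
      qed
    qed
  qed
qed

section \<open>Continuous functions\<close>

definition is_code :: "stm \<Rightarrow> tv" where
  "is_code \<phi> = (\<forall>\<^sub>o a. \<exists>\<^sub>o n. \<not>\<^sub>o (App \<phi> (Init a n) \<doteq> Zero))"
definition val_is :: "stm \<Rightarrow> stm \<Rightarrow> ntm \<Rightarrow> tv" where
  "val_is \<phi> a p = (\<exists>\<^sub>o n. App \<phi> (Init a n) \<doteq> Succ p \<and>\<^sub>o (\<forall>\<^sub>o k. lt k n \<longrightarrow>\<^sub>o App \<phi> (Init a k) \<doteq> Zero))"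
definition im_is :: "stm \<Rightarrow> stm \<Rightarrow> stm \<Rightarrow> tv" where
  "im_is \<phi> a c = (\<forall>\<^sub>o n. val_is (Sect \<phi> n) a (App c n))"

lemma dfm_val_is [def_intros]: "dst n s S \<Longrightarrow> dst n s T \<Longrightarrow> dnt n s U \<Longrightarrow> dfm n s (\<lambda>f g. val_is (S f g) (T f g) (U f g))"
  unfolding val_is_def by (intro def_intros dst_shiftN dnt_shiftN)
lemma dfm_im_is [def_intros]: "dst n s S \<Longrightarrow> dst n s T \<Longrightarrow> dst n s U \<Longrightarrow> dfm n s (\<lambda>f g. im_is (S f g) (T f g) (U f g))"
  unfolding im_is_def by (intro def_intros dst_shiftN dnt_shiftN)

lemma val_unique:
  assumes "\<Gamma> \<tturnstile> val_is \<phi> a p" "\<Gamma> \<tturnstile> val_is \<phi> a q" shows "\<Gamma> \<tturnstile> p \<doteq> q"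
  using assms(1) unfolding val_is_def
proof (rule exE_o)
  fix \<Delta> n assume \<Delta>: "\<Gamma> \<preceq> \<Delta>" and n: "\<Delta> \<tturnstile> App \<phi> (Init a n) \<doteq> Succ p \<and>\<^sub>o (\<forall>\<^sub>o k. lt k n \<longrightarrow>\<^sub>o App \<phi> (Init a k) \<doteq> Zero)"
  show "\<Delta> \<tturnstile> p \<doteq> q"
    using forces_mono[OF \<Delta> assms(2)] unfolding val_is_def
  proof (rule exE_o)
    fix \<Theta> m assume \<Theta>: "\<Delta> \<preceq> \<Theta>" and m: "\<Theta> \<tturnstile> App \<phi> (Init a m) \<doteq> Succ q \<and>\<^sub>o (\<forall>\<^sub>o k. lt k m \<longrightarrow>\<^sub>o App \<phi> (Init a k) \<doteq> Zero)"
    note n = forces_mono[OF \<Theta> n]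
    show "\<Theta> \<tturnstile> p \<doteq> q"
    proof (rule orE_o[OF lt_trichotomy[of _ n m]])
      fix \<Omega> assume "\<Theta> \<preceq> \<Omega>" and lt: "\<Omega> \<tturnstile> lt n m"
      note up = forces_mono[OF this(1)]
      have "\<Omega> \<tturnstile> App \<phi> (Init a n) \<doteq> Zero" by (rule all_impE[OF up[OF m[unfolded forces_and, THEN conjunct2]] lt])
      with up[OF n] show "\<Omega> \<tturnstile> p \<doteq> q" by - (rule Succ_neq_Zero[of _ p], simp add: nv_eq)
    next
      fix \<Omega> assume \<Omega>: "\<Theta> \<preceq> \<Omega>" and "\<Omega> \<tturnstile> n \<doteq> m \<or>\<^sub>o lt m n"
      from this(2) show "\<Omega> \<tturnstile> p \<doteq> q"
      proof (rule orE_o)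
        fix \<Phi> assume "\<Omega> \<preceq> \<Phi>" and "\<Phi> \<tturnstile> n \<doteq> m"
        note up = forces_mono[OF extends_trans[OF \<Omega> this(1)]]
        show "\<Phi> \<tturnstile> p \<doteq> q" using \<open>\<Phi> \<tturnstile> n \<doteq> m\<close> up[OF n] up[OF m] by - (rule Succ_inj, simp add: nv_eq nv_simps)
      next
        fix \<Phi> assume "\<Omega> \<preceq> \<Phi>" and lt: "\<Phi> \<tturnstile> lt m n"
        note up = forces_mono[OF extends_trans[OF \<Omega> this(1)]]
        have "\<Phi> \<tturnstile> App \<phi> (Init a m) \<doteq> Zero" by (rule all_impE[OF up[OF n[unfolded forces_and, THEN conjunct2]] lt])
        with up[OF m] show "\<Phi> \<tturnstile> p \<doteq> q" by - (rule Succ_neq_Zero[of _ q], simp add: nv_eq)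
      qed
    qed
  qed
qed

text \<open>The search for the least number yields only a double negation of vanishing at earlier
  stages; stability of equality removes it.\<close>

lemma first_nonzero:
  assumes "\<Gamma> \<tturnstile> is_code \<phi>"
  shows "\<Gamma> \<tturnstile> (\<exists>\<^sub>o n. \<not>\<^sub>o (App \<phi> (Init a n) \<doteq> Zero) \<and>\<^sub>o (\<forall>\<^sub>o k. lt k n \<longrightarrow>\<^sub>o App \<phi> (Init a k) \<doteq> Zero))"
proof -
  have "\<Gamma> \<tturnstile> (\<exists>\<^sub>o n. \<not>\<^sub>o (App \<phi> (Init a n) \<doteq> Zero) \<and>\<^sub>o (\<forall>\<^sub>o k. lt k n \<longrightarrow>\<^sub>o \<not>\<^sub>o \<not>\<^sub>o (App \<phi> (Init a k) \<doteq> Zero)))"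
    by (rule least_number, intro def_intros, rule dec_not[OF eq_dec]) (use assms in \<open>simp add: is_code_def\<close>)
  then show ?thesis
  proof (rule ex_mono_o)
    fix \<Delta> n assume *: "\<Delta> \<tturnstile> \<not>\<^sub>o (App \<phi> (Init a n) \<doteq> Zero) \<and>\<^sub>o (\<forall>\<^sub>o k. lt k n \<longrightarrow>\<^sub>o \<not>\<^sub>o \<not>\<^sub>o (App \<phi> (Init a k) \<doteq> Zero))"
    have "\<Delta> \<tturnstile> (\<forall>\<^sub>o k. lt k n \<longrightarrow>\<^sub>o App \<phi> (Init a k) \<doteq> Zero)"
      by (rule all_impI, rule eq_dne, rule all_impE[OF forces_mono[OF _ *[unfolded forces_and, THEN conjunct2]]])
    with * show "\<Delta> \<tturnstile> \<not>\<^sub>o (App \<phi> (Init a n) \<doteq> Zero) \<and>\<^sub>o (\<forall>\<^sub>o k. lt k n \<longrightarrow>\<^sub>o App \<phi> (Init a k) \<doteq> Zero)"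
      by (simp only: forces_and)
  qed
qed

lemma nonzero_Succ: "\<Gamma> \<tturnstile> \<not>\<^sub>o (t \<doteq> Zero) \<Longrightarrow> \<Gamma> \<tturnstile> t \<doteq> Succ (Pred t)"
  by (rule orE_o[OF Zero_or_Succ[of _ t]]) (erule notE_o[OF forces_mono])

lemma val_exists:
  assumes "\<Gamma> \<tturnstile> is_code \<phi>" shows "\<Gamma> \<tturnstile> (\<exists>\<^sub>o p. val_is \<phi> a p)"
proof (rule exE_o[OF first_nonzero[OF assms, of a]])
  fix \<Delta> n assume "\<Delta> \<tturnstile> \<not>\<^sub>o (App \<phi> (Init a n) \<doteq> Zero) \<and>\<^sub>o (\<forall>\<^sub>o k. lt k n \<longrightarrow>\<^sub>o App \<phi> (Init a k) \<doteq> Zero)"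
  then show "\<Delta> \<tturnstile> (\<exists>\<^sub>o p. val_is \<phi> a p)"
    unfolding val_is_def
    by (intro exI_o[of _ _ "Pred (App \<phi> (Init a n))"] exI_o[of _ _ n]) (simp add: nonzero_Succ del: forces_all)
qed

text \<open>The image is not a term of the language; it is obtained by unique choice, because the
  first answer of a code is unique.\<close>

lemma im_exists:
  assumes "\<Gamma> \<tturnstile> (\<forall>\<^sub>o n. is_code (Sect \<phi> n))" shows "\<Gamma> \<tturnstile> (\<exists>\<^sub>o c. im_is \<phi> a c)"
  unfolding im_is_def
proof (rule seq_exists, intro def_intros)
  fix n show "\<Gamma> \<tturnstile> (\<exists>\<^sub>o k. val_is (Sect \<phi> n) a k)" using assms by (intro val_exists) simp
qed (rule val_unique)

lemma im_unique: "\<Gamma> \<tturnstile> im_is \<phi> a c \<Longrightarrow> \<Gamma> \<tturnstile> im_is \<phi> a c' \<Longrightarrow> \<Gamma> \<tturnstile> App c n \<doteq> App c' n"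
  unfolding im_is_def by (rule val_unique[of _ "Sect \<phi> n" a]) simp_all

lemma lt_neq: "\<Gamma> \<tturnstile> lt t u \<Longrightarrow> \<Gamma> \<tturnstile> t \<doteq> u \<Longrightarrow> \<Gamma> \<tturnstile> G"
  by (rule lt_irrefl[of _ u]) (simp add: nv_eq nv_lt)

lemma lt_not_gt: "\<Gamma> \<tturnstile> lt t u \<Longrightarrow> \<Gamma> \<tturnstile> lt u t \<Longrightarrow> \<Gamma> \<tturnstile> G"
  by (rule lt_irrefl[OF lt_trans])

lemma trichotomyE:
  assumes "\<And>\<Delta>. \<Gamma> \<preceq> \<Delta> \<Longrightarrow> \<Delta> \<tturnstile> lt t u \<Longrightarrow> \<Delta> \<tturnstile> G" "\<And>\<Delta>. \<Gamma> \<preceq> \<Delta> \<Longrightarrow> \<Delta> \<tturnstile> t \<doteq> u \<Longrightarrow> \<Delta> \<tturnstile> G"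
    "\<And>\<Delta>. \<Gamma> \<preceq> \<Delta> \<Longrightarrow> \<Delta> \<tturnstile> lt u t \<Longrightarrow> \<Delta> \<tturnstile> G"
  shows "\<Gamma> \<tturnstile> G"
proof (rule orE_o[OF lt_trichotomy[of _ t u]])
  fix \<Delta> assume \<Delta>: "\<Gamma> \<preceq> \<Delta>" and "\<Delta> \<tturnstile> t \<doteq> u \<or>\<^sub>o lt u t"
  from this(2) show "\<Delta> \<tturnstile> G" by (rule orE_o) (use assms(2,3) extends_trans[OF \<Delta>] in blast)+
qed (rule assms(1))

section \<open>Closed sets\<close>

text \<open>The code \<open>\<phi>\<close> waits on input \<open>p\<close> until the initial segment reaches \<open>\<theta>(p)\<close>; it answers \<open>\<delta>(p)\<close> if
  \<open>\<theta>(p)\<close> is met exactly and \<open>0\<close> otherwise. As codes of initial segments grow strictly, no length function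
  is needed.\<close>

lemma threshold_code:
  "\<Gamma> \<tturnstile> (\<exists>\<^sub>o \<phi>. (\<forall>\<^sub>o n. is_code (Sect \<phi> n)) \<and>\<^sub>o
     (\<forall>\<^sub>o a. \<forall>\<^sub>o c. im_is \<phi> a c \<longrightarrow>\<^sub>o (\<forall>\<^sub>o p. (\<exists>\<^sub>o k. App \<theta> p \<doteq> Init a k \<and>\<^sub>o App c p \<doteq> App \<delta> p) \<or>\<^sub>o
        (\<not>\<^sub>o (\<exists>\<^sub>o k. App \<theta> p \<doteq> Init a k) \<and>\<^sub>o App c p \<doteq> Zero))))"
proof -
  \<comment> \<open>In a code the value 0 means that no answer has been given yet, and
    \<open>Succ y\<close> gives the answer \<open>y\<close>. So \<open>Succ Zero\<close> is the
    answer 0 and not a request for more input.\<close>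
  let ?P = "\<lambda>p s y. (lt s (App \<theta> p) \<longrightarrow>\<^sub>o y \<doteq> Zero) \<and>\<^sub>o (s \<doteq> App \<theta> p \<longrightarrow>\<^sub>o y \<doteq> Succ (App \<delta> p)) \<and>\<^sub>o
    (lt (App \<theta> p) s \<longrightarrow>\<^sub>o y \<doteq> Succ Zero)"
  have "\<Gamma> \<tturnstile> (\<exists>\<^sub>o \<phi>. \<forall>\<^sub>o p. \<forall>\<^sub>o s. ?P p s (App (Sect \<phi> p) s))"
  proof (rule seq2_exists, intro def_intros)
    fix \<Delta> p s
    show "\<Delta> \<tturnstile> (\<exists>\<^sub>o y. ?P p s y)"
    proof (rule trichotomyE[of _ s "App \<theta> p"])
      fix \<Theta> assume *: "\<Theta> \<tturnstile> lt s (App \<theta> p)"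
      show "\<Theta> \<tturnstile> (\<exists>\<^sub>o y. ?P p s y)"
        by (rule exI_o[of _ _ Zero], unfold forces_and, intro conjI impI_o)
          (use forces_mono[OF _ *] in \<open>blast intro: lt_neq lt_not_gt eq_refl_o\<close>)+
    next
      fix \<Theta> assume *: "\<Theta> \<tturnstile> s \<doteq> App \<theta> p"
      show "\<Theta> \<tturnstile> (\<exists>\<^sub>o y. ?P p s y)"
        by (rule exI_o[of _ _ "Succ (App \<delta> p)"], unfold forces_and, intro conjI impI_o)
          (use forces_mono[OF _ *] in \<open>blast intro: lt_neq lt_neq[OF _ eq_sym_o] eq_refl_o\<close>)+
    next
      fix \<Theta> assume *: "\<Theta> \<tturnstile> lt (App \<theta> p) s"
      show "\<Theta> \<tturnstile> (\<exists>\<^sub>o y. ?P p s y)"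
        by (rule exI_o[of _ _ "Succ Zero"], unfold forces_and, intro conjI impI_o)
          (use forces_mono[OF _ *] in \<open>blast intro: lt_neq[OF _ eq_sym_o] lt_not_gt eq_refl_o\<close>)+
    qed
  next
    fix \<Delta> p s y y' assume y: "\<Delta> \<tturnstile> ?P p s y" and y': "\<Delta> \<tturnstile> ?P p s y'"
    show "\<Delta> \<tturnstile> y' \<doteq> y"
      by (rule trichotomyE[of _ s "App \<theta> p"];
          frule forces_mono[OF _ y]; drule forces_mono[OF _ y']; auto dest!: mp_o simp: nv_eq)
  qed
  then show ?thesis
  proof (rule ex_mono_o)
    fix \<Delta> \<phi> assume \<phi>: "\<Delta> \<tturnstile> (\<forall>\<^sub>o p. \<forall>\<^sub>o s. ?P p s (App (Sect \<phi> p) s))"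
    have below: "\<Theta> \<tturnstile> App (Sect \<phi> p) s \<doteq> Zero" if "\<Delta> \<preceq> \<Theta>" "\<Theta> \<tturnstile> lt s (App \<theta> p)" for \<Theta> p s
      by (rule mp_o[OF _ that(2)]) (use forces_mono[OF that(1) \<phi>] in simp)
    have at: "\<Theta> \<tturnstile> App (Sect \<phi> p) s \<doteq> Succ (App \<delta> p)" if "\<Delta> \<preceq> \<Theta>" "\<Theta> \<tturnstile> s \<doteq> App \<theta> p" for \<Theta> p s
      by (rule mp_o[OF _ that(2)]) (use forces_mono[OF that(1) \<phi>] in simp)
    have above: "\<Theta> \<tturnstile> App (Sect \<phi> p) s \<doteq> Succ Zero" if "\<Delta> \<preceq> \<Theta>" "\<Theta> \<tturnstile> lt (App \<theta> p) s" for \<Theta> p s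
      by (rule mp_o[OF _ that(2)]) (use forces_mono[OF that(1) \<phi>] in simp)
    have nz: "\<Theta> \<tturnstile> \<not>\<^sub>o (t \<doteq> Zero)" if "\<Theta> \<tturnstile> t \<doteq> Succ u" for \<Theta> t u
    proof (rule notI_o)
      fix \<Omega> assume le: "\<Theta> \<preceq> \<Omega>" and "\<Omega> \<tturnstile> t \<doteq> Zero"
      with forces_mono[OF le that] show "\<Omega> \<tturnstile> \<bottom>\<^sub>o" by - (rule Succ_neq_Zero[of _ u], simp add: nv_eq)
    qed
    have "\<Delta> \<tturnstile> (\<forall>\<^sub>o n. is_code (Sect \<phi> n))"
      unfolding forces_all is_code_def
    proof (intro allI)
      fix p a
      show "\<Delta> \<tturnstile> (\<exists>\<^sub>o n. \<not>\<^sub>o (App (Sect \<phi> p) (Init a n) \<doteq> Zero))"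
      \<comment> \<open>By \<open>Init_ge\<close> the segment whose length is the threshold has at
        least the threshold as its code, so an answer has been given by then.\<close>
      proof (rule exI_o[of _ _ "App \<theta> p"], rule orE_o[OF lt_SuccE[OF Init_ge[of _ "App \<theta> p" a]]])
        fix \<Theta> assume "\<Delta> \<preceq> \<Theta>" "\<Theta> \<tturnstile> lt (App \<theta> p) (Init a (App \<theta> p))"
        from nz[OF above[OF this]] show "\<Theta> \<tturnstile> \<not>\<^sub>o (App (Sect \<phi> p) (Init a (App \<theta> p)) \<doteq> Zero)" .
      next
        fix \<Theta> assume "\<Delta> \<preceq> \<Theta>" "\<Theta> \<tturnstile> App \<theta> p \<doteq> Init a (App \<theta> p)"
        from nz[OF at[OF this(1) eq_sym_o[OF this(2)]]] show "\<Theta> \<tturnstile> \<not>\<^sub>o (App (Sect \<phi> p) (Init a (App \<theta> p)) \<doteq> Zero)" .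
      qed
    qed
    moreover have "\<Delta> \<tturnstile> (\<forall>\<^sub>o a. \<forall>\<^sub>o c. im_is \<phi> a c \<longrightarrow>\<^sub>o (\<forall>\<^sub>o p. (\<exists>\<^sub>o k. App \<theta> p \<doteq> Init a k \<and>\<^sub>o App c p \<doteq> App \<delta> p) \<or>\<^sub>o
        (\<not>\<^sub>o (\<exists>\<^sub>o k. App \<theta> p \<doteq> Init a k) \<and>\<^sub>o App c p \<doteq> Zero)))"
      unfolding forces_all[of _ "\<lambda>a. \<forall>\<^sub>o c. im_is \<phi> a c \<longrightarrow>\<^sub>o _ a c"]
    proof (intro allI all_impI, unfold forces_all, rule allI)
      fix a c p \<Theta> assume \<Theta>: "\<Delta> \<preceq> \<Theta>" and im: "\<Theta> \<tturnstile> im_is \<phi> a c"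
      let ?G = "(\<exists>\<^sub>o k. App \<theta> p \<doteq> Init a k \<and>\<^sub>o App c p \<doteq> App \<delta> p) \<or>\<^sub>o
        (\<not>\<^sub>o (\<exists>\<^sub>o k. App \<theta> p \<doteq> Init a k) \<and>\<^sub>o App c p \<doteq> Zero)"
      from im have "\<Theta> \<tturnstile> val_is (Sect \<phi> p) a (App c p)" by (simp add: im_is_def)
      then show "\<Theta> \<tturnstile> ?G"
        unfolding val_is_def
      proof (rule exE_o)
        fix \<Omega> n assume \<Omega>: "\<Theta> \<preceq> \<Omega>" and
          "\<Omega> \<tturnstile> App (Sect \<phi> p) (Init a n) \<doteq> Succ (App c p) \<and>\<^sub>o (\<forall>\<^sub>o k. lt k n \<longrightarrow>\<^sub>o App (Sect \<phi> p) (Init a k) \<doteq> Zero)"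
        then have v: "\<Omega> \<tturnstile> App (Sect \<phi> p) (Init a n) \<doteq> Succ (App c p)"
          and z: "\<Omega> \<tturnstile> (\<forall>\<^sub>o k. lt k n \<longrightarrow>\<^sub>o App (Sect \<phi> p) (Init a k) \<doteq> Zero)" by (simp_all only: forces_and)
        note \<Omega> = extends_trans[OF \<Theta> \<Omega>]
        show "\<Omega> \<tturnstile> ?G"
        proof (rule trichotomyE[of _ "Init a n" "App \<theta> p"])
          fix \<Phi> assume le: "\<Omega> \<preceq> \<Phi>" and "\<Phi> \<tturnstile> lt (Init a n) (App \<theta> p)"
          with below[OF extends_trans[OF \<Omega> le]] forces_mono[OF le v] show "\<Phi> \<tturnstile> ?G"
            by - (rule Succ_neq_Zero[of _ "App c p"], simp add: nv_eq del: nv_arith(7))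
        next
          fix \<Phi> assume le: "\<Omega> \<preceq> \<Phi>" and eq: "\<Phi> \<tturnstile> Init a n \<doteq> App \<theta> p"
          have "\<Phi> \<tturnstile> Succ (App c p) \<doteq> Succ (App \<delta> p)"
            using at[OF extends_trans[OF \<Omega> le] eq] forces_mono[OF le v] by (simp add: nv_eq)
          then have "\<Phi> \<tturnstile> App c p \<doteq> App \<delta> p" by (rule Succ_inj)
          then show "\<Phi> \<tturnstile> ?G" using eq by (intro orI1_o exI_o[of _ _ n]) (simp add: nv_eq)
        next
          fix \<Phi> assume le: "\<Omega> \<preceq> \<Phi>" and gt: "\<Phi> \<tturnstile> lt (App \<theta> p) (Init a n)"
          have "\<Phi> \<tturnstile> Succ (App c p) \<doteq> Succ Zero"
            using above[OF extends_trans[OF \<Omega> le] gt] forces_mono[OF le v] by (simp add: nv_eq)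
          then have "\<Phi> \<tturnstile> App c p \<doteq> Zero" by (rule Succ_inj)
          \<comment> \<open>The answer came at stage \<open>n\<close>, after the threshold was
            jumped over. A shorter segment that meets it would have answered earlier, the one of
            length \<open>n\<close> is too large, and longer ones are larger still.\<close>
          moreover have "\<Phi> \<tturnstile> \<not>\<^sub>o (\<exists>\<^sub>o k. App \<theta> p \<doteq> Init a k)"
          proof (rule notI_o, erule exE_o)
            fix \<Psi>' \<Psi> k assume le': "\<Phi> \<preceq> \<Psi>'" "\<Psi>' \<preceq> \<Psi>" and k: "\<Psi> \<tturnstile> App \<theta> p \<doteq> Init a k"
            note le' = extends_trans[OF le']
            note gt' = forces_mono[OF le' gt]
            show "\<Psi> \<tturnstile> \<bottom>\<^sub>o"
            proof (rule trichotomyE[of _ k n])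
              fix \<Xi> assume le'': "\<Psi> \<preceq> \<Xi>" and lt: "\<Xi> \<tturnstile> lt k n"
              note e = extends_trans[OF le extends_trans[OF le' le'']]
              have "\<Xi> \<tturnstile> App (Sect \<phi> p) (Init a k) \<doteq> Zero" by (rule all_impE[OF forces_mono[OF e z] lt])
              moreover have "\<Xi> \<tturnstile> App (Sect \<phi> p) (Init a k) \<doteq> Succ (App \<delta> p)"
                by (rule at[OF extends_trans[OF \<Omega> e] eq_sym_o[OF forces_mono[OF le'' k]]])
              ultimately show "\<Xi> \<tturnstile> \<bottom>\<^sub>o" by - (rule Succ_neq_Zero[of _ "App \<delta> p"], simp add: nv_eq)
            next
              fix \<Xi> assume le'': "\<Psi> \<preceq> \<Xi>" and "\<Xi> \<tturnstile> k \<doteq> n"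
              with forces_mono[OF le'' k] have "\<Xi> \<tturnstile> App \<theta> p \<doteq> Init a n" by (simp add: nv_eq nv_simps)
              then show "\<Xi> \<tturnstile> \<bottom>\<^sub>o" by (rule lt_neq[OF forces_mono[OF le'' gt']])
            next
              fix \<Xi> assume le'': "\<Psi> \<preceq> \<Xi>" and "\<Xi> \<tturnstile> lt n k"
              then have "\<Xi> \<tturnstile> lt (App \<theta> p) (Init a k)"
                by (intro lt_trans[OF forces_mono[OF le'' gt'] Init_mono])
              then show "\<Xi> \<tturnstile> \<bottom>\<^sub>o" by (rule lt_neq[OF _ forces_mono[OF le'' k]])
            qed
          qed
          ultimately show "\<Phi> \<tturnstile> ?G" by (intro orI2_o) simp
        qed
      qed
    qed
    ultimately show "\<Delta> \<tturnstile> (\<forall>\<^sub>o n. is_code (Sect \<phi> n)) \<and>\<^sub>o (\<forall>\<^sub>o a. \<forall>\<^sub>o c. im_is \<phi> a c \<longrightarrow>\<^sub>o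
        (\<forall>\<^sub>o p. (\<exists>\<^sub>o k. App \<theta> p \<doteq> Init a k \<and>\<^sub>o App c p \<doteq> App \<delta> p) \<or>\<^sub>o
        (\<not>\<^sub>o (\<exists>\<^sub>o k. App \<theta> p \<doteq> Init a k) \<and>\<^sub>o App c p \<doteq> Zero)))"
      unfolding forces_and by blast
  qed
qed

text \<open>The initial segment of length \<open>idx m n\<close> is responsible for stage \<open>m\<close> of the computation of \<open>\<Psi> n\<close>:
  it is rejected if \<open>\<Psi> n\<close> gives its answer at that stage and the answer is not \<open>0\<close>.\<close>

lemma closed_code:
  assumes \<Psi>: "dst (Suc 0) 0 (\<lambda>f g. \<Psi> (f 0))" and code: "\<And>n. \<Gamma> \<tturnstile> is_code (\<Psi> n)"
  shows "\<Gamma> \<tturnstile> (\<exists>\<^sub>o \<beta>. \<forall>\<^sub>o a. (\<forall>\<^sub>o n. val_is (\<Psi> n) a Zero) \<longleftrightarrow>\<^sub>o (\<forall>\<^sub>o k. App \<beta> (Init a k) \<doteq> Zero))"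
proof -
  let ?z = "\<lambda>n a j. App (\<Psi> n) (Init a j) \<doteq> Zero"
  \<comment> \<open>\<open>Pred\<close> sends both "no answer yet" and "the answer is 0" to 0. So
    \<open>y\<close> is non-zero exactly if stage \<open>m\<close> gives the first answer and this
    answer is not 0.\<close>
  let ?R = "\<lambda>a m n y. ((\<forall>\<^sub>o j. lt j m \<longrightarrow>\<^sub>o ?z n a j) \<longrightarrow>\<^sub>o y \<doteq> Pred (App (\<Psi> n) (Init a m))) \<and>\<^sub>o
      (\<not>\<^sub>o (\<forall>\<^sub>o j. lt j m \<longrightarrow>\<^sub>o ?z n a j) \<longrightarrow>\<^sub>o y \<doteq> Zero)"
  let ?P = "\<lambda>s y. \<exists>\<^sub>o a. \<exists>\<^sub>o m. \<exists>\<^sub>o n. s \<doteq> Init a (idx m n) \<and>\<^sub>o ?R a m n y"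
  note d = def_intros dst_comp[OF \<Psi>]
  have dec: "\<Delta> \<tturnstile> (\<forall>\<^sub>o j. lt j m \<longrightarrow>\<^sub>o ?z n a j) \<or>\<^sub>o \<not>\<^sub>o (\<forall>\<^sub>o j. lt j m \<longrightarrow>\<^sub>o ?z n a j)" for \<Delta> a m n
    by (rule dec_bounded, intro def_intros, rule eq_dec)
  have R_ex: "\<Delta> \<tturnstile> (\<exists>\<^sub>o y. ?R a m n y)" for \<Delta> a m n
  proof (rule orE_o[OF dec[of _ m n a]])
    fix \<Theta> assume *: "\<Theta> \<tturnstile> (\<forall>\<^sub>o j. lt j m \<longrightarrow>\<^sub>o ?z n a j)"
    show "\<Theta> \<tturnstile> (\<exists>\<^sub>o y. ?R a m n y)"
      by (rule exI_o[of _ _ "Pred (App (\<Psi> n) (Init a m))"], unfold forces_and, intro conjI impI_o, simp,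
          erule notE_o[OF _ forces_mono[OF _ *]])
  next
    fix \<Theta> assume *: "\<Theta> \<tturnstile> \<not>\<^sub>o (\<forall>\<^sub>o j. lt j m \<longrightarrow>\<^sub>o ?z n a j)"
    show "\<Theta> \<tturnstile> (\<exists>\<^sub>o y. ?R a m n y)"
      by (rule exI_o[of _ _ "Zero"], unfold forces_and, intro conjI impI_o, erule notE_o[OF forces_mono[OF _ *]], simp_all)
  qed
  have R_uniq: "\<Delta> \<tturnstile> y' \<doteq> y" if "\<Delta> \<tturnstile> ?R a m n y" "\<Delta> \<tturnstile> ?R a m n y'" for \<Delta> a m n y y'
  proof (rule orE_o[OF dec[of _ m n a]])
    fix \<Theta> assume le: "\<Delta> \<preceq> \<Theta>" and "\<Theta> \<tturnstile> (\<forall>\<^sub>o j. lt j m \<longrightarrow>\<^sub>o ?z n a j)"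
    with that[THEN forces_mono[OF le]] show "\<Theta> \<tturnstile> y' \<doteq> y" unfolding forces_and nv_eq by (metis mp_o nv_eq)
  next
    fix \<Theta> assume le: "\<Delta> \<preceq> \<Theta>" and "\<Theta> \<tturnstile> \<not>\<^sub>o (\<forall>\<^sub>o j. lt j m \<longrightarrow>\<^sub>o ?z n a j)"
    with that[THEN forces_mono[OF le]] show "\<Theta> \<tturnstile> y' \<doteq> y" unfolding forces_and nv_eq by (metis mp_o nv_eq)
  qed
  \<comment> \<open>The relation reads only segments of length at most \<open>m\<close>, so
    \<open>a\<close> may be replaced by any sequence that shares them.\<close>
  have R_transfer: "\<Delta> \<tturnstile> ?R b m n y"
    if R: "\<Delta> \<tturnstile> ?R a m n y" and eq: "\<Delta> \<tturnstile> (\<forall>\<^sub>o j. lt j (Succ m) \<longrightarrow>\<^sub>o Init a j \<doteq> Init b j)" for \<Delta> a b m n y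
  proof -
    have allz: "\<Theta> \<tturnstile> (\<forall>\<^sub>o j. lt j m \<longrightarrow>\<^sub>o ?z n b j) \<longleftrightarrow> \<Theta> \<tturnstile> (\<forall>\<^sub>o j. lt j m \<longrightarrow>\<^sub>o ?z n a j)" if le: "\<Delta> \<preceq> \<Theta>" for \<Theta>
    proof -
      have "\<Phi> \<tturnstile> ?z n a j \<longleftrightarrow> \<Phi> \<tturnstile> ?z n b j" if "\<Theta> \<preceq> \<Phi>" "\<Phi> \<tturnstile> lt j m" for \<Phi> j
        using all_impE[OF forces_mono[OF extends_trans[OF le that(1)] eq] lt_Succ[OF that(2)]]
        by (simp add: nv_eq nv_simps(3))
      then show ?thesis by (simp add: forces_imp)
    qed
    have allz': "\<Theta> \<tturnstile> \<not>\<^sub>o (\<forall>\<^sub>o j. lt j m \<longrightarrow>\<^sub>o ?z n b j) \<longleftrightarrow> \<Theta> \<tturnstile> \<not>\<^sub>o (\<forall>\<^sub>o j. lt j m \<longrightarrow>\<^sub>o ?z n a j)" if le: "\<Delta> \<preceq> \<Theta>" for \<Theta>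
      unfolding not_o_def forces_imp[of _ "\<forall>\<^sub>o j. _ j"] using allz extends_trans[OF le] by blast
    show "\<Delta> \<tturnstile> ?R b m n y"
      unfolding forces_and
    proof (intro conjI impI_o)
      fix \<Theta> assume le: "\<Delta> \<preceq> \<Theta>" and "\<Theta> \<tturnstile> (\<forall>\<^sub>o j. lt j m \<longrightarrow>\<^sub>o ?z n b j)"
      then have "\<Theta> \<tturnstile> y \<doteq> Pred (App (\<Psi> n) (Init a m))"
        using forces_mono[OF le R] unfolding allz[OF le] by (auto simp only: forces_and intro: mp_o)
      moreover have "\<Theta> \<tturnstile> Init a m \<doteq> Init b m" by (rule all_impE[OF forces_mono[OF le eq] lt_Succ_self])
      ultimately show "\<Theta> \<tturnstile> y \<doteq> Pred (App (\<Psi> n) (Init b m))" by (simp add: nv_eq nv_simps(2,3))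
    next
      fix \<Theta> assume le: "\<Delta> \<preceq> \<Theta>" and "\<Theta> \<tturnstile> \<not>\<^sub>o (\<forall>\<^sub>o j. lt j m \<longrightarrow>\<^sub>o ?z n b j)"
      then show "\<Theta> \<tturnstile> y \<doteq> Zero"
        using forces_mono[OF le R] unfolding allz'[OF le] by (auto simp only: forces_and intro: mp_o)
    qed
  qed
  \<comment> \<open>Well-definedness of the code: another representation of \<open>s\<close> has the
    same \<open>m\<close> and \<open>n\<close>, and it shares the segments up to \<open>m\<close>
    because \<open>m\<close> is at most \<open>idx m n\<close>.\<close>
  have PR: "\<Delta> \<tturnstile> ?R a m n y" if "\<Delta> \<tturnstile> ?P s y" "\<Delta> \<tturnstile> s \<doteq> Init a (idx m n)" for \<Delta> s y a m n
    using that(1)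
  proof (rule exE_o, elim exE_o)
    fix a' m' n' \<Delta>1 \<Delta>2 \<Delta>3
    assume le: "\<Delta> \<preceq> \<Delta>1" "\<Delta>1 \<preceq> \<Delta>2" "\<Delta>2 \<preceq> \<Delta>3" and "\<Delta>3 \<tturnstile> s \<doteq> Init a' (idx m' n') \<and>\<^sub>o ?R a' m' n' y"
    then have s: "\<Delta>3 \<tturnstile> s \<doteq> Init a' (idx m' n')" and R: "\<Delta>3 \<tturnstile> ?R a' m' n' y" by (simp_all only: forces_and)
    have "\<Delta>3 \<tturnstile> Init a' (idx m' n') \<doteq> Init a (idx m n)"
      using s forces_mono[OF extends_trans[OF extends_trans[OF le(1,2)] le(3)] that(2)] by (simp add: nv_eq)
    note i = Init_inj[OF this] and j = idx_inj[OF Init_inj(1)[OF this]]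
    have "\<Delta>3 \<tturnstile> ?R a' m' n y" by (rule subst_o[where P = "\<lambda>z. ?R a' m' z y", OF _ j(2) R]) (intro d)
    then have R: "\<Delta>3 \<tturnstile> ?R a' m n y" by (rule subst_o[where P = "\<lambda>z. ?R a' z n y", OF _ j(1), rotated]) (intro d)
    have "\<Delta>3 \<tturnstile> (\<forall>\<^sub>o j. lt j (Succ m) \<longrightarrow>\<^sub>o Init a' j \<doteq> Init a j)"
    proof (rule all_impI, rule all_impE[OF forces_mono[OF _ i(2)]])
      fix \<Theta> q assume le: "\<Delta>3 \<preceq> \<Theta>" and "\<Theta> \<tturnstile> lt q (Succ m)"
      then have "\<Theta> \<tturnstile> lt q (Succ m')" using forces_mono[OF le j(1)] by (simp add: nv_eq nv_lt nv_simps)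
      moreover have "\<Theta> \<tturnstile> lt m' (Succ (idx m' n'))" by (rule lt_idx)
      ultimately show "\<Theta> \<tturnstile> lt q (Succ (idx m' n'))" by (rule lt_trans_Succ')
    qed
    with R show "\<Delta>3 \<tturnstile> ?R a m n y" by (rule R_transfer)
  qed
  have "\<Gamma> \<tturnstile> (\<exists>\<^sub>o \<beta>. \<forall>\<^sub>o s. ?P s (App \<beta> s))"
  proof (rule seq_exists, intro d)
    fix s show "\<Gamma> \<tturnstile> (\<exists>\<^sub>o y. ?P s y)"
    proof (rule exE_o[OF Init_surj[of _ s]], elim exE_o)
      fix a k \<Delta>1 \<Delta>2 assume s: "\<Delta>2 \<tturnstile> s \<doteq> Init a k"
      show "\<Delta>2 \<tturnstile> (\<exists>\<^sub>o y. ?P s y)"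
      proof (rule exE_o[OF idx_surj[of _ k]], elim exE_o)
        fix m n \<Delta>3 \<Delta>4 assume le: "\<Delta>2 \<preceq> \<Delta>3" "\<Delta>3 \<preceq> \<Delta>4" and "\<Delta>4 \<tturnstile> k \<doteq> idx m n"
        with forces_mono[OF extends_trans[OF le] s] have s: "\<Delta>4 \<tturnstile> s \<doteq> Init a (idx m n)"
          by (simp add: nv_eq nv_simps)
        show "\<Delta>4 \<tturnstile> (\<exists>\<^sub>o y. ?P s y)"
          by (rule ex_mono_o[OF R_ex[of _ m n a]], rule exI_o[of _ _ a], rule exI_o[of _ _ m], rule exI_o[of _ _ n])
             (simp only: forces_and forces_mono[OF _ s])
      qed
    qed
  next
    fix \<Delta> s y y' assume y: "\<Delta> \<tturnstile> ?P s y" and y': "\<Delta> \<tturnstile> ?P s y'"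
    from y show "\<Delta> \<tturnstile> y' \<doteq> y"
    proof (rule exE_o, elim exE_o)
      fix a m n \<Delta>1 \<Delta>2 \<Delta>3
      assume le: "\<Delta> \<preceq> \<Delta>1" "\<Delta>1 \<preceq> \<Delta>2" "\<Delta>2 \<preceq> \<Delta>3" and "\<Delta>3 \<tturnstile> s \<doteq> Init a (idx m n) \<and>\<^sub>o ?R a m n y"
      then have s: "\<Delta>3 \<tturnstile> s \<doteq> Init a (idx m n)" and R: "\<Delta>3 \<tturnstile> ?R a m n y" by (simp_all only: forces_and)
      from R PR[OF forces_mono[OF extends_trans[OF extends_trans[OF le(1,2)] le(3)] y'] s]
      show "\<Delta>3 \<tturnstile> y' \<doteq> y" by (rule R_uniq)
    qed
  qed
  then show ?thesis
  proof (rule ex_mono_o)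
    fix \<Delta> \<beta> assume \<Delta>: "\<Gamma> \<preceq> \<Delta>" and \<beta>: "\<Delta> \<tturnstile> (\<forall>\<^sub>o s. ?P s (App \<beta> s))"
    have R: "\<Delta> \<tturnstile> ?R a m n (App \<beta> (Init a (idx m n)))" for a m n
      by (rule PR[OF spec_o[OF \<beta>] eq_refl_o])
    have case1: "\<Theta> \<tturnstile> App \<beta> (Init a (idx m n)) \<doteq> Pred (App (\<Psi> n) (Init a m))"
      if "\<Delta> \<preceq> \<Theta>" "\<Theta> \<tturnstile> (\<forall>\<^sub>o j. lt j m \<longrightarrow>\<^sub>o ?z n a j)" for \<Theta> a m n
      by (rule mp_o[OF _ that(2)]) (use forces_mono[OF that(1) R[of m n a]] in \<open>simp only: forces_and\<close>)
    have case2: "\<Theta> \<tturnstile> App \<beta> (Init a (idx m n)) \<doteq> Zero"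
      if "\<Delta> \<preceq> \<Theta>" "\<Theta> \<tturnstile> \<not>\<^sub>o (\<forall>\<^sub>o j. lt j m \<longrightarrow>\<^sub>o ?z n a j)" for \<Theta> a m n
      by (rule mp_o[OF _ that(2)]) (use forces_mono[OF that(1) R[of m n a]] in \<open>simp only: forces_and\<close>)
    show "\<Delta> \<tturnstile> (\<forall>\<^sub>o a. (\<forall>\<^sub>o n. val_is (\<Psi> n) a Zero) \<longleftrightarrow>\<^sub>o (\<forall>\<^sub>o k. App \<beta> (Init a k) \<doteq> Zero))"
      unfolding forces_all[of _ "\<lambda>a. _ a \<longleftrightarrow>\<^sub>o _ a"]
    proof (intro allI iffI_o, unfold forces_all, rule_tac [!] allI)
      fix a k \<Theta> assume \<Theta>: "\<Delta> \<preceq> \<Theta>" and val: "\<forall>n. \<Theta> \<tturnstile> val_is (\<Psi> n) a Zero"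
      show "\<Theta> \<tturnstile> App \<beta> (Init a k) \<doteq> Zero"
      proof (rule exE_o[OF idx_surj[of _ k]], elim exE_o)
        fix m n \<Theta>1 \<Theta>2 assume le: "\<Theta> \<preceq> \<Theta>1" "\<Theta>1 \<preceq> \<Theta>2" and k: "\<Theta>2 \<tturnstile> k \<doteq> idx m n"
        note le = extends_trans[OF le]
        have "\<Theta>2 \<tturnstile> App \<beta> (Init a (idx m n)) \<doteq> Zero"
        proof (rule orE_o[OF dec[of _ m n a]])
          fix \<Phi> assume \<Phi>: "\<Theta>2 \<preceq> \<Phi>" and z: "\<Phi> \<tturnstile> (\<forall>\<^sub>o j. lt j m \<longrightarrow>\<^sub>o ?z n a j)"
          note c = case1[OF extends_trans[OF \<Theta> extends_trans[OF le \<Phi>]] z]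
          have "\<Phi> \<tturnstile> Pred (App (\<Psi> n) (Init a m)) \<doteq> Zero"
            using forces_mono[OF extends_trans[OF le \<Phi>] val[rule_format, of n]] unfolding val_is_def
          proof (rule exE_o)
            fix \<Phi>' N assume \<Phi>': "\<Phi> \<preceq> \<Phi>'" and "\<Phi>' \<tturnstile> App (\<Psi> n) (Init a N) \<doteq> Succ Zero \<and>\<^sub>o (\<forall>\<^sub>o k. lt k N \<longrightarrow>\<^sub>o ?z n a k)"
            then have N: "\<Phi>' \<tturnstile> App (\<Psi> n) (Init a N) \<doteq> Succ Zero" and zN: "\<Phi>' \<tturnstile> (\<forall>\<^sub>o k. lt k N \<longrightarrow>\<^sub>o ?z n a k)"
              by (simp_all only: forces_and)
            show "\<Phi>' \<tturnstile> Pred (App (\<Psi> n) (Init a m)) \<doteq> Zero"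
            \<comment> \<open>\<open>N\<close> is the stage of the answer 0. Before it the code is
              silent, at it the predecessor is 0, and stage \<open>m\<close> cannot be later because
              all stages before \<open>m\<close> are silent.\<close>
            proof (rule trichotomyE[of _ m N])
              fix \<Xi> assume "\<Phi>' \<preceq> \<Xi>" "\<Xi> \<tturnstile> lt m N"
              then have "\<Xi> \<tturnstile> ?z n a m" by (rule all_impE[OF forces_mono[OF _ zN]])
              then show "\<Xi> \<tturnstile> Pred (App (\<Psi> n) (Init a m)) \<doteq> Zero" by (simp add: nv_eq nv_simps)
            next
              fix \<Xi> assume "\<Phi>' \<preceq> \<Xi>" "\<Xi> \<tturnstile> m \<doteq> N"
              with forces_mono[OF this(1) N] show "\<Xi> \<tturnstile> Pred (App (\<Psi> n) (Init a m)) \<doteq> Zero" by (simp add: nv_eq nv_simps)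
            next
              fix \<Xi> assume le: "\<Phi>' \<preceq> \<Xi>" and "\<Xi> \<tturnstile> lt N m"
              then have "\<Xi> \<tturnstile> ?z n a N" by (intro all_impE[OF forces_mono[OF extends_trans[OF \<Phi>' le] z]])
              with forces_mono[OF le N] show "\<Xi> \<tturnstile> Pred (App (\<Psi> n) (Init a m)) \<doteq> Zero"
                by - (rule Succ_neq_Zero[of _ Zero], simp add: nv_eq)
            qed
          qed
          with c show "\<Phi> \<tturnstile> App \<beta> (Init a (idx m n)) \<doteq> Zero" by (rule eq_trans_o)
        next
          fix \<Phi> assume "\<Theta>2 \<preceq> \<Phi>" "\<Phi> \<tturnstile> \<not>\<^sub>o (\<forall>\<^sub>o j. lt j m \<longrightarrow>\<^sub>o ?z n a j)"
          then show "\<Phi> \<tturnstile> App \<beta> (Init a (idx m n)) \<doteq> Zero"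
            by (intro case2 extends_trans[OF extends_trans[OF \<Theta> le]])
        qed
        with k show "\<Theta>2 \<tturnstile> App \<beta> (Init a k) \<doteq> Zero" by (simp add: nv_eq nv_simps)
      qed
    next
      fix a n \<Theta> assume \<Theta>: "\<Delta> \<preceq> \<Theta>" and all: "\<forall>k. \<Theta> \<tturnstile> App \<beta> (Init a k) \<doteq> Zero"
      show "\<Theta> \<tturnstile> val_is (\<Psi> n) a Zero"
        unfolding val_is_def
      \<comment> \<open>For the first stage \<open>N\<close> with an answer, the segment of length
        \<open>idx N n\<close> checks precisely this answer; since it is accepted, the answer is
        0.\<close>
      proof (rule ex_mono_o[OF first_nonzero[OF forces_mono[OF extends_trans[OF \<Delta> \<Theta>] code[of n]], of a]])
        fix \<Phi> N assume \<Phi>: "\<Theta> \<preceq> \<Phi>" and "\<Phi> \<tturnstile> \<not>\<^sub>o ?z n a N \<and>\<^sub>o (\<forall>\<^sub>o k. lt k N \<longrightarrow>\<^sub>o ?z n a k)"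
        then have N: "\<Phi> \<tturnstile> \<not>\<^sub>o ?z n a N" and z: "\<Phi> \<tturnstile> (\<forall>\<^sub>o k. lt k N \<longrightarrow>\<^sub>o ?z n a k)" by (simp_all only: forces_and)
        have "\<Phi> \<tturnstile> Pred (App (\<Psi> n) (Init a N)) \<doteq> Zero"
          using case1[OF extends_trans[OF \<Theta> \<Phi>] z] forces_mono[OF \<Phi> all[rule_format, of "idx N n"]] by (simp add: nv_eq)
        with nonzero_Succ[OF N] have "\<Phi> \<tturnstile> App (\<Psi> n) (Init a N) \<doteq> Succ Zero" by (metis nv_eq nv_simps(1))
        with z show "\<Phi> \<tturnstile> App (\<Psi> n) (Init a N) \<doteq> Succ Zero \<and>\<^sub>o (\<forall>\<^sub>o k. lt k N \<longrightarrow>\<^sub>o ?z n a k)" by (simp only: forces_and)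
      qed
    qed
  qed
qed

lemma forces_iff: "\<Gamma> \<tturnstile> P \<longleftrightarrow>\<^sub>o Q \<longleftrightarrow> (\<forall>\<Delta>. \<Gamma> \<preceq> \<Delta> \<longrightarrow> (\<Delta> \<tturnstile> P \<longleftrightarrow> \<Delta> \<tturnstile> Q))"
  by (auto simp: iff_o_def forces_imp)

lemma bex_cong_o:
  "(\<And>\<Delta> i. \<Gamma> \<preceq> \<Delta> \<Longrightarrow> \<Delta> \<tturnstile> lt i n \<Longrightarrow> \<Delta> \<tturnstile> P i \<longleftrightarrow> \<Delta> \<tturnstile> Q i) \<Longrightarrow>
   \<Gamma> \<tturnstile> (\<exists>\<^sub>o i. lt i n \<and>\<^sub>o P i) \<longleftrightarrow> \<Gamma> \<tturnstile> (\<exists>\<^sub>o i. lt i n \<and>\<^sub>o Q i)"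
  by (rule iffI; rule ex_mono_o, assumption) auto

section \<open>Closed sets and reductions on the level of truth values\<close>

definition codes :: "stm \<Rightarrow> tv" where "codes \<phi> = (\<forall>\<^sub>o n. is_code (Sect \<phi> n))"
definition zeros :: "stm \<Rightarrow> tv" where "zeros a = (\<forall>\<^sub>o n. App a n \<doteq> Zero)"
definition zero_row :: "ntm \<Rightarrow> stm \<Rightarrow> tv" where "zero_row n a = (\<exists>\<^sub>o i. lt i n \<and>\<^sub>o zeros (Sect a i))"
text \<open>The argument is a HOL function into truth values, so that a set variable and a member of
  a family given by a relation variable are treated alike; the same goes for
  \<open>red\<close>.\<close>

definition closed :: "(stm \<Rightarrow> tv) \<Rightarrow> tv" where
  "closed X = (\<exists>\<^sub>o \<beta>. \<forall>\<^sub>o a. X a \<longleftrightarrow>\<^sub>o (\<forall>\<^sub>o k. App \<beta> (Init a k) \<doteq> Zero))"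
definition red :: "(stm \<Rightarrow> tv) \<Rightarrow> (stm \<Rightarrow> tv) \<Rightarrow> tv" where
  "red X Y = (\<exists>\<^sub>o \<phi>. codes \<phi> \<and>\<^sub>o (\<forall>\<^sub>o a. X a \<longleftrightarrow>\<^sub>o (\<exists>\<^sub>o c. im_is \<phi> a c \<and>\<^sub>o Y c)))"

lemma dfm_zeros [def_intros]: "dst n s S \<Longrightarrow> dfm n s (\<lambda>f g. zeros (S f g))"
  unfolding zeros_def by (intro def_intros dst_shiftN)
lemma dfm_zero_row [def_intros]: "dnt n s T \<Longrightarrow> dst n s S \<Longrightarrow> dfm n s (\<lambda>f g. zero_row (T f g) (S f g))"
  unfolding zero_row_def by (intro def_intros dst_shiftN dnt_shiftN)

text \<open>The image exists and is unique up to pointwise equality, so "some image lies in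
  \<open>Y\<close>" and "every image lies in \<open>Y\<close>" agree. Definability of
  \<open>Y\<close> enters because \<open>Y\<close> must not distinguish pointwise equal
  sequences.\<close>

lemma red_iff:
  assumes Y: "defS Y"
  shows "\<Gamma> \<tturnstile> red X Y \<longleftrightarrow> \<Gamma> \<tturnstile> (\<exists>\<^sub>o \<phi>. codes \<phi> \<and>\<^sub>o (\<forall>\<^sub>o a. \<forall>\<^sub>o c. im_is \<phi> a c \<longrightarrow>\<^sub>o X a \<longleftrightarrow>\<^sub>o Y c))"
  unfolding red_def
proof (intro iffI; erule ex_mono_o; unfold forces_and; intro conjI; (elim conjE, assumption)?; elim conjE)
  fix \<Delta> \<phi> assume *: "\<Delta> \<tturnstile> (\<forall>\<^sub>o a. X a \<longleftrightarrow>\<^sub>o (\<exists>\<^sub>o c. im_is \<phi> a c \<and>\<^sub>o Y c))"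
  have "\<Theta> \<tturnstile> X a \<longleftrightarrow> \<Theta> \<tturnstile> Y c" if "\<Delta> \<preceq> \<Theta>" "\<Theta> \<tturnstile> im_is \<phi> a c" for \<Theta> a c
  proof
    assume "\<Theta> \<tturnstile> X a"
    then have "\<Theta> \<tturnstile> (\<exists>\<^sub>o c. im_is \<phi> a c \<and>\<^sub>o Y c)" using * that(1) by (simp add: forces_iff)
    then show "\<Theta> \<tturnstile> Y c"
    proof (rule exE_o)
      fix \<Omega> c' assume le: "\<Theta> \<preceq> \<Omega>" and c': "\<Omega> \<tturnstile> im_is \<phi> a c' \<and>\<^sub>o Y c'"
      show "\<Omega> \<tturnstile> Y c"
        by (rule substS_o[OF Y, of _ c']) (use im_unique forces_mono[OF le that(2)] c' in auto)
    qed
  next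
    assume "\<Theta> \<tturnstile> Y c"
    with that(2) have "\<Theta> \<tturnstile> (\<exists>\<^sub>o c. im_is \<phi> a c \<and>\<^sub>o Y c)" by (intro exI_o[of _ _ c]) simp
    then show "\<Theta> \<tturnstile> X a" using * that(1) by (simp add: forces_iff)
  qed
  then show "\<Delta> \<tturnstile> (\<forall>\<^sub>o a. \<forall>\<^sub>o c. im_is \<phi> a c \<longrightarrow>\<^sub>o X a \<longleftrightarrow>\<^sub>o Y c)"
    unfolding forces_all forces_imp forces_iff by (meson extends_trans forces_mono)
next
  fix \<Delta> \<phi> assume c: "\<Delta> \<tturnstile> codes \<phi>" and *: "\<Delta> \<tturnstile> (\<forall>\<^sub>o a. \<forall>\<^sub>o c. im_is \<phi> a c \<longrightarrow>\<^sub>o X a \<longleftrightarrow>\<^sub>o Y c)"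
  have XY: "\<Theta> \<tturnstile> X a \<longleftrightarrow> \<Theta> \<tturnstile> Y c" if "\<Delta> \<preceq> \<Theta>" "\<Theta> \<tturnstile> im_is \<phi> a c" for \<Theta> a c
    using * that by (auto simp: forces_imp forces_iff)
  have "\<Theta> \<tturnstile> X a \<longleftrightarrow> \<Theta> \<tturnstile> (\<exists>\<^sub>o c. im_is \<phi> a c \<and>\<^sub>o Y c)" if le: "\<Delta> \<preceq> \<Theta>" for \<Theta> a
  proof
    assume X: "\<Theta> \<tturnstile> X a"
    show "\<Theta> \<tturnstile> (\<exists>\<^sub>o c. im_is \<phi> a c \<and>\<^sub>o Y c)"
      by (rule ex_mono_o[OF im_exists[OF forces_mono[OF le c[unfolded codes_def]], of a]])
         (use XY[OF extends_trans[OF le]] forces_mono[OF _ X] in auto)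
  next
    assume "\<Theta> \<tturnstile> (\<exists>\<^sub>o c. im_is \<phi> a c \<and>\<^sub>o Y c)"
    then show "\<Theta> \<tturnstile> X a"
      by (rule exE_o) (use XY[OF extends_trans[OF le]] in auto)
  qed
  then show "\<Delta> \<tturnstile> (\<forall>\<^sub>o a. X a \<longleftrightarrow>\<^sub>o (\<exists>\<^sub>o c. im_is \<phi> a c \<and>\<^sub>o Y c))" by (simp add: forces_iff)
qed

lemma im_zero:
  assumes "\<Gamma> \<tturnstile> im_is \<phi> a c" shows "\<Gamma> \<tturnstile> App c p \<doteq> Zero \<longleftrightarrow> \<Gamma> \<tturnstile> val_is (Sect \<phi> p) a Zero"
proof -
  have v: "\<Gamma> \<tturnstile> val_is (Sect \<phi> p) a (App c p)" using assms by (simp add: im_is_def)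
  show ?thesis
  proof
    assume "\<Gamma> \<tturnstile> App c p \<doteq> Zero"
    then show "\<Gamma> \<tturnstile> val_is (Sect \<phi> p) a Zero"
      by (rule subst_o[where P = "\<lambda>z. val_is (Sect \<phi> p) a z", OF _ _ v, rotated]) (intro def_intros)
  qed (rule val_unique[OF v])
qed

text \<open>Common core of both constructions of reductions. \<open>Q m\<close> is the position that
  watches the code \<open>m\<close>: it is \<open>m\<close> itself for one closed set, and
  \<open>idx m i\<close> for the member \<open>i\<close> of a family. A position that watches a code
  which is no segment of \<open>a\<close> shows 0 in any case.\<close>

lemma threshold_zero:
  assumes Q: "dnt (Suc 0) 0 (\<lambda>f g. Q (f 0))" and \<theta>: "\<And>m. \<Gamma> \<tturnstile> App \<theta> (Q m) \<doteq> m"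
    and c: "\<Gamma> \<tturnstile> (\<forall>\<^sub>o p. (\<exists>\<^sub>o k. App \<theta> p \<doteq> Init a k \<and>\<^sub>o App c p \<doteq> App \<beta> p) \<or>\<^sub>o
        (\<not>\<^sub>o (\<exists>\<^sub>o k. App \<theta> p \<doteq> Init a k) \<and>\<^sub>o App c p \<doteq> Zero))"
  shows "\<Gamma> \<tturnstile> (\<forall>\<^sub>o m. App c (Q m) \<doteq> Zero) \<longleftrightarrow> \<Gamma> \<tturnstile> (\<forall>\<^sub>o k. App \<beta> (Q (Init a k)) \<doteq> Zero)"
proof (rule iffI; unfold forces_all; rule allI)
  fix k assume z: "\<forall>m. \<Gamma> \<tturnstile> App c (Q m) \<doteq> Zero"
  show "\<Gamma> \<tturnstile> App \<beta> (Q (Init a k)) \<doteq> Zero"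
  proof (rule orE_o[OF spec_o[OF c, of "Q (Init a k)"]])
    fix \<Delta> assume le: "\<Gamma> \<preceq> \<Delta>" and "\<Delta> \<tturnstile> (\<exists>\<^sub>o k'. App \<theta> (Q (Init a k)) \<doteq> Init a k' \<and>\<^sub>o App c (Q (Init a k)) \<doteq> App \<beta> (Q (Init a k)))"
    from this(2) show "\<Delta> \<tturnstile> App \<beta> (Q (Init a k)) \<doteq> Zero"
    proof (rule exE_o)
      fix \<Theta> k' assume le': "\<Delta> \<preceq> \<Theta>" and "\<Theta> \<tturnstile> App \<theta> (Q (Init a k)) \<doteq> Init a k' \<and>\<^sub>o App c (Q (Init a k)) \<doteq> App \<beta> (Q (Init a k))"
      with forces_mono[OF extends_trans[OF le le'] z[rule_format, of "Init a k"]]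
      show "\<Theta> \<tturnstile> App \<beta> (Q (Init a k)) \<doteq> Zero" by (simp add: nv_eq)
    qed
  next
    fix \<Delta> assume le: "\<Gamma> \<preceq> \<Delta>" and "\<Delta> \<tturnstile> \<not>\<^sub>o (\<exists>\<^sub>o k'. App \<theta> (Q (Init a k)) \<doteq> Init a k') \<and>\<^sub>o App c (Q (Init a k)) \<doteq> Zero"
    then have "\<Delta> \<tturnstile> \<not>\<^sub>o (\<exists>\<^sub>o k'. App \<theta> (Q (Init a k)) \<doteq> Init a k')" by simp
    then show "\<Delta> \<tturnstile> App \<beta> (Q (Init a k)) \<doteq> Zero"
      by (rule notE_o) (rule exI_o[of _ _ k], rule forces_mono[OF le \<theta>])
  qed
next
  fix m assume z: "\<forall>k. \<Gamma> \<tturnstile> App \<beta> (Q (Init a k)) \<doteq> Zero"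
  show "\<Gamma> \<tturnstile> App c (Q m) \<doteq> Zero"
  proof (rule orE_o[OF spec_o[OF c, of "Q m"]])
    fix \<Delta> assume le: "\<Gamma> \<preceq> \<Delta>" and "\<Delta> \<tturnstile> (\<exists>\<^sub>o k. App \<theta> (Q m) \<doteq> Init a k \<and>\<^sub>o App c (Q m) \<doteq> App \<beta> (Q m))"
    from this(2) show "\<Delta> \<tturnstile> App c (Q m) \<doteq> Zero"
    proof (rule exE_o)
      fix \<Theta> k assume le': "\<Delta> \<preceq> \<Theta>" and k: "\<Theta> \<tturnstile> App \<theta> (Q m) \<doteq> Init a k \<and>\<^sub>o App c (Q m) \<doteq> App \<beta> (Q m)"
      note up = forces_mono[OF extends_trans[OF le le']]
      have "\<Theta> \<tturnstile> Init a k \<doteq> m" using k up[OF \<theta>[of m]] by (simp add: nv_eq)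
      then have "\<Theta> \<tturnstile> App \<beta> (Q m) \<doteq> Zero"
        by (rule subst_o[where P = "\<lambda>z. App \<beta> (Q z) \<doteq> Zero", OF _ _ up[OF z[rule_format, of k]], rotated])
           (intro def_intros dnt_comp[OF Q])
      with k show "\<Theta> \<tturnstile> App c (Q m) \<doteq> Zero" by (simp add: nv_eq)
    qed
  qed simp
qed

lemma closed_iff_red: "\<Gamma> \<tturnstile> closed X \<longleftrightarrow> \<Gamma> \<tturnstile> red X zeros"
proof
  assume "\<Gamma> \<tturnstile> closed X"
  then show "\<Gamma> \<tturnstile> red X zeros"
    unfolding closed_def
  proof (rule exE_o)
    fix \<Delta>1 \<beta> assume \<beta>: "\<Delta>1 \<tturnstile> (\<forall>\<^sub>o a. X a \<longleftrightarrow>\<^sub>o (\<forall>\<^sub>o k. App \<beta> (Init a k) \<doteq> Zero))"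
    \<comment> \<open>With the identity as threshold, position \<open>p\<close> of the image watches
      the code \<open>p\<close>.\<close>
    have "\<Delta>1 \<tturnstile> (\<exists>\<^sub>o \<theta>. \<forall>\<^sub>o p. App \<theta> p \<doteq> p)"
      by (rule seq_exists[where P = "\<lambda>p y. y \<doteq> p"], intro def_intros) (auto intro!: exI_o simp: nv_eq)
    then show "\<Delta>1 \<tturnstile> red X zeros"
    proof (rule exE_o)
      fix \<Delta>2 \<theta> assume le2: "\<Delta>1 \<preceq> \<Delta>2" and \<theta>: "\<Delta>2 \<tturnstile> (\<forall>\<^sub>o p. App \<theta> p \<doteq> p)"
      show "\<Delta>2 \<tturnstile> red X zeros"
        unfolding red_iff[OF dfm_zeros[OF dst_var]]
      proof (rule ex_mono_o[OF threshold_code[of _ \<theta> \<beta>]], unfold forces_and, elim conjE, intro conjI)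
        fix \<Delta> \<phi> assume le: "\<Delta>2 \<preceq> \<Delta>" and \<phi>: "\<Delta> \<tturnstile> (\<forall>\<^sub>o a. \<forall>\<^sub>o c. im_is \<phi> a c \<longrightarrow>\<^sub>o
          (\<forall>\<^sub>o p. (\<exists>\<^sub>o k. App \<theta> p \<doteq> Init a k \<and>\<^sub>o App c p \<doteq> App \<beta> p) \<or>\<^sub>o
          (\<not>\<^sub>o (\<exists>\<^sub>o k. App \<theta> p \<doteq> Init a k) \<and>\<^sub>o App c p \<doteq> Zero)))"
        show "\<Delta> \<tturnstile> (\<forall>\<^sub>o a. \<forall>\<^sub>o c. im_is \<phi> a c \<longrightarrow>\<^sub>o X a \<longleftrightarrow>\<^sub>o zeros c)"
          unfolding forces_all forces_imp forces_iff
        proof (intro allI impI)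
          fix a c \<Theta> \<Omega> assume "\<Delta> \<preceq> \<Theta>" "\<Theta> \<tturnstile> im_is \<phi> a c" "\<Theta> \<preceq> \<Omega>"
          then have le': "\<Delta> \<preceq> \<Omega>" and im: "\<Omega> \<tturnstile> im_is \<phi> a c" using extends_trans forces_mono by blast+
          have "\<Omega> \<tturnstile> zeros c \<longleftrightarrow> \<Omega> \<tturnstile> (\<forall>\<^sub>o k. App \<beta> (Init a k) \<doteq> Zero)"
            unfolding zeros_def
          proof (rule threshold_zero[OF dnt_var])
            show "\<Omega> \<tturnstile> App \<theta> m \<doteq> m" for m by (rule forces_mono[OF extends_trans[OF le le'] spec_o[OF \<theta>]])
          qed (rule mp_o[OF spec_o[OF spec_o[OF forces_mono[OF le' \<phi>]]] im])
          then show "\<Omega> \<tturnstile> X a \<longleftrightarrow> \<Omega> \<tturnstile> zeros c"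
            using \<beta> extends_trans[OF le2 extends_trans[OF le le']] by (simp add: forces_iff)
        qed
      qed (simp add: codes_def)
    qed
  qed
next
  assume "\<Gamma> \<tturnstile> red X zeros"
  then show "\<Gamma> \<tturnstile> closed X"
    unfolding red_iff[OF dfm_zeros[OF dst_var]] closed_def
  proof (rule exE_o, unfold forces_and, elim conjE)
    fix \<Delta> \<phi> assume c: "\<Delta> \<tturnstile> codes \<phi>" and *: "\<Delta> \<tturnstile> (\<forall>\<^sub>o a. \<forall>\<^sub>o c. im_is \<phi> a c \<longrightarrow>\<^sub>o X a \<longleftrightarrow>\<^sub>o zeros c)"
    \<comment> \<open>The image of \<open>a\<close> vanishes if and only if each section of
      \<open>\<phi>\<close> takes the value 0 at \<open>a\<close>, and \<open>closed_code\<close>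
      turns all these conditions into one closed set.\<close>
    have "\<Delta> \<tturnstile> (\<exists>\<^sub>o \<beta>. \<forall>\<^sub>o a. (\<forall>\<^sub>o n. val_is (Sect \<phi> n) a Zero) \<longleftrightarrow>\<^sub>o (\<forall>\<^sub>o k. App \<beta> (Init a k) \<doteq> Zero))"
      by (rule closed_code, intro def_intros) (use c in \<open>simp add: codes_def\<close>)
    then show "\<Delta> \<tturnstile> (\<exists>\<^sub>o \<beta>. \<forall>\<^sub>o a. X a \<longleftrightarrow>\<^sub>o (\<forall>\<^sub>o k. App \<beta> (Init a k) \<doteq> Zero))"
    proof (rule ex_mono_o)
      fix \<Theta> \<beta> assume le: "\<Delta> \<preceq> \<Theta>" and \<beta>: "\<Theta> \<tturnstile> (\<forall>\<^sub>o a. (\<forall>\<^sub>o n. val_is (Sect \<phi> n) a Zero) \<longleftrightarrow>\<^sub>o (\<forall>\<^sub>o k. App \<beta> (Init a k) \<doteq> Zero))"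
      show "\<Theta> \<tturnstile> (\<forall>\<^sub>o a. X a \<longleftrightarrow>\<^sub>o (\<forall>\<^sub>o k. App \<beta> (Init a k) \<doteq> Zero))"
        unfolding forces_all[of _ "\<lambda>a. _ a \<longleftrightarrow>\<^sub>o _ a"]
      proof (intro allI exE_o[OF im_exists[OF forces_mono[OF le c[unfolded codes_def]]]])
        fix a c \<Omega> assume le': "\<Theta> \<preceq> \<Omega>" and im: "\<Omega> \<tturnstile> im_is \<phi> a c"
        show "\<Omega> \<tturnstile> X a \<longleftrightarrow>\<^sub>o (\<forall>\<^sub>o k. App \<beta> (Init a k) \<doteq> Zero)"
          unfolding forces_iff
        proof (intro allI impI)
          fix \<Phi> assume le'': "\<Omega> \<preceq> \<Phi>"
          have "\<Phi> \<tturnstile> X a \<longleftrightarrow> \<Phi> \<tturnstile> zeros c"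
            using mp_o[OF spec_o[OF spec_o[OF forces_mono[OF extends_trans[OF le le'] *]]] im] le'' by (simp add: forces_iff)
          also have "\<dots> \<longleftrightarrow> \<Phi> \<tturnstile> (\<forall>\<^sub>o n. val_is (Sect \<phi> n) a Zero)"
            by (simp add: zeros_def im_zero[OF forces_mono[OF le'' im]])
          also have "\<dots> \<longleftrightarrow> \<Phi> \<tturnstile> (\<forall>\<^sub>o k. App \<beta> (Init a k) \<doteq> Zero)"
            using spec_o[OF \<beta>, of a] extends_trans[OF le' le''] unfolding forces_iff by blast
          finally show "\<Phi> \<tturnstile> X a \<longleftrightarrow> \<Phi> \<tturnstile> (\<forall>\<^sub>o k. App \<beta> (Init a k) \<doteq> Zero)" .
        qed
      qed
    qed
  qed
qed

section \<open>Finite unions of closed sets\<close>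

definition union_of :: "(stm \<Rightarrow> tv) \<Rightarrow> ntm \<Rightarrow> nat \<Rightarrow> tv" where
  "union_of X n R = ((\<forall>\<^sub>o i. lt i n \<longrightarrow>\<^sub>o closed (\<lambda>a. tr (Rel R a i))) \<and>\<^sub>o
     (\<forall>\<^sub>o a. X a \<longleftrightarrow>\<^sub>o (\<exists>\<^sub>o i. lt i n \<and>\<^sub>o tr (Rel R a i))))"

lemma zeros_Sect: "\<Gamma> \<tturnstile> zeros (Sect a i) \<longleftrightarrow> (\<forall>m. \<Gamma> \<tturnstile> App a (idx m i) \<doteq> Zero)"
  by (simp add: zeros_def nv_eq nv_simps)

text \<open>The members of the family are the preimages of "row \<open>i\<close> vanishes". Each is
  closed by \<open>closed_code\<close>, applied to the sections of \<open>\<phi>\<close> at the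
  positions \<open>idx m i\<close> of that row.\<close>

lemma red_union:
  assumes "\<Gamma> \<tturnstile> red X (zero_row n)" shows "\<Gamma> \<tturnstile> (\<exists>\<^sub>o R. union_of X n R)"
  using assms unfolding red_iff[OF dfm_zero_row[OF dnt_const dst_var]]
proof (rule exE_o, unfold forces_and, elim conjE)
  fix \<Delta> \<phi> assume c: "\<Delta> \<tturnstile> codes \<phi>" and *: "\<Delta> \<tturnstile> (\<forall>\<^sub>o a. \<forall>\<^sub>o c. im_is \<phi> a c \<longrightarrow>\<^sub>o X a \<longleftrightarrow>\<^sub>o zero_row n c)"
  have "\<Delta> \<tturnstile> (\<exists>\<^sub>o R. \<forall>\<^sub>o a. \<forall>\<^sub>o i. tr (Rel R a i) \<longleftrightarrow>\<^sub>o (\<forall>\<^sub>o m. val_is (Sect \<phi> (idx m i)) a Zero))"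
    by (rule comprehension_o) (intro def_intros)
  then show "\<Delta> \<tturnstile> (\<exists>\<^sub>o R. union_of X n R)"
  proof (rule ex_mono_o)
    fix \<Theta> R assume le: "\<Delta> \<preceq> \<Theta>" and R: "\<Theta> \<tturnstile> (\<forall>\<^sub>o a. \<forall>\<^sub>o i. tr (Rel R a i) \<longleftrightarrow>\<^sub>o (\<forall>\<^sub>o m. val_is (Sect \<phi> (idx m i)) a Zero))"
    have R': "\<Omega> \<tturnstile> tr (Rel R a i) \<longleftrightarrow> \<Omega> \<tturnstile> (\<forall>\<^sub>o m. val_is (Sect \<phi> (idx m i)) a Zero)" if "\<Theta> \<preceq> \<Omega>" for \<Omega> a i
      using spec_o[OF spec_o[OF R, of a], of i] that unfolding forces_iff by blast
    note c = forces_mono[OF le c] and * = forces_mono[OF le *]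
    have "\<Theta> \<tturnstile> (\<forall>\<^sub>o i. lt i n \<longrightarrow>\<^sub>o closed (\<lambda>a. tr (Rel R a i)))"
    proof (rule all_impI)
      fix \<Omega> i assume le: "\<Theta> \<preceq> \<Omega>"
      have "\<Omega> \<tturnstile> (\<exists>\<^sub>o \<beta>. \<forall>\<^sub>o a. (\<forall>\<^sub>o m. val_is (Sect \<phi> (idx m i)) a Zero) \<longleftrightarrow>\<^sub>o (\<forall>\<^sub>o k. App \<beta> (Init a k) \<doteq> Zero))"
        by (rule closed_code, intro def_intros) (use forces_mono[OF le c] in \<open>simp add: codes_def\<close>)
      then show "\<Omega> \<tturnstile> closed (\<lambda>a. tr (Rel R a i))"
        unfolding closed_def
      proof (rule ex_mono_o)
        fix \<Omega>' \<beta> assume le': "\<Omega> \<preceq> \<Omega>'"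
          and \<beta>: "\<Omega>' \<tturnstile> (\<forall>\<^sub>o a. (\<forall>\<^sub>o m. val_is (Sect \<phi> (idx m i)) a Zero) \<longleftrightarrow>\<^sub>o (\<forall>\<^sub>o k. App \<beta> (Init a k) \<doteq> Zero))"
        show "\<Omega>' \<tturnstile> (\<forall>\<^sub>o a. tr (Rel R a i) \<longleftrightarrow>\<^sub>o (\<forall>\<^sub>o k. App \<beta> (Init a k) \<doteq> Zero))"
          unfolding forces_all[of _ "\<lambda>a. _ a \<longleftrightarrow>\<^sub>o _ a"] forces_iff
        proof (intro allI impI)
          fix a \<Phi> assume "\<Omega>' \<preceq> \<Phi>"
          with spec_o[OF \<beta>, of a] R'[of \<Phi> a i] extends_trans[OF le extends_trans[OF le']]
          show "\<Phi> \<tturnstile> tr (Rel R a i) \<longleftrightarrow> \<Phi> \<tturnstile> (\<forall>\<^sub>o k. App \<beta> (Init a k) \<doteq> Zero)"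
            unfolding forces_iff by blast
        qed
      qed
    qed
    moreover have "\<Theta> \<tturnstile> (\<forall>\<^sub>o a. X a \<longleftrightarrow>\<^sub>o (\<exists>\<^sub>o i. lt i n \<and>\<^sub>o tr (Rel R a i)))"
      unfolding forces_all[of _ "\<lambda>a. _ a \<longleftrightarrow>\<^sub>o _ a"]
    proof (intro allI exE_o[OF im_exists[OF c[unfolded codes_def]]])
      fix a c \<Omega> assume le': "\<Theta> \<preceq> \<Omega>" and im: "\<Omega> \<tturnstile> im_is \<phi> a c"
      show "\<Omega> \<tturnstile> X a \<longleftrightarrow>\<^sub>o (\<exists>\<^sub>o i. lt i n \<and>\<^sub>o tr (Rel R a i))"
        unfolding forces_iff
      proof (intro allI impI)
        fix \<Phi> assume le'': "\<Omega> \<preceq> \<Phi>"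
        have "\<Phi> \<tturnstile> X a \<longleftrightarrow> \<Phi> \<tturnstile> zero_row n c"
          using mp_o[OF spec_o[OF spec_o[OF forces_mono[OF le' *]]] im] le'' by (simp add: forces_iff)
        also have "\<dots> \<longleftrightarrow> \<Phi> \<tturnstile> (\<exists>\<^sub>o i. lt i n \<and>\<^sub>o tr (Rel R a i))"
          unfolding zero_row_def
        proof (rule bex_cong_o)
          fix \<Xi> i assume le: "\<Phi> \<preceq> \<Xi>"
          show "\<Xi> \<tturnstile> zeros (Sect c i) \<longleftrightarrow> \<Xi> \<tturnstile> tr (Rel R a i)"
            using im_zero[OF forces_mono[OF extends_trans[OF le'' le] im]]
              R'[OF extends_trans[OF le' extends_trans[OF le'' le]]] by (simp add: zeros_Sect)
        qed
        finally show "\<Phi> \<tturnstile> X a \<longleftrightarrow> \<Phi> \<tturnstile> (\<exists>\<^sub>o i. lt i n \<and>\<^sub>o tr (Rel R a i))" .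
      qed
    qed
    ultimately show "\<Theta> \<tturnstile> union_of X n R" by (simp only: union_of_def forces_and)
  qed
qed

lemma update_sect:
  "\<Gamma> \<tturnstile> (\<exists>\<^sub>o b. \<forall>\<^sub>o i. \<forall>\<^sub>o s. (i \<doteq> k \<longrightarrow>\<^sub>o App (Sect b i) s \<doteq> App c s) \<and>\<^sub>o
     (\<not>\<^sub>o (i \<doteq> k) \<longrightarrow>\<^sub>o App (Sect b i) s \<doteq> App (Sect a i) s))"
proof (rule seq2_exists[where P = "\<lambda>i s y. (i \<doteq> k \<longrightarrow>\<^sub>o y \<doteq> App c s) \<and>\<^sub>o (\<not>\<^sub>o (i \<doteq> k) \<longrightarrow>\<^sub>o y \<doteq> App (Sect a i) s)"],
    intro def_intros)
  fix \<Delta> i s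
  show "\<Delta> \<tturnstile> (\<exists>\<^sub>o y. (i \<doteq> k \<longrightarrow>\<^sub>o y \<doteq> App c s) \<and>\<^sub>o (\<not>\<^sub>o (i \<doteq> k) \<longrightarrow>\<^sub>o y \<doteq> App (Sect a i) s))"
  proof (rule orE_o[OF eq_dec[of _ i k]])
    fix \<Theta> assume *: "\<Theta> \<tturnstile> i \<doteq> k"
    show "\<Theta> \<tturnstile> (\<exists>\<^sub>o y. (i \<doteq> k \<longrightarrow>\<^sub>o y \<doteq> App c s) \<and>\<^sub>o (\<not>\<^sub>o (i \<doteq> k) \<longrightarrow>\<^sub>o y \<doteq> App (Sect a i) s))"
      by (rule exI_o[of _ _ "App c s"], unfold forces_and, intro conjI impI_o) (simp, erule notE_o[OF _ forces_mono[OF _ *]])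
  next
    fix \<Theta> assume *: "\<Theta> \<tturnstile> \<not>\<^sub>o (i \<doteq> k)"
    show "\<Theta> \<tturnstile> (\<exists>\<^sub>o y. (i \<doteq> k \<longrightarrow>\<^sub>o y \<doteq> App c s) \<and>\<^sub>o (\<not>\<^sub>o (i \<doteq> k) \<longrightarrow>\<^sub>o y \<doteq> App (Sect a i) s))"
      by (rule exI_o[of _ _ "App (Sect a i) s"], unfold forces_and, intro conjI impI_o) (erule notE_o[OF forces_mono[OF _ *]], simp_all)
  qed
next
  fix \<Delta> i s y y'
  assume y: "\<Delta> \<tturnstile> (i \<doteq> k \<longrightarrow>\<^sub>o y \<doteq> App c s) \<and>\<^sub>o (\<not>\<^sub>o (i \<doteq> k) \<longrightarrow>\<^sub>o y \<doteq> App (Sect a i) s)"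
    and y': "\<Delta> \<tturnstile> (i \<doteq> k \<longrightarrow>\<^sub>o y' \<doteq> App c s) \<and>\<^sub>o (\<not>\<^sub>o (i \<doteq> k) \<longrightarrow>\<^sub>o y' \<doteq> App (Sect a i) s)"
  show "\<Delta> \<tturnstile> y' \<doteq> y"
    by (rule orE_o[OF eq_dec[of _ i k]]; frule forces_mono[OF _ y]; drule forces_mono[OF _ y']; auto dest!: mp_o simp: nv_eq)
qed

text \<open>A closed set has many codes, so unique choice does not select one. For finitely many
  sets the codes are collected by induction, as rows of one sequence.\<close>

lemma finite_closed_choice:
  assumes F: "\<Gamma> \<tturnstile> (\<forall>\<^sub>o i. lt i n \<longrightarrow>\<^sub>o closed (\<lambda>a. tr (Rel F a i)))"
  shows "\<Gamma> \<tturnstile> (\<exists>\<^sub>o \<beta>. \<forall>\<^sub>o i. lt i n \<longrightarrow>\<^sub>o (\<forall>\<^sub>o a. tr (Rel F a i) \<longleftrightarrow>\<^sub>o (\<forall>\<^sub>o k. App (Sect \<beta> i) (Init a k) \<doteq> Zero)))"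
proof -
  let ?C = "\<lambda>\<beta> i. \<forall>\<^sub>o a. tr (Rel F a i) \<longleftrightarrow>\<^sub>o (\<forall>\<^sub>o k. App (Sect \<beta> i) (Init a k) \<doteq> Zero)"
  \<comment> \<open>The induction runs over the number \<open>k\<close> of rows already filled; the
    bound by \<open>n\<close> ensures in the step that the set with index \<open>k\<close> is known
    to be closed.\<close>
  have "\<Gamma> \<tturnstile> lt n (Succ n) \<longrightarrow>\<^sub>o (\<exists>\<^sub>o \<beta>. \<forall>\<^sub>o i. lt i n \<longrightarrow>\<^sub>o ?C \<beta> i)"
  proof (rule induct_o[where P = "\<lambda>k. lt k (Succ n) \<longrightarrow>\<^sub>o (\<exists>\<^sub>o \<beta>. \<forall>\<^sub>o i. lt i k \<longrightarrow>\<^sub>o ?C \<beta> i)"], intro def_intros)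
    show "\<Gamma> \<tturnstile> lt Zero (Succ n) \<longrightarrow>\<^sub>o (\<exists>\<^sub>o \<beta>. \<forall>\<^sub>o i. lt i Zero \<longrightarrow>\<^sub>o ?C \<beta> i)"
      by (rule impI_o, rule exI_o[of _ _ "SVar 0"], rule all_impI) (rule lt_ZeroE)
  next
    fix \<Delta> k assume \<Delta>: "\<Gamma> \<preceq> \<Delta>" and IH: "\<Delta> \<tturnstile> lt k (Succ n) \<longrightarrow>\<^sub>o (\<exists>\<^sub>o \<beta>. \<forall>\<^sub>o i. lt i k \<longrightarrow>\<^sub>o ?C \<beta> i)"
    show "\<Delta> \<tturnstile> lt (Succ k) (Succ n) \<longrightarrow>\<^sub>o (\<exists>\<^sub>o \<beta>. \<forall>\<^sub>o i. lt i (Succ k) \<longrightarrow>\<^sub>o ?C \<beta> i)"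
    proof (rule impI_o)
      fix \<Theta> assume le: "\<Delta> \<preceq> \<Theta>" and "\<Theta> \<tturnstile> lt (Succ k) (Succ n)"
      then have kn: "\<Theta> \<tturnstile> lt k n" by (simp add: lt_Succ_Succ)
      show "\<Theta> \<tturnstile> (\<exists>\<^sub>o \<beta>. \<forall>\<^sub>o i. lt i (Succ k) \<longrightarrow>\<^sub>o ?C \<beta> i)"
      proof (rule exE_o[OF mp_o[OF forces_mono[OF le IH] lt_Succ[OF kn]]])
        fix \<Theta>1 \<beta> assume le1: "\<Theta> \<preceq> \<Theta>1" and \<beta>: "\<Theta>1 \<tturnstile> (\<forall>\<^sub>o i. lt i k \<longrightarrow>\<^sub>o ?C \<beta> i)"
        have "\<Theta>1 \<tturnstile> closed (\<lambda>a. tr (Rel F a k))"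
          by (rule forces_mono[OF le1 all_impE[OF forces_mono[OF extends_trans[OF \<Delta> le] F] kn]])
        then show "\<Theta>1 \<tturnstile> (\<exists>\<^sub>o \<beta>. \<forall>\<^sub>o i. lt i (Succ k) \<longrightarrow>\<^sub>o ?C \<beta> i)"
          unfolding closed_def
        proof (rule exE_o)
          fix \<Theta>2 c assume le2: "\<Theta>1 \<preceq> \<Theta>2" and c: "\<Theta>2 \<tturnstile> (\<forall>\<^sub>o a. tr (Rel F a k) \<longleftrightarrow>\<^sub>o (\<forall>\<^sub>o l. App c (Init a l) \<doteq> Zero))"
          show "\<Theta>2 \<tturnstile> (\<exists>\<^sub>o \<beta>. \<forall>\<^sub>o i. lt i (Succ k) \<longrightarrow>\<^sub>o ?C \<beta> i)"
          proof (rule ex_mono_o[OF update_sect[of _ k c \<beta>]], rule all_impI)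
            fix \<Theta>3 \<Theta>4 b i
            assume le3: "\<Theta>2 \<preceq> \<Theta>3" and b: "\<Theta>3 \<tturnstile> (\<forall>\<^sub>o i. \<forall>\<^sub>o s. (i \<doteq> k \<longrightarrow>\<^sub>o App (Sect b i) s \<doteq> App c s) \<and>\<^sub>o
                (\<not>\<^sub>o (i \<doteq> k) \<longrightarrow>\<^sub>o App (Sect b i) s \<doteq> App (Sect \<beta> i) s))"
              and le4: "\<Theta>3 \<preceq> \<Theta>4" and i: "\<Theta>4 \<tturnstile> lt i (Succ k)"
            note b = forces_mono[OF le4 spec_o[OF spec_o[OF b]], unfolded forces_and]
            note c = forces_mono[OF extends_trans[OF le3 le4] c]
            note \<beta> = forces_mono[OF extends_trans[OF le2 extends_trans[OF le3 le4]] \<beta>]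
            show "\<Theta>4 \<tturnstile> ?C b i"
            proof (rule orE_o[OF eq_dec[of _ i k]])
              fix \<Phi> assume le: "\<Theta>4 \<preceq> \<Phi>" and ik: "\<Phi> \<tturnstile> i \<doteq> k"
              have b1: "\<Phi> \<tturnstile> App (Sect b i) s \<doteq> App c s" for s
                by (rule mp_o[OF forces_mono[OF le b[THEN conjunct1]] ik])
              have "\<Phi> \<tturnstile> (\<forall>\<^sub>o a. tr (Rel F a i) \<longleftrightarrow>\<^sub>o (\<forall>\<^sub>o l. App c (Init a l) \<doteq> Zero))"
                by (rule subst_o[where P = "\<lambda>i. \<forall>\<^sub>o a. tr (Rel F a i) \<longleftrightarrow>\<^sub>o (\<forall>\<^sub>o l. App c (Init a l) \<doteq> Zero)",
                      OF _ eq_sym_o[OF ik] forces_mono[OF le c]]) (intro def_intros)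
              then show "\<Phi> \<tturnstile> ?C b i"
                by (rule substS_o[where P = "\<lambda>c. \<forall>\<^sub>o a. tr (Rel F a i) \<longleftrightarrow>\<^sub>o (\<forall>\<^sub>o l. App c (Init a l) \<doteq> Zero)",
                      OF _ eq_sym_o[OF b1], rotated]) (intro def_intros)
            next
              fix \<Phi> assume le: "\<Theta>4 \<preceq> \<Phi>" and ik: "\<Phi> \<tturnstile> \<not>\<^sub>o (i \<doteq> k)"
              have b2: "\<Phi> \<tturnstile> App (Sect b i) s \<doteq> App (Sect \<beta> i) s" for s
                by (rule mp_o[OF forces_mono[OF le b[THEN conjunct2]] ik])
              have "\<Phi> \<tturnstile> lt i k"
                by (rule orE_o[OF lt_SuccE[OF forces_mono[OF le i]]]) (assumption, rule notE_o[OF forces_mono[OF _ ik]])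
              from all_impE[OF forces_mono[OF le \<beta>] this] show "\<Phi> \<tturnstile> ?C b i"
                by (rule substS_o[where P = "\<lambda>c. \<forall>\<^sub>o a. tr (Rel F a i) \<longleftrightarrow>\<^sub>o (\<forall>\<^sub>o l. App c (Init a l) \<doteq> Zero)",
                      OF _ eq_sym_o[OF b2], rotated]) (intro def_intros)
            qed
          qed
        qed
      qed
    qed
  qed
  then show ?thesis by (rule mp_o) (rule lt_Succ_self)
qed

text \<open>Position \<open>idx m i\<close> of the image watches the code \<open>m\<close> on behalf
  of member \<open>i\<close>. Hence the threshold is the first component of the position, and the
  answer is the value of \<open>\<beta>\<close> there, which is row \<open>i\<close> of
  \<open>\<beta>\<close> at \<open>m\<close>.\<close>

lemma union_red:
  assumes "\<Gamma> \<tturnstile> union_of X n F" shows "\<Gamma> \<tturnstile> red X (zero_row n)"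
proof (rule exE_o[OF finite_closed_choice])
  show "\<Gamma> \<tturnstile> (\<forall>\<^sub>o i. lt i n \<longrightarrow>\<^sub>o closed (\<lambda>a. tr (Rel F a i)))"
    using assms unfolding union_of_def forces_and by blast
  fix \<Delta>1 \<beta> assume le1: "\<Gamma> \<preceq> \<Delta>1"
    and \<beta>: "\<Delta>1 \<tturnstile> (\<forall>\<^sub>o i. lt i n \<longrightarrow>\<^sub>o (\<forall>\<^sub>o a. tr (Rel F a i) \<longleftrightarrow>\<^sub>o (\<forall>\<^sub>o k. App (Sect \<beta> i) (Init a k) \<doteq> Zero)))"
  have X: "\<Delta>1 \<tturnstile> (\<forall>\<^sub>o a. X a \<longleftrightarrow>\<^sub>o (\<exists>\<^sub>o i. lt i n \<and>\<^sub>o tr (Rel F a i)))"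
    using forces_mono[OF le1 assms] unfolding union_of_def forces_and by blast
  have "\<Delta>1 \<tturnstile> (\<exists>\<^sub>o \<theta>. \<forall>\<^sub>o p. \<exists>\<^sub>o i. p \<doteq> idx (App \<theta> p) i)"
  proof (rule seq_exists[where P = "\<lambda>p y. \<exists>\<^sub>o i. p \<doteq> idx y i"], intro def_intros, rule idx_surj)
    fix \<Delta> p y y' assume y: "\<Delta> \<tturnstile> (\<exists>\<^sub>o i. p \<doteq> idx y i)" and y': "\<Delta> \<tturnstile> (\<exists>\<^sub>o i. p \<doteq> idx y' i)"
    from y show "\<Delta> \<tturnstile> y' \<doteq> y"
    proof (rule exE_o)
      fix \<Theta> i assume le: "\<Delta> \<preceq> \<Theta>" and i: "\<Theta> \<tturnstile> p \<doteq> idx y i"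
      show "\<Theta> \<tturnstile> y' \<doteq> y"
        by (rule exE_o[OF forces_mono[OF le y']], rule idx_inj(1), drule forces_mono[OF _ i]) (simp add: nv_eq)
    qed
  qed
  then show "\<Delta>1 \<tturnstile> red X (zero_row n)"
  proof (rule exE_o)
    fix \<Delta>2 \<theta> assume le2: "\<Delta>1 \<preceq> \<Delta>2" and \<theta>: "\<Delta>2 \<tturnstile> (\<forall>\<^sub>o p. \<exists>\<^sub>o i. p \<doteq> idx (App \<theta> p) i)"
    have \<theta>': "\<Delta>2 \<tturnstile> App \<theta> (idx m i) \<doteq> m" for m i
      by (rule exE_o[OF spec_o[OF \<theta>, of "idx m i"]], rule eq_sym_o, rule idx_inj(1))
    show "\<Delta>2 \<tturnstile> red X (zero_row n)"
      unfolding red_iff[OF dfm_zero_row[OF dnt_const dst_var]]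
    proof (rule ex_mono_o[OF threshold_code[of _ \<theta> \<beta>]], unfold forces_and, elim conjE, intro conjI)
      fix \<Delta> \<phi> assume le: "\<Delta>2 \<preceq> \<Delta>" and \<phi>: "\<Delta> \<tturnstile> (\<forall>\<^sub>o a. \<forall>\<^sub>o c. im_is \<phi> a c \<longrightarrow>\<^sub>o
        (\<forall>\<^sub>o p. (\<exists>\<^sub>o k. App \<theta> p \<doteq> Init a k \<and>\<^sub>o App c p \<doteq> App \<beta> p) \<or>\<^sub>o
        (\<not>\<^sub>o (\<exists>\<^sub>o k. App \<theta> p \<doteq> Init a k) \<and>\<^sub>o App c p \<doteq> Zero)))"
      show "\<Delta> \<tturnstile> (\<forall>\<^sub>o a. \<forall>\<^sub>o c. im_is \<phi> a c \<longrightarrow>\<^sub>o X a \<longleftrightarrow>\<^sub>o zero_row n c)"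
        unfolding forces_all forces_imp forces_iff
      proof (intro allI impI)
        fix a c \<Theta> \<Omega> assume "\<Delta> \<preceq> \<Theta>" "\<Theta> \<tturnstile> im_is \<phi> a c" "\<Theta> \<preceq> \<Omega>"
        then have le': "\<Delta> \<preceq> \<Omega>" and im: "\<Omega> \<tturnstile> im_is \<phi> a c" using extends_trans forces_mono by blast+
        note le2' = extends_trans[OF le le']
        have "\<Omega> \<tturnstile> zero_row n c \<longleftrightarrow> \<Omega> \<tturnstile> (\<exists>\<^sub>o i. lt i n \<and>\<^sub>o tr (Rel F a i))"
          unfolding zero_row_def
        proof (rule bex_cong_o)
          fix \<Xi> i assume le3: "\<Omega> \<preceq> \<Xi>" and i: "\<Xi> \<tturnstile> lt i n"
          have "\<Xi> \<tturnstile> (\<forall>\<^sub>o m. App c (idx m i) \<doteq> Zero) \<longleftrightarrow> \<Xi> \<tturnstile> (\<forall>\<^sub>o k. App \<beta> (idx (Init a k) i) \<doteq> Zero)"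
            by (rule threshold_zero[OF _ forces_mono[OF extends_trans[OF le2' le3] \<theta>']], intro def_intros)
               (rule mp_o[OF spec_o[OF spec_o[OF forces_mono[OF extends_trans[OF le' le3] \<phi>]]] forces_mono[OF le3 im]])
          moreover have "\<Xi> \<tturnstile> tr (Rel F a i) \<longleftrightarrow>\<^sub>o (\<forall>\<^sub>o k. App (Sect \<beta> i) (Init a k) \<doteq> Zero)"
            by (rule spec_o[OF all_impE[OF forces_mono[OF extends_trans[OF le2 extends_trans[OF le2' le3]] \<beta>] i]])
          ultimately show "\<Xi> \<tturnstile> zeros (Sect c i) \<longleftrightarrow> \<Xi> \<tturnstile> tr (Rel F a i)"
            unfolding forces_iff zeros_Sect using extends_refl[of \<Xi>] by (simp add: nv_eq nv_simps)
        qed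
        then show "\<Omega> \<tturnstile> X a \<longleftrightarrow> \<Omega> \<tturnstile> zero_row n c"
          using spec_o[OF X, of a] extends_trans[OF le2 le2'] unfolding forces_iff by blast
      qed
    qed (simp add: codes_def)
  qed
qed

section \<open>Consequences of the continuity principle\<close>

definition continuity :: tv where
  "continuity = (\<forall>\<^sub>o R. (\<forall>\<^sub>o a. \<exists>\<^sub>o n. tr (Rel R a n)) \<longrightarrow>\<^sub>o
     (\<forall>\<^sub>o a. \<exists>\<^sub>o m. \<exists>\<^sub>o n. \<forall>\<^sub>o b. (\<exists>\<^sub>o k. Init a m \<doteq> Init b k) \<longrightarrow>\<^sub>o tr (Rel R b n)))"

text \<open>Comprehension turns the definable \<open>P\<close> into a relation variable, and
  agreement of entries replaces equality of codes. Only neighbourhoods of the zero sequence are used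
  below.\<close>

lemma continuity_at_zero:
  assumes bcp: "\<Gamma> \<tturnstile> continuity" and P: "defSN P" and tot: "\<Gamma> \<tturnstile> (\<forall>\<^sub>o a. \<exists>\<^sub>o n. P a n)"
  shows "\<Gamma> \<tturnstile> (\<exists>\<^sub>o m. \<exists>\<^sub>o n. \<forall>\<^sub>o b. (\<forall>\<^sub>o q. lt q m \<longrightarrow>\<^sub>o App b q \<doteq> Zero) \<longrightarrow>\<^sub>o P b n)"
proof (rule exE_o[OF comprehension_o[OF P]], rule exE_o[OF zero_seq])
  fix R z \<Delta>1 \<Delta> assume le1: "\<Gamma> \<preceq> \<Delta>1" and R: "\<Delta>1 \<tturnstile> (\<forall>\<^sub>o a. \<forall>\<^sub>o n. tr (Rel R a n) \<longleftrightarrow>\<^sub>o P a n)"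
    and le2: "\<Delta>1 \<preceq> \<Delta>" and z: "\<Delta> \<tturnstile> (\<forall>\<^sub>o n. App z n \<doteq> Zero)"
  have R': "\<Theta> \<tturnstile> tr (Rel R a n) \<longleftrightarrow> \<Theta> \<tturnstile> P a n" if "\<Delta> \<preceq> \<Theta>" for \<Theta> a n
    using spec_o[OF spec_o[OF R, of a], of n] extends_trans[OF le2 that] unfolding forces_iff by blast
  have "\<Delta> \<tturnstile> (\<forall>\<^sub>o a. \<exists>\<^sub>o n. tr (Rel R a n))"
    unfolding forces_all
    by (intro allI, rule ex_mono_o[OF spec_o[OF forces_mono[OF extends_trans[OF le1 le2] tot]]]) (simp add: R')
  then have "\<Delta> \<tturnstile> (\<exists>\<^sub>o m. \<exists>\<^sub>o n. \<forall>\<^sub>o b. (\<exists>\<^sub>o k. Init z m \<doteq> Init b k) \<longrightarrow>\<^sub>o tr (Rel R b n))"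
    by (rule spec_o[OF mp_o[OF spec_o[OF forces_mono[OF extends_trans[OF le1 le2] bcp, unfolded continuity_def]]]])
  then show "\<Delta> \<tturnstile> (\<exists>\<^sub>o m. \<exists>\<^sub>o n. \<forall>\<^sub>o b. (\<forall>\<^sub>o q. lt q m \<longrightarrow>\<^sub>o App b q \<doteq> Zero) \<longrightarrow>\<^sub>o P b n)"
  proof (rule ex_mono_o, elim ex_mono_o)
    fix m n \<Delta>2 \<Delta>3 assume le: "\<Delta> \<preceq> \<Delta>2" "\<Delta>2 \<preceq> \<Delta>3"
      and *: "\<Delta>3 \<tturnstile> (\<forall>\<^sub>o b. (\<exists>\<^sub>o k. Init z m \<doteq> Init b k) \<longrightarrow>\<^sub>o tr (Rel R b n))"
    note le = extends_trans[OF le]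
    show "\<Delta>3 \<tturnstile> (\<forall>\<^sub>o b. (\<forall>\<^sub>o q. lt q m \<longrightarrow>\<^sub>o App b q \<doteq> Zero) \<longrightarrow>\<^sub>o P b n)"
    proof (rule all_impI)
      fix b \<Theta> assume le': "\<Delta>3 \<preceq> \<Theta>" and b: "\<Theta> \<tturnstile> (\<forall>\<^sub>o q. lt q m \<longrightarrow>\<^sub>o App b q \<doteq> Zero)"
      have "\<Theta> \<tturnstile> Init z m \<doteq> Init b m"
      proof (rule Init_cong)
        fix q \<Omega> assume \<Omega>: "\<Theta> \<preceq> \<Omega>" and "\<Omega> \<tturnstile> lt q m"
        with all_impE[OF forces_mono[OF \<Omega> b]] spec_o[OF forces_mono[OF extends_trans[OF le extends_trans[OF le' \<Omega>]] z]]
        show "\<Omega> \<tturnstile> App z q \<doteq> App b q" by (metis nv_eq)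
      qed
      then have "\<Theta> \<tturnstile> (\<exists>\<^sub>o k. Init z m \<doteq> Init b k)" by (rule exI_o)
      from all_impE[OF forces_mono[OF le' *] this] show "\<Theta> \<tturnstile> P b n"
        using R'[OF extends_trans[OF le le']] by simp
    qed
  qed
qed

text \<open>"At most one place" is expressed by equality of any two places of difference, so that it
  remains open whether there is one.\<close>

definition spike :: "stm \<Rightarrow> ntm \<Rightarrow> stm \<Rightarrow> tv" where
  "spike b K a = ((\<forall>\<^sub>o p. \<not>\<^sub>o (App a p \<doteq> App b p) \<longrightarrow>\<^sub>o lt K (Succ p)) \<and>\<^sub>o
     (\<forall>\<^sub>o p. \<forall>\<^sub>o q. \<not>\<^sub>o (App a p \<doteq> App b p) \<longrightarrow>\<^sub>o \<not>\<^sub>o (App a q \<doteq> App b q) \<longrightarrow>\<^sub>o p \<doteq> q))"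

lemma spikeD:
  assumes "\<Gamma> \<tturnstile> spike b K a"
  shows "\<Gamma> \<tturnstile> \<not>\<^sub>o (App a p \<doteq> App b p) \<Longrightarrow> \<Gamma> \<tturnstile> lt K (Succ p)"
    and "\<Gamma> \<tturnstile> \<not>\<^sub>o (App a p \<doteq> App b p) \<Longrightarrow> \<Gamma> \<tturnstile> \<not>\<^sub>o (App a q \<doteq> App b q) \<Longrightarrow> \<Gamma> \<tturnstile> p \<doteq> q"
proof -
  from assms have 1: "\<Gamma> \<tturnstile> (\<forall>\<^sub>o p. \<not>\<^sub>o (App a p \<doteq> App b p) \<longrightarrow>\<^sub>o lt K (Succ p))"
    and 2: "\<Gamma> \<tturnstile> (\<forall>\<^sub>o p. \<forall>\<^sub>o q. \<not>\<^sub>o (App a p \<doteq> App b p) \<longrightarrow>\<^sub>o \<not>\<^sub>o (App a q \<doteq> App b q) \<longrightarrow>\<^sub>o p \<doteq> q)"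
    unfolding spike_def forces_and by blast+
  show "\<Gamma> \<tturnstile> \<not>\<^sub>o (App a p \<doteq> App b p) \<Longrightarrow> \<Gamma> \<tturnstile> lt K (Succ p)" by (rule all_impE[OF 1])
  show "\<Gamma> \<tturnstile> \<not>\<^sub>o (App a p \<doteq> App b p) \<Longrightarrow> \<Gamma> \<tturnstile> \<not>\<^sub>o (App a q \<doteq> App b q) \<Longrightarrow> \<Gamma> \<tturnstile> p \<doteq> q"
    by (rule mp_o[OF mp_o[OF spec_o[OF spec_o[OF 2]]]])
qed

text \<open>A sum is used where a maximum would do: it is at least each of its summands.\<close>

lemma Add_ge: "\<Gamma> \<tturnstile> lt (Add K m) (Succ p) \<Longrightarrow> \<Gamma> \<tturnstile> lt K (Succ p)"
  by (rule lt_trans_Succ'[OF lt_Add])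

lemma Add_ge': "\<Gamma> \<tturnstile> lt (Add K m) (Succ p) \<Longrightarrow> \<Gamma> \<tturnstile> lt m (Succ p)"
  by (rule Add_ge[of _ m K]) (erule lt_cong, simp_all add: nv_eq nv_simps nv_Add_commute)

lemma neq_mono_o: "\<Gamma> \<tturnstile> \<not>\<^sub>o P \<Longrightarrow> (\<And>\<Delta>. \<Gamma> \<preceq> \<Delta> \<Longrightarrow> \<Delta> \<tturnstile> Q \<Longrightarrow> \<Delta> \<tturnstile> P) \<Longrightarrow> \<Gamma> \<tturnstile> \<not>\<^sub>o Q"
  by (rule notI_o, rule notE_o[OF forces_mono])

text \<open>By continuity, which row of \<open>a\<close> vanishes would be known from an initial segment of \<open>a\<close>, too early to
  exclude a spike in that row.\<close>

lemma no_spike_choice: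
  assumes bcp: "\<Gamma> \<tturnstile> continuity"
    and H: "\<Gamma> \<tturnstile> (\<forall>\<^sub>o a. spike b K a \<longrightarrow>\<^sub>o (\<exists>\<^sub>o l. zeros (Sect b l) \<and>\<^sub>o zeros (Sect a l)))"
  shows "\<Gamma> \<tturnstile> \<bottom>\<^sub>o"
proof -
  \<comment> \<open>\<open>?r\<close> maps an arbitrary \<open>g\<close> to a sequence of the kind
    that the hypothesis covers: the entry \<open>g(p)\<close> is added to \<open>b(p)\<close> if
    \<open>p\<close> is at least \<open>K\<close> and \<open>g\<close> vanishes before
    \<open>p\<close>. So \<open>b\<close> can change only at the first non-zero entry of
    \<open>g\<close>.\<close>
  let ?D = "\<lambda>g p. lt K (Succ p) \<and>\<^sub>o (\<forall>\<^sub>o q. lt q p \<longrightarrow>\<^sub>o App g q \<doteq> Zero)"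
  let ?r = "\<lambda>g a. \<forall>\<^sub>o p. (?D g p \<longrightarrow>\<^sub>o App a p \<doteq> Add (App b p) (App g p)) \<and>\<^sub>o (\<not>\<^sub>o ?D g p \<longrightarrow>\<^sub>o App a p \<doteq> App b p)"
  let ?P = "\<lambda>g l. zeros (Sect b l) \<and>\<^sub>o (\<exists>\<^sub>o a. ?r g a \<and>\<^sub>o zeros (Sect a l))"
  have dec: "\<Delta> \<tturnstile> ?D g p \<or>\<^sub>o \<not>\<^sub>o ?D g p" for \<Delta> g p
    by (rule dec_and, rule dec_lt, rule dec_bounded, intro def_intros, rule eq_dec)
  have tot: "\<Gamma> \<tturnstile> (\<forall>\<^sub>o g. \<exists>\<^sub>o l. ?P g l)"
    unfolding forces_all
  proof
    fix g
    have "\<Gamma> \<tturnstile> (\<exists>\<^sub>o a. ?r g a)" by (rule seq_if) (intro def_intros | rule dec)+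
    then show "\<Gamma> \<tturnstile> (\<exists>\<^sub>o l. ?P g l)"
    proof (rule exE_o)
      fix \<Delta> a assume le: "\<Gamma> \<preceq> \<Delta>" and a: "\<Delta> \<tturnstile> ?r g a"
      \<comment> \<open>A place where \<open>a\<close> differs from \<open>b\<close> is the first
        non-zero place of \<open>g\<close>; hence there are no two such places.\<close>
      have D: "\<Theta> \<tturnstile> ?D g p \<and>\<^sub>o \<not>\<^sub>o (App g p \<doteq> Zero)" if "\<Delta> \<preceq> \<Theta>" and neq: "\<Theta> \<tturnstile> \<not>\<^sub>o (App a p \<doteq> App b p)" for \<Theta> p
      proof (rule orE_o[OF dec[of _ p g]])
        fix \<Omega> assume le': "\<Theta> \<preceq> \<Omega>" and "\<Omega> \<tturnstile> \<not>\<^sub>o ?D g p"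
        from this(2) have "\<Omega> \<tturnstile> App a p \<doteq> App b p"
          by (rule if2_o[OF spec_o[OF forces_mono[OF extends_trans[OF that(1) le'] a]]])
        then show "\<Omega> \<tturnstile> ?D g p \<and>\<^sub>o \<not>\<^sub>o (App g p \<doteq> Zero)" by (rule notE_o[OF forces_mono[OF le' neq]])
      next
        fix \<Omega> assume le': "\<Theta> \<preceq> \<Omega>" and D: "\<Omega> \<tturnstile> ?D g p"
        from D have "\<Omega> \<tturnstile> App a p \<doteq> Add (App b p) (App g p)"
          by (rule if1_o[OF spec_o[OF forces_mono[OF extends_trans[OF that(1) le'] a]]])
        then have "\<Omega> \<tturnstile> \<not>\<^sub>o (App g p \<doteq> Zero)"
          by - (rule neq_mono_o[OF forces_mono[OF le' neq]], drule(1) forces_mono, simp add: nv_eq nv_simps(5))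
        with D show "\<Omega> \<tturnstile> ?D g p \<and>\<^sub>o \<not>\<^sub>o (App g p \<doteq> Zero)" unfolding forces_and by blast
      qed
      have lt: "\<Theta> \<tturnstile> G" if "\<Delta> \<preceq> \<Theta>" "\<Theta> \<tturnstile> \<not>\<^sub>o (App a p \<doteq> App b p)" "\<Theta> \<tturnstile> \<not>\<^sub>o (App a q \<doteq> App b q)" "\<Theta> \<tturnstile> lt p q" for \<Theta> p q G
      proof -
        have 1: "\<Theta> \<tturnstile> \<not>\<^sub>o (App g p \<doteq> Zero)" and 2: "\<Theta> \<tturnstile> (\<forall>\<^sub>o p. lt p q \<longrightarrow>\<^sub>o App g p \<doteq> Zero)"
          using D[OF that(1,2)] D[OF that(1,3)] unfolding forces_and by blast+
        show ?thesis by (rule notE_o[OF 1 all_impE[OF 2 that(4)]])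
      qed
      have "\<Delta> \<tturnstile> spike b K a"
        unfolding spike_def forces_and
      proof (intro conjI)
        show "\<Delta> \<tturnstile> (\<forall>\<^sub>o p. \<not>\<^sub>o (App a p \<doteq> App b p) \<longrightarrow>\<^sub>o lt K (Succ p))"
          using D by (intro all_impI) simp
        show "\<Delta> \<tturnstile> (\<forall>\<^sub>o p. \<forall>\<^sub>o q. \<not>\<^sub>o (App a p \<doteq> App b p) \<longrightarrow>\<^sub>o \<not>\<^sub>o (App a q \<doteq> App b q) \<longrightarrow>\<^sub>o p \<doteq> q)"
          unfolding forces_all
        proof (intro allI impI_o)
          fix p q \<Theta> \<Omega> assume le: "\<Delta> \<preceq> \<Theta>" "\<Theta> \<preceq> \<Omega>" and p: "\<Theta> \<tturnstile> \<not>\<^sub>o (App a p \<doteq> App b p)" and q: "\<Omega> \<tturnstile> \<not>\<^sub>o (App a q \<doteq> App b q)"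
          note p = forces_mono[OF le(2) p]
          show "\<Omega> \<tturnstile> p \<doteq> q"
          proof (rule trichotomyE[of _ p q])
            fix \<Phi> assume le': "\<Omega> \<preceq> \<Phi>" and "\<Phi> \<tturnstile> lt p q"
            from this(2) show "\<Phi> \<tturnstile> p \<doteq> q"
              by (rule lt[OF extends_trans[OF le(1) extends_trans[OF le(2) le']] forces_mono[OF le' p] forces_mono[OF le' q]])
          next
            fix \<Phi> assume le': "\<Omega> \<preceq> \<Phi>" and "\<Phi> \<tturnstile> lt q p"
            from this(2) show "\<Phi> \<tturnstile> p \<doteq> q"
              by (rule lt[OF extends_trans[OF le(1) extends_trans[OF le(2) le']] forces_mono[OF le' q] forces_mono[OF le' p]])
          qed
        qed
      qed
      from all_impE[OF forces_mono[OF le H] this] show "\<Delta> \<tturnstile> (\<exists>\<^sub>o l. ?P g l)"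
      proof (rule ex_mono_o)
        fix \<Theta> l assume le: "\<Delta> \<preceq> \<Theta>" and l: "\<Theta> \<tturnstile> zeros (Sect b l) \<and>\<^sub>o zeros (Sect a l)"
        then have "\<Theta> \<tturnstile> (\<exists>\<^sub>o a. ?r g a \<and>\<^sub>o zeros (Sect a l))"
          using forces_mono[OF le a] by (intro exI_o[of _ _ a]) (simp only: forces_and)
        with l show "\<Theta> \<tturnstile> ?P g l" unfolding forces_and by blast
      qed
    qed
  qed
  have "\<Gamma> \<tturnstile> (\<exists>\<^sub>o m. \<exists>\<^sub>o l. \<forall>\<^sub>o g. (\<forall>\<^sub>o q. lt q m \<longrightarrow>\<^sub>o App g q \<doteq> Zero) \<longrightarrow>\<^sub>o ?P g l)"
    by (rule continuity_at_zero[OF bcp _ tot]) (intro def_intros)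
  then show ?thesis
  proof (rule exE_o, elim exE_o)
    fix m l \<Delta>1 \<Delta>2 assume P: "\<Delta>2 \<tturnstile> (\<forall>\<^sub>o g. (\<forall>\<^sub>o q. lt q m \<longrightarrow>\<^sub>o App g q \<doteq> Zero) \<longrightarrow>\<^sub>o ?P g l)"
    \<comment> \<open>The spike is planted at entry \<open>K + m\<close> of row \<open>l\<close>. A
      position is at least the number of the entry, so it lies beyond both \<open>K\<close> and the
      part of \<open>g\<close> that the continuity principle has seen.\<close>
    let ?p = "idx (Add K m) l"
    have p: "\<Theta> \<tturnstile> lt (Add K m) (Succ ?p)" for \<Theta> by (rule lt_idx)
    show "\<Delta>2 \<tturnstile> \<bottom>\<^sub>o"
    proof (rule exE_o[OF zero_seq], rule exE_o[OF update_seq[of _ ?p "Succ Zero"]])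
      fix z g \<Delta>3 \<Delta> assume le: "\<Delta>2 \<preceq> \<Delta>3" "\<Delta>3 \<preceq> \<Delta>" and z: "\<Delta>3 \<tturnstile> (\<forall>\<^sub>o n. App z n \<doteq> Zero)"
        and "\<Delta> \<tturnstile> App g ?p \<doteq> Succ Zero \<and>\<^sub>o (\<forall>\<^sub>o i. \<not>\<^sub>o (i \<doteq> ?p) \<longrightarrow>\<^sub>o App g i \<doteq> App z i)"
      then have g1: "\<Delta> \<tturnstile> App g ?p \<doteq> Succ Zero" and g2: "\<Delta> \<tturnstile> (\<forall>\<^sub>o i. \<not>\<^sub>o (i \<doteq> ?p) \<longrightarrow>\<^sub>o App g i \<doteq> App z i)"
        by (simp_all only: forces_and)
      have g0: "\<Theta> \<tturnstile> App g q \<doteq> Zero" if le': "\<Delta> \<preceq> \<Theta>" and q: "\<Theta> \<tturnstile> lt q ?p" for \<Theta> q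
      proof -
        have "\<Theta> \<tturnstile> \<not>\<^sub>o (q \<doteq> ?p)" by (rule notI_o, rule lt_neq[OF forces_mono[OF _ q]])
        from all_impE[OF forces_mono[OF le' g2] this] spec_o[OF forces_mono[OF extends_trans[OF le(2) le'] z], of q]
        show ?thesis by (rule eq_trans_o)
      qed
      have "\<Delta> \<tturnstile> (\<forall>\<^sub>o q. lt q m \<longrightarrow>\<^sub>o App g q \<doteq> Zero)"
      proof (rule all_impI)
        fix q \<Theta> assume le: "\<Delta> \<preceq> \<Theta>" and "\<Theta> \<tturnstile> lt q m"
        from lt_trans_Succ[OF this(2) Add_ge'[OF p]] show "\<Theta> \<tturnstile> App g q \<doteq> Zero" by (rule g0[OF le])
      qed
      from all_impE[OF forces_mono[OF extends_trans[OF le] P] this]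
      have b: "\<Delta> \<tturnstile> zeros (Sect b l)" and ex: "\<Delta> \<tturnstile> (\<exists>\<^sub>o a. ?r g a \<and>\<^sub>o zeros (Sect a l))" unfolding forces_and by blast+
      from ex show "\<Delta> \<tturnstile> \<bottom>\<^sub>o"
      proof (rule exE_o)
        fix a \<Theta> assume le': "\<Delta> \<preceq> \<Theta>" and "\<Theta> \<tturnstile> ?r g a \<and>\<^sub>o zeros (Sect a l)"
        then have r: "\<Theta> \<tturnstile> ?r g a" and a: "\<Theta> \<tturnstile> zeros (Sect a l)" unfolding forces_and by blast+
        \<comment> \<open>As \<open>g\<close> vanishes before \<open>?p\<close>, the sequence
          \<open>a\<close> has the value \<open>b(?p) + 1\<close> there, although row
          \<open>l\<close> of both \<open>a\<close> and \<open>b\<close> vanishes.\<close>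
        have "\<Theta> \<tturnstile> ?D g ?p"
          unfolding forces_and by (intro conjI Add_ge[OF p] all_impI g0 extends_trans[OF le'])
        then have "\<Theta> \<tturnstile> App a ?p \<doteq> Add (App b ?p) (App g ?p)"
          by (rule if1_o[OF spec_o[OF r]])
        moreover have "\<Theta> \<tturnstile> App a ?p \<doteq> Zero" "\<Theta> \<tturnstile> App b ?p \<doteq> Zero" "\<Theta> \<tturnstile> App g ?p \<doteq> Succ Zero"
          using a forces_mono[OF le' b] forces_mono[OF le' g1] unfolding zeros_Sect by blast+
        ultimately show "\<Theta> \<tturnstile> \<bottom>\<^sub>o"
          by - (rule Succ_neq_Zero[of _ Zero], simp add: nv_eq nv_simps(5) nv_simps(1))
      qed
    qed
  qed
qed

text \<open>The zero sequence plays the part of \<open>b\<close>; as all its rows vanish, only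
  membership of the spike sequences has to be shown. The \<open>Pi02\<close> form reduces it to one
  test for each \<open>m\<close>, which a finite segment can pass.\<close>

lemma zero_row_not_Pi02:
  assumes bcp: "\<Gamma> \<tturnstile> continuity"
    and Pi02: "\<Gamma> \<tturnstile> (\<exists>\<^sub>o \<beta>. \<forall>\<^sub>o a. zero_row (Succ (Succ Zero)) a \<longleftrightarrow>\<^sub>o
      (\<forall>\<^sub>o m. \<exists>\<^sub>o n. \<not>\<^sub>o (App (Sect \<beta> m) (Init a n) \<doteq> Zero)))"
  shows "\<Gamma> \<tturnstile> \<bottom>\<^sub>o"
  using Pi02
proof (rule exE_o)
  let ?two = "Succ (Succ Zero)"
  fix \<Delta>1 \<beta> assume le1: "\<Gamma> \<preceq> \<Delta>1" and \<beta>: "\<Delta>1 \<tturnstile> (\<forall>\<^sub>o a. zero_row ?two a \<longleftrightarrow>\<^sub>o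
      (\<forall>\<^sub>o m. \<exists>\<^sub>o n. \<not>\<^sub>o (App (Sect \<beta> m) (Init a n) \<doteq> Zero)))"
  have \<beta>': "\<Theta> \<tturnstile> zero_row ?two a \<longleftrightarrow> (\<forall>m. \<Theta> \<tturnstile> (\<exists>\<^sub>o n. \<not>\<^sub>o (App (Sect \<beta> m) (Init a n) \<doteq> Zero)))" if "\<Delta>1 \<preceq> \<Theta>" for \<Theta> a
    using spec_o[OF \<beta>, of a] that unfolding forces_iff forces_all by blast
  show "\<Delta>1 \<tturnstile> \<bottom>\<^sub>o"
  proof (rule exE_o[OF zero_seq])
    fix \<Delta> z assume le2: "\<Delta>1 \<preceq> \<Delta>" and z: "\<Delta> \<tturnstile> (\<forall>\<^sub>o n. App z n \<doteq> Zero)"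
    have zz: "\<Theta> \<tturnstile> zeros (Sect z l)" if "\<Delta> \<preceq> \<Theta>" for \<Theta> l
      using forces_mono[OF that z] by (simp add: zeros_Sect)
    have zero_two: "\<Theta> \<tturnstile> lt Zero ?two" and one_two: "\<Theta> \<tturnstile> lt (Succ Zero) ?two" for \<Theta>
      by (simp_all add: lt_Zero_Succ lt_Succ_Succ)
    show "\<Delta> \<tturnstile> \<bottom>\<^sub>o"
    proof (rule no_spike_choice[OF forces_mono[OF extends_trans[OF le1 le2] bcp], of z Zero], rule all_impI)
      fix a \<Theta> assume le3: "\<Delta> \<preceq> \<Theta>" and sp: "\<Theta> \<tturnstile> spike z Zero a"
      \<comment> \<open>Once a place of difference in row \<open>l\<close> is known, the one of the
        rows 0 and 1 that is not \<open>l\<close> vanishes, since there is no second spike.\<close>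
      have differs: "\<Omega> \<tturnstile> zero_row ?two a" if le: "\<Theta> \<preceq> \<Omega>" and j: "\<Omega> \<tturnstile> \<not>\<^sub>o (App a j \<doteq> App z j)" for \<Omega> j
      proof (rule exE_o[OF idx_surj[of _ j]], elim exE_o)
        fix s l \<Omega>1 \<Omega>2 assume le': "\<Omega> \<preceq> \<Omega>1" "\<Omega>1 \<preceq> \<Omega>2" and sl: "\<Omega>2 \<tturnstile> j \<doteq> idx s l"
        note le' = extends_trans[OF le']
        have row: "\<Phi> \<tturnstile> zero_row ?two a" if le'': "\<Omega>2 \<preceq> \<Phi>" and i: "\<Phi> \<tturnstile> lt i ?two" and il: "\<Phi> \<tturnstile> \<not>\<^sub>o (i \<doteq> l)" for \<Phi> i
        proof -
          have "\<Phi> \<tturnstile> App a (idx m i) \<doteq> Zero" for m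
          proof -
            have "\<Phi> \<tturnstile> App a (idx m i) \<doteq> App z (idx m i)"
            proof (rule eq_dne, rule notI_o)
              fix \<Psi> assume le3: "\<Phi> \<preceq> \<Psi>" and neq: "\<Psi> \<tturnstile> \<not>\<^sub>o (App a (idx m i) \<doteq> App z (idx m i))"
              note le4 = extends_trans[OF le' extends_trans[OF le'' le3]]
              have "\<Psi> \<tturnstile> idx m i \<doteq> j"
                by (rule spikeD(2)[OF forces_mono[OF extends_trans[OF le le4] sp] neq forces_mono[OF le4 j]])
              then have "\<Psi> \<tturnstile> idx m i \<doteq> idx s l" by (rule eq_trans_o[OF _ forces_mono[OF extends_trans[OF le'' le3] sl]])
              then show "\<Psi> \<tturnstile> \<bottom>\<^sub>o" by (rule notE_o[OF forces_mono[OF le3 il] idx_inj(2)])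
            qed
            then show ?thesis
              by (rule eq_trans_o)
                (rule spec_o[OF forces_mono[OF extends_trans[OF le3 extends_trans[OF le extends_trans[OF le' le'']]] z]])
          qed
          with i show ?thesis unfolding zero_row_def by (intro exI_o[of _ _ i]) (simp add: zeros_Sect)
        qed
        show "\<Omega>2 \<tturnstile> zero_row ?two a"
        proof (rule orE_o[OF eq_dec[of _ Zero l]])
          fix \<Phi> assume "\<Omega>2 \<preceq> \<Phi>" and l: "\<Phi> \<tturnstile> Zero \<doteq> l"
          then show "\<Phi> \<tturnstile> zero_row ?two a"
          proof (intro row[OF _ one_two] notI_o)
            fix \<Psi> assume le: "\<Phi> \<preceq> \<Psi>" and "\<Psi> \<tturnstile> Succ Zero \<doteq> l"
            with forces_mono[OF le l] show "\<Psi> \<tturnstile> \<bottom>\<^sub>o" by - (rule Succ_neq_Zero[of _ Zero], simp add: nv_eq)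
          qed
        next
          fix \<Phi> assume "\<Omega>2 \<preceq> \<Phi>" and "\<Phi> \<tturnstile> \<not>\<^sub>o (Zero \<doteq> l)"
          then show "\<Phi> \<tturnstile> zero_row ?two a" by (intro row[OF _ zero_two])
        qed
      qed
      \<comment> \<open>The zero sequence passes test \<open>m\<close> on a segment of length
        \<open>n\<close>. Either \<open>a\<close> shares this segment and passes on it, or the spike
        shows up within it; then \<open>a\<close> is in the set by \<open>differs\<close> and passes
        the test for that reason.\<close>
      have "\<Theta> \<tturnstile> (\<exists>\<^sub>o n. \<not>\<^sub>o (App (Sect \<beta> m) (Init a n) \<doteq> Zero))" for m
      proof -
        have "\<Theta> \<tturnstile> zero_row ?two z"
          unfolding zero_row_def using zero_two zz[OF le3] by (intro exI_o[of _ _ Zero]) simp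
        then have "\<Theta> \<tturnstile> (\<exists>\<^sub>o n. \<not>\<^sub>o (App (Sect \<beta> m) (Init z n) \<doteq> Zero))"
          using \<beta>'[OF extends_trans[OF le2 le3]] by blast
        then show ?thesis
        proof (rule exE_o)
          fix \<Omega> n assume le: "\<Theta> \<preceq> \<Omega>" and n: "\<Omega> \<tturnstile> \<not>\<^sub>o (App (Sect \<beta> m) (Init z n) \<doteq> Zero)"
          have "\<Omega> \<tturnstile> (\<exists>\<^sub>o j. lt j n \<and>\<^sub>o \<not>\<^sub>o (App a j \<doteq> App z j)) \<or>\<^sub>o (\<forall>\<^sub>o j. lt j n \<longrightarrow>\<^sub>o \<not>\<^sub>o \<not>\<^sub>o (App a j \<doteq> App z j))"
            by (rule bounded_dec, intro def_intros, rule dec_not[OF eq_dec])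
          then show "\<Omega> \<tturnstile> (\<exists>\<^sub>o n. \<not>\<^sub>o (App (Sect \<beta> m) (Init a n) \<doteq> Zero))"
          proof (rule orE_o)
            fix \<Phi> assume le': "\<Omega> \<preceq> \<Phi>" and "\<Phi> \<tturnstile> (\<exists>\<^sub>o j. lt j n \<and>\<^sub>o \<not>\<^sub>o (App a j \<doteq> App z j))"
            from this(2) show "\<Phi> \<tturnstile> (\<exists>\<^sub>o n. \<not>\<^sub>o (App (Sect \<beta> m) (Init a n) \<doteq> Zero))"
            proof (rule exE_o)
              fix \<Psi> j assume le'': "\<Phi> \<preceq> \<Psi>" and "\<Psi> \<tturnstile> lt j n \<and>\<^sub>o \<not>\<^sub>o (App a j \<doteq> App z j)"
              note le3' = extends_trans[OF le extends_trans[OF le' le'']]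
              have "\<Psi> \<tturnstile> zero_row ?two a" using differs[OF le3', of j] \<open>\<Psi> \<tturnstile> lt j n \<and>\<^sub>o _\<close> by simp
              then show "\<Psi> \<tturnstile> (\<exists>\<^sub>o n. \<not>\<^sub>o (App (Sect \<beta> m) (Init a n) \<doteq> Zero))"
                using \<beta>'[OF extends_trans[OF le2 extends_trans[OF le3 le3']]] by blast
            qed
          next
            fix \<Phi> assume le': "\<Omega> \<preceq> \<Phi>" and same: "\<Phi> \<tturnstile> (\<forall>\<^sub>o j. lt j n \<longrightarrow>\<^sub>o \<not>\<^sub>o \<not>\<^sub>o (App a j \<doteq> App z j))"
            have "\<Phi> \<tturnstile> Init z n \<doteq> Init a n"
              by (rule Init_cong, rule eq_sym_o, rule eq_dne, rule all_impE[OF forces_mono[OF _ same]])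
            then show "\<Phi> \<tturnstile> (\<exists>\<^sub>o n. \<not>\<^sub>o (App (Sect \<beta> m) (Init a n) \<doteq> Zero))"
              by (intro exI_o[of _ _ n] subst_o[where P = "\<lambda>y. \<not>\<^sub>o (App (Sect \<beta> m) y \<doteq> Zero)", OF _ _ forces_mono[OF le' n]])
                 (intro def_intros)
          qed
        qed
      qed
      then have "\<Theta> \<tturnstile> zero_row ?two a" using \<beta>'[OF extends_trans[OF le2 le3]] by blast
      then show "\<Theta> \<tturnstile> (\<exists>\<^sub>o l. zeros (Sect z l) \<and>\<^sub>o zeros (Sect a l))"
        unfolding zero_row_def by (rule ex_mono_o) (simp add: zz[OF extends_trans[OF le3]])
    qed
  qed
qed

section \<open>Finite choice and the pigeonhole principle\<close>

lemma finite_choice: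
  assumes Q: "defNN Q" and ex: "\<Gamma> \<tturnstile> (\<forall>\<^sub>o i. lt i n \<longrightarrow>\<^sub>o (\<exists>\<^sub>o j. Q i j))"
  shows "\<Gamma> \<tturnstile> (\<exists>\<^sub>o f. \<forall>\<^sub>o i. lt i n \<longrightarrow>\<^sub>o Q i (App f i))"
proof -
  note d = def_intros dfm_defNN[OF Q]
  \<comment> \<open>Witnesses are not unique, so they are collected one index at a time. The bound
    by \<open>n\<close> guarantees a witness for the new index.\<close>
  have "\<Gamma> \<tturnstile> lt n (Succ n) \<longrightarrow>\<^sub>o (\<exists>\<^sub>o f. \<forall>\<^sub>o i. lt i n \<longrightarrow>\<^sub>o Q i (App f i))"
  proof (rule induct_o[where P = "\<lambda>k. lt k (Succ n) \<longrightarrow>\<^sub>o (\<exists>\<^sub>o f. \<forall>\<^sub>o i. lt i k \<longrightarrow>\<^sub>o Q i (App f i))"], intro d)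
    show "\<Gamma> \<tturnstile> lt Zero (Succ n) \<longrightarrow>\<^sub>o (\<exists>\<^sub>o f. \<forall>\<^sub>o i. lt i Zero \<longrightarrow>\<^sub>o Q i (App f i))"
      by (rule impI_o, rule exI_o[of _ _ "SVar 0"], rule all_impI) (rule lt_ZeroE)
  next
    fix \<Delta> k assume \<Delta>: "\<Gamma> \<preceq> \<Delta>" and IH: "\<Delta> \<tturnstile> lt k (Succ n) \<longrightarrow>\<^sub>o (\<exists>\<^sub>o f. \<forall>\<^sub>o i. lt i k \<longrightarrow>\<^sub>o Q i (App f i))"
    show "\<Delta> \<tturnstile> lt (Succ k) (Succ n) \<longrightarrow>\<^sub>o (\<exists>\<^sub>o f. \<forall>\<^sub>o i. lt i (Succ k) \<longrightarrow>\<^sub>o Q i (App f i))"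
    proof (rule impI_o)
      fix \<Theta> assume le: "\<Delta> \<preceq> \<Theta>" and "\<Theta> \<tturnstile> lt (Succ k) (Succ n)"
      then have kn: "\<Theta> \<tturnstile> lt k n" by (simp add: lt_Succ_Succ)
      show "\<Theta> \<tturnstile> (\<exists>\<^sub>o f. \<forall>\<^sub>o i. lt i (Succ k) \<longrightarrow>\<^sub>o Q i (App f i))"
      proof (rule exE_o[OF mp_o[OF forces_mono[OF le IH] lt_Succ[OF kn]]])
        fix \<Theta>1 f assume le1: "\<Theta> \<preceq> \<Theta>1" and f: "\<Theta>1 \<tturnstile> (\<forall>\<^sub>o i. lt i k \<longrightarrow>\<^sub>o Q i (App f i))"
        have "\<Theta>1 \<tturnstile> (\<exists>\<^sub>o j. Q k j)"
          by (rule forces_mono[OF le1 all_impE[OF forces_mono[OF extends_trans[OF \<Delta> le] ex] kn]])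
        then show "\<Theta>1 \<tturnstile> (\<exists>\<^sub>o f. \<forall>\<^sub>o i. lt i (Succ k) \<longrightarrow>\<^sub>o Q i (App f i))"
        proof (rule exE_o)
          fix \<Theta>2 j assume le2: "\<Theta>1 \<preceq> \<Theta>2" and j: "\<Theta>2 \<tturnstile> Q k j"
          show "\<Theta>2 \<tturnstile> (\<exists>\<^sub>o f. \<forall>\<^sub>o i. lt i (Succ k) \<longrightarrow>\<^sub>o Q i (App f i))"
          proof (rule ex_mono_o[OF update_seq[of _ k j f]], rule all_impI)
            fix \<Theta>3 \<Theta>4 g i
            assume le3: "\<Theta>2 \<preceq> \<Theta>3" and g: "\<Theta>3 \<tturnstile> App g k \<doteq> j \<and>\<^sub>o (\<forall>\<^sub>o i. \<not>\<^sub>o (i \<doteq> k) \<longrightarrow>\<^sub>o App g i \<doteq> App f i)"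
              and le4: "\<Theta>3 \<preceq> \<Theta>4" and i: "\<Theta>4 \<tturnstile> lt i (Succ k)"
            note g = forces_mono[OF le4 g, unfolded forces_and]
            note le34 = extends_trans[OF le3 le4]
            from lt_SuccE[OF i] show "\<Theta>4 \<tturnstile> Q i (App g i)"
            proof (rule orE_o)
              fix \<Phi> assume le: "\<Theta>4 \<preceq> \<Phi>" and ik: "\<Phi> \<tturnstile> i \<doteq> k"
              have "\<Phi> \<tturnstile> j \<doteq> App g k" by (rule eq_sym_o[OF forces_mono[OF le g[THEN conjunct1]]])
              then have "\<Phi> \<tturnstile> Q k (App g k)"
                by (rule subst_o[where P = "\<lambda>z. Q k z", OF _ _ forces_mono[OF extends_trans[OF le34 le] j], rotated]) (intro d)
              then show "\<Phi> \<tturnstile> Q i (App g i)"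
                by (rule subst_o[where P = "\<lambda>z. Q z (App g z)", OF _ eq_sym_o[OF ik], rotated]) (intro d)
            next
              fix \<Phi> assume le: "\<Theta>4 \<preceq> \<Phi>" and ik: "\<Phi> \<tturnstile> lt i k"
              have "\<Phi> \<tturnstile> \<not>\<^sub>o (i \<doteq> k)" by (rule notI_o, rule lt_neq[OF forces_mono[OF _ ik]])
              from eq_sym_o[OF all_impE[OF forces_mono[OF le g[THEN conjunct2]] this]]
              show "\<Phi> \<tturnstile> Q i (App g i)"
                by (rule subst_o[where P = "\<lambda>z. Q i z", OF _ _ all_impE[OF forces_mono[OF extends_trans[OF le2 extends_trans[OF le34 le]] f] ik], rotated])
                   (intro d)
            qed
          qed
        qed
      qed
    qed
  qed
  then show ?thesis by (rule mp_o) (rule lt_Succ_self)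
qed

text \<open>Induction on \<open>n\<close> for all \<open>f\<close>. If the last value does not occur
  earlier, it is deleted from the range, which leaves one argument and one value less.\<close>

lemma pigeonhole_aux:
  "\<Gamma> \<tturnstile> (\<forall>\<^sub>o f. (\<forall>\<^sub>o i. lt i (Succ n) \<longrightarrow>\<^sub>o lt (App f i) n) \<longrightarrow>\<^sub>o
     (\<exists>\<^sub>o i. \<exists>\<^sub>o j. lt i j \<and>\<^sub>o lt j (Succ n) \<and>\<^sub>o App f i \<doteq> App f j))"
proof (rule induct_o[where P = "\<lambda>n. \<forall>\<^sub>o f. (\<forall>\<^sub>o i. lt i (Succ n) \<longrightarrow>\<^sub>o lt (App f i) n) \<longrightarrow>\<^sub>o
     (\<exists>\<^sub>o i. \<exists>\<^sub>o j. lt i j \<and>\<^sub>o lt j (Succ n) \<and>\<^sub>o App f i \<doteq> App f j)"], intro def_intros)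
  show "\<Gamma> \<tturnstile> (\<forall>\<^sub>o f. (\<forall>\<^sub>o i. lt i (Succ Zero) \<longrightarrow>\<^sub>o lt (App f i) Zero) \<longrightarrow>\<^sub>o
     (\<exists>\<^sub>o i. \<exists>\<^sub>o j. lt i j \<and>\<^sub>o lt j (Succ Zero) \<and>\<^sub>o App f i \<doteq> App f j))"
    by (rule all_impI, rule lt_ZeroE, erule all_impE) (rule lt_Succ_self)
next
  fix \<Delta> n assume IH: "\<Delta> \<tturnstile> (\<forall>\<^sub>o f. (\<forall>\<^sub>o i. lt i (Succ n) \<longrightarrow>\<^sub>o lt (App f i) n) \<longrightarrow>\<^sub>o
     (\<exists>\<^sub>o i. \<exists>\<^sub>o j. lt i j \<and>\<^sub>o lt j (Succ n) \<and>\<^sub>o App f i \<doteq> App f j))"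
  show "\<Delta> \<tturnstile> (\<forall>\<^sub>o f. (\<forall>\<^sub>o i. lt i (Succ (Succ n)) \<longrightarrow>\<^sub>o lt (App f i) (Succ n)) \<longrightarrow>\<^sub>o
     (\<exists>\<^sub>o i. \<exists>\<^sub>o j. lt i j \<and>\<^sub>o lt j (Succ (Succ n)) \<and>\<^sub>o App f i \<doteq> App f j))"
  proof (rule all_impI)
    fix f \<Theta> assume le: "\<Delta> \<preceq> \<Theta>" and f: "\<Theta> \<tturnstile> (\<forall>\<^sub>o i. lt i (Succ (Succ n)) \<longrightarrow>\<^sub>o lt (App f i) (Succ n))"
    let ?G = "\<exists>\<^sub>o i. \<exists>\<^sub>o j. lt i j \<and>\<^sub>o lt j (Succ (Succ n)) \<and>\<^sub>o App f i \<doteq> App f j"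
    let ?v = "App f (Succ n)"
    have v: "\<Theta> \<tturnstile> lt ?v (Succ n)" by (rule all_impE[OF f lt_Succ_self])
    \<comment> \<open>Whether the last value is repeated is decided by bounded search, which also
      names the earlier argument.\<close>
    have "\<Theta> \<tturnstile> (\<exists>\<^sub>o i. lt i (Succ n) \<and>\<^sub>o App f i \<doteq> ?v) \<or>\<^sub>o (\<forall>\<^sub>o i. lt i (Succ n) \<longrightarrow>\<^sub>o \<not>\<^sub>o (App f i \<doteq> ?v))"
      by (rule bounded_dec, intro def_intros, rule eq_dec)
    then show "\<Theta> \<tturnstile> ?G"
    proof (rule orE_o)
      fix \<Omega> assume "\<Omega> \<tturnstile> (\<exists>\<^sub>o i. lt i (Succ n) \<and>\<^sub>o App f i \<doteq> ?v)"
      then show "\<Omega> \<tturnstile> ?G"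
        by (rule ex_mono_o) (auto intro!: exI_o[of _ _ "Succ n"] lt_Succ_self)
    next
      fix \<Omega> assume \<Omega>: "\<Theta> \<preceq> \<Omega>" and neq: "\<Omega> \<tturnstile> (\<forall>\<^sub>o i. lt i (Succ n) \<longrightarrow>\<^sub>o \<not>\<^sub>o (App f i \<doteq> ?v))"
      have "\<Omega> \<tturnstile> (\<exists>\<^sub>o g. \<forall>\<^sub>o i. (lt (App f i) ?v \<longrightarrow>\<^sub>o App g i \<doteq> App f i) \<and>\<^sub>o (\<not>\<^sub>o lt (App f i) ?v \<longrightarrow>\<^sub>o App g i \<doteq> Pred (App f i)))"
        by (rule seq_if) (intro def_intros | rule dec_lt)+
      then show "\<Omega> \<tturnstile> ?G"
      proof (rule exE_o)
        fix g \<Phi> assume \<Phi>: "\<Omega> \<preceq> \<Phi>" and g: "\<Phi> \<tturnstile> (\<forall>\<^sub>o i. (lt (App f i) ?v \<longrightarrow>\<^sub>o App g i \<doteq> App f i) \<and>\<^sub>o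
          (\<not>\<^sub>o lt (App f i) ?v \<longrightarrow>\<^sub>o App g i \<doteq> Pred (App f i)))"
        note v = forces_mono[OF extends_trans[OF \<Omega> \<Phi>] v] and neq = forces_mono[OF \<Phi> neq]
          and f = forces_mono[OF extends_trans[OF \<Omega> \<Phi>] f]
        text \<open>The values of \<open>f\<close> below \<open>?v\<close> are kept by \<open>g\<close>, those above are shifted down.\<close>
        have cases: "\<Psi> \<tturnstile> G" if le': "\<Phi> \<preceq> \<Psi>" and i: "\<Psi> \<tturnstile> lt i (Succ n)"
          and below: "\<And>\<Xi>. \<Psi> \<preceq> \<Xi> \<Longrightarrow> \<Xi> \<tturnstile> lt (App f i) ?v \<Longrightarrow> \<Xi> \<tturnstile> App g i \<doteq> App f i \<Longrightarrow> \<Xi> \<tturnstile> G"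
          and above: "\<And>\<Xi>. \<Psi> \<preceq> \<Xi> \<Longrightarrow> \<Xi> \<tturnstile> lt ?v (App f i) \<Longrightarrow> \<Xi> \<tturnstile> App f i \<doteq> Succ (App g i) \<Longrightarrow> \<Xi> \<tturnstile> G"
        for \<Psi> i G
        proof (rule trichotomyE[of _ "App f i" ?v])
          fix \<Xi> assume le'': "\<Psi> \<preceq> \<Xi>" and lt: "\<Xi> \<tturnstile> lt (App f i) ?v"
          from below[OF le'' lt if1_o[OF spec_o[OF forces_mono[OF extends_trans[OF le' le''] g]] lt]] show "\<Xi> \<tturnstile> G" .
        next
          fix \<Xi> assume le'': "\<Psi> \<preceq> \<Xi>" and eq: "\<Xi> \<tturnstile> App f i \<doteq> ?v"
          show "\<Xi> \<tturnstile> G"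
            by (rule notE_o[OF all_impE[OF forces_mono[OF extends_trans[OF le' le''] neq] forces_mono[OF le'' i]] eq])
        next
          fix \<Xi> assume le'': "\<Psi> \<preceq> \<Xi>" and lt: "\<Xi> \<tturnstile> lt ?v (App f i)"
          have "\<Xi> \<tturnstile> \<not>\<^sub>o lt (App f i) ?v" by (rule notI_o, erule lt_not_gt) (rule forces_mono[OF _ lt])
          then have "\<Xi> \<tturnstile> App g i \<doteq> Pred (App f i)"
            by (rule if2_o[OF spec_o[OF forces_mono[OF extends_trans[OF le' le''] g]]])
          moreover have "\<Xi> \<tturnstile> App f i \<doteq> Succ (Pred (App f i))"
          proof (rule nonzero_Succ, rule notI_o)
            fix \<Xi>' assume le: "\<Xi> \<preceq> \<Xi>'" and "\<Xi>' \<tturnstile> App f i \<doteq> Zero"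
            from lt_cong[OF forces_mono[OF le lt] eq_refl_o this(2)] show "\<Xi>' \<tturnstile> \<bottom>\<^sub>o" by (rule lt_ZeroE)
          qed
          ultimately have "\<Xi> \<tturnstile> App f i \<doteq> Succ (App g i)" by (metis nv_eq nv_simps(1))
          from above[OF le'' lt this] show "\<Xi> \<tturnstile> G" .
        qed
        have "\<Phi> \<tturnstile> (\<forall>\<^sub>o i. lt i (Succ n) \<longrightarrow>\<^sub>o lt (App g i) n)"
        proof (rule all_impI)
          fix \<Psi> i assume le': "\<Phi> \<preceq> \<Psi>" and i: "\<Psi> \<tturnstile> lt i (Succ n)"
          then show "\<Psi> \<tturnstile> lt (App g i) n"
          proof (rule cases)
            fix \<Xi> assume le'': "\<Psi> \<preceq> \<Xi>" and "\<Xi> \<tturnstile> lt (App f i) ?v" and eq: "\<Xi> \<tturnstile> App g i \<doteq> App f i"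
            from lt_trans_Succ[OF this(2) forces_mono[OF extends_trans[OF le' le''] v]]
            show "\<Xi> \<tturnstile> lt (App g i) n" by (rule lt_cong[OF _ eq_sym_o[OF eq] eq_refl_o])
          next
            fix \<Xi> assume le'': "\<Psi> \<preceq> \<Xi>" and eq: "\<Xi> \<tturnstile> App f i \<doteq> Succ (App g i)"
            have "\<Xi> \<tturnstile> lt (App f i) (Succ n)"
              by (rule all_impE[OF forces_mono[OF extends_trans[OF le' le''] f] lt_Succ[OF forces_mono[OF le'' i]]])
            from lt_cong[OF this eq eq_refl_o] show "\<Xi> \<tturnstile> lt (App g i) n" by (simp add: lt_Succ_Succ)
          qed
        qed
        from all_impE[OF forces_mono[OF extends_trans[OF le extends_trans[OF \<Omega> \<Phi>]] IH] this]
        show "\<Phi> \<tturnstile> ?G"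
        proof (rule ex_mono_o, elim ex_mono_o)
          fix i j \<Psi>1 \<Psi> assume le': "\<Phi> \<preceq> \<Psi>1" "\<Psi>1 \<preceq> \<Psi>" and "\<Psi> \<tturnstile> lt i j \<and>\<^sub>o lt j (Succ n) \<and>\<^sub>o App g i \<doteq> App g j"
          then have ij: "\<Psi> \<tturnstile> lt i j" and j: "\<Psi> \<tturnstile> lt j (Succ n)" and eq: "\<Psi> \<tturnstile> App g i \<doteq> App g j" by simp_all
          note le' = extends_trans[OF le']
          have i: "\<Psi> \<tturnstile> lt i (Succ n)" by (rule lt_trans[OF ij j])
          \<comment> \<open>A kept and a shifted value cannot collide:
            \<open>f(i) = g(i) = g(j)\<close> would lie below \<open>?v\<close>, while
            \<open>f(j) = g(j) + 1\<close> lies above it.\<close>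
          have mixed: "\<Xi> \<tturnstile> G" if "\<Xi> \<tturnstile> lt (App f i) ?v" "\<Xi> \<tturnstile> App g i \<doteq> App f i"
            "\<Xi> \<tturnstile> lt ?v (App f j)" "\<Xi> \<tturnstile> App f j \<doteq> Succ (App g j)" "\<Xi> \<tturnstile> App g i \<doteq> App g j" for \<Xi> G i j
            by (rule lt_asym[OF that(1) lt_cong[OF that(3) eq_refl_o]]) (use that in \<open>simp add: nv_eq nv_simps(1)\<close>)
          have "\<Psi> \<tturnstile> App f i \<doteq> App f j"
          proof (rule cases[OF le' i])
            fix \<Xi> assume \<Xi>: "\<Psi> \<preceq> \<Xi>" and lt_i: "\<Xi> \<tturnstile> lt (App f i) ?v" and eq_i: "\<Xi> \<tturnstile> App g i \<doteq> App f i"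
            show "\<Xi> \<tturnstile> App f i \<doteq> App f j"
            proof (rule cases[OF extends_trans[OF le' \<Xi>] forces_mono[OF \<Xi> j]])
              fix \<Xi>' assume le: "\<Xi> \<preceq> \<Xi>'" and "\<Xi>' \<tturnstile> App g j \<doteq> App f j"
              with forces_mono[OF le eq_i] forces_mono[OF extends_trans[OF \<Xi> le] eq] show "\<Xi>' \<tturnstile> App f i \<doteq> App f j"
                by (metis nv_eq)
            next
              fix \<Xi>' assume le: "\<Xi> \<preceq> \<Xi>'" and "\<Xi>' \<tturnstile> lt ?v (App f j)" "\<Xi>' \<tturnstile> App f j \<doteq> Succ (App g j)"
              from mixed[OF forces_mono[OF le lt_i] forces_mono[OF le eq_i] this(2,3) forces_mono[OF extends_trans[OF \<Xi> le] eq]]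
              show "\<Xi>' \<tturnstile> App f i \<doteq> App f j" .
            qed
          next
            fix \<Xi> assume \<Xi>: "\<Psi> \<preceq> \<Xi>" and lt_i: "\<Xi> \<tturnstile> lt ?v (App f i)" and eq_i: "\<Xi> \<tturnstile> App f i \<doteq> Succ (App g i)"
            show "\<Xi> \<tturnstile> App f i \<doteq> App f j"
            proof (rule cases[OF extends_trans[OF le' \<Xi>] forces_mono[OF \<Xi> j]])
              fix \<Xi>' assume le: "\<Xi> \<preceq> \<Xi>'" and "\<Xi>' \<tturnstile> lt (App f j) ?v" "\<Xi>' \<tturnstile> App g j \<doteq> App f j"
              from mixed[OF this(2,3) forces_mono[OF le lt_i] forces_mono[OF le eq_i] eq_sym_o[OF forces_mono[OF extends_trans[OF \<Xi> le] eq]]]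
              show "\<Xi>' \<tturnstile> App f i \<doteq> App f j" .
            next
              fix \<Xi>' assume le: "\<Xi> \<preceq> \<Xi>'" and "\<Xi>' \<tturnstile> App f j \<doteq> Succ (App g j)"
              with forces_mono[OF le eq_i] forces_mono[OF extends_trans[OF \<Xi> le] eq] show "\<Xi>' \<tturnstile> App f i \<doteq> App f j"
                by (metis nv_eq nv_simps(1))
            qed
          qed
          with ij j show "\<Psi> \<tturnstile> lt i j \<and>\<^sub>o lt j (Succ (Succ n)) \<and>\<^sub>o App f i \<doteq> App f j" by (simp add: lt_Succ)
        qed
      qed
    qed
  qed
qed

lemma pigeonhole:
  "\<Gamma> \<tturnstile> (\<forall>\<^sub>o i. lt i (Succ n) \<longrightarrow>\<^sub>o lt (App f i) n) \<Longrightarrow>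
   \<Gamma> \<tturnstile> (\<exists>\<^sub>o i. \<exists>\<^sub>o j. lt i j \<and>\<^sub>o lt j (Succ n) \<and>\<^sub>o App f i \<doteq> App f j)"
  by (rule all_impE[OF pigeonhole_aux])

text \<open>Every position is \<open>idx s l\<close> for unique \<open>s\<close> and
  \<open>l\<close>, so the question is whether \<open>l\<close> equals \<open>i\<close>.\<close>

lemma dec_row: "\<Gamma> \<tturnstile> (\<exists>\<^sub>o m. p \<doteq> idx m i) \<or>\<^sub>o \<not>\<^sub>o (\<exists>\<^sub>o m. p \<doteq> idx m i)"
proof (rule exE_o[OF idx_surj[of _ p]], elim exE_o)
  fix s l \<Delta>1 \<Delta> assume p: "\<Delta> \<tturnstile> p \<doteq> idx s l"
  show "\<Delta> \<tturnstile> (\<exists>\<^sub>o m. p \<doteq> idx m i) \<or>\<^sub>o \<not>\<^sub>o (\<exists>\<^sub>o m. p \<doteq> idx m i)"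
  proof (rule or_mono_o[OF eq_dec[of _ l i]])
    fix \<Theta> assume "\<Delta> \<preceq> \<Theta>" "\<Theta> \<tturnstile> l \<doteq> i"
    with forces_mono[OF this(1) p] show "\<Theta> \<tturnstile> (\<exists>\<^sub>o m. p \<doteq> idx m i)"
      by (intro exI_o[of _ _ s]) (simp add: nv_eq nv_simps)
  next
    fix \<Theta> assume le: "\<Delta> \<preceq> \<Theta>" and neq: "\<Theta> \<tturnstile> \<not>\<^sub>o (l \<doteq> i)"
    show "\<Theta> \<tturnstile> \<not>\<^sub>o (\<exists>\<^sub>o m. p \<doteq> idx m i)"
    proof (rule notI_o, erule exE_o)
      fix m \<Omega>1 \<Omega> assume le': "\<Theta> \<preceq> \<Omega>1" "\<Omega>1 \<preceq> \<Omega>" and "\<Omega> \<tturnstile> p \<doteq> idx m i"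
      with forces_mono[OF extends_trans[OF le extends_trans[OF le']] p] have "\<Omega> \<tturnstile> idx s l \<doteq> idx m i" by (metis nv_eq)
      then show "\<Omega> \<tturnstile> \<bottom>\<^sub>o" by (rule notE_o[OF forces_mono[OF extends_trans[OF le'] neq] idx_inj(2)])
    qed
  qed
qed

text \<open>The radius \<open>k\<close> of the neighbourhood is quantified inside, so that this is a
  property of the two row numbers alone, to which finite choice and the pigeonhole principle
  apply.\<close>

definition selects :: "stm \<Rightarrow> ntm \<Rightarrow> ntm \<Rightarrow> tv" where
  "selects \<phi> i j = (\<exists>\<^sub>o k. \<forall>\<^sub>o a. (\<forall>\<^sub>o q. lt q k \<longrightarrow>\<^sub>o App a q \<doteq> Zero) \<longrightarrow>\<^sub>o zeros (Sect a i) \<longrightarrow>\<^sub>o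
     (\<exists>\<^sub>o c. im_is \<phi> a c \<and>\<^sub>o zeros (Sect c j)))"

lemma dfm_selects: "dnt n s T \<Longrightarrow> dnt n s U \<Longrightarrow> dfm n s (\<lambda>f g. selects \<phi> (T f g) (U f g))"
  unfolding selects_def by (intro def_intros dnt_shiftN dnt_shiftS)

text \<open>Erasing row \<open>i\<close> maps every \<open>g\<close> into the domain of the
  reduction, so its image has a vanishing row, and near zero the continuity principle fixes the
  number of that row. A sequence whose row \<open>i\<close> already vanishes is not changed by the
  erasure.\<close>

lemma selects_exists:
  assumes bcp: "\<Gamma> \<tturnstile> continuity" and c: "\<Gamma> \<tturnstile> codes \<phi>"
    and \<phi>: "\<Gamma> \<tturnstile> (\<forall>\<^sub>o a. \<forall>\<^sub>o c. im_is \<phi> a c \<longrightarrow>\<^sub>o zero_row (Succ n) a \<longleftrightarrow>\<^sub>o zero_row n c)"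
    and i: "\<Gamma> \<tturnstile> lt i (Succ n)"
  shows "\<Gamma> \<tturnstile> (\<exists>\<^sub>o j. lt j n \<and>\<^sub>o selects \<phi> i j)"
proof -
  let ?D = "\<lambda>p. \<exists>\<^sub>o m. p \<doteq> idx m i"
  let ?r = "\<lambda>g a. \<forall>\<^sub>o p. (?D p \<longrightarrow>\<^sub>o App a p \<doteq> Zero) \<and>\<^sub>o (\<not>\<^sub>o ?D p \<longrightarrow>\<^sub>o App a p \<doteq> App g p)"
  let ?P = "\<lambda>g j. lt j n \<and>\<^sub>o (\<exists>\<^sub>o a. ?r g a \<and>\<^sub>o (\<exists>\<^sub>o c. im_is \<phi> a c \<and>\<^sub>o zeros (Sect c j)))"
  have tot: "\<Gamma> \<tturnstile> (\<forall>\<^sub>o g. \<exists>\<^sub>o j. ?P g j)"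
    unfolding forces_all
  proof
    fix g
    have "\<Gamma> \<tturnstile> (\<exists>\<^sub>o a. ?r g a)" by (rule seq_if) (intro def_intros | rule dec_row)+
    then show "\<Gamma> \<tturnstile> (\<exists>\<^sub>o j. ?P g j)"
    proof (rule exE_o)
      fix \<Delta> a assume le: "\<Gamma> \<preceq> \<Delta>" and a: "\<Delta> \<tturnstile> ?r g a"
      have "\<Delta> \<tturnstile> App a (idx m i) \<doteq> Zero" for m
        by (rule if1_o[OF spec_o[OF a]]) (rule exI_o[of _ _ m], rule eq_refl_o)
      then have zr: "\<Delta> \<tturnstile> zero_row (Succ n) a"
        unfolding zero_row_def using forces_mono[OF le i] by (intro exI_o[of _ _ i]) (simp add: zeros_Sect)
      show "\<Delta> \<tturnstile> (\<exists>\<^sub>o j. ?P g j)"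
      proof (rule exE_o[OF im_exists[OF forces_mono[OF le c[unfolded codes_def]], of a]])
        fix c \<Theta> assume le': "\<Delta> \<preceq> \<Theta>" and im: "\<Theta> \<tturnstile> im_is \<phi> a c"
        have "\<Theta> \<tturnstile> zero_row n c"
          by (rule iffD1_o[OF mp_o[OF spec_o[OF spec_o[OF forces_mono[OF extends_trans[OF le le'] \<phi>]]] im] forces_mono[OF le' zr]])
        then show "\<Theta> \<tturnstile> (\<exists>\<^sub>o j. ?P g j)"
          unfolding zero_row_def
        proof (rule ex_mono_o)
          fix j \<Omega> assume le: "\<Theta> \<preceq> \<Omega>" and j: "\<Omega> \<tturnstile> lt j n \<and>\<^sub>o zeros (Sect c j)"
          then have "\<Omega> \<tturnstile> (\<exists>\<^sub>o c. im_is \<phi> a c \<and>\<^sub>o zeros (Sect c j))"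
            using forces_mono[OF le im] by (intro exI_o[of _ _ c]) simp
          then have "\<Omega> \<tturnstile> (\<exists>\<^sub>o a. ?r g a \<and>\<^sub>o (\<exists>\<^sub>o c. im_is \<phi> a c \<and>\<^sub>o zeros (Sect c j)))"
            using forces_mono[OF extends_trans[OF le' le] a] by (intro exI_o[of _ _ a]) (simp only: forces_and)
          with j show "\<Omega> \<tturnstile> ?P g j" by (simp only: forces_and)
        qed
      qed
    qed
  qed
  have "\<Gamma> \<tturnstile> (\<exists>\<^sub>o k. \<exists>\<^sub>o j. \<forall>\<^sub>o g. (\<forall>\<^sub>o q. lt q k \<longrightarrow>\<^sub>o App g q \<doteq> Zero) \<longrightarrow>\<^sub>o ?P g j)"
    by (rule continuity_at_zero[OF bcp _ tot]) (intro def_intros)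
  then show ?thesis
  proof (rule exE_o, elim ex_mono_o)
    fix k j \<Delta>1 \<Delta> assume P: "\<Delta> \<tturnstile> (\<forall>\<^sub>o g. (\<forall>\<^sub>o q. lt q k \<longrightarrow>\<^sub>o App g q \<doteq> Zero) \<longrightarrow>\<^sub>o ?P g j)"
    \<comment> \<open>The bound on \<open>j\<close> is stated for each \<open>g\<close> near zero;
      the zero sequence is one of them.\<close>
    have "\<Delta> \<tturnstile> lt j n"
    proof (rule exE_o[OF zero_seq])
      fix z \<Theta> assume le: "\<Delta> \<preceq> \<Theta>" and z: "\<Theta> \<tturnstile> (\<forall>\<^sub>o n. App z n \<doteq> Zero)"
      have "\<Theta> \<tturnstile> (\<forall>\<^sub>o q. lt q k \<longrightarrow>\<^sub>o App z q \<doteq> Zero)" by (rule all_impI) (rule spec_o[OF forces_mono[OF _ z]])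
      from all_impE[OF forces_mono[OF le P] this] show "\<Theta> \<tturnstile> lt j n" by (simp only: forces_and)
    qed
    moreover have "\<Delta> \<tturnstile> selects \<phi> i j"
      unfolding selects_def
    proof (rule exI_o[of _ _ k], rule all_impI, rule impI_o)
      fix g \<Theta>1 \<Theta> assume le: "\<Delta> \<preceq> \<Theta>1" "\<Theta>1 \<preceq> \<Theta>" and near: "\<Theta>1 \<tturnstile> (\<forall>\<^sub>o q. lt q k \<longrightarrow>\<^sub>o App g q \<doteq> Zero)"
        and gi: "\<Theta> \<tturnstile> zeros (Sect g i)"
      have "\<Theta> \<tturnstile> (\<exists>\<^sub>o a. ?r g a \<and>\<^sub>o (\<exists>\<^sub>o c. im_is \<phi> a c \<and>\<^sub>o zeros (Sect c j)))"
        using forces_mono[OF le(2) all_impE[OF forces_mono[OF le(1) P] near]] by (simp only: forces_and)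
      then show "\<Theta> \<tturnstile> (\<exists>\<^sub>o c. im_is \<phi> g c \<and>\<^sub>o zeros (Sect c j))"
      proof (rule exE_o)
        fix a \<Omega> assume le: "\<Theta> \<preceq> \<Omega>" and "\<Omega> \<tturnstile> ?r g a \<and>\<^sub>o (\<exists>\<^sub>o c. im_is \<phi> a c \<and>\<^sub>o zeros (Sect c j))"
        then have r: "\<Omega> \<tturnstile> ?r g a" and ex: "\<Omega> \<tturnstile> (\<exists>\<^sub>o c. im_is \<phi> a c \<and>\<^sub>o zeros (Sect c j))" unfolding forces_and by blast+
        \<comment> \<open>The erased sequence \<open>a\<close> coincides with \<open>g\<close>, so
          the image found for \<open>a\<close> is an image of \<open>g\<close>.\<close>
        have "\<Omega> \<tturnstile> App a p \<doteq> App g p" for p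
        proof (rule orE_o[OF dec_row[of _ p i]])
          fix \<Phi> assume le': "\<Omega> \<preceq> \<Phi>" and D: "\<Phi> \<tturnstile> ?D p"
          have "\<Phi> \<tturnstile> App a p \<doteq> Zero" by (rule if1_o[OF spec_o[OF forces_mono[OF le' r]] D])
          moreover from D have "\<Phi> \<tturnstile> App g p \<doteq> Zero"
          proof (rule exE_o)
            fix m \<Psi> assume le'': "\<Phi> \<preceq> \<Psi>" and "\<Psi> \<tturnstile> p \<doteq> idx m i"
            moreover have "\<Psi> \<tturnstile> App g (idx m i) \<doteq> Zero"
              using forces_mono[OF extends_trans[OF le extends_trans[OF le' le'']] gi] by (simp add: zeros_Sect)
            ultimately show "\<Psi> \<tturnstile> App g p \<doteq> Zero" by (simp add: nv_eq nv_simps(3))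
          qed
          ultimately show "\<Phi> \<tturnstile> App a p \<doteq> App g p" by (simp add: nv_eq)
        next
          fix \<Phi> assume le': "\<Omega> \<preceq> \<Phi>" and D: "\<Phi> \<tturnstile> \<not>\<^sub>o ?D p"
          show "\<Phi> \<tturnstile> App a p \<doteq> App g p" by (rule if2_o[OF spec_o[OF forces_mono[OF le' r]] D])
        qed
        then show "\<Omega> \<tturnstile> (\<exists>\<^sub>o c. im_is \<phi> g c \<and>\<^sub>o zeros (Sect c j))"
          by (rule substS_o[where P = "\<lambda>a. \<exists>\<^sub>o c. im_is \<phi> a c \<and>\<^sub>o zeros (Sect c j)", OF _ _ ex, rotated]) (intro def_intros)
      qed
    qed
    ultimately show "\<Delta> \<tturnstile> lt j n \<and>\<^sub>o selects \<phi> i j" by simp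
  qed
qed

text \<open>Let \<open>b\<close> vanish below \<open>K\<close> and in the rows \<open>i\<close> and \<open>i'\<close> only. If \<open>\<phi>\<close> selects the same row for both,
  it maps every sequence with a spike on top of \<open>b\<close> into \<open>zero_row n\<close>: otherwise neither of the two rows
  could vanish, but the spike spoils only one of them.\<close>

lemma selects_distinct:
  assumes bcp: "\<Gamma> \<tturnstile> continuity" and c: "\<Gamma> \<tturnstile> codes \<phi>"
    and \<phi>: "\<Gamma> \<tturnstile> (\<forall>\<^sub>o a. \<forall>\<^sub>o c. im_is \<phi> a c \<longrightarrow>\<^sub>o zero_row (Succ n) a \<longleftrightarrow>\<^sub>o zero_row n c)"
    and ii: "\<Gamma> \<tturnstile> lt i i'" and j: "\<Gamma> \<tturnstile> lt j n"
    and sel: "\<Gamma> \<tturnstile> selects \<phi> i j" and sel': "\<Gamma> \<tturnstile> selects \<phi> i' j"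
  shows "\<Gamma> \<tturnstile> \<bottom>\<^sub>o"
proof (rule exE_o[OF sel[unfolded selects_def]], rule exE_o[OF forces_mono[OF _ sel'[unfolded selects_def]]], assumption)
  let ?near = "\<lambda>k a. \<forall>\<^sub>o q. lt q k \<longrightarrow>\<^sub>o App a q \<doteq> Zero"
  let ?im = "\<lambda>a. \<exists>\<^sub>o c. im_is \<phi> a c \<and>\<^sub>o zeros (Sect c j)"
  fix k k' \<Delta>1 \<Delta>2 assume le1: "\<Gamma> \<preceq> \<Delta>1" and le2: "\<Delta>1 \<preceq> \<Delta>2"
    and k: "\<Delta>1 \<tturnstile> (\<forall>\<^sub>o a. ?near k a \<longrightarrow>\<^sub>o zeros (Sect a i) \<longrightarrow>\<^sub>o ?im a)"
    and k': "\<Delta>2 \<tturnstile> (\<forall>\<^sub>o a. ?near k' a \<longrightarrow>\<^sub>o zeros (Sect a i') \<longrightarrow>\<^sub>o ?im a)"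
  \<comment> \<open>A common radius: sequences that vanish below \<open>?K\<close> lie in both
    neighbourhoods.\<close>
  let ?K = "Add k k'"
  \<comment> \<open>\<open>b\<close> is 1 at the places from \<open>?K\<close> on that lie outside
    of the rows \<open>i\<close> and \<open>i'\<close>, and 0 elsewhere. All other rows contain
    infinitely many ones, so a single change cannot make one of them vanish.\<close>
  let ?D = "\<lambda>p. lt ?K (Succ p) \<and>\<^sub>o \<not>\<^sub>o (\<exists>\<^sub>o m. p \<doteq> idx m i) \<and>\<^sub>o \<not>\<^sub>o (\<exists>\<^sub>o m. p \<doteq> idx m i')"
  have "\<Delta>2 \<tturnstile> (\<exists>\<^sub>o b. \<forall>\<^sub>o p. (?D p \<longrightarrow>\<^sub>o App b p \<doteq> Succ Zero) \<and>\<^sub>o (\<not>\<^sub>o ?D p \<longrightarrow>\<^sub>o App b p \<doteq> Zero))"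
    by (rule seq_if) (intro def_intros | rule dec_and dec_lt dec_not dec_row)+
  then show "\<Delta>2 \<tturnstile> \<bottom>\<^sub>o"
  proof (rule exE_o)
    fix b \<Delta> assume le3: "\<Delta>2 \<preceq> \<Delta>"
      and b: "\<Delta> \<tturnstile> (\<forall>\<^sub>o p. (?D p \<longrightarrow>\<^sub>o App b p \<doteq> Succ Zero) \<and>\<^sub>o (\<not>\<^sub>o ?D p \<longrightarrow>\<^sub>o App b p \<doteq> Zero))"
    note le\<Gamma> = extends_trans[OF le1 extends_trans[OF le2 le3]]
    note k = forces_mono[OF extends_trans[OF le2 le3] k] and k' = forces_mono[OF le3 k']
    note up = forces_mono[OF le\<Gamma>]
    note ii = up[OF ii] and j = up[OF j] and bcp = up[OF bcp] and c = up[OF c] and \<phi> = up[OF \<phi>]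
    have b0: "\<Theta> \<tturnstile> App b p \<doteq> Zero" if "\<Delta> \<preceq> \<Theta>" "\<Theta> \<tturnstile> \<not>\<^sub>o ?D p" for \<Theta> p
      by (rule if2_o[OF spec_o[OF forces_mono[OF that(1) b]] that(2)])
    have bi: "\<Theta> \<tturnstile> App b (idx m i) \<doteq> Zero" if "\<Delta> \<preceq> \<Theta>" for \<Theta> m
      by (rule b0[OF that], rule notI_o, rule notE_o[of _ "\<exists>\<^sub>o m'. idx m i \<doteq> idx m' i"])
         (simp_all add: exI_o[of _ _ m])
    have bi': "\<Theta> \<tturnstile> App b (idx m i') \<doteq> Zero" if "\<Delta> \<preceq> \<Theta>" for \<Theta> m
      by (rule b0[OF that], rule notI_o, rule notE_o[of _ "\<exists>\<^sub>o m'. idx m i' \<doteq> idx m' i'"])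
         (simp_all add: exI_o[of _ _ m])
    have b_low: "\<Theta> \<tturnstile> App b p \<doteq> Zero" if le: "\<Delta> \<preceq> \<Theta>" and p: "\<Theta> \<tturnstile> lt p ?K" for \<Theta> p
    proof (rule b0[OF le], rule notI_o)
      fix \<Omega> assume le: "\<Theta> \<preceq> \<Omega>" and "\<Omega> \<tturnstile> ?D p"
      then show "\<Omega> \<tturnstile> \<bottom>\<^sub>o" by - (rule lt_asym[OF forces_mono[OF le p]], simp)
    qed
    have neq_rows: "\<Theta> \<tturnstile> G" if "\<Delta> \<preceq> \<Theta>" "\<Theta> \<tturnstile> idx m i \<doteq> idx m' i'" for \<Theta> m m' G
      by (rule lt_neq[OF forces_mono[OF that(1) ii] idx_inj(2)[OF that(2)]])
    show "\<Delta> \<tturnstile> \<bottom>\<^sub>o"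
    proof (rule no_spike_choice[OF bcp, of b ?K], rule all_impI)
      fix a \<Theta> assume le: "\<Delta> \<preceq> \<Theta>" and sp: "\<Theta> \<tturnstile> spike b ?K a"
      have low: "\<Omega> \<tturnstile> App a p \<doteq> Zero" if le': "\<Theta> \<preceq> \<Omega>" and p: "\<Omega> \<tturnstile> lt p ?K" for \<Omega> p
      proof (rule eq_trans_o[OF _ b_low[OF extends_trans[OF le le'] p]], rule eq_dne, rule notI_o)
        fix \<Phi> assume le'': "\<Omega> \<preceq> \<Phi>" and "\<Phi> \<tturnstile> \<not>\<^sub>o (App a p \<doteq> App b p)"
        from spikeD(1)[OF forces_mono[OF extends_trans[OF le' le''] sp] this(2)] show "\<Phi> \<tturnstile> \<bottom>\<^sub>o"
          by (rule lt_asym[OF forces_mono[OF le'' p]])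
      qed
      have near: "\<Omega> \<tturnstile> ?near k a" if le': "\<Theta> \<preceq> \<Omega>" for \<Omega>
      proof (rule all_impI)
        fix q \<Phi> assume le'': "\<Omega> \<preceq> \<Phi>" and "\<Phi> \<tturnstile> lt q k"
        from lt_trans_Succ[OF this(2) lt_Add] show "\<Phi> \<tturnstile> App a q \<doteq> Zero"
          by (rule low[OF extends_trans[OF le' le'']])
      qed
      have near': "\<Omega> \<tturnstile> ?near k' a" if le': "\<Theta> \<preceq> \<Omega>" for \<Omega>
      proof (rule all_impI)
        fix q \<Phi> assume le'': "\<Omega> \<preceq> \<Phi>" and q: "\<Phi> \<tturnstile> lt q k'"
        have "\<Phi> \<tturnstile> lt k' (Succ ?K)" by (rule lt_cong[OF lt_Add[of _ k' k]]) (simp_all add: nv_eq nv_simps nv_Add_commute)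
        from lt_trans_Succ[OF q this] show "\<Phi> \<tturnstile> App a q \<doteq> Zero" by (rule low[OF extends_trans[OF le' le'']])
      qed
      have "\<Theta> \<tturnstile> zero_row (Succ n) a"
      proof (rule exE_o[OF im_exists[OF forces_mono[OF le c[unfolded codes_def]], of a]])
        fix d \<Omega> assume le': "\<Theta> \<preceq> \<Omega>" and d: "\<Omega> \<tturnstile> im_is \<phi> a d"
        have "\<Omega> \<tturnstile> App d (idx m j) \<doteq> Zero" for m
        \<comment> \<open>Stability of equality permits a refutation here; this avoids a decision
          which of the rows \<open>i\<close> and \<open>i'\<close> of \<open>a\<close>
          vanishes.\<close>
        proof (rule eq_dne, rule notI_o)
          fix \<Phi> assume le'': "\<Omega> \<preceq> \<Phi>" and neq: "\<Phi> \<tturnstile> \<not>\<^sub>o (App d (idx m j) \<doteq> Zero)"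
          note le\<Phi> = extends_trans[OF le' le'']
          have no_im: "\<Psi> \<tturnstile> G" if le: "\<Phi> \<preceq> \<Psi>" and "\<Psi> \<tturnstile> ?im a" for \<Psi> G
            using that(2)
          proof (rule exE_o)
            fix d' \<Psi>' assume le''': "\<Psi> \<preceq> \<Psi>'" and "\<Psi>' \<tturnstile> im_is \<phi> a d' \<and>\<^sub>o zeros (Sect d' j)"
            then have "\<Psi>' \<tturnstile> im_is \<phi> a d'" and z: "\<Psi>' \<tturnstile> App d' (idx m j) \<doteq> Zero" by (simp_all add: zeros_Sect)
            note im_unique[OF forces_mono[OF extends_trans[OF le'' extends_trans[OF le le''']] d] this(1), of "idx m j"]
            from eq_trans_o[OF this z] show "\<Psi>' \<tturnstile> G" by (rule notE_o[OF forces_mono[OF extends_trans[OF le le'''] neq]])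
          qed
          have no': "\<Psi> \<tturnstile> G" if "\<Phi> \<preceq> \<Psi>" "\<Psi> \<tturnstile> zeros (Sect a i')" for \<Psi> G
            by (rule no_im[OF that(1)], rule mp_o[OF mp_o[OF spec_o[OF forces_mono[OF _ k']] near'] that(2)])
               (blast intro: extends_trans le le\<Phi> that(1))+
          \<comment> \<open>A non-zero entry in row \<open>i\<close> would be the only place where
            \<open>a\<close> differs from \<open>b\<close>. Then row \<open>i'\<close> of
            \<open>a\<close> would vanish like that of \<open>b\<close>, which \<open>no'\<close>
            excludes.\<close>
          have "\<Phi> \<tturnstile> zeros (Sect a i)"
            unfolding zeros_Sect
          proof (intro allI eq_dne notI_o)
            fix m1 \<Psi> assume le4: "\<Phi> \<preceq> \<Psi>" and neq1: "\<Psi> \<tturnstile> \<not>\<^sub>o (App a (idx m1 i) \<doteq> Zero)"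
            note le5 = extends_trans[OF le\<Phi> le4]
            have neq1': "\<Psi> \<tturnstile> \<not>\<^sub>o (App a (idx m1 i) \<doteq> App b (idx m1 i))"
              by (rule neq_mono_o[OF neq1]) (erule eq_trans_o, rule bi, blast intro: extends_trans le le5)
            have "\<Psi> \<tturnstile> zeros (Sect a i')"
              unfolding zeros_Sect
            proof
              fix m2
              show "\<Psi> \<tturnstile> App a (idx m2 i') \<doteq> Zero"
              proof (rule eq_trans_o[OF _ bi'[OF extends_trans[OF le le5]]], rule eq_dne, rule notI_o)
                fix \<Xi> assume le6: "\<Psi> \<preceq> \<Xi>" and "\<Xi> \<tturnstile> \<not>\<^sub>o (App a (idx m2 i') \<doteq> App b (idx m2 i'))"
                from spikeD(2)[OF forces_mono[OF extends_trans[OF le5 le6] sp] forces_mono[OF le6 neq1'] this(2)]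
                show "\<Xi> \<tturnstile> \<bottom>\<^sub>o" by (rule neq_rows[OF extends_trans[OF le extends_trans[OF le5 le6]]])
              qed
            qed
            then show "\<Psi> \<tturnstile> \<bottom>\<^sub>o" by (rule no'[OF le4])
          qed
          then show "\<Phi> \<tturnstile> \<bottom>\<^sub>o"
            by (rule no_im[OF extends_refl mp_o[OF mp_o[OF spec_o[OF forces_mono[OF extends_trans[OF le le\<Phi>] k]] near[OF le\<Phi>]]]])
        qed
        then have "\<Omega> \<tturnstile> zero_row n d"
          unfolding zero_row_def using forces_mono[OF extends_trans[OF le le'] j] by (intro exI_o[of _ _ j]) (simp add: zeros_Sect)
        then show "\<Omega> \<tturnstile> zero_row (Succ n) a"
          by (rule iffD2_o[OF mp_o[OF spec_o[OF spec_o[OF forces_mono[OF extends_trans[OF le le'] \<phi>]]] d]])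
      qed
      then show "\<Theta> \<tturnstile> (\<exists>\<^sub>o l. zeros (Sect b l) \<and>\<^sub>o zeros (Sect a l))"
        unfolding zero_row_def
      proof (rule ex_mono_o)
        fix l \<Omega> assume le': "\<Theta> \<preceq> \<Omega>" and "\<Omega> \<tturnstile> lt l (Succ n) \<and>\<^sub>o zeros (Sect a l)"
        then have a: "\<Omega> \<tturnstile> zeros (Sect a l)" by simp
        \<comment> \<open>The reduction has produced a vanishing row \<open>l\<close> of
          \<open>a\<close>. Either it is \<open>i\<close> or \<open>i'\<close>, where
          \<open>b\<close> vanishes too, or it leads to a contradiction.\<close>
        have "\<Omega> \<tturnstile> zeros (Sect b l)"
        proof (rule orE_o[OF eq_dec[of _ l i]])
          fix \<Phi> assume le'': "\<Omega> \<preceq> \<Phi>" and "\<Phi> \<tturnstile> l \<doteq> i"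
          with bi[OF extends_trans[OF le extends_trans[OF le' le'']]] show "\<Phi> \<tturnstile> zeros (Sect b l)"
            by (simp add: zeros_Sect nv_eq nv_simps)
        next
          fix \<Phi> assume le'': "\<Omega> \<preceq> \<Phi>" and li: "\<Phi> \<tturnstile> \<not>\<^sub>o (l \<doteq> i)"
          show "\<Phi> \<tturnstile> zeros (Sect b l)"
          proof (rule orE_o[OF eq_dec[of _ l i']])
            fix \<Psi> assume le''': "\<Phi> \<preceq> \<Psi>" and "\<Psi> \<tturnstile> l \<doteq> i'"
            with bi'[OF extends_trans[OF le extends_trans[OF le' extends_trans[OF le'' le''']]]] show "\<Psi> \<tturnstile> zeros (Sect b l)"
              by (simp add: zeros_Sect nv_eq nv_simps)
          next
            fix \<Psi> assume le''': "\<Phi> \<preceq> \<Psi>" and li': "\<Psi> \<tturnstile> \<not>\<^sub>o (l \<doteq> i')"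
            note le4 = extends_trans[OF le' extends_trans[OF le'' le''']]
            have no_row: "\<Psi> \<tturnstile> \<not>\<^sub>o (\<exists>\<^sub>o m'. idx m l \<doteq> idx m' i)" for m
              by (rule notI_o, erule exE_o, rule notE_o[OF forces_mono[OF extends_trans[OF le''' extends_trans] li]])
                 (assumption+, rule idx_inj(2))
            have no_row': "\<Psi> \<tturnstile> \<not>\<^sub>o (\<exists>\<^sub>o m'. idx m l \<doteq> idx m' i')" for m
              by (rule notI_o, erule exE_o, rule notE_o[OF forces_mono[OF extends_trans li']])
                 (assumption+, rule idx_inj(2))
            have spike: "\<Psi> \<tturnstile> \<not>\<^sub>o (App a (idx m l) \<doteq> App b (idx m l))" if "\<Psi> \<tturnstile> lt ?K (Succ (idx m l))" for m
            proof (rule notI_o)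
              have "\<Psi> \<tturnstile> ?D (idx m l)" using that no_row no_row' by simp
              then have b1: "\<Psi> \<tturnstile> App b (idx m l) \<doteq> Succ Zero"
                by (rule if1_o[OF spec_o[OF forces_mono[OF extends_trans[OF le le4] b]]])
              fix \<Xi> assume \<Xi>: "\<Psi> \<preceq> \<Xi>" and "\<Xi> \<tturnstile> App a (idx m l) \<doteq> App b (idx m l)"
              moreover have "\<Xi> \<tturnstile> App a (idx m l) \<doteq> Zero"
                using forces_mono[OF extends_trans[OF le'' extends_trans[OF le''' \<Xi>]] a] by (simp add: zeros_Sect)
              ultimately show "\<Xi> \<tturnstile> \<bottom>\<^sub>o" using forces_mono[OF \<Xi> b1]
                by - (rule Succ_neq_Zero[of _ Zero], simp add: nv_eq)
            qed
            \<comment> \<open>In any other row, entries \<open>?K\<close> and \<open>?K + 1\<close>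
              sit at positions not below \<open>?K\<close>, where \<open>b\<close> is 1. Both would
              be places of difference, but there is at most one.\<close>
            have "\<Psi> \<tturnstile> idx ?K l \<doteq> idx (Succ ?K) l"
              by (intro spikeD(2)[OF forces_mono[OF le4 sp]] spike lt_idx lt_trans[OF lt_Succ_self lt_idx])
            from idx_inj(1)[OF this] show "\<Psi> \<tturnstile> zeros (Sect b l)" by (rule lt_neq[OF lt_Succ_self])
          qed
        qed
        with a show "\<Omega> \<tturnstile> zeros (Sect b l) \<and>\<^sub>o zeros (Sect a l)" by simp
      qed
    qed
  qed
qed

lemma zero_row_not_red:
  assumes bcp: "\<Gamma> \<tturnstile> continuity" and red: "\<Gamma> \<tturnstile> red (zero_row (Succ n)) (zero_row n)"
  shows "\<Gamma> \<tturnstile> \<bottom>\<^sub>o"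
proof (rule exE_o[OF red[unfolded red_iff[OF dfm_zero_row[OF dnt_const dst_var]]]], unfold forces_and, elim conjE)
  fix \<phi> \<Delta> assume le: "\<Gamma> \<preceq> \<Delta>" and c: "\<Delta> \<tturnstile> codes \<phi>"
    and \<phi>: "\<Delta> \<tturnstile> (\<forall>\<^sub>o a. \<forall>\<^sub>o c. im_is \<phi> a c \<longrightarrow>\<^sub>o zero_row (Succ n) a \<longleftrightarrow>\<^sub>o zero_row n c)"
  note bcp = forces_mono[OF le bcp]
  \<comment> \<open>The selected row is not determined by \<open>i\<close>, so the assignment of
    rows is made by finite choice before the pigeonhole principle is applied.\<close>
  have "\<Delta> \<tturnstile> (\<exists>\<^sub>o f. \<forall>\<^sub>o i. lt i (Succ n) \<longrightarrow>\<^sub>o lt (App f i) n \<and>\<^sub>o selects \<phi> i (App f i))"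
    by (rule finite_choice, intro def_intros dfm_selects, rule all_impI,
        rule selects_exists[OF forces_mono[OF _ bcp] forces_mono[OF _ c] forces_mono[OF _ \<phi>]])
  then show "\<Delta> \<tturnstile> \<bottom>\<^sub>o"
  proof (rule exE_o)
    fix f \<Theta> assume le1: "\<Delta> \<preceq> \<Theta>" and f: "\<Theta> \<tturnstile> (\<forall>\<^sub>o i. lt i (Succ n) \<longrightarrow>\<^sub>o lt (App f i) n \<and>\<^sub>o selects \<phi> i (App f i))"
    have "\<Theta> \<tturnstile> (\<forall>\<^sub>o i. lt i (Succ n) \<longrightarrow>\<^sub>o lt (App f i) n)"
    proof (rule all_impI)
      fix i \<Omega> assume le: "\<Theta> \<preceq> \<Omega>" and "\<Omega> \<tturnstile> lt i (Succ n)"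
      from all_impE[OF forces_mono[OF le f] this(2)] show "\<Omega> \<tturnstile> lt (App f i) n" by simp
    qed
    from pigeonhole[OF this] show "\<Theta> \<tturnstile> \<bottom>\<^sub>o"
    proof (rule exE_o, elim exE_o)
      fix i i' \<Omega>1 \<Omega> assume le2: "\<Theta> \<preceq> \<Omega>1" "\<Omega>1 \<preceq> \<Omega>" and "\<Omega> \<tturnstile> lt i i' \<and>\<^sub>o lt i' (Succ n) \<and>\<^sub>o App f i \<doteq> App f i'"
      then have ii: "\<Omega> \<tturnstile> lt i i'" and i': "\<Omega> \<tturnstile> lt i' (Succ n)" and eq: "\<Omega> \<tturnstile> App f i \<doteq> App f i'" by simp_all
      note le2 = extends_trans[OF le2]
      note up = forces_mono[OF extends_trans[OF le1 le2]]
      have 1: "\<Omega> \<tturnstile> lt (App f i) n" "\<Omega> \<tturnstile> selects \<phi> i (App f i)"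
        using all_impE[OF forces_mono[OF le2 f] lt_trans[OF ii i']] by simp_all
      have "\<Omega> \<tturnstile> selects \<phi> i' (App f i')" using all_impE[OF forces_mono[OF le2 f] i'] by simp
      then have "\<Omega> \<tturnstile> selects \<phi> i' (App f i)"
        by (rule subst_o[where P = "\<lambda>z. selects \<phi> i' z", OF _ eq_sym_o[OF eq], rotated]) (intro dfm_selects def_intros)
      from selects_distinct[OF up[OF bcp] up[OF c] up[OF \<phi>] ii 1 this] show "\<Omega> \<tturnstile> \<bottom>\<^sub>o" .
    qed
  qed
qed

section \<open>The four statements as truth values\<close>

lemmas scoped_defs = closed_fm_def allN_def exN_def allS_def exS_def allX_def allR_def exR_def zero_def succ_def add_def
  app_def init_def sect_def bot_def eqN_def mem_def rel_def conj_def imp_def iff_def neg_def neqN_def less_def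
  initial_of_def BCP_def codes_NtoNat_def value_at_def codes_NtoN_def image_is_def reducible_def A1_def \<D>_def
  Pi01_def Pi02_def

lemmas notion_defs = closed_def red_def codes_def is_code_def im_is_def val_is_def lt_def zeros_def zero_row_def
  union_of_def continuity_def not_o_def

lemma derives_iff_forces: "\<Gamma> \<turnstile> A \<longleftrightarrow> \<Gamma> \<tturnstile> val NVar SVar id id A"
  by (simp add: forces_tr[symmetric] tr_val[symmetric])

text \<open>The principle is the only hypothesis of the context, and its value in the identity
  environment is literally \<open>continuity\<close>.\<close>

lemma BCP_forces: "[closed_fm BCP] \<tturnstile> continuity"
proof -
  have "[closed_fm BCP] \<turnstile> closed_fm BCP" by (rule Assm) simp
  moreover have "val NVar SVar id id (closed_fm BCP) = continuity"
    by (simp add: scoped_defs notion_defs)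
  ultimately show ?thesis by (simp add: derives_iff_forces)
qed

theorem theorem19p9:
  shows "([closed_fm BCP] \<turnstile> closed_fm
            (\<^bold>\<forall>\<^sub>X X. Pi01 (\<lambda>\<alpha>. \<alpha> \<^bold>\<in> X) \<^bold>\<longleftrightarrow> (\<lambda>\<alpha>. \<alpha> \<^bold>\<in> X) \<^bold>\<preceq> A1)) \<and>
         ([closed_fm BCP] \<turnstile> closed_fm
            (\<^bold>\<forall>\<^sub>X X. \<^bold>\<forall>\<^sub>N n. \<^bold>0 \<^bold>< n \<^bold>\<longrightarrow>
               ((\<lambda>\<alpha>. \<alpha> \<^bold>\<in> X) \<^bold>\<preceq> \<D> n A1 \<^bold>\<longleftrightarrow>
                (\<^bold>\<exists>\<^sub>R F. (\<^bold>\<forall>\<^sub>N i. i \<^bold>< n \<^bold>\<longrightarrow> Pi01 (\<lambda>\<alpha>. rel F \<alpha> i)) \<^bold>\<and>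
                      (\<^bold>\<forall>\<^sub>S \<alpha>. \<alpha> \<^bold>\<in> X \<^bold>\<longleftrightarrow> (\<^bold>\<exists>\<^sub>N i. i \<^bold>< n \<^bold>\<and> rel F \<alpha> i)))))) \<and>
         ([closed_fm BCP] \<turnstile> closed_fm (\<^bold>\<not> Pi02 (\<D> (\<^bold>S \<^bold>S \<^bold>0) A1))) \<and>
         ([closed_fm BCP] \<turnstile> closed_fm
            (\<^bold>\<forall>\<^sub>N n. \<^bold>0 \<^bold>< n \<^bold>\<longrightarrow> \<^bold>\<not> (\<D> (\<^bold>S n) A1 \<^bold>\<preceq> \<D> n A1)))"
    (is "(_ \<turnstile> ?i) \<and> (_ \<turnstile> ?ii) \<and> (_ \<turnstile> ?iii) \<and> (_ \<turnstile> ?iv)")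
proof -
  let ?\<Gamma> = "[closed_fm BCP]"
  \<comment> \<open>Unfolding the notation with named variables and evaluating by
    \<open>val_simps\<close> yields exactly the notions treated above, so that no de Bruijn index
    survives.\<close>
  have i: "val NVar SVar id id ?i = (\<forall>\<^sub>o X. closed (\<lambda>a. tr (Mem a X)) \<longleftrightarrow>\<^sub>o red (\<lambda>a. tr (Mem a X)) zeros)"
    by (simp add: scoped_defs notion_defs)
  have ii: "val NVar SVar id id ?ii = (\<forall>\<^sub>o X. \<forall>\<^sub>o n. lt Zero n \<longrightarrow>\<^sub>o
      (red (\<lambda>a. tr (Mem a X)) (zero_row n) \<longleftrightarrow>\<^sub>o (\<exists>\<^sub>o R. union_of (\<lambda>a. tr (Mem a X)) n R)))"
    by (simp add: scoped_defs notion_defs)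
  have iii: "val NVar SVar id id ?iii = (\<not>\<^sub>o (\<exists>\<^sub>o \<beta>. \<forall>\<^sub>o a. zero_row (Succ (Succ Zero)) a \<longleftrightarrow>\<^sub>o
      (\<forall>\<^sub>o m. \<exists>\<^sub>o n. \<not>\<^sub>o (App (Sect \<beta> m) (Init a n) \<doteq> Zero))))"
    by (simp add: scoped_defs notion_defs)
  have iv: "val NVar SVar id id ?iv = (\<forall>\<^sub>o n. lt Zero n \<longrightarrow>\<^sub>o \<not>\<^sub>o red (zero_row (Succ n)) (zero_row n))"
    by (simp add: scoped_defs notion_defs)
  show ?thesis
    unfolding derives_iff_forces i ii iii iv
  proof (intro conjI)
    show "?\<Gamma> \<tturnstile> (\<forall>\<^sub>o X. closed (\<lambda>a. tr (Mem a X)) \<longleftrightarrow>\<^sub>o red (\<lambda>a. tr (Mem a X)) zeros)"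
      by (simp add: forces_iff closed_iff_red)
    show "?\<Gamma> \<tturnstile> (\<forall>\<^sub>o X. \<forall>\<^sub>o n. lt Zero n \<longrightarrow>\<^sub>o
      (red (\<lambda>a. tr (Mem a X)) (zero_row n) \<longleftrightarrow>\<^sub>o (\<exists>\<^sub>o R. union_of (\<lambda>a. tr (Mem a X)) n R)))"
      by (auto intro!: impI_o iffI_o red_union elim!: exE_o union_red)
    show "?\<Gamma> \<tturnstile> \<not>\<^sub>o (\<exists>\<^sub>o \<beta>. \<forall>\<^sub>o a. zero_row (Succ (Succ Zero)) a \<longleftrightarrow>\<^sub>o
      (\<forall>\<^sub>o m. \<exists>\<^sub>o n. \<not>\<^sub>o (App (Sect \<beta> m) (Init a n) \<doteq> Zero)))"
      by (rule notI_o, rule zero_row_not_Pi02[OF forces_mono[OF _ BCP_forces]])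
    show "?\<Gamma> \<tturnstile> (\<forall>\<^sub>o n. lt Zero n \<longrightarrow>\<^sub>o \<not>\<^sub>o red (zero_row (Succ n)) (zero_row n))"
      by (rule all_impI, rule notI_o, rule zero_row_not_red[OF forces_mono[OF _ BCP_forces]], rule extends_trans)
  qed
qed

end
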